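(* Let $A=\mathbb{K}Q/J^2$ be a radical square zero algebra. Then $\phi\dim(A)=\phi\dim(A^{op})$.
   Context: $\mathbb{K}$ is a field, $Q$ is a finite connected quiver, $J$ is the ideal of the path algebra $\mathbb{K}Q$ generated by the arrows; a radical square zero algebra is an algebra of the form $A=\mathbb{K}Q/J^2$. Modules are finitely generated right modules. For an Artin algebra $A$, $K_0(A)$ is the abelian group generated by symbols $[M]$, one for each isomorphism class of finitely generated $A$-modules, modulo the relations $[M]-[M']-[M'']$ whenever $M\cong M'\oplus M''$ and $[P]$ for each projective $P$ (it is free on the classes of indecomposable non-projective modules). The (first) syzygy $\Omega$ induces a group endomorphism $\overline{\Omega}:K_0(A)\to K_0(A)$. For a module $M$, $\langle \mathrm{add}\, M\rangle$ is the subgroup of $K_0(A)$ generated by the classes of the indecomposable direct summands of $M$, and $\phi(M)=\min\{l\in\mathbb{N}: \overline{\Omega}|_{\overline{\Omega}^{l+s}\langle \mathrm{add}\, M\rangle}\text{ is injective for all } s\in\mathbb{N}\}$ ($0\in\mathbb{N}$). $\phi\dim(A)=\sup\{\phi(M): M\in \mathrm{mod}\,A\}$. *)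

theory Defs
  imports
    "HOL-Algebra.QuotRing"
    "HOL-Algebra.Ideal_Product"
    "HOL-Algebra.Module"
    "HOL-Algebra.Free_Abelian_Groups"
    "HOL-Library.Extended_Nat"
    "Graph_Theory.Digraph_Component"
begin

section \<open>Path algebras and radical square zero algebras\<close>

text \<open>
  Quivers are the directed multigraphs of Graph Theory (loops and parallel arcs are allowed).
  A path is a pair \<open>(u, p)\<close> of a starting vertex and a list of consecutive arcs; the trivial
  path at \<open>u\<close> is \<open>(u, [])\<close>.  Elements of the path algebra are finitely supported functions on
  paths, zero off the set of paths, and paths are multiplied by concatenation from left to right
  (the other convention yields the path algebra of the opposite quiver).
\<close>

definition quiver_paths :: "('v, 'a) pre_digraph \<Rightarrow> ('v \<times> 'a list) set" where
  "quiver_paths Q = {(u, p). \<exists>v. pre_digraph.awalk Q u p v}"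

definition path_algebra ::
    "('k, 'm) ring_scheme \<Rightarrow> ('v, 'a) pre_digraph \<Rightarrow> ('v \<times> 'a list \<Rightarrow> 'k) ring" where
  "path_algebra K Q =
    \<lparr>carrier = {f. (\<forall>q. f q \<in> carrier K) \<and> finite {q. f q \<noteq> \<zero>\<^bsub>K\<^esub>} \<and> {q. f q \<noteq> \<zero>\<^bsub>K\<^esub>} \<subseteq> quiver_paths Q},
     monoid.mult = (\<lambda>f g (u, p). \<Oplus>\<^bsub>K\<^esub>i\<in>{..length p}.
        f (u, take i p) \<otimes>\<^bsub>K\<^esub> g (last (pre_digraph.awalk_verts Q u (take i p)), drop i p)),
     monoid.one = (\<lambda>(u, p). if u \<in> verts Q \<and> p = [] then \<one>\<^bsub>K\<^esub> else \<zero>\<^bsub>K\<^esub>),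
     ring.zero = (\<lambda>_. \<zero>\<^bsub>K\<^esub>),
     ring.add = (\<lambda>f g q. f q \<oplus>\<^bsub>K\<^esub> g q)\<rparr>"

definition arrow_element ::
    "('k, 'm) ring_scheme \<Rightarrow> ('v, 'a) pre_digraph \<Rightarrow> 'a \<Rightarrow> ('v \<times> 'a list \<Rightarrow> 'k)" where
  "arrow_element K Q a = (\<lambda>q. if q = (tail Q a, [a]) then \<one>\<^bsub>K\<^esub> else \<zero>\<^bsub>K\<^esub>)"

definition arrow_ideal ::
    "('k, 'm) ring_scheme \<Rightarrow> ('v, 'a) pre_digraph \<Rightarrow> ('v \<times> 'a list \<Rightarrow> 'k) set" where
  "arrow_ideal K Q = genideal (path_algebra K Q) (arrow_element K Q ` arcs Q)"

definition radical_square_zero_algebra ::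
    "('k, 'm) ring_scheme \<Rightarrow> ('v, 'a) pre_digraph \<Rightarrow> ('v \<times> 'a list \<Rightarrow> 'k) set ring" where
  "radical_square_zero_algebra K Q =
    path_algebra K Q Quot (ideal_prod (path_algebra K Q) (arrow_ideal K Q) (arrow_ideal K Q))"

definition opposite_ring :: "('r, 'm) ring_scheme \<Rightarrow> ('r, 'm) ring_scheme" where
  "opposite_ring R = R\<lparr>monoid.mult := (\<lambda>x y. y \<otimes>\<^bsub>R\<^esub> x)\<rparr>"


section \<open>Finitely generated right modules\<close>

text \<open>
  Right modules reuse the record \<open>module\<close>, whose fields \<open>mult\<close> and \<open>one\<close> are ignored.
  Since \<open>smult\<close> takes the scalar first, \<open>r \<odot>\<^bsub>M\<^esub> x\<close> stands for the right action \<open>x r\<close>;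
  hence the order of scalars in \<open>smult_mult\<close>.
\<close>

locale right_module = R?: ring R + M?: abelian_group M for R (structure) and M (structure) +
  assumes smult_closed:
      "\<lbrakk>r \<in> carrier R; x \<in> carrier M\<rbrakk> \<Longrightarrow> r \<odot>\<^bsub>M\<^esub> x \<in> carrier M"
    and smult_add_scalar:
      "\<lbrakk>r \<in> carrier R; s \<in> carrier R; x \<in> carrier M\<rbrakk> \<Longrightarrow>
        (r \<oplus>\<^bsub>R\<^esub> s) \<odot>\<^bsub>M\<^esub> x = r \<odot>\<^bsub>M\<^esub> x \<oplus>\<^bsub>M\<^esub> s \<odot>\<^bsub>M\<^esub> x"
    and smult_add_vector:
      "\<lbrakk>r \<in> carrier R; x \<in> carrier M; y \<in> carrier M\<rbrakk> \<Longrightarrow>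
        r \<odot>\<^bsub>M\<^esub> (x \<oplus>\<^bsub>M\<^esub> y) = r \<odot>\<^bsub>M\<^esub> x \<oplus>\<^bsub>M\<^esub> r \<odot>\<^bsub>M\<^esub> y"
    and smult_mult:
      "\<lbrakk>r \<in> carrier R; s \<in> carrier R; x \<in> carrier M\<rbrakk> \<Longrightarrow>
        (r \<otimes>\<^bsub>R\<^esub> s) \<odot>\<^bsub>M\<^esub> x = s \<odot>\<^bsub>M\<^esub> (r \<odot>\<^bsub>M\<^esub> x)"
    and smult_one:
      "x \<in> carrier M \<Longrightarrow> \<one>\<^bsub>R\<^esub> \<odot>\<^bsub>M\<^esub> x = x"

definition rmod_hom ::
    "('r, 'i) ring_scheme \<Rightarrow> ('r, 'b, 'm) module_scheme \<Rightarrow> ('r, 'c, 'n) module_scheme \<Rightarrow> ('b \<Rightarrow> 'c) set" where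
  "rmod_hom R M N = {f. (\<forall>x\<in>carrier M. f x \<in> carrier N)
      \<and> (\<forall>x\<in>carrier M. \<forall>y\<in>carrier M. f (x \<oplus>\<^bsub>M\<^esub> y) = f x \<oplus>\<^bsub>N\<^esub> f y)
      \<and> (\<forall>r\<in>carrier R. \<forall>x\<in>carrier M. f (r \<odot>\<^bsub>M\<^esub> x) = r \<odot>\<^bsub>N\<^esub> f x)}"

definition rmod_isomorphic ::
    "('r, 'i) ring_scheme \<Rightarrow> ('r, 'b, 'm) module_scheme \<Rightarrow> ('r, 'c, 'n) module_scheme \<Rightarrow> bool" where
  "rmod_isomorphic R M N \<longleftrightarrow> (\<exists>f\<in>rmod_hom R M N. bij_betw f (carrier M) (carrier N))"

definition rmod_sum ::
    "('r, 'b, 'm) module_scheme \<Rightarrow> ('r, 'c, 'n) module_scheme \<Rightarrow> ('r, 'b \<times> 'c) module" where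
  "rmod_sum M N =
    \<lparr>carrier = carrier M \<times> carrier N,
     monoid.mult = undefined,
     monoid.one = undefined,
     ring.zero = (\<zero>\<^bsub>M\<^esub>, \<zero>\<^bsub>N\<^esub>),
     ring.add = (\<lambda>(x, y) (x', y'). (x \<oplus>\<^bsub>M\<^esub> x', y \<oplus>\<^bsub>N\<^esub> y')),
     smult = (\<lambda>r (x, y). (r \<odot>\<^bsub>M\<^esub> x, r \<odot>\<^bsub>N\<^esub> y))\<rparr>"

definition finitely_generated ::
    "('r, 'i) ring_scheme \<Rightarrow> ('r, 'b, 'm) module_scheme \<Rightarrow> bool" where
  "finitely_generated R M \<longleftrightarrow>
    (\<exists>S. finite S \<and> S \<subseteq> carrier M \<and> (\<forall>H. submodule H R M \<and> S \<subseteq> H \<longrightarrow> H = carrier M))"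

text \<open>
  The category of all finitely generated right modules is represented by those whose elements
  are sets of functions \<open>nat \<Rightarrow> 'r\<close>.  This is a large enough universe: such a module is a quotient
  of some \<open>R\<^sup>n\<close>, so that its elements can be taken to be cosets in \<open>R\<^sup>n\<close>; see
  \<open>ex_isomorphic_fg_rmodule\<close> below.
\<close>

type_synonym 'r rmodule = "('r, (nat \<Rightarrow> 'r) set) module"

definition fg_rmodules :: "('r, 'i) ring_scheme \<Rightarrow> 'r rmodule set" where
  "fg_rmodules R = {M. right_module R M \<and> finitely_generated R M}"

lemma rmodule_transport:
  fixes M :: "('r, 'b, 'n) module_scheme" and e :: "'b \<Rightarrow> (nat \<Rightarrow> 'r) set"
  assumes M: "right_module R M" "finitely_generated R M" and e: "inj_on e (carrier M)"
  shows "\<exists>N\<in>fg_rmodules R. rmod_isomorphic R M N"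
proof -
  interpret right_module R M by fact
  define d where "d = the_inv_into (carrier M) e"
  have d: "d (e x) = x" if "x \<in> carrier M" for x
    using e that by (simp add: d_def the_inv_into_f_f)
  define N :: "'r rmodule" where "N =
    \<lparr>carrier = e ` carrier M, monoid.mult = undefined, monoid.one = undefined,
     ring.zero = e \<zero>\<^bsub>M\<^esub>, ring.add = (\<lambda>x y. e (d x \<oplus>\<^bsub>M\<^esub> d y)), smult = (\<lambda>r x. e (r \<odot>\<^bsub>M\<^esub> d x))\<rparr>"
  have Ns [simp]: "carrier N = e ` carrier M" "\<zero>\<^bsub>N\<^esub> = e \<zero>\<^bsub>M\<^esub>"
      "x \<oplus>\<^bsub>N\<^esub> y = e (d x \<oplus>\<^bsub>M\<^esub> d y)" "r \<odot>\<^bsub>N\<^esub> x = e (r \<odot>\<^bsub>M\<^esub> d x)" for x y r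
    by (simp_all add: N_def)
  have neg: "\<exists>y\<in>carrier M. e (x \<oplus>\<^bsub>M\<^esub> y) = e \<zero>\<^bsub>M\<^esub>" if "x \<in> carrier M" for x
    using that M.r_neg by (metis M.a_inv_closed)
  have "abelian_group N"
    by (rule abelian_groupI) (use neg in \<open>auto simp: d M.a_ac\<close>)
  then have N: "right_module R N"
    by (intro right_module.intro right_module_axioms.intro R.ring_axioms \<open>abelian_group N\<close>)
       (auto simp: d smult_closed smult_add_scalar smult_add_vector smult_mult smult_one)
  from M(2) obtain S where S: "finite S" "S \<subseteq> carrier M"
      "\<And>H. submodule H R M \<Longrightarrow> S \<subseteq> H \<Longrightarrow> H = carrier M"
    unfolding finitely_generated_def by blast
  have "H = carrier N" if H: "submodule H R N" "e ` S \<subseteq> H" for H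
  proof -
    interpret H: submodule H R N by fact
    interpret N: right_module R N by fact
    have HN: "H \<subseteq> e ` carrier M" using H.subset by simp
    have dH: "a \<in> carrier M \<and> e a \<in> H" if "a \<in> d ` H" for a
      using HN d that by auto
    have "submodule (d ` H) R M"
    proof (intro submodule.intro submodule_axioms.intro)
      show "subgroup (d ` H) (add_monoid M)"
      proof (rule group.subgroupI)
        show "Group.group (add_monoid M)" by (rule M.a_group)
        show "d ` H \<subseteq> carrier (add_monoid M)" using HN d by auto
        show "d ` H \<noteq> {}" using H.one_closed by auto
      next
        fix a assume "a \<in> d ` H"
        then obtain x where x: "x \<in> carrier M" "e x \<in> H" "a = x" using HN d by auto
        have i: "inv\<^bsub>add_monoid N\<^esub> (e x) = e (\<ominus>\<^bsub>M\<^esub> x)"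
        proof -
          have "\<ominus>\<^bsub>N\<^esub> (e x) = e (\<ominus>\<^bsub>M\<^esub> x)"
            by (rule N.minus_equality) (use x d in \<open>auto simp: M.l_neg\<close>)
          then show ?thesis by (simp add: a_inv_def)
        qed
        have "e (\<ominus>\<^bsub>M\<^esub> x) \<in> H" using H.m_inv_closed[OF x(2)] i by simp
        then have "d (e (\<ominus>\<^bsub>M\<^esub> x)) \<in> d ` H" by blast
        then show "inv\<^bsub>add_monoid M\<^esub> a \<in> d ` H" using x d by (simp add: a_inv_def[symmetric])
      next
        fix a b assume "a \<in> d ` H" "b \<in> d ` H"
        then obtain x y where x: "x \<in> carrier M" "e x \<in> H" "a = x" "y \<in> carrier M" "e y \<in> H" "b = y"
          using dH by blast
        have "e (x \<oplus>\<^bsub>M\<^esub> y) \<in> H" using H.m_closed[OF x(2,5)] x d by simp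
        then have "d (e (x \<oplus>\<^bsub>M\<^esub> y)) \<in> d ` H" by blast
        then show "a \<otimes>\<^bsub>add_monoid M\<^esub> b \<in> d ` H" using x d by simp
      qed
    next
      fix r a assume r: "r \<in> carrier R" and "a \<in> d ` H"
      then obtain x where x: "x \<in> carrier M" "e x \<in> H" "a = x" using HN d by auto
      have "e (r \<odot>\<^bsub>M\<^esub> x) \<in> H" using H.smult_closed[OF r x(2)] x d by simp
      then have "d (e (r \<odot>\<^bsub>M\<^esub> x)) \<in> d ` H" by blast
      then show "r \<odot>\<^bsub>M\<^esub> a \<in> d ` H" using x d r by (simp add: smult_closed)
    qed
    moreover have "S \<subseteq> d ` H"
      using H(2) S(2) d by (force simp: image_iff subset_iff)
    ultimately have "d ` H = carrier M" by (rule S(3))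
    moreover have "e ` d ` H = H"
    proof -
      have "e (d x) = x" if "x \<in> H" for x using HN d that by auto
      then show ?thesis by (simp add: image_image)
    qed
    ultimately show ?thesis by simp
  qed
  then have "finitely_generated R N"
    unfolding finitely_generated_def using S(1,2) by (intro exI[of _ "e ` S"]) auto
  with N have "N \<in> fg_rmodules R" by (simp add: fg_rmodules_def)
  moreover have "e \<in> rmod_hom R M N" by (auto simp: rmod_hom_def d)
  then have "rmod_isomorphic R M N"
    unfolding rmod_isomorphic_def using e by (auto simp: bij_betw_def)
  ultimately show ?thesis by blast
qed

theorem ex_isomorphic_fg_rmodule:
  fixes M :: "('r, 'b, 'n) module_scheme"
  assumes M: "right_module R M" "finitely_generated R M"
  shows "\<exists>N\<in>fg_rmodules R. rmod_isomorphic R M N"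
proof -
  interpret right_module R M by fact
  from M(2) obtain S where S: "finite S" "S \<subseteq> carrier M"
      "\<And>H. submodule H R M \<Longrightarrow> S \<subseteq> H \<Longrightarrow> H = carrier M"
    unfolding finitely_generated_def by blast
  obtain g :: "nat \<Rightarrow> 'b" and n where g: "S = g ` {..<n}"
    using S(1) by (metis finite_imp_nat_seg_image_inj_on lessThan_def)
  have gM: "g i \<in> carrier M" if "i < n" for i using g S(2) that by auto
  define C where "C f = (\<Oplus>\<^bsub>M\<^esub>i\<in>{..<n}. f i \<odot>\<^bsub>M\<^esub> g i)" for f
  define F :: "(nat \<Rightarrow> 'r) set" where "F = {f. \<forall>i. f i \<in> carrier R}"
  have cl: "(\<lambda>i. f i \<odot>\<^bsub>M\<^esub> g i) \<in> Pi {..<n} (\<lambda>_. carrier M)" if "f \<in> F" for f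
    using that gM by (auto simp: F_def smult_closed)
  have C_add: "C (\<lambda>i. f i \<oplus>\<^bsub>R\<^esub> h i) = C f \<oplus>\<^bsub>M\<^esub> C h" if "f \<in> F" "h \<in> F" for f h
  proof -
    have "C f \<oplus>\<^bsub>M\<^esub> C h = (\<Oplus>\<^bsub>M\<^esub>i\<in>{..<n}. f i \<odot>\<^bsub>M\<^esub> g i \<oplus>\<^bsub>M\<^esub> h i \<odot>\<^bsub>M\<^esub> g i)"
      unfolding C_def using cl that by (intro M.finsum_addf[symmetric]) auto
    also have "\<dots> = C (\<lambda>i. f i \<oplus>\<^bsub>R\<^esub> h i)"
      unfolding C_def using that gM
      by (intro M.finsum_cong') (auto simp: F_def smult_add_scalar smult_closed)
    finally show ?thesis by simp
  qed
  have s0: "r \<odot>\<^bsub>M\<^esub> \<zero>\<^bsub>M\<^esub> = \<zero>\<^bsub>M\<^esub>" if "r \<in> carrier R" for r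
    using smult_add_vector[of r "\<zero>\<^bsub>M\<^esub>" "\<zero>\<^bsub>M\<^esub>"] that smult_closed[of r "\<zero>\<^bsub>M\<^esub>"]
    by (metis M.add.l_cancel_one M.zero_closed M.l_zero)
  have z0: "\<zero>\<^bsub>R\<^esub> \<odot>\<^bsub>M\<^esub> x = \<zero>\<^bsub>M\<^esub>" if "x \<in> carrier M" for x
    using smult_add_scalar[of "\<zero>\<^bsub>R\<^esub>" "\<zero>\<^bsub>R\<^esub>" x] that smult_closed[of "\<zero>\<^bsub>R\<^esub>" x]
    by (metis M.add.l_cancel_one R.zero_closed R.l_zero)
  have C_smult: "C (\<lambda>i. f i \<otimes>\<^bsub>R\<^esub> r) = r \<odot>\<^bsub>M\<^esub> C f" if "f \<in> F" "r \<in> carrier R" for f r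
  proof -
    have "r \<odot>\<^bsub>M\<^esub> (\<Oplus>\<^bsub>M\<^esub>i\<in>A. f i \<odot>\<^bsub>M\<^esub> g i) = (\<Oplus>\<^bsub>M\<^esub>i\<in>A. (f i \<otimes>\<^bsub>R\<^esub> r) \<odot>\<^bsub>M\<^esub> g i)"
      if "finite A" "A \<subseteq> {..<n}" for A
      using that
    proof (induction A)
      case empty then show ?case by (simp add: s0 \<open>r \<in> carrier R\<close>)
    next
      case (insert a A)
      have *: "(\<lambda>i. f i \<odot>\<^bsub>M\<^esub> g i) \<in> Pi A (\<lambda>_. carrier M)" "f a \<odot>\<^bsub>M\<^esub> g a \<in> carrier M"
        "(\<lambda>i. (f i \<otimes>\<^bsub>R\<^esub> r) \<odot>\<^bsub>M\<^esub> g i) \<in> Pi A (\<lambda>_. carrier M)"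
        "(f a \<otimes>\<^bsub>R\<^esub> r) \<odot>\<^bsub>M\<^esub> g a \<in> carrier M"
        "(f a \<otimes>\<^bsub>R\<^esub> r) \<odot>\<^bsub>M\<^esub> g a = r \<odot>\<^bsub>M\<^esub> (f a \<odot>\<^bsub>M\<^esub> g a)"
        using insert.prems \<open>f \<in> F\<close> \<open>r \<in> carrier R\<close> gM
        by (auto simp: F_def smult_closed smult_mult subset_iff)
      with insert \<open>r \<in> carrier R\<close> show ?case
        by (simp add: smult_add_vector M.finsum_closed)
    qed
    then show ?thesis by (simp add: C_def)
  qed
  have C_closed: "C f \<in> carrier M" if "f \<in> F" for f
    using cl[OF that] unfolding C_def by (rule M.finsum_closed)
  have C_zero: "C (\<lambda>_. \<zero>\<^bsub>R\<^esub>) = \<zero>\<^bsub>M\<^esub>"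
    unfolding C_def by (rule M.add.finprod_one_eqI[folded finsum_def]) (auto simp: z0 gM)
  have sub: "submodule (C ` F) R M"
  proof (intro submodule.intro submodule_axioms.intro)
    show "subgroup (C ` F) (add_monoid M)"
    proof (rule group.subgroupI)
      show "Group.group (add_monoid M)" by (rule M.a_group)
      show "C ` F \<subseteq> carrier (add_monoid M)" using C_closed by auto
      show "C ` F \<noteq> {}" by (auto simp: F_def)
    next
      fix a assume "a \<in> C ` F"
      then obtain f where f: "f \<in> F" "a = C f" by auto
      have f': "(\<lambda>i. \<ominus>\<^bsub>R\<^esub> f i) \<in> F" using f by (auto simp: F_def)
      have "C (\<lambda>i. \<ominus>\<^bsub>R\<^esub> f i) \<oplus>\<^bsub>M\<^esub> a = \<zero>\<^bsub>M\<^esub>"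
        using C_add[OF f' f(1)] f C_zero by (simp add: F_def R.l_neg)
      then have "\<ominus>\<^bsub>M\<^esub> a = C (\<lambda>i. \<ominus>\<^bsub>R\<^esub> f i)"
        using f f' C_closed by (intro M.minus_equality) auto
      then show "inv\<^bsub>add_monoid M\<^esub> a \<in> C ` F" using f' by (simp add: a_inv_def[symmetric])
    next
      fix a b assume "a \<in> C ` F" "b \<in> C ` F"
      then obtain f h where f: "f \<in> F" "h \<in> F" "a = C f" "b = C h" by auto
      have "(\<lambda>i. f i \<oplus>\<^bsub>R\<^esub> h i) \<in> F" using f by (auto simp: F_def)
      then show "a \<otimes>\<^bsub>add_monoid M\<^esub> b \<in> C ` F" using f C_add[OF f(1,2)] by force
    qed
  next
    fix r a assume r: "r \<in> carrier R" and "a \<in> C ` F"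
    then obtain f where f: "f \<in> F" "a = C f" by auto
    have "(\<lambda>i. f i \<otimes>\<^bsub>R\<^esub> r) \<in> F" using f r by (auto simp: F_def)
    then show "r \<odot>\<^bsub>M\<^esub> a \<in> C ` F" using f C_smult[OF f(1) r] by force
  qed
  have "g j \<in> C ` F" if "j < n" for j
  proof -
    define f where "f i = (if i = j then \<one>\<^bsub>R\<^esub> else \<zero>\<^bsub>R\<^esub>)" for i
    have "f \<in> F" by (auto simp: F_def f_def)
    have "C f = (\<Oplus>\<^bsub>M\<^esub>i\<in>{..<n}. if j = i then g i else \<zero>\<^bsub>M\<^esub>)"
      unfolding C_def by (rule M.finsum_cong') (auto simp: f_def z0 smult_one gM)
    also have "\<dots> = g j"
      using that gM by (intro M.add.finprod_singleton[folded finsum_def, simplified]) auto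
    finally show ?thesis using \<open>f \<in> F\<close> by force
  qed
  then have "S \<subseteq> C ` F" using g by auto
  with sub S(3) have surj: "C ` F = carrier M" by blast
  have "inj_on (\<lambda>x. {f \<in> F. C f = x}) (carrier M)"
    using surj by (intro inj_onI) (force simp: set_eq_iff)
  then show ?thesis using M rmodule_transport by blast
qed

definition indecomposable :: "('r, 'i) ring_scheme \<Rightarrow> 'r rmodule \<Rightarrow> bool" where
  "indecomposable R M \<longleftrightarrow> M \<in> fg_rmodules R \<and> carrier M \<noteq> {\<zero>\<^bsub>M\<^esub>} \<and>
    (\<forall>M'\<in>fg_rmodules R. \<forall>M''\<in>fg_rmodules R. rmod_isomorphic R M (rmod_sum M' M'') \<longrightarrow>
      carrier M' = {\<zero>\<^bsub>M'\<^esub>} \<or> carrier M'' = {\<zero>\<^bsub>M''\<^esub>})"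

definition direct_summand :: "('r, 'i) ring_scheme \<Rightarrow> 'r rmodule \<Rightarrow> 'r rmodule \<Rightarrow> bool" where
  "direct_summand R N M \<longleftrightarrow> N \<in> fg_rmodules R \<and>
    (\<exists>N'\<in>fg_rmodules R. rmod_isomorphic R M (rmod_sum N N'))"

definition projective :: "('r, 'i) ring_scheme \<Rightarrow> 'r rmodule \<Rightarrow> bool" where
  "projective R P \<longleftrightarrow> P \<in> fg_rmodules R \<and>
    (\<forall>M\<in>fg_rmodules R. \<forall>N\<in>fg_rmodules R. \<forall>g\<in>rmod_hom R M N. \<forall>f\<in>rmod_hom R P N.
      g ` carrier M = carrier N \<longrightarrow> (\<exists>h\<in>rmod_hom R P M. \<forall>x\<in>carrier P. g (h x) = f x))"

definition rmod_kernel ::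
    "('r, 'b, 'm) module_scheme \<Rightarrow> ('r, 'c, 'n) module_scheme \<Rightarrow> ('b \<Rightarrow> 'c) \<Rightarrow> 'b set" where
  "rmod_kernel M N f = {x \<in> carrier M. f x = \<zero>\<^bsub>N\<^esub>}"

definition projective_cover ::
    "('r, 'i) ring_scheme \<Rightarrow> 'r rmodule \<Rightarrow> 'r rmodule \<Rightarrow> ((nat \<Rightarrow> 'r) set \<Rightarrow> (nat \<Rightarrow> 'r) set) \<Rightarrow> bool" where
  "projective_cover R P M f \<longleftrightarrow> projective R P \<and> M \<in> fg_rmodules R \<and>
    f \<in> rmod_hom R P M \<and> f ` carrier P = carrier M \<and>
    (\<forall>H. submodule H R P \<and> H <+>\<^bsub>P\<^esub> rmod_kernel P M f = carrier P \<longrightarrow> H = carrier P)"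

definition is_syzygy :: "('r, 'i) ring_scheme \<Rightarrow> 'r rmodule \<Rightarrow> 'r rmodule \<Rightarrow> bool" where
  "is_syzygy R M N \<longleftrightarrow> N \<in> fg_rmodules R \<and>
    (\<exists>P f. projective_cover R P M f \<and> rmod_isomorphic R N (P\<lparr>carrier := rmod_kernel P M f\<rparr>))"


section \<open>The group \<open>K\<^sub>0\<close> and the \<open>\<phi>\<close>-dimension\<close>

definition iso_class :: "('r, 'i) ring_scheme \<Rightarrow> 'r rmodule \<Rightarrow> 'r rmodule set" where
  "iso_class R M = {N \<in> fg_rmodules R. rmod_isomorphic R M N}"

definition K0_free :: "('r, 'i) ring_scheme \<Rightarrow> ('r rmodule set \<Rightarrow>\<^sub>0 int) monoid" where
  "K0_free R = free_Abelian_group (iso_class R ` fg_rmodules R)"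

definition K0_relations :: "('r, 'i) ring_scheme \<Rightarrow> ('r rmodule set \<Rightarrow>\<^sub>0 int) set" where
  "K0_relations R =
    {frag_of (iso_class R M) - frag_of (iso_class R M') - frag_of (iso_class R M'') | M M' M''.
       M \<in> fg_rmodules R \<and> M' \<in> fg_rmodules R \<and> M'' \<in> fg_rmodules R \<and>
       rmod_isomorphic R M (rmod_sum M' M'')}
    \<union> {frag_of (iso_class R P) | P. projective R P}"

definition K0 :: "('r, 'i) ring_scheme \<Rightarrow> ('r rmodule set \<Rightarrow>\<^sub>0 int) set monoid" where
  "K0 R = K0_free R Mod generate (K0_free R) (K0_relations R)"

definition K0_class :: "('r, 'i) ring_scheme \<Rightarrow> 'r rmodule \<Rightarrow> ('r rmodule set \<Rightarrow>\<^sub>0 int) set" where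
  "K0_class R M = generate (K0_free R) (K0_relations R) #>\<^bsub>K0_free R\<^esub> frag_of (iso_class R M)"

text \<open>
  The endomorphism induced by the syzygy is pinned down by its values on the generators; it exists
  whenever all finitely generated modules have projective covers, in particular for Artin algebras.
\<close>

definition K0_syzygy ::
    "('r, 'i) ring_scheme \<Rightarrow> ('r rmodule set \<Rightarrow>\<^sub>0 int) set \<Rightarrow> ('r rmodule set \<Rightarrow>\<^sub>0 int) set" where
  "K0_syzygy R = (THE h. h \<in> hom (K0 R) (K0 R) \<and> h \<in> extensional (carrier (K0 R)) \<and>
    (\<forall>M N. is_syzygy R M N \<longrightarrow> h (K0_class R M) = K0_class R N))"

definition add_subgroup :: "('r, 'i) ring_scheme \<Rightarrow> 'r rmodule \<Rightarrow> ('r rmodule set \<Rightarrow>\<^sub>0 int) set set" where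
  "add_subgroup R M = generate (K0 R) {K0_class R N | N. indecomposable R N \<and> direct_summand R N M}"

definition phi :: "('r, 'i) ring_scheme \<Rightarrow> 'r rmodule \<Rightarrow> nat" where
  "phi R M = (LEAST l. \<forall>s. inj_on (K0_syzygy R) ((K0_syzygy R ^^ (l + s)) ` add_subgroup R M))"

definition phi_dim :: "('r, 'i) ring_scheme \<Rightarrow> enat" where
  "phi_dim R = (SUP M\<in>fg_rmodules R. enat (phi R M))"

end

theory Submission
  imports Defs "Jordan_Normal_Form.Missing_VectorSpace"
begin

text \<open>
  A syzygy over a radical square zero algebra lies in the radical of a projective module, so it is
  semisimple.  Simples at sinks are projective and simples at sources do not occur in syzygies, so the image
  of \<open>\<Omega>\<close> is contained in the free abelian group on the simples at the vertices that are both source and target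
  of an arrow, and there \<open>\<Omega>\<close> acts by the adjacency matrix \<open>T\<close> of the quiver.  Hence \<open>\<phi> M \<le> m + 1\<close>, where \<open>m\<close> is
  the least \<open>l\<close> for which \<open>T\<close> is injective on the image of \<open>T\<^sup>l\<close>.  Equality holds for the direct sum of all
  simples and all modules \<open>e\<^bsub>s(a)\<^esub>A / aA\<close>, whose syzygies are the simples at the targets of the arrows \<open>a\<close>,
  unless every vertex that meets an arrow is the source of exactly one arrow and the target of exactly one
  arrow.  In that case all modules are direct sums of projectives and simples, and \<open>\<Omega>\<close> permutes the classes of
  the nonprojective simples, so the \<open>\<phi>\<close>-dimension is 0.  Passing to the opposite algebra reverses the quiver
  and transposes \<open>T\<close>, which affects neither \<open>m\<close> nor the exceptional case.
\<close>

section \<open>Stabilisation of the powers of an integer matrix\<close>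

text \<open>The group \<open>K0 R\<close> is given by generators and relations, so equalities in it
  are easy to produce and inequalities are not. Its elements are separated by homomorphisms to the
  integers, built from dimensions of subspaces that all module homomorphisms respect, such as the
  part of the socle at a vertex or the image of an arrow; suitable differences vanish on
  projectives. A second obstacle is that injectivity on a subgroup has no evident transpose. On the
  simples it amounts to a condition on a rational matrix, which is recast as a polynomial identity.
  The 1 in \<open>m + 1\<close> is the first syzygy, the step that leads into the span of simples at
  vertices that are both source and target. For \<open>m = 0\<close> the lower bound claims that
  \<open>\<Omega>\<close> itself is not injective on some \<open>add_subgroup\<close>: otherwise the
  rational inverse of \<open>T\<close> would turn a multiple of a test class into an element of that
  span, which an integer invariant excludes. One axiomatic description by coordinates at vertices
  and arrows serves both algebras; for the opposite ring only sources and targets are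
  exchanged.\<close>

lemma int_vectors_dependent:
  fixes u :: "'k \<Rightarrow> 'j \<Rightarrow> int"
  assumes "finite J" "finite S" "card J < card S"
  shows "\<exists>c. (\<exists>k\<in>S. c k \<noteq> 0) \<and> (\<forall>j\<in>J. (\<Sum>k\<in>S. c k * u k j) = 0)"
  using assms
proof (induction J arbitrary: S u)
  case empty
  then obtain k where "k \<in> S" by fastforce
  then show ?case by (intro exI[of _ "\<lambda>_. 1"]) auto
next
  case (insert j J)
  show ?case
  proof (cases "\<forall>k\<in>S. u k j = 0")
    case True
    have "card J < card S" using insert.prems insert.hyps by simp
    from insert.IH[OF insert.prems(1) this, of u] obtain c where
      "\<exists>k\<in>S. c k \<noteq> 0" "\<forall>j\<in>J. (\<Sum>k\<in>S. c k * u k j) = 0" by blast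
    with True show ?thesis by (intro exI[of _ c]) auto
  next
    case False
    then obtain k0 where k0: "k0 \<in> S" "u k0 j \<noteq> 0" by blast
    let ?S = "S - {k0}"
    have "card J < card ?S" using insert.prems insert.hyps k0 by simp
    \<comment> \<open>Fraction-free elimination: with the pivot \<open>u k0 j\<close> every other
      vector is combined with \<open>u k0\<close> so that its coordinate \<open>j\<close> cancels.
      This keeps all coefficients integral.\<close>
    from insert.IH[OF _ this, of "\<lambda>k i. u k0 j * u k i - u k j * u k0 i"] insert.prems(1)
    obtain c where c: "\<exists>k\<in>?S. c k \<noteq> 0"
      "\<forall>i\<in>J. (\<Sum>k\<in>?S. c k * (u k0 j * u k i - u k j * u k0 i)) = 0" by auto
    \<comment> \<open>The relation among the combined vectors, expanded in the original ones; the
      coefficient of \<open>k0\<close> collects all contributions of the pivot vector.\<close>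
    define d where "d k = (if k = k0 then - (\<Sum>k\<in>?S. c k * u k j) else c k * u k0 j)" for k
    have split: "(\<Sum>k\<in>S. d k * u k i) = (\<Sum>k\<in>?S. c k * (u k0 j * u k i - u k j * u k0 i))" for i
    proof -
      have "(\<Sum>k\<in>S. d k * u k i) = d k0 * u k0 i + (\<Sum>k\<in>?S. d k * u k i)"
        using k0 insert.prems(1) by (simp add: sum.remove)
      also have "(\<Sum>k\<in>?S. d k * u k i) = (\<Sum>k\<in>?S. c k * u k0 j * u k i)"
        by (rule sum.cong) (auto simp: d_def)
      also have "d k0 * u k0 i = - (\<Sum>k\<in>?S. c k * u k j * u k0 i)"
        by (simp add: d_def sum_distrib_right)
      finally show ?thesis
        by (simp add: right_diff_distrib sum_subtractf mult.assoc)
    qed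
    have "\<exists>k\<in>S. d k \<noteq> 0" using c(1) k0 by (auto simp: d_def)
    moreover have "(\<Sum>k\<in>S. d k * u k i) = 0" if "i \<in> insert j J" for i
    proof (cases "i = j")
      case False
      with that c(2) show ?thesis by (simp add: split)
    qed (auto simp: split intro!: sum.neutral)
    ultimately show ?thesis by blast
  qed
qed

text \<open>The lattice \<open>Z^I\<close>, with vectors extended by 0 to all indices so that equal
  vectors are equal functions.\<close>

definition int_vecs :: "'v set \<Rightarrow> ('v \<Rightarrow> int) set" where
  "int_vecs I = {x. \<forall>w. w \<notin> I \<longrightarrow> x w = 0}"

text \<open>The matrix acts on row vectors, \<open>x T\<close>: when \<open>T\<close> is the
  adjacency matrix, its row \<open>v\<close> lists the multiplicities in the syzygy of the simple at
  \<open>v\<close>.\<close>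

definition mat_vec :: "'v set \<Rightarrow> ('v \<Rightarrow> 'v \<Rightarrow> int) \<Rightarrow> ('v \<Rightarrow> int) \<Rightarrow> 'v \<Rightarrow> int" where
  "mat_vec I T x = (\<lambda>w. if w \<in> I then \<Sum>v\<in>I. x v * T v w else 0)"

fun mat_pow :: "'v set \<Rightarrow> ('v \<Rightarrow> 'v \<Rightarrow> int) \<Rightarrow> nat \<Rightarrow> 'v \<Rightarrow> 'v \<Rightarrow> int" where
  "mat_pow I T 0 v w = (if v = w then 1 else 0)"
| "mat_pow I T (Suc n) v w = (\<Sum>u\<in>I. mat_pow I T n v u * T u w)"

text \<open>Equivalently, \<open>T^l\<close> and \<open>T^(l+1)\<close> have the same rational rank,
  since a rational kernel vector has an integral multiple.\<close>

definition inj_after :: "'v set \<Rightarrow> ('v \<Rightarrow> 'v \<Rightarrow> int) \<Rightarrow> nat \<Rightarrow> bool" where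
  "inj_after I T l \<longleftrightarrow> inj_on (mat_vec I T) ((mat_vec I T ^^ l) ` int_vecs I)"

text \<open>Over the rationals this says that 0 is a root of multiplicity at most \<open>l\<close> of the minimal polynomial of
  \<open>T\<close>; unlike injectivity, it is invariant under transposition by its form.\<close>

definition annihilated_after :: "'v set \<Rightarrow> ('v \<Rightarrow> 'v \<Rightarrow> int) \<Rightarrow> nat \<Rightarrow> bool" where
  "annihilated_after I T l \<longleftrightarrow> (\<exists>N c. c 0 \<noteq> 0 \<and>
     (\<forall>v\<in>I. \<forall>w\<in>I. (\<Sum>k\<le>N. c k * mat_pow I T (l + k) v w) = 0))"

text \<open>The index of \<open>T\<close> as a rational matrix: the exponent from which the ranks of
  its powers are constant.\<close>

definition stable_index :: "'v set \<Rightarrow> ('v \<Rightarrow> 'v \<Rightarrow> int) \<Rightarrow> nat" where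
  "stable_index I T = (LEAST l. inj_after I T l)"

lemma mat_vec_pow:
  assumes "finite I" "x \<in> int_vecs I"
  shows "(mat_vec I T ^^ n) x w = (if w \<in> I then \<Sum>v\<in>I. x v * mat_pow I T n v w else 0)"
proof (induction n arbitrary: w)
  case 0
  have "(\<Sum>v\<in>I. x v * (if v = w then 1 else 0)) = (\<Sum>v\<in>I. if w = v then x v else 0)"
    by (rule sum.cong) auto
  with assms show ?case by (simp add: int_vecs_def)
next
  case (Suc n)
  have "(\<Sum>u\<in>I. (\<Sum>v\<in>I. x v * mat_pow I T n v u) * T u w)
      = (\<Sum>v\<in>I. x v * (\<Sum>u\<in>I. mat_pow I T n v u * T u w))"
    by (simp add: sum_distrib_left sum_distrib_right mult.assoc) (rule sum.swap)
  with Suc show ?case by (simp add: mat_vec_def cong: sum.cong)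
qed

text \<open>\<open>mat_pow\<close> grows by a factor on the right. Transposition turns this into a
  factor on the left, so the two recursions have to agree.\<close>

lemma mat_pow_Suc_left:
  assumes "finite I" "v \<in> I" "w \<in> I"
  shows "mat_pow I T (Suc n) v w = (\<Sum>u\<in>I. T v u * mat_pow I T n u w)"
  using assms(3)
proof (induction n arbitrary: w)
  case 0
  have "(\<Sum>u\<in>I. (if v = u then 1 else 0) * T u w) = (\<Sum>u\<in>I. if v = u then T u w else 0)"
    "(\<Sum>u\<in>I. T v u * (if u = w then 1 else 0)) = (\<Sum>u\<in>I. if w = u then T v u else 0)"
    by (rule sum.cong; auto)+
  with 0 assms(1,2) show ?case by simp
next
  case (Suc n)
  have "mat_pow I T (Suc (Suc n)) v w = (\<Sum>z\<in>I. (\<Sum>u\<in>I. T v u * mat_pow I T n u z) * T z w)"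
    using Suc.IH by (simp only: mat_pow.simps(2)[of I T "Suc n"] cong: sum.cong)
  also have "\<dots> = (\<Sum>u\<in>I. T v u * mat_pow I T (Suc n) u w)"
    by (simp add: sum_distrib_left sum_distrib_right mult.assoc) (rule sum.swap)
  finally show ?case .
qed

lemma mat_pow_transpose:
  assumes "finite I" "v \<in> I" "w \<in> I"
  shows "mat_pow I (\<lambda>v w. T w v) n v w = mat_pow I T n w v"
  using assms(2,3)
proof (induction n arbitrary: v w)
  case (Suc n)
  have "mat_pow I (\<lambda>v w. T w v) (Suc n) v w = (\<Sum>u\<in>I. T w u * mat_pow I T n u v)"
    using Suc by (simp add: mult.commute cong: sum.cong)
  with mat_pow_Suc_left[OF assms(1) Suc.prems(2,1)] show ?case by metis
qed auto

text \<open>A polynomial that annihilates a matrix annihilates its transpose, with the same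
  coefficients.\<close>

lemma annihilated_after_transpose:
  assumes "finite I"
  shows "annihilated_after I (\<lambda>v w. T w v) l \<longleftrightarrow> annihilated_after I T l"
proof -
  have "(\<forall>v\<in>I. \<forall>w\<in>I. (\<Sum>k\<le>N. c k * mat_pow I (\<lambda>v w. T w v) (l + k) v w) = 0) \<longleftrightarrow>
      (\<forall>v\<in>I. \<forall>w\<in>I. (\<Sum>k\<le>N. c k * mat_pow I T (l + k) v w) = 0)" for N c
  proof -
    have "(\<Sum>k\<le>N. c k * mat_pow I (\<lambda>v w. T w v) (l + k) v w) = (\<Sum>k\<le>N. c k * mat_pow I T (l + k) w v)"
      if "v \<in> I" "w \<in> I" for v w
      by (simp only: mat_pow_transpose[OF assms that, of T])
    then have "(\<forall>v\<in>I. \<forall>w\<in>I. (\<Sum>k\<le>N. c k * mat_pow I (\<lambda>v w. T w v) (l + k) v w) = 0) \<longleftrightarrow>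
      (\<forall>v\<in>I. \<forall>w\<in>I. (\<Sum>k\<le>N. c k * mat_pow I T (l + k) w v) = 0)"
      by (intro ball_cong refl) simp
    then show ?thesis by blast
  qed
  then show ?thesis unfolding annihilated_after_def by simp
qed

lemma int_vecs_delta: "v \<in> I \<Longrightarrow> (\<lambda>u. if u = v then 1 else 0) \<in> int_vecs I"
  by (auto simp: int_vecs_def)

lemma mat_vec_in: "mat_vec I T x \<in> int_vecs I"
  by (auto simp: int_vecs_def mat_vec_def)

lemma mat_vec_pow_in: "x \<in> int_vecs I \<Longrightarrow> (mat_vec I T ^^ n) x \<in> int_vecs I"
  by (induction n) (auto simp: mat_vec_in)

text \<open>The matrix entries are the coordinates of the images of the unit vectors, and every
  vector is a combination of these.\<close>

lemma annihilated_after_iff: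
  assumes "finite I"
  shows "annihilated_after I T l \<longleftrightarrow> (\<exists>N c. c 0 \<noteq> 0 \<and>
     (\<forall>x\<in>int_vecs I. \<forall>w. (\<Sum>k\<le>N. c k * (mat_vec I T ^^ (l + k)) x w) = 0))"
proof -
  have "(\<forall>v\<in>I. \<forall>w\<in>I. (\<Sum>k\<le>N. c k * mat_pow I T (l + k) v w) = 0) \<longleftrightarrow>
     (\<forall>x\<in>int_vecs I. \<forall>w. (\<Sum>k\<le>N. c k * (mat_vec I T ^^ (l + k)) x w) = 0)" for N c
  proof (intro iffI ballI allI)
    fix x w assume *: "\<forall>v\<in>I. \<forall>w\<in>I. (\<Sum>k\<le>N. c k * mat_pow I T (l + k) v w) = 0"
      and x: "x \<in> int_vecs I"
    show "(\<Sum>k\<le>N. c k * (mat_vec I T ^^ (l + k)) x w) = 0"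
    proof (cases "w \<in> I")
      case True
      have "(\<Sum>k\<le>N. c k * (mat_vec I T ^^ (l + k)) x w)
          = (\<Sum>k\<le>N. \<Sum>v\<in>I. x v * (c k * mat_pow I T (l + k) v w))"
        using True by (simp add: mat_vec_pow[OF assms x] sum_distrib_left mult.left_commute)
      also have "\<dots> = (\<Sum>v\<in>I. x v * (\<Sum>k\<le>N. c k * mat_pow I T (l + k) v w))"
        by (subst sum.swap) (simp add: sum_distrib_left)
      finally show ?thesis using * True by simp
    qed (simp add: mat_vec_pow[OF assms x])
  next
    fix v w assume *: "\<forall>x\<in>int_vecs I. \<forall>w. (\<Sum>k\<le>N. c k * (mat_vec I T ^^ (l + k)) x w) = 0"
      and vw: "v \<in> I" "w \<in> I"
    let ?x = "\<lambda>u. if u = v then 1 else 0"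
    have "(\<Sum>u\<in>I. ?x u * m u) = m v" for m :: "_ \<Rightarrow> int"
    proof -
      have "(\<Sum>u\<in>I. ?x u * m u) = (\<Sum>u\<in>I. if v = u then m u else 0)"
        by (rule sum.cong) auto
      then show ?thesis using assms vw by simp
    qed
    then have eq: "(mat_vec I T ^^ n) ?x w = mat_pow I T n v w" for n
      using mat_vec_pow[OF assms int_vecs_delta[OF vw(1)]] vw by simp
    show "(\<Sum>k\<le>N. c k * mat_pow I T (l + k) v w) = 0"
      using spec[OF bspec[OF * int_vecs_delta[OF vw(1)]], of w] by (simp only: eq)
  qed
  then show ?thesis by (simp add: annihilated_after_def)
qed

text \<open>For an \<open>n\<close> by \<open>n\<close> matrix the powers with exponents 0 to
  \<open>n^2\<close> are linearly dependent in the space of matrices. The lowest power with nonzero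
  coefficient in a dependency can serve as \<open>l\<close>; its coefficient becomes
  \<open>c 0\<close> after the shift.\<close>

lemma annihilated_after_exists:
  assumes "finite I"
  shows "\<exists>l. annihilated_after I T l"
proof -
  let ?n = "card (I \<times> I)"
  have "\<exists>c. (\<exists>k\<in>{..?n}. c k \<noteq> 0) \<and>
      (\<forall>p\<in>I \<times> I. (\<Sum>k\<in>{..?n}. c k * mat_pow I T k (fst p) (snd p)) = 0)"
    using assms
    by (intro int_vectors_dependent[of "I \<times> I" "{..?n}" "\<lambda>k p. mat_pow I T k (fst p) (snd p)"]) auto
  then obtain c where c: "\<exists>k\<in>{..?n}. c k \<noteq> 0"
      "\<forall>p\<in>I \<times> I. (\<Sum>k\<in>{..?n}. c k * mat_pow I T k (fst p) (snd p)) = 0" by blast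
  define l where "l = (LEAST k. c k \<noteq> 0)"
  have "\<exists>k. c k \<noteq> 0" using c(1) by blast
  then have l: "c l \<noteq> 0" unfolding l_def by (rule LeastI_ex)
  have lmin: "c k = 0" if "k < l" for k using that not_less_Least unfolding l_def by blast
  have ln: "l \<le> ?n" using c(1) lmin by (meson atMost_iff leI le_trans less_imp_le_nat)
  have "(\<Sum>k\<le>?n - l. c (l + k) * mat_pow I T (l + k) v w) = 0" if "v \<in> I" "w \<in> I" for v w
  proof -
    have "(\<Sum>k\<in>{..?n}. c k * mat_pow I T k v w) = (\<Sum>k\<in>{l..?n}. c k * mat_pow I T k v w)"
      by (rule sum.mono_neutral_right) (auto simp: lmin)
    also have "\<dots> = (\<Sum>k\<le>?n - l. c (l + k) * mat_pow I T (l + k) v w)"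
      by (rule sum.reindex_bij_witness[of _ "\<lambda>k. l + k" "\<lambda>k. k - l"]) (use ln in auto)
    finally show ?thesis using c(2) that by force
  qed
  then have "annihilated_after I T l"
    unfolding annihilated_after_def using l
    by (intro exI[of _ "?n - l"] exI[of _ "\<lambda>k. c (l + k)"]) auto
  then show ?thesis ..
qed

lemma mat_vec_diff: "mat_vec I T (\<lambda>w. x w - y w) = (\<lambda>w. mat_vec I T x w - mat_vec I T y w)"
  by (auto simp: mat_vec_def left_diff_distrib sum_subtractf)

lemma mat_vec_pow_diff:
  "(mat_vec I T ^^ n) (\<lambda>w. x w - y w) = (\<lambda>w. (mat_vec I T ^^ n) x w - (mat_vec I T ^^ n) y w)"
  by (induction n) (simp_all add: mat_vec_diff)

lemma mat_vec_sum:
  "finite S \<Longrightarrow> mat_vec I T (\<lambda>w. \<Sum>k\<in>S. c k * y k w) = (\<lambda>w. \<Sum>k\<in>S. c k * mat_vec I T (y k) w)"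
  by (rule ext) (simp add: mat_vec_def sum_distrib_left sum_distrib_right mult.assoc sum.swap[of _ I])

lemma mat_vec_pow_sum:
  "finite S \<Longrightarrow> (mat_vec I T ^^ n) (\<lambda>w. \<Sum>k\<in>S. c k * y k w)
     = (\<lambda>w. \<Sum>k\<in>S. c k * (mat_vec I T ^^ n) (y k) w)"
  by (induction n) (simp_all add: mat_vec_sum)

lemma mat_vec_zero: "mat_vec I T (\<lambda>_. 0) = (\<lambda>_. 0)"
  by (auto simp: mat_vec_def)

lemma mat_vec_pow_zero: "(mat_vec I T ^^ n) (\<lambda>_. 0) = (\<lambda>_. 0)"
  by (induction n) (simp_all add: mat_vec_zero)

lemma int_vecs_diff: "x \<in> int_vecs I \<Longrightarrow> y \<in> int_vecs I \<Longrightarrow> (\<lambda>w. x w - y w) \<in> int_vecs I"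
  by (auto simp: int_vecs_def)

text \<open>If \<open>T\<close> kills \<open>T^l z\<close>, all terms of the annihilating sum except
  the one for \<open>k = 0\<close> vanish on \<open>z\<close>, and \<open>c 0\<close> is
  nonzero.\<close>

lemma annihilated_after_imp_inj_after:
  assumes "finite I" "annihilated_after I T l"
  shows "inj_after I T l"
proof -
  let ?B = "mat_vec I T"
  from assms obtain N c where c: "c 0 \<noteq> 0"
    "\<And>x w. x \<in> int_vecs I \<Longrightarrow> (\<Sum>k\<le>N. c k * (?B ^^ (l + k)) x w) = 0"
    unfolding annihilated_after_iff[OF assms(1)] by blast
  have "(?B ^^ l) x = (?B ^^ l) y"
    if xy: "x \<in> int_vecs I" "y \<in> int_vecs I" "?B ((?B ^^ l) x) = ?B ((?B ^^ l) y)" for x y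
  proof
    fix w
    define z where "z = (\<lambda>w. x w - y w)"
    have z: "z \<in> int_vecs I" using xy by (simp add: z_def int_vecs_diff)
    have "?B ((?B ^^ l) z) = (\<lambda>_. 0)"
      using xy(3) by (simp add: z_def mat_vec_pow_diff mat_vec_diff)
    then have *: "(?B ^^ (l + Suc k)) z = (\<lambda>_. 0)" for k
    proof -
      assume a: "?B ((?B ^^ l) z) = (\<lambda>_. 0)"
      have "(?B ^^ (l + Suc k)) z = (?B ^^ k) (?B ((?B ^^ l) z))"
      proof -
        have "l + Suc k = k + Suc l" by simp
        then show ?thesis by (simp only: funpow_add o_apply funpow.simps)
      qed
      with a show ?thesis by (simp add: mat_vec_pow_zero)
    qed
    have "(\<Sum>k\<le>N. c k * (?B ^^ (l + k)) z w) = (\<Sum>k\<in>{0}. c k * (?B ^^ (l + k)) z w)"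
    proof (rule sum.mono_neutral_right)
      show "\<forall>k\<in>{..N} - {0}. c k * (?B ^^ (l + k)) z w = 0"
      proof
        fix k assume "k \<in> {..N} - {0}"
        then obtain k' where "k = Suc k'" by (cases k) auto
        then show "c k * (?B ^^ (l + k)) z w = 0" using fun_cong[OF *[of k'], of w] by simp
      qed
    qed auto
    with c(2)[OF z] c(1) have "(?B ^^ l) z w = 0" by simp
    then show "(?B ^^ l) x w = (?B ^^ l) y w" by (simp add: z_def mat_vec_pow_diff)
  qed
  then show ?thesis by (auto simp: inj_after_def intro!: inj_onI)
qed

lemma inj_after_mono:
  assumes "inj_after I T l" "l \<le> m"
  shows "inj_after I T m"
proof -
  have "(mat_vec I T ^^ m) ` int_vecs I \<subseteq> (mat_vec I T ^^ l) ` int_vecs I"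
  proof
    fix y assume "y \<in> (mat_vec I T ^^ m) ` int_vecs I"
    then obtain x where x: "x \<in> int_vecs I" "y = (mat_vec I T ^^ m) x" by blast
    have "y = (mat_vec I T ^^ l) ((mat_vec I T ^^ (m - l)) x)"
      using x assms(2) by (metis funpow_add le_add_diff_inverse o_apply)
    then show "y \<in> (mat_vec I T ^^ l) ` int_vecs I" using mat_vec_pow_in[OF x(1)] by blast
  qed
  with assms(1) show ?thesis unfolding inj_after_def by (rule inj_on_subset)
qed

lemma annihilated_after_mono:
  assumes "finite I" "annihilated_after I T l" "l \<le> m"
  shows "annihilated_after I T m"
proof -
  let ?B = "mat_vec I T"
  from assms obtain N c where c: "c 0 \<noteq> 0"
    "\<And>x w. x \<in> int_vecs I \<Longrightarrow> (\<Sum>k\<le>N. c k * (?B ^^ (l + k)) x w) = 0"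
    unfolding annihilated_after_iff[OF assms(1)] by blast
  have "(\<Sum>k\<le>N. c k * (?B ^^ (m + k)) x w) = 0" if x: "x \<in> int_vecs I" for x w
  proof -
    have "(?B ^^ (m + k)) x = (?B ^^ (l + k)) ((?B ^^ (m - l)) x)" for k
    proof -
      have "m + k = (l + k) + (m - l)" using assms(3) by simp
      then show ?thesis by (metis funpow_add o_apply)
    qed
    then show ?thesis using c(2)[OF mat_vec_pow_in[OF x, of "m - l" T]] by simp
  qed
  with c(1) show ?thesis unfolding annihilated_after_iff[OF assms(1)] by blast
qed

text \<open>Let \<open>q\<close> be the sum of the \<open>c k T^k\<close>. The vector obtained from
  \<open>x\<close> by \<open>q\<close> and \<open>T^l\<close> is killed by \<open>T\<close> and lies
  in the image of \<open>T^l\<close>, where \<open>T\<close> is injective.\<close>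

lemma annihilated_after_down:
  assumes "finite I" "annihilated_after I T (Suc l)" "inj_after I T l"
  shows "annihilated_after I T l"
proof -
  let ?B = "mat_vec I T"
  from assms obtain N c where c: "c 0 \<noteq> 0"
    "\<And>x w. x \<in> int_vecs I \<Longrightarrow> (\<Sum>k\<le>N. c k * (?B ^^ (Suc l + k)) x w) = 0"
    unfolding annihilated_after_iff[OF assms(1)] by blast
  have "(\<Sum>k\<le>N. c k * (?B ^^ (l + k)) x w) = 0" if x: "x \<in> int_vecs I" for x w
  proof -
    define y where "y = (\<lambda>w. \<Sum>k\<le>N. c k * (?B ^^ (l + k)) x w)"
    define y' where "y' = (\<lambda>w. \<Sum>k\<le>N. c k * (?B ^^ k) x w)"
    have "y' \<in> int_vecs I"
      using mat_vec_pow_in[OF x] by (auto simp: y'_def int_vecs_def)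
    moreover have y: "y = (?B ^^ l) y'"
      by (simp add: y_def y'_def mat_vec_pow_sum funpow_add)
    moreover have "?B y = (\<lambda>_. 0)"
      using c(2)[OF x] by (simp add: y_def mat_vec_sum)
    moreover have "(\<lambda>_. 0) = (?B ^^ l) (\<lambda>_. 0)" "(\<lambda>_. 0) \<in> int_vecs I"
      by (auto simp: mat_vec_pow_zero int_vecs_def)
    moreover have "?B (\<lambda>_. 0) = (\<lambda>_. 0)" by (rule mat_vec_zero)
    ultimately have "y = (\<lambda>_. 0)"
      using assms(3) unfolding inj_after_def by (metis (no_types, lifting) imageI inj_onD)
    then show ?thesis by (metis y_def)
  qed
  with c(1) show ?thesis unfolding annihilated_after_iff[OF assms(1)] by blast
qed

text \<open>Some exponent admits an annihilating polynomial. \<open>annihilated_after_down\<close>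
  lowers the exponent step by step as long as injectivity holds, that is, down to
  \<open>l\<close>.\<close>

lemma inj_after_iff:
  assumes "finite I"
  shows "inj_after I T l \<longleftrightarrow> annihilated_after I T l"
proof
  assume l: "inj_after I T l"
  obtain m where "annihilated_after I T m" using annihilated_after_exists[OF assms] ..
  then have "annihilated_after I T (max l m)" by (rule annihilated_after_mono[OF assms]) simp
  then show "annihilated_after I T l"
  proof (rule dec_induct[where P = "\<lambda>n. annihilated_after I T n \<longrightarrow> annihilated_after I T l",
        of l "max l m", THEN mp, rotated -1])
    fix n assume "l \<le> n" "annihilated_after I T n \<longrightarrow> annihilated_after I T l"
    then show "annihilated_after I T (Suc n) \<longrightarrow> annihilated_after I T l"
      using annihilated_after_down[OF assms] inj_after_mono[OF l] by blast
  qed auto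
qed (rule annihilated_after_imp_inj_after[OF assms])

lemma stable_index_transpose:
  "finite I \<Longrightarrow> stable_index I (\<lambda>v w. T w v) = stable_index I T"
proof -
  assume I: "finite I"
  have "inj_after I (\<lambda>v w. T w v) = inj_after I T"
    by (rule ext) (simp only: inj_after_iff[OF I] annihilated_after_transpose[OF I, of T])
  then show ?thesis unfolding stable_index_def by (rule arg_cong)
qed

lemma inj_after_stable_index: "finite I \<Longrightarrow> inj_after I T (stable_index I T)"
  unfolding stable_index_def using annihilated_after_exists inj_after_iff by (metis LeastI_ex)

lemma inj_after_iff_le:
  assumes "finite I"
  shows "inj_after I T l \<longleftrightarrow> stable_index I T \<le> l"
  using inj_after_stable_index[OF assms] inj_after_mono
  by (metis Least_le stable_index_def)

text \<open>For index 0 the matrix is invertible over the rationals and its inverse is a polynomial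
  in it. Denominators are cleared by the factor \<open>c 0\<close>, which is why a multiple of
  \<open>z\<close> appears.\<close>

lemma stable_index_0_preimage:
  assumes "finite I" "stable_index I T = 0" "z \<in> int_vecs I"
  obtains n y where "n \<noteq> 0" "y \<in> int_vecs I" "mat_vec I T y = (\<lambda>w. n * z w)"
proof -
  let ?B = "mat_vec I T"
  have "annihilated_after I T 0"
    using inj_after_iff[OF assms(1), of T 0] inj_after_iff_le[OF assms(1), of T 0] assms(2) by simp
  then obtain N c where c: "c 0 \<noteq> 0"
    "\<And>x w. x \<in> int_vecs I \<Longrightarrow> (\<Sum>k\<le>N. c k * (?B ^^ k) x w) = 0"
    unfolding annihilated_after_iff[OF assms(1)] by auto
  \<comment> \<open>The annihilating identity is solved for its constant term, and one factor
    \<open>T\<close> is split off.\<close>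
  define y where "y = (\<lambda>w. \<Sum>k<N. - c (Suc k) * (?B ^^ k) z w)"
  have "y \<in> int_vecs I" using mat_vec_pow_in[OF assms(3)] by (auto simp: y_def int_vecs_def)
  moreover have "?B y = (\<lambda>w. c 0 * z w)"
  proof
    fix w
    have "(\<Sum>k\<le>N. c k * (?B ^^ k) z w) = c 0 * z w + (\<Sum>k<N. c (Suc k) * (?B ^^ Suc k) z w)"
      by (subst sum.atMost_shift) simp
    moreover have "?B y w = (\<Sum>k<N. - c (Suc k) * (?B ^^ Suc k) z w)"
      unfolding y_def by (simp only: mat_vec_sum[OF finite_lessThan] funpow.simps o_apply)
    ultimately show "?B y w = c 0 * z w" using c(2)[OF assms(3), of w] by (simp add: sum_negf)
  qed
  ultimately show ?thesis using c(1) that by blast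
qed

section \<open>The path algebra\<close>

text \<open>\<open>cv v r\<close> and \<open>ca a r\<close> stand for the coefficients of \<open>r\<close> at the trivial path at \<open>v\<close> and at the arrow \<open>a\<close>.\<close>

locale rad_sq_zero = R: ring R + K: field K
  for R :: "('r, 'i) ring_scheme" (structure) and K :: "('k, 'j) ring_scheme" +
  fixes V :: "'v set" and E :: "'a set" and src tgt :: "'a \<Rightarrow> 'v"
    and cv :: "'v \<Rightarrow> 'r \<Rightarrow> 'k" and ca :: "'a \<Rightarrow> 'r \<Rightarrow> 'k"
  assumes finite_V: "finite V" and finite_E: "finite E"
    and src_in: "a \<in> E \<Longrightarrow> src a \<in> V" and tgt_in: "a \<in> E \<Longrightarrow> tgt a \<in> V"
    and cv_closed: "v \<in> V \<Longrightarrow> r \<in> carrier R \<Longrightarrow> cv v r \<in> carrier K"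
    and ca_closed: "a \<in> E \<Longrightarrow> r \<in> carrier R \<Longrightarrow> ca a r \<in> carrier K"
    and cv_add: "v \<in> V \<Longrightarrow> r \<in> carrier R \<Longrightarrow> r' \<in> carrier R \<Longrightarrow> cv v (r \<oplus> r') = cv v r \<oplus>\<^bsub>K\<^esub> cv v r'"
    and ca_add: "a \<in> E \<Longrightarrow> r \<in> carrier R \<Longrightarrow> r' \<in> carrier R \<Longrightarrow> ca a (r \<oplus> r') = ca a r \<oplus>\<^bsub>K\<^esub> ca a r'"
    and cv_mult: "v \<in> V \<Longrightarrow> r \<in> carrier R \<Longrightarrow> r' \<in> carrier R \<Longrightarrow> cv v (r \<otimes> r') = cv v r \<otimes>\<^bsub>K\<^esub> cv v r'"
    and ca_mult: "a \<in> E \<Longrightarrow> r \<in> carrier R \<Longrightarrow> r' \<in> carrier R \<Longrightarrow>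
      ca a (r \<otimes> r') = cv (src a) r \<otimes>\<^bsub>K\<^esub> ca a r' \<oplus>\<^bsub>K\<^esub> ca a r \<otimes>\<^bsub>K\<^esub> cv (tgt a) r'"
    and cv_one: "v \<in> V \<Longrightarrow> cv v \<one> = \<one>\<^bsub>K\<^esub>" and ca_one: "a \<in> E \<Longrightarrow> ca a \<one> = \<zero>\<^bsub>K\<^esub>"
    and coord_ext: "r \<in> carrier R \<Longrightarrow> r' \<in> carrier R \<Longrightarrow> (\<And>v. v \<in> V \<Longrightarrow> cv v r = cv v r') \<Longrightarrow>
      (\<And>a. a \<in> E \<Longrightarrow> ca a r = ca a r') \<Longrightarrow> r = r'"
    and coord_ex: "(\<And>v. v \<in> V \<Longrightarrow> p v \<in> carrier K) \<Longrightarrow> (\<And>a. a \<in> E \<Longrightarrow> q a \<in> carrier K) \<Longrightarrow>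
      \<exists>r\<in>carrier R. (\<forall>v\<in>V. cv v r = p v) \<and> (\<forall>a\<in>E. ca a r = q a)"

text \<open>Reversing the product exchanges the two terms in the product rule for \<open>ca\<close>,
  hence the roles of \<open>src\<close> and \<open>tgt\<close>. Every result of the locale thereby
  applies to the opposite ring as well.\<close>

lemma (in rad_sq_zero) opposite: "rad_sq_zero (opposite_ring R) K V E tgt src cv ca"
proof -
  have [simp]: "carrier (opposite_ring R) = carrier R" "x \<oplus>\<^bsub>opposite_ring R\<^esub> y = x \<oplus> y"
    "x \<otimes>\<^bsub>opposite_ring R\<^esub> y = y \<otimes> x" "\<one>\<^bsub>opposite_ring R\<^esub> = \<one>" "\<zero>\<^bsub>opposite_ring R\<^esub> = \<zero>" for x y
    by (simp_all add: opposite_ring_def)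
  have "ring (opposite_ring R)"
  proof (rule ringI)
    show "abelian_group (opposite_ring R)"
      by (rule abelian_groupI) (use R.l_neg R.a_inv_closed in \<open>auto simp: R.a_ac\<close>)
    show "Group.monoid (opposite_ring R)"
      by (rule monoidI) (auto simp: R.m_assoc)
  qed (auto simp: R.l_distr R.r_distr)
  then show ?thesis
  proof (intro rad_sq_zero.intro rad_sq_zero_axioms.intro K.field_axioms)
    fix r r' assume "r \<in> carrier (opposite_ring R)" "r' \<in> carrier (opposite_ring R)"
      "\<And>v. v \<in> V \<Longrightarrow> cv v r = cv v r'" "\<And>a. a \<in> E \<Longrightarrow> ca a r = ca a r'"
    then show "r = r'" using coord_ext[of r r'] by simp
  next
    fix p q assume "\<And>v. v \<in> V \<Longrightarrow> p v \<in> carrier K" "\<And>a. a \<in> E \<Longrightarrow> q a \<in> carrier K"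
    then show "\<exists>r\<in>carrier (opposite_ring R). (\<forall>v\<in>V. cv v r = p v) \<and> (\<forall>a\<in>E. ca a r = q a)"
      using coord_ex by simp
  qed (auto simp: finite_V finite_E src_in tgt_in cv_closed ca_closed cv_add ca_add cv_mult ca_mult
      cv_one ca_one K.m_comm K.a_comm)
qed

text \<open>Associativity of the path product along one path: \<open>a\<close>, \<open>b\<close>,
  \<open>c\<close> are the values of the three factors on the segments obtained by cutting at
  \<open>i\<close> and \<open>j\<close>. Both sides run over all cuts
  \<open>i \<le> j \<le> n\<close>, with \<open>j = i + m\<close> on the right.\<close>

lemma (in ring) convolution_assoc:
  fixes a c :: "nat \<Rightarrow> 'a" and b :: "nat \<Rightarrow> nat \<Rightarrow> 'a"
  assumes "\<And>i. i \<le> n \<Longrightarrow> a i \<in> carrier R" "\<And>i j. i \<le> j \<Longrightarrow> j \<le> n \<Longrightarrow> b i j \<in> carrier R"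
    "\<And>i. i \<le> n \<Longrightarrow> c i \<in> carrier R"
  shows "(\<Oplus>j\<in>{..n}. (\<Oplus>i\<in>{..j}. a i \<otimes> b i j) \<otimes> c j)
       = (\<Oplus>i\<in>{..n}. a i \<otimes> (\<Oplus>m\<in>{..n - i}. b i (i + m) \<otimes> c (i + m)))"
  using assms
proof (induction n)
  case 0
  then show ?case by (simp add: m_assoc)
next
  case (Suc n)
  note [simp] = Suc.prems
  let ?S = "\<lambda>n i. (\<Oplus>m\<in>{..n - i}. b i (i + m) \<otimes> c (i + m))"
  have Sc: "?S n i \<in> carrier R" if "i \<le> n" for i using that by (intro finsum_closed) auto
  have "(\<Oplus>j\<in>{..Suc n}. (\<Oplus>i\<in>{..j}. a i \<otimes> b i j) \<otimes> c j)
      = (\<Oplus>i\<in>{..Suc n}. a i \<otimes> b i (Suc n)) \<otimes> c (Suc n) \<oplus> (\<Oplus>j\<in>{..n}. (\<Oplus>i\<in>{..j}. a i \<otimes> b i j) \<otimes> c j)"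
    by (rule finsum_Suc) auto
  also have "(\<Oplus>j\<in>{..n}. (\<Oplus>i\<in>{..j}. a i \<otimes> b i j) \<otimes> c j) = (\<Oplus>i\<in>{..n}. a i \<otimes> ?S n i)"
    by (rule Suc.IH) auto
  also have "(\<Oplus>i\<in>{..Suc n}. a i \<otimes> b i (Suc n)) \<otimes> c (Suc n)
      = (\<Oplus>i\<in>{..Suc n}. a i \<otimes> (b i (Suc n) \<otimes> c (Suc n)))"
    by (subst finsum_ldistr) (auto simp: m_assoc intro!: finsum_cong')
  also have "\<dots> = a (Suc n) \<otimes> (b (Suc n) (Suc n) \<otimes> c (Suc n))
      \<oplus> (\<Oplus>i\<in>{..n}. a i \<otimes> (b i (Suc n) \<otimes> c (Suc n)))"
    by (rule finsum_Suc) auto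
  finally have "(\<Oplus>j\<in>{..Suc n}. (\<Oplus>i\<in>{..j}. a i \<otimes> b i j) \<otimes> c j)
    = a (Suc n) \<otimes> (b (Suc n) (Suc n) \<otimes> c (Suc n))
      \<oplus> ((\<Oplus>i\<in>{..n}. a i \<otimes> (b i (Suc n) \<otimes> c (Suc n))) \<oplus> (\<Oplus>i\<in>{..n}. a i \<otimes> ?S n i))"
    by (simp add: a_assoc Sc)
  also have "(\<Oplus>i\<in>{..n}. a i \<otimes> (b i (Suc n) \<otimes> c (Suc n))) \<oplus> (\<Oplus>i\<in>{..n}. a i \<otimes> ?S n i)
      = (\<Oplus>i\<in>{..n}. a i \<otimes> (b i (Suc n) \<otimes> c (Suc n)) \<oplus> a i \<otimes> ?S n i)"
    by (rule finsum_addf[symmetric]) (auto simp: Sc)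
  also have "\<dots> = (\<Oplus>i\<in>{..n}. a i \<otimes> ?S (Suc n) i)"
  proof (rule finsum_cong')
    fix i assume i: "i \<in> {..n}"
    have "?S (Suc n) i = b i (Suc n) \<otimes> c (Suc n) \<oplus> ?S n i"
    proof -
      have "Suc n - i = Suc (n - i)" using i by auto
      moreover have "(\<Oplus>m\<in>{..Suc (n - i)}. b i (i + m) \<otimes> c (i + m))
         = b i (i + Suc (n - i)) \<otimes> c (i + Suc (n - i)) \<oplus> ?S n i"
        by (rule finsum_Suc) (use i in auto)
      ultimately show ?thesis using i by simp
    qed
    then show "a i \<otimes> (b i (Suc n) \<otimes> c (Suc n)) \<oplus> a i \<otimes> ?S n i = a i \<otimes> ?S (Suc n) i"
      using i Sc by (simp add: r_distr)
  next
    show "(\<lambda>i. a i \<otimes> ?S (Suc n) i) \<in> {..n} \<rightarrow> carrier R" by (auto intro!: m_closed finsum_closed)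
  qed simp
  also have "a (Suc n) \<otimes> (b (Suc n) (Suc n) \<otimes> c (Suc n)) \<oplus> \<dots> = (\<Oplus>i\<in>{..Suc n}. a i \<otimes> ?S (Suc n) i)"
  proof -
    have "(\<Oplus>i\<in>{..Suc n}. a i \<otimes> ?S (Suc n) i) = a (Suc n) \<otimes> ?S (Suc n) (Suc n) \<oplus> (\<Oplus>i\<in>{..n}. a i \<otimes> ?S (Suc n) i)"
      by (rule finsum_Suc) (auto intro!: m_closed finsum_closed)
    then show ?thesis by simp
  qed
  finally show ?case .
qed

section \<open>Ring structure of the path algebra\<close>

locale path_alg = field K + fin_digraph Q
  for K :: "('k, 'm) ring_scheme" (structure) and Q :: "('v, 'a) pre_digraph"
begin

abbreviation "KQ \<equiv> path_algebra K Q"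

text \<open>Total on arc lists, whether walks or not. This makes \<open>walk_end_append\<close>
  unconditional, so that the ring laws can be checked at every pair \<open>(u, p)\<close>.\<close>

definition walk_end :: "'v \<Rightarrow> 'a list \<Rightarrow> 'v" where
  "walk_end u p = (if p = [] then u else head Q (last p))"

lemma awlast_eq: "awlast u p = walk_end u p"
  by (simp add: walk_end_def awalk_verts_conv)

lemma walk_end_append: "walk_end u (p @ p') = walk_end (walk_end u p) p'"
  by (auto simp: walk_end_def)

lemma quiver_path_append:
  "(u, p) \<in> quiver_paths Q \<Longrightarrow> (walk_end u p, p') \<in> quiver_paths Q \<Longrightarrow> (u, p @ p') \<in> quiver_paths Q"
  using awalk_appendI unfolding quiver_paths_def by (force simp: awlast_eq[symmetric])

lemma quiver_path_end: "(u, p) \<in> quiver_paths Q \<Longrightarrow> walk_end u p \<in> verts Q"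
  unfolding quiver_paths_def using awalk_last_in_verts by (force simp: awlast_eq[symmetric])

lemma quiver_path_start: "(u, p) \<in> quiver_paths Q \<Longrightarrow> u \<in> verts Q"
  unfolding quiver_paths_def by (auto simp: awalk_def)

lemma KQ_simps [simp]:
  "\<zero>\<^bsub>KQ\<^esub> = (\<lambda>_. \<zero>)" "f \<oplus>\<^bsub>KQ\<^esub> g = (\<lambda>q. f q \<oplus> g q)"
  "\<one>\<^bsub>KQ\<^esub> = (\<lambda>(u, p). if u \<in> verts Q \<and> p = [] then \<one> else \<zero>)"
  by (simp_all add: path_algebra_def)

lemma KQ_mult:
  "(f \<otimes>\<^bsub>KQ\<^esub> g) (u, p) = (\<Oplus>i\<in>{..length p}. f (u, take i p) \<otimes> g (walk_end u (take i p), drop i p))"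
  by (simp add: path_algebra_def awlast_eq)

lemma KQ_I:
  assumes "\<And>q. f q \<in> carrier K" "finite S" "\<And>q. f q \<noteq> \<zero> \<Longrightarrow> q \<in> S" "\<And>q. f q \<noteq> \<zero> \<Longrightarrow> q \<in> quiver_paths Q"
  shows "f \<in> carrier KQ"
proof -
  have "{q. f q \<noteq> \<zero>} \<subseteq> S" using assms(3) by blast
  then have "finite {q. f q \<noteq> \<zero>}" using assms(2) finite_subset by blast
  with assms(1,4) show ?thesis unfolding path_algebra_def by auto
qed

lemma KQ_D:
  assumes "f \<in> carrier KQ"
  shows KQ_closed [simp]: "f q \<in> carrier K" and KQ_finite: "finite {q. f q \<noteq> \<zero>}"
    and KQ_path: "f q \<noteq> \<zero> \<Longrightarrow> q \<in> quiver_paths Q"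
  using assms unfolding path_algebra_def by (cases q; auto)+

text \<open>A nonzero coefficient of the product requires a cut with nonzero coefficients on both
  halves. The support therefore consists of paths and lies in the finite set of concatenations of
  the two supports.\<close>

lemma KQ_mult_closed:
  assumes "f \<in> carrier KQ" "g \<in> carrier KQ"
  shows "f \<otimes>\<^bsub>KQ\<^esub> g \<in> carrier KQ"
proof -
  let ?F = "{q. f q \<noteq> \<zero>}" and ?G = "{q. g q \<noteq> \<zero>}"
  have ex: "\<exists>i\<le>length p. f (u, take i p) \<noteq> \<zero> \<and> g (walk_end u (take i p), drop i p) \<noteq> \<zero>"
    if "(f \<otimes>\<^bsub>KQ\<^esub> g) (u, p) \<noteq> \<zero>" for u p
  proof (rule ccontr)
    assume *: "\<not> ?thesis"
    have "(f \<otimes>\<^bsub>KQ\<^esub> g) (u, p) = (\<Oplus>i\<in>{..length p}. \<zero>)"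
      unfolding KQ_mult
    proof (rule finsum_cong')
      fix i assume "i \<in> {..length p}"
      with * have "f (u, take i p) = \<zero> \<or> g (walk_end u (take i p), drop i p) = \<zero>" by auto
      then show "f (u, take i p) \<otimes> g (walk_end u (take i p), drop i p) = \<zero>" using assms by auto
    qed auto
    with that show False by simp
  qed
  have sub: "(u, p) \<in> (\<lambda>((u, p), (w, p')). (u, p @ p')) ` (?F \<times> ?G)" if "(f \<otimes>\<^bsub>KQ\<^esub> g) (u, p) \<noteq> \<zero>" for u p
  proof -
    from ex[OF that] obtain i where "f (u, take i p) \<noteq> \<zero>" "g (walk_end u (take i p), drop i p) \<noteq> \<zero>" by blast
    then show "(u, p) \<in> (\<lambda>((u, p), (w, p')). (u, p @ p')) ` (?F \<times> ?G)"
      by (intro image_eqI[of _ _ "((u, take i p), (walk_end u (take i p), drop i p))"]) simp_all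
  qed
  have "finite ((\<lambda>((u, p), (w, p')). (u, p @ p')) ` (?F \<times> ?G))" using assms by (simp add: KQ_finite)
  moreover have "q \<in> quiver_paths Q" if "(f \<otimes>\<^bsub>KQ\<^esub> g) q \<noteq> \<zero>" for q
  proof -
    obtain u p where q: "q = (u, p)" by fastforce
    from ex that q obtain i where "f (u, take i p) \<noteq> \<zero>" "g (walk_end u (take i p), drop i p) \<noteq> \<zero>" by blast
    then have "(u, take i p @ drop i p) \<in> quiver_paths Q" using assms KQ_path quiver_path_append by blast
    then show ?thesis by (simp add: q)
  qed
  moreover have "(f \<otimes>\<^bsub>KQ\<^esub> g) q \<in> carrier K" for q
    by (cases q) (simp add: KQ_mult, rule finsum_closed, use assms in auto)
  ultimately show ?thesis using sub by (intro KQ_I) (auto simp del: KQ_simps)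
qed

lemma KQ_assoc:
  assumes f: "f \<in> carrier KQ" and g: "g \<in> carrier KQ" and h: "h \<in> carrier KQ"
  shows "(f \<otimes>\<^bsub>KQ\<^esub> g) \<otimes>\<^bsub>KQ\<^esub> h = f \<otimes>\<^bsub>KQ\<^esub> (g \<otimes>\<^bsub>KQ\<^esub> h)"
proof (rule ext, clarify)
  fix u and p :: "'a list"
  let ?n = "length p"
  \<comment> \<open>The factors on the segments of \<open>p\<close> before \<open>i\<close>, between
    \<open>i\<close> and \<open>j\<close>, and after \<open>j\<close>.\<close>
  define a where "a i = f (u, take i p)" for i
  define b where "b i j = g (walk_end u (take i p), drop i (take j p))" for i j
  define c where "c j = h (walk_end u (take j p), drop j p)" for j
  have [simp]: "a i \<in> carrier K" "b i j \<in> carrier K" "c j \<in> carrier K" for i j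
    using assms by (simp_all add: a_def b_def c_def)
  have "((f \<otimes>\<^bsub>KQ\<^esub> g) \<otimes>\<^bsub>KQ\<^esub> h) (u, p) = (\<Oplus>j\<in>{..?n}. (f \<otimes>\<^bsub>KQ\<^esub> g) (u, take j p) \<otimes> c j)"
    by (simp add: KQ_mult c_def)
  also have "\<dots> = (\<Oplus>j\<in>{..?n}. (\<Oplus>i\<in>{..j}. a i \<otimes> b i j) \<otimes> c j)"
  proof (rule finsum_cong')
    fix j assume j: "j \<in> {..?n}"
    have "(f \<otimes>\<^bsub>KQ\<^esub> g) (u, take j p) = (\<Oplus>i\<in>{..j}. a i \<otimes> b i j)"
      unfolding KQ_mult
      by (rule finsum_cong') (use j in \<open>auto simp: a_def b_def min_def f g\<close>)
    then show "(f \<otimes>\<^bsub>KQ\<^esub> g) (u, take j p) \<otimes> c j = (\<Oplus>i\<in>{..j}. a i \<otimes> b i j) \<otimes> c j" by simp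
  qed (auto intro!: m_closed finsum_closed)
  also have "\<dots> = (\<Oplus>i\<in>{..?n}. a i \<otimes> (\<Oplus>m\<in>{..?n - i}. b i (i + m) \<otimes> c (i + m)))"
    by (rule convolution_assoc) auto
  also have "\<dots> = (\<Oplus>i\<in>{..?n}. a i \<otimes> (g \<otimes>\<^bsub>KQ\<^esub> h) (walk_end u (take i p), drop i p))"
  proof (rule finsum_cong')
    fix i assume i: "i \<in> {..?n}"
    have "(g \<otimes>\<^bsub>KQ\<^esub> h) (walk_end u (take i p), drop i p) = (\<Oplus>m\<in>{..?n - i}. b i (i + m) \<otimes> c (i + m))"
      unfolding KQ_mult
    proof (rule finsum_cong')
      fix m assume m: "m \<in> {..?n - i}"
      have "take (i + m) p = take i p @ take m (drop i p)" by (simp add: take_add)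
      then show "g (walk_end u (take i p), take m (drop i p)) \<otimes>
          h (walk_end (walk_end u (take i p)) (take m (drop i p)), drop m (drop i p)) = b i (i + m) \<otimes> c (i + m)"
        using i m by (simp add: b_def c_def walk_end_append add.commute)
    qed auto
    then show "a i \<otimes> (\<Oplus>m\<in>{..?n - i}. b i (i + m) \<otimes> c (i + m)) = a i \<otimes> (g \<otimes>\<^bsub>KQ\<^esub> h) (walk_end u (take i p), drop i p)"
      by simp
  qed (auto simp: KQ_mult_closed[OF g h])
  finally show "((f \<otimes>\<^bsub>KQ\<^esub> g) \<otimes>\<^bsub>KQ\<^esub> h) (u, p) = (f \<otimes>\<^bsub>KQ\<^esub> (g \<otimes>\<^bsub>KQ\<^esub> h)) (u, p)"
    by (simp add: KQ_mult[of f] a_def)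
qed

lemma KQ_l_one:
  assumes f: "f \<in> carrier KQ"
  shows "\<one>\<^bsub>KQ\<^esub> \<otimes>\<^bsub>KQ\<^esub> f = f"
proof (rule ext, clarify)
  fix u p
  have "(\<one>\<^bsub>KQ\<^esub> \<otimes>\<^bsub>KQ\<^esub> f) (u, p) = (\<Oplus>i\<in>{..length p}. if 0 = i then f (u, p) else \<zero>)"
    unfolding KQ_mult
  proof (rule finsum_cong')
    fix i assume "i \<in> {..length p}"
    \<comment> \<open>The one of the algebra is 0 at \<open>(u, [])\<close> if \<open>u\<close> is
      not a vertex; no path starts at such a \<open>u\<close>, so \<open>f\<close> vanishes there
      too.\<close>
    moreover have "f (u, p) = \<zero>" if "u \<notin> verts Q" using f that KQ_path quiver_path_start by blast
    ultimately show "\<one>\<^bsub>KQ\<^esub> (u, take i p) \<otimes> f (walk_end u (take i p), drop i p) = (if 0 = i then f (u, p) else \<zero>)"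
      using f by (auto simp: walk_end_def)
  qed (use f in auto)
  also have "\<dots> = f (u, p)"
    using finsum_singleton[of 0 "{..length p}" "\<lambda>_. f (u, p)"] f by auto
  finally show "(\<one>\<^bsub>KQ\<^esub> \<otimes>\<^bsub>KQ\<^esub> f) (u, p) = f (u, p)" .
qed

lemma KQ_r_one:
  assumes f: "f \<in> carrier KQ"
  shows "f \<otimes>\<^bsub>KQ\<^esub> \<one>\<^bsub>KQ\<^esub> = f"
proof (rule ext, clarify)
  fix u p
  have "(f \<otimes>\<^bsub>KQ\<^esub> \<one>\<^bsub>KQ\<^esub>) (u, p) = (\<Oplus>i\<in>{..length p}. if length p = i then f (u, p) else \<zero>)"
    unfolding KQ_mult
  proof (rule finsum_cong')
    fix i assume "i \<in> {..length p}"
    moreover have "f (u, p) = \<zero>" if "walk_end u p \<notin> verts Q" using f that KQ_path quiver_path_end by blast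
    ultimately show "f (u, take i p) \<otimes> \<one>\<^bsub>KQ\<^esub> (walk_end u (take i p), drop i p) = (if length p = i then f (u, p) else \<zero>)"
      using f by auto
  qed (use f in auto)
  also have "\<dots> = f (u, p)"
    using finsum_singleton[of "length p" "{..length p}" "\<lambda>_. f (u, p)"] f by auto
  finally show "(f \<otimes>\<^bsub>KQ\<^esub> \<one>\<^bsub>KQ\<^esub>) (u, p) = f (u, p)" .
qed

lemma KQ_add_closed: "f \<in> carrier KQ \<Longrightarrow> g \<in> carrier KQ \<Longrightarrow> f \<oplus>\<^bsub>KQ\<^esub> g \<in> carrier KQ"
proof (rule KQ_I)
  assume fg: "f \<in> carrier KQ" "g \<in> carrier KQ"
  show "finite ({q. f q \<noteq> \<zero>} \<union> {q. g q \<noteq> \<zero>})" using fg by (simp add: KQ_finite)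
  fix q
  show "(f \<oplus>\<^bsub>KQ\<^esub> g) q \<in> carrier K" using fg by simp
  assume "(f \<oplus>\<^bsub>KQ\<^esub> g) q \<noteq> \<zero>"
  then have "f q \<noteq> \<zero> \<or> g q \<noteq> \<zero>" by auto
  then show "q \<in> {q. f q \<noteq> \<zero>} \<union> {q. g q \<noteq> \<zero>}" "q \<in> quiver_paths Q" using fg KQ_path by blast+
qed

lemma trivial_path: "u \<in> verts Q \<Longrightarrow> (u, []) \<in> quiver_paths Q"
  by (auto simp: quiver_paths_def awalk_Nil_iff intro: exI[of _ u])

lemma KQ_one_closed: "\<one>\<^bsub>KQ\<^esub> \<in> carrier KQ"
proof (rule KQ_I)
  show "finite ((\<lambda>u. (u, []::'a list)) ` verts Q)" by simp
qed (auto split: if_splits simp: trivial_path)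

lemma KQ_zero_closed: "(\<lambda>_. \<zero>) \<in> carrier KQ"
  by (rule KQ_I[of _ "{}"]) auto

lemma KQ_uminus_closed: "f \<in> carrier KQ \<Longrightarrow> (\<lambda>q. \<ominus> f q) \<in> carrier KQ"
proof (rule KQ_I)
  assume f: "f \<in> carrier KQ"
  show "finite {q. f q \<noteq> \<zero>}" using f by (simp add: KQ_finite)
  fix q show "\<ominus> f q \<in> carrier K" using f by simp
  assume "\<ominus> f q \<noteq> \<zero>"
  then have "f q \<noteq> \<zero>" by auto
  then show "q \<in> {q. f q \<noteq> \<zero>}" "q \<in> quiver_paths Q" using f KQ_path by auto
qed

lemma KQ_ring: "ring KQ"
proof (rule ringI)
  show "abelian_group KQ"
  proof (rule abelian_groupI)
    fix f assume f: "f \<in> carrier KQ"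
    show "\<exists>g\<in>carrier KQ. g \<oplus>\<^bsub>KQ\<^esub> f = \<zero>\<^bsub>KQ\<^esub>"
      by (rule bexI[OF _ KQ_uminus_closed[OF f]]) (use f in \<open>simp add: l_neg\<close>)
  qed (simp_all add: KQ_add_closed[simplified] a_ac KQ_zero_closed)
  show "Group.monoid KQ"
    by (rule monoidI) (simp_all only: KQ_mult_closed KQ_one_closed KQ_assoc KQ_l_one KQ_r_one)
next
  fix f g h assume c: "f \<in> carrier KQ" "g \<in> carrier KQ" "h \<in> carrier KQ"
  show "(f \<oplus>\<^bsub>KQ\<^esub> g) \<otimes>\<^bsub>KQ\<^esub> h = f \<otimes>\<^bsub>KQ\<^esub> h \<oplus>\<^bsub>KQ\<^esub> g \<otimes>\<^bsub>KQ\<^esub> h"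
  proof (rule ext, clarify)
    fix u p
    show "((f \<oplus>\<^bsub>KQ\<^esub> g) \<otimes>\<^bsub>KQ\<^esub> h) (u, p) = (f \<otimes>\<^bsub>KQ\<^esub> h \<oplus>\<^bsub>KQ\<^esub> g \<otimes>\<^bsub>KQ\<^esub> h) (u, p)"
      using c unfolding KQ_simps(2) KQ_mult
      by (subst finsum_addf[symmetric]) (auto simp: l_distr intro!: finsum_cong')
  qed
  show "h \<otimes>\<^bsub>KQ\<^esub> (f \<oplus>\<^bsub>KQ\<^esub> g) = h \<otimes>\<^bsub>KQ\<^esub> f \<oplus>\<^bsub>KQ\<^esub> h \<otimes>\<^bsub>KQ\<^esub> g"
  proof (rule ext, clarify)
    fix u p
    show "(h \<otimes>\<^bsub>KQ\<^esub> (f \<oplus>\<^bsub>KQ\<^esub> g)) (u, p) = (h \<otimes>\<^bsub>KQ\<^esub> f \<oplus>\<^bsub>KQ\<^esub> h \<otimes>\<^bsub>KQ\<^esub> g) (u, p)"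
      using c unfolding KQ_simps(2) KQ_mult
      by (subst finsum_addf[symmetric]) (auto simp: r_distr intro!: finsum_cong')
  qed
qed

sublocale KQ: ring KQ by (rule KQ_ring)

lemma KQ_uminus: "f \<in> carrier KQ \<Longrightarrow> \<ominus>\<^bsub>KQ\<^esub> f = (\<lambda>q. \<ominus> f q)"
  by (rule KQ.minus_equality) (simp_all add: l_neg KQ_uminus_closed)

lemma KQ_mult_Nil: "f \<in> carrier KQ \<Longrightarrow> g \<in> carrier KQ \<Longrightarrow> (f \<otimes>\<^bsub>KQ\<^esub> g) (u, []) = f (u, []) \<otimes> g (u, [])"
  by (simp add: KQ_mult walk_end_def)

lemma KQ_mult_single:
  "f \<in> carrier KQ \<Longrightarrow> g \<in> carrier KQ \<Longrightarrow>
    (f \<otimes>\<^bsub>KQ\<^esub> g) (u, [a]) = f (u, []) \<otimes> g (u, [a]) \<oplus> f (u, [a]) \<otimes> g (head Q a, [])"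
proof -
  assume "f \<in> carrier KQ" "g \<in> carrier KQ"
  moreover have "(\<Oplus>i\<in>{..Suc 0}. f (u, take i [a]) \<otimes> g (walk_end u (take i [a]), drop i [a]))
     = f (u, [a]) \<otimes> g (head Q a, []) \<oplus> f (u, []) \<otimes> g (u, [a])"
    using calculation by (subst finsum_Suc) (auto simp: walk_end_def)
  ultimately show ?thesis by (simp add: KQ_mult a_comm)
qed

section \<open>The square of the arrow ideal\<close>

definition vanish1 :: "('v \<times> 'a list \<Rightarrow> 'k) set" where
  "vanish1 = {f \<in> carrier KQ. \<forall>u. f (u, []) = \<zero>}"

text \<open>The elements supported on paths of length at least two;
  \<open>square_arrow_ideal\<close> identifies them with the square of the arrow ideal.\<close>

definition vanish2 :: "('v \<times> 'a list \<Rightarrow> 'k) set" where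
  "vanish2 = {f \<in> carrier KQ. \<forall>u. f (u, []) = \<zero> \<and> (\<forall>a. f (u, [a]) = \<zero>)}"

lemma vanish1_ideal: "ideal vanish1 KQ"
proof (rule idealI[OF KQ_ring])
  show "subgroup vanish1 (add_monoid KQ)"
  proof (rule KQ.add.subgroupI)
    show "vanish1 \<noteq> {}" using KQ.zero_closed by (auto simp: vanish1_def)
  qed (auto simp: vanish1_def a_inv_def[symmetric] KQ_uminus KQ_add_closed[simplified] KQ_uminus_closed)
qed (auto simp: vanish1_def KQ_mult_Nil KQ_mult_closed)

lemma vanish2_ideal: "ideal vanish2 KQ"
proof (rule idealI[OF KQ_ring])
  show "subgroup vanish2 (add_monoid KQ)"
  proof (rule KQ.add.subgroupI)
    show "vanish2 \<noteq> {}" using KQ.zero_closed by (auto simp: vanish2_def)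
  qed (auto simp: vanish2_def a_inv_def[symmetric] KQ_uminus KQ_add_closed[simplified] KQ_uminus_closed)
qed (auto simp: vanish2_def KQ_mult_Nil KQ_mult_single KQ_mult_closed)

definition single :: "'v \<times> 'a list \<Rightarrow> 'k \<Rightarrow> 'v \<times> 'a list \<Rightarrow> 'k" where
  "single q c = (\<lambda>q'. if q' = q then c else \<zero>)"

lemma single_closed: "q \<in> quiver_paths Q \<Longrightarrow> c \<in> carrier K \<Longrightarrow> single q c \<in> carrier KQ"
  by (rule KQ_I[of _ "{q}"]) (auto simp: single_def split: if_splits)

lemma arrow_element_single: "arrow_element K Q a = single (tail Q a, [a]) \<one>"
  by (simp add: arrow_element_def single_def)

lemma quiver_path_Cons: "(u, a # p) \<in> quiver_paths Q \<longleftrightarrow> a \<in> arcs Q \<and> u = tail Q a \<and> (head Q a, p) \<in> quiver_paths Q"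
  by (auto simp: quiver_paths_def awalk_Cons_iff)

lemma quiver_path_arc: "a \<in> arcs Q \<Longrightarrow> (tail Q a, [a]) \<in> quiver_paths Q"
  by (simp add: quiver_path_Cons trivial_path)

lemma arrow_element_closed: "a \<in> arcs Q \<Longrightarrow> arrow_element K Q a \<in> carrier KQ"
  by (simp add: arrow_element_single single_closed quiver_path_arc)

text \<open>Only the cut after the first arrow meets the support of the first factor.\<close>

lemma single_Cons:
  assumes "(u, a # p) \<in> quiver_paths Q" "c \<in> carrier K"
  shows "arrow_element K Q a \<otimes>\<^bsub>KQ\<^esub> single (head Q a, p) c = single (u, a # p) c"
proof (rule ext, clarify)
  fix w q
  have *: "arrow_element K Q a (w, take i q) \<otimes> single (head Q a, p) c (walk_end w (take i q), drop i q)
      = (if 1 = i then single (u, a # p) c (w, q) else \<zero>)" if "i \<le> length q" for i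
  proof (cases "i = 1")
    case True
    then show ?thesis using assms that
      by (cases q) (auto simp: arrow_element_single single_def walk_end_def quiver_path_Cons)
  next
    case False
    then have "take i q \<noteq> [a]" using that by (metis length_take min_absorb2 length_Cons list.size(3) One_nat_def)
    with False assms show ?thesis by (auto simp: arrow_element_single single_def)
  qed
  have "(arrow_element K Q a \<otimes>\<^bsub>KQ\<^esub> single (head Q a, p) c) (w, q)
     = (\<Oplus>i\<in>{..length q}. if 1 = i then single (u, a # p) c (w, q) else \<zero>)"
    unfolding KQ_mult by (rule finsum_cong') (use * assms in \<open>auto simp: single_def\<close>)
  also have "\<dots> = single (u, a # p) c (w, q)"
  proof (cases "1 \<le> length q")
    case True
    then show ?thesis
      using finsum_singleton[of 1 "{..length q}" "\<lambda>_. single (u, a # p) c (w, q)"] assms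
      by (auto simp: single_def)
  next
    case False
    then have "single (u, a # p) c (w, q) = \<zero>" by (auto simp: single_def)
    then show ?thesis using False by simp
  qed
  finally show "(arrow_element K Q a \<otimes>\<^bsub>KQ\<^esub> single (head Q a, p) c) (w, q) = single (u, a # p) c (w, q)" .
qed

lemma arrow_ideal: "ideal (arrow_ideal K Q) KQ"
  unfolding arrow_ideal_def by (rule KQ.genideal_ideal) (auto simp: arrow_element_closed)

lemma arrow_in_ideal: "a \<in> arcs Q \<Longrightarrow> arrow_element K Q a \<in> arrow_ideal K Q"
  unfolding arrow_ideal_def using KQ.genideal_self[of "arrow_element K Q ` arcs Q"] arrow_element_closed by blast

lemma arrow_ideal_le: "arrow_ideal K Q \<subseteq> vanish1"
  unfolding arrow_ideal_def
  by (rule KQ.genideal_minimal[OF vanish1_ideal])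
     (auto simp: vanish1_def arrow_element_closed, auto simp: arrow_element_def)

text \<open>A product of two elements without trivial paths has no terms of length below two.
  Conversely, a path of length at least two is an arrow times a path that again begins with an arrow
  and so lies in the ideal; an element of \<open>vanish2\<close> is a finite sum of multiples of
  such paths.\<close>

lemma square_arrow_ideal: "ideal_prod KQ (arrow_ideal K Q) (arrow_ideal K Q) = vanish2"
proof (intro equalityI subsetI)
  fix f assume "f \<in> ideal_prod KQ (arrow_ideal K Q) (arrow_ideal K Q)"
  then show "f \<in> vanish2"
  proof (induction rule: ideal_prod.induct)
    case (prod f g)
    then have "f \<in> vanish1" "g \<in> vanish1" using arrow_ideal_le by auto
    then show ?case by (auto simp: vanish1_def vanish2_def KQ_mult_Nil KQ_mult_single KQ_mult_closed)
  next
    case (sum f g)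
    then show ?case by (auto simp: vanish2_def KQ_add_closed[simplified])
  qed
next
  let ?J2 = "ideal_prod KQ (arrow_ideal K Q) (arrow_ideal K Q)"
  have J2: "ideal ?J2 KQ" by (rule KQ.ideal_prod_is_ideal[OF arrow_ideal arrow_ideal])
  have sgl: "single (u, p) c \<in> ?J2" if "(u, p) \<in> quiver_paths Q" "2 \<le> length p" "c \<in> carrier K" for u p c
  proof -
    from that(2) obtain a b p' where p: "p = a # b # p'"
      by (metis Suc_le_length_iff numeral_2_eq_2)
    have 1: "(head Q a, b # p') \<in> quiver_paths Q" "(head Q b, p') \<in> quiver_paths Q" "a \<in> arcs Q" "b \<in> arcs Q"
      using that(1) by (auto simp: p quiver_path_Cons)
    have "single (head Q a, b # p') c \<in> arrow_ideal K Q"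
      using ideal.I_r_closed[OF arrow_ideal arrow_in_ideal[OF 1(4)] single_closed[OF 1(2) that(3)]]
        single_Cons[OF 1(1) that(3)] by simp
    then have "arrow_element K Q a \<otimes>\<^bsub>KQ\<^esub> single (head Q a, b # p') c \<in> ?J2"
      by (rule ideal_prod.prod[OF arrow_in_ideal[OF 1(3)]])
    then show ?thesis using single_Cons[of u a "b # p'" c] that p by simp
  qed
  fix f assume f: "f \<in> vanish2"
  have "f \<in> ?J2" if "finite S" "f \<in> vanish2" "{q. f q \<noteq> \<zero>} \<subseteq> S" for S f
    using that
  proof (induction S arbitrary: f)
    case empty
    then have "f = \<zero>\<^bsub>KQ\<^esub>" by auto
    then show ?case using J2 by (metis additive_subgroup.zero_closed ideal.axioms(1))
  next
    case (insert q S)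
    have fc: "f \<in> carrier KQ" using insert.prems by (simp add: vanish2_def)
    show ?case
    proof (cases "f q = \<zero>")
      case True
      with insert.prems have "{q. f q \<noteq> \<zero>} \<subseteq> S" by auto
      with insert show ?thesis by blast
    next
      case False
      define g where "g = f(q := \<zero>)"
      have eq: "f = single q (f q) \<oplus>\<^bsub>KQ\<^esub> g" using fc by (auto simp: g_def single_def)
      have "g \<in> carrier KQ"
        by (rule KQ_I[OF _ KQ_finite[OF fc]]) (use fc KQ_path in \<open>auto simp: g_def split: if_splits\<close>)
      then have "g \<in> vanish2" using insert.prems by (auto simp: vanish2_def g_def)
      moreover have "{q. g q \<noteq> \<zero>} \<subseteq> S" using insert.prems by (auto simp: g_def)
      ultimately have g: "g \<in> ?J2" by (rule insert.IH)
      obtain u p where q: "q = (u, p)" by fastforce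
      have "2 \<le> length p"
      proof (rule ccontr)
        assume "\<not> 2 \<le> length p"
        then have "p = [] \<or> (\<exists>a. p = [a])" by (cases p; cases "tl p") auto
        with insert.prems(1) False q show False by (auto simp: vanish2_def)
      qed
      then have "single q (f q) \<in> ?J2" using sgl[of u p "f q"] fc False KQ_path q by auto
      from ideal_prod.sum[OF this g] eq show ?thesis by simp
    qed
  qed
  then show "f \<in> ?J2" using f KQ_finite[of f] unfolding vanish2_def by blast
qed

section \<open>Coordinates on the quotient algebra\<close>

abbreviation "A \<equiv> radical_square_zero_algebra K Q"

lemma A_eq: "A = KQ Quot vanish2"
  by (simp add: radical_square_zero_algebra_def square_arrow_ideal)

definition rep where "rep X = (SOME f. f \<in> X)"

text \<open>Two members of a coset differ by an element of \<open>vanish2\<close>, so the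
  coefficients at paths of length at most one do not depend on the representative.\<close>

lemma coset_values:
  assumes f: "f \<in> carrier KQ"
  shows "rep (vanish2 +>\<^bsub>KQ\<^esub> f) \<in> carrier KQ"
    "rep (vanish2 +>\<^bsub>KQ\<^esub> f) (u, []) = f (u, [])" "rep (vanish2 +>\<^bsub>KQ\<^esub> f) (u, [a]) = f (u, [a])"
proof -
  have "f \<in> vanish2 +>\<^bsub>KQ\<^esub> f"
    using f vanish2_ideal
    by (intro abelian_subgroup.a_rcos_self[OF abelian_subgroupI3[OF _ KQ.abelian_group_axioms]])
       (auto simp: ideal.axioms(1))
  then have "rep (vanish2 +>\<^bsub>KQ\<^esub> f) \<in> vanish2 +>\<^bsub>KQ\<^esub> f" unfolding rep_def by (rule someI[of "\<lambda>g. g \<in> vanish2 +>\<^bsub>KQ\<^esub> f"])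
  then obtain z where "z \<in> vanish2" "rep (vanish2 +>\<^bsub>KQ\<^esub> f) = z \<oplus>\<^bsub>KQ\<^esub> f"
    by (auto simp: a_r_coset_def' )
  with f show "rep (vanish2 +>\<^bsub>KQ\<^esub> f) \<in> carrier KQ"
    "rep (vanish2 +>\<^bsub>KQ\<^esub> f) (u, []) = f (u, [])" "rep (vanish2 +>\<^bsub>KQ\<^esub> f) (u, [a]) = f (u, [a])"
    by (auto simp: vanish2_def KQ_add_closed[simplified])
qed

lemma A_carrier: "X \<in> carrier A \<longleftrightarrow> (\<exists>f\<in>carrier KQ. X = vanish2 +>\<^bsub>KQ\<^esub> f)"
  by (auto simp: A_eq FactRing_def A_RCOSETS_def')

lemma A_add: "f \<in> carrier KQ \<Longrightarrow> g \<in> carrier KQ \<Longrightarrow>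
    (vanish2 +>\<^bsub>KQ\<^esub> f) \<oplus>\<^bsub>A\<^esub> (vanish2 +>\<^bsub>KQ\<^esub> g) = vanish2 +>\<^bsub>KQ\<^esub> (f \<oplus>\<^bsub>KQ\<^esub> g)"
  unfolding A_eq FactRing_def
  by (simp add: abelian_subgroup.a_rcos_sum[OF abelian_subgroupI3[OF _ KQ.abelian_group_axioms]]
      vanish2_ideal ideal.axioms(1) del: KQ_simps)

lemma A_mult: "f \<in> carrier KQ \<Longrightarrow> g \<in> carrier KQ \<Longrightarrow>
    (vanish2 +>\<^bsub>KQ\<^esub> f) \<otimes>\<^bsub>A\<^esub> (vanish2 +>\<^bsub>KQ\<^esub> g) = vanish2 +>\<^bsub>KQ\<^esub> (f \<otimes>\<^bsub>KQ\<^esub> g)"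
  unfolding A_eq FactRing_def by (simp add: ideal.rcoset_mult_add[OF vanish2_ideal])

lemma A_one: "\<one>\<^bsub>A\<^esub> = vanish2 +>\<^bsub>KQ\<^esub> \<one>\<^bsub>KQ\<^esub>"
  unfolding A_eq FactRing_def by simp

lemma A_eqI:
  assumes "f \<in> carrier KQ" "g \<in> carrier KQ" "\<And>u. f (u, []) = g (u, [])" "\<And>u a. f (u, [a]) = g (u, [a])"
  shows "vanish2 +>\<^bsub>KQ\<^esub> f = vanish2 +>\<^bsub>KQ\<^esub> g"
proof -
  have "f \<ominus>\<^bsub>KQ\<^esub> g \<in> carrier KQ" using assms by blast
  moreover have "f \<ominus>\<^bsub>KQ\<^esub> g = (\<lambda>q. f q \<oplus> \<ominus> g q)" using assms by (simp add: a_minus_def KQ_uminus)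
  ultimately have "f \<ominus>\<^bsub>KQ\<^esub> g \<in> vanish2" using assms by (auto simp: vanish2_def r_neg)
  then show ?thesis using KQ.quotient_eq_iff_same_a_r_cos[OF vanish2_ideal assms(1,2)] by blast
qed

text \<open>Modulo \<open>vanish2\<close> exactly the coefficients at trivial paths and at arrows
  survive, and they can be prescribed freely. The product rule at an arrow has two terms because a
  path of length one can be cut before or after its arrow.\<close>

theorem rad_sq_zero_path_algebra:
  "rad_sq_zero A K (verts Q) (arcs Q) (tail Q) (head Q)
    (\<lambda>v X. rep X (v, [])) (\<lambda>a X. rep X (tail Q a, [a]))"
proof (intro rad_sq_zero.intro rad_sq_zero_axioms.intro field_axioms)
  show "ring A" unfolding A_eq by (rule ideal.quotient_is_ring[OF vanish2_ideal])
next
  fix X X' assume X: "X \<in> carrier A" "X' \<in> carrier A"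
    and eq: "\<And>v. v \<in> verts Q \<Longrightarrow> rep X (v, []) = rep X' (v, [])"
      "\<And>a. a \<in> arcs Q \<Longrightarrow> rep X (tail Q a, [a]) = rep X' (tail Q a, [a])"
  from X obtain f g where fg: "f \<in> carrier KQ" "X = vanish2 +>\<^bsub>KQ\<^esub> f" "g \<in> carrier KQ" "X' = vanish2 +>\<^bsub>KQ\<^esub> g"
    by (auto simp: A_carrier)
  have "f q = g q" if "q \<notin> quiver_paths Q" for q using that fg KQ_path by metis
  moreover have "f (u, []) = g (u, [])" if "(u, []) \<in> quiver_paths Q" for u
    using eq(1)[of u] quiver_path_start[OF that] fg by (simp add: coset_values)
  moreover have "f (u, [a]) = g (u, [a])" if "(u, [a]) \<in> quiver_paths Q" for u a
    using eq(2)[of a] that fg by (simp add: coset_values quiver_path_Cons)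
  ultimately show "X = X'" unfolding fg using fg by (intro A_eqI) blast+
next
  fix p :: "'v \<Rightarrow> 'k" and q :: "'a \<Rightarrow> 'k"
  assume pq: "\<And>v. v \<in> verts Q \<Longrightarrow> p v \<in> carrier K" "\<And>a. a \<in> arcs Q \<Longrightarrow> q a \<in> carrier K"
  \<comment> \<open>A representative supported on paths of length at most one, with the prescribed
    coefficients.\<close>
  define f where "f = (\<lambda>(u, es). case es of [] \<Rightarrow> if u \<in> verts Q then p u else \<zero>
    | [a] \<Rightarrow> if a \<in> arcs Q \<and> u = tail Q a then q a else \<zero> | _ \<Rightarrow> \<zero>)"
  have f: "f \<in> carrier KQ"
  proof (rule KQ_I)
    show "finite ((\<lambda>u. (u, []::'a list)) ` verts Q \<union> (\<lambda>a. (tail Q a, [a])) ` arcs Q)" by simp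
  qed (use pq in \<open>auto simp: f_def quiver_path_arc trivial_path split: list.splits prod.splits if_splits\<close>)
  then show "\<exists>X\<in>carrier A. (\<forall>v\<in>verts Q. rep X (v, []) = p v) \<and> (\<forall>a\<in>arcs Q. rep X (tail Q a, [a]) = q a)"
    by (intro bexI[of _ "vanish2 +>\<^bsub>KQ\<^esub> f"]) (auto simp: coset_values f A_carrier, auto simp: f_def)
qed (auto simp: A_carrier A_add[simplified] A_mult A_one[simplified] coset_values KQ_mult_Nil KQ_mult_single KQ_mult_closed
     KQ_add_closed[simplified] KQ_one_closed[simplified])

end

section \<open>Dimensions of subspaces\<close>

definition kdim :: "('k, 'j) ring_scheme \<Rightarrow> ('k, 'b, 'm) module_scheme \<Rightarrow> 'b set \<Rightarrow> nat" where
  "kdim K V W = vectorspace.dim K (V\<lparr>carrier := W\<rparr>)"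

context vectorspace
begin

lemma subspaceI:
  assumes "W \<subseteq> carrier V" "\<zero>\<^bsub>V\<^esub> \<in> W" "\<And>x y. x \<in> W \<Longrightarrow> y \<in> W \<Longrightarrow> x \<oplus>\<^bsub>V\<^esub> y \<in> W"
    "\<And>c x. c \<in> carrier K \<Longrightarrow> x \<in> W \<Longrightarrow> c \<odot>\<^bsub>V\<^esub> x \<in> W"
  shows "subspace K W V"
  using assms by (intro subspace.intro vectorspace_axioms submodule.intro module_axioms) auto

text \<open>Independent subsets of \<open>W\<close> have at most \<open>dim\<close> elements, so a
  maximal one exists, and it spans \<open>W\<close>.\<close>

lemma fin_dim_subspace:
  assumes fd: "fin_dim" and W: "subspace K W V"
  shows "vectorspace.fin_dim K (vs W)"
proof -
  interpret Wv: vectorspace K "vs W" using W by (rule subspace_is_vs)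
  have sm: "submodule K W V" using W by simp
  have WV: "W \<subseteq> carrier V" using sm by (simp add: submodule_def)
  have li: "Wv.lin_dep S = lin_dep S" if "S \<subseteq> W" for S
    using span_li_not_depend(2)[OF that sm] .
  have "\<exists>A. finite A \<and> maximal A (\<lambda>S. S \<subseteq> W \<and> \<not> Wv.lin_dep S)"
  proof (rule maximal_exists[where N = dim and B = "{}"])
    fix S assume S: "S \<subseteq> W \<and> \<not> Wv.lin_dep S"
    then have "S \<subseteq> carrier V" "lin_indpt S" using WV li by auto
    then show "finite S \<and> card S \<le> dim" using li_le_dim[OF fd] by blast
  next
    show "{} \<subseteq> W \<and> \<not> Wv.lin_dep {}" by (auto simp: Wv.lin_dep_def)
  qed
  then obtain A where A: "finite A" "maximal A (\<lambda>S. S \<subseteq> carrier (vs W) \<and> \<not> Wv.lin_dep S)" by auto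
  then have "Wv.gen_set A" using Wv.max_li_is_gen by blast
  then show ?thesis using A unfolding Wv.fin_dim_def maximal_def by blast
qed

lemma rank_nullity_subspace:
  assumes fd: "fin_dim" and W: "subspace K W V" and U: "vectorspace K U"
    and f: "f \<in> module_hom K (vs W) U"
  shows "kdim K V W = kdim K V {x \<in> W. f x = \<zero>\<^bsub>U\<^esub>} + kdim K U (f ` W)"
proof -
  interpret Wv: vectorspace K "vs W" using W by (rule subspace_is_vs)
  interpret U: vectorspace K U by fact
  interpret f: linear_map K "vs W" U f
    by (intro linear_map.intro mod_hom.intro mod_hom_axioms.intro
        Wv.vectorspace_axioms U.vectorspace_axioms Wv.module_axioms U.module_axioms f)
  show ?thesis
    using f.rank_nullity[OF fin_dim_subspace[OF fd W]] by (simp add: kdim_def f.im_def f.ker_def)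
qed

lemma kdim_zero: "kdim K V {\<zero>\<^bsub>V\<^esub>} = 0"
proof -
  have s: "subspace K {\<zero>\<^bsub>V\<^esub>} V" by (rule subspaceI) auto
  interpret Z: vectorspace K "vs {\<zero>\<^bsub>V\<^esub>}" using s by (rule subspace_is_vs)
  have "Z.span {} = {\<zero>\<^bsub>V\<^esub>}" using Z.span_empty by simp
  then have "Z.dim \<le> card ({}::'c set)" by (intro Z.gen_ge_dim) auto
  then show ?thesis by (simp add: kdim_def)
qed

lemma kdim_inj_image:
  assumes fd: "fin_dim" and W: "subspace K W V" and U: "vectorspace K U"
    and f: "f \<in> module_hom K (vs W) U" and inj: "inj_on f W"
  shows "kdim K U (f ` W) = kdim K V W"
proof -
  interpret Wv: vectorspace K "vs W" using W by (rule subspace_is_vs)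
  interpret U: vectorspace K U by fact
  interpret f: linear_map K "vs W" U f
    by (intro linear_map.intro mod_hom.intro mod_hom_axioms.intro
        Wv.vectorspace_axioms U.vectorspace_axioms Wv.module_axioms U.module_axioms f)
  have z: "\<zero>\<^bsub>V\<^esub> \<in> W" using W by (auto simp: subspace_def submodule_def)
  have "f \<zero>\<^bsub>V\<^esub> = \<zero>\<^bsub>U\<^esub>" using f.f0_is_0 by simp
  then have "{x \<in> W. f x = \<zero>\<^bsub>U\<^esub>} = {\<zero>\<^bsub>V\<^esub>}" using inj z unfolding inj_on_def by force
  then show ?thesis using rank_nullity_subspace[OF fd W U f] kdim_zero by simp
qed

end

text \<open>Functions supported in the finite set \<open>D\<close>: the form in which the explicit
  modules below appear as vector spaces. Dimensions of coordinate subspaces are then obtained by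
  counting.\<close>

locale function_space = vectorspace K V
  for K :: "('k, 'j) ring_scheme" (structure) and V :: "('k, 'z \<Rightarrow> 'k, 'm) module_scheme" +
  fixes D :: "'z set"
  assumes finite_D: "finite D"
    and fun_carrier: "carrier V = {f. (\<forall>z. f z \<in> carrier K) \<and> (\<forall>z. z \<notin> D \<longrightarrow> f z = \<zero>)}"
    and fun_zero: "\<zero>\<^bsub>V\<^esub> = (\<lambda>_. \<zero>)"
    and fun_add: "f \<in> carrier V \<Longrightarrow> g \<in> carrier V \<Longrightarrow> f \<oplus>\<^bsub>V\<^esub> g = (\<lambda>z. f z \<oplus> g z)"
    and fun_smult: "c \<in> carrier K \<Longrightarrow> f \<in> carrier V \<Longrightarrow> c \<odot>\<^bsub>V\<^esub> f = (\<lambda>z. c \<otimes> f z)"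
begin

definition unit_vec :: "'z \<Rightarrow> 'z \<Rightarrow> 'k" where
  "unit_vec z = (\<lambda>w. if w = z then \<one> else \<zero>)"

lemma unit_vec_inj: "inj unit_vec"
proof (rule injI)
  fix y z assume "unit_vec y = unit_vec z"
  then have "unit_vec y y = unit_vec z y" by simp
  then show "y = z" by (auto simp: unit_vec_def split: if_splits)
qed

lemma unit_vec_in: "z \<in> D \<Longrightarrow> unit_vec z \<in> carrier V"
  by (auto simp: fun_carrier unit_vec_def)

definition coord_space :: "'z set \<Rightarrow> ('z \<Rightarrow> 'k) set" where
  "coord_space J = {f \<in> carrier V. \<forall>z. z \<notin> J \<longrightarrow> f z = \<zero>}"

lemma coord_space_subspace: "subspace K (coord_space J) V"
  by (rule subspaceI) (auto simp: coord_space_def fun_add fun_smult fun_zero fun_carrier)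

lemma coord_space_basis:
  assumes J: "J \<subseteq> D"
  shows "\<exists>B. finite B \<and> card B = card J \<and> vectorspace.basis K (vs (coord_space J)) B"
proof -
  have fJ: "finite J" using J finite_D finite_subset by blast
  interpret W: vectorspace K "vs (coord_space J)" by (rule subspace_is_vs[OF coord_space_subspace])
  have cs: "coord_space J \<subseteq> carrier V" by (auto simp: coord_space_def)
  have u: "unit_vec z \<in> coord_space J" if "z \<in> J" for z
    using that J unit_vec_in by (auto simp: coord_space_def unit_vec_def)
  \<comment> \<open>The values of a combination of unit vectors are its coefficients, which gives
    both independence and spanning.\<close>
  have lc: "W.lincomb a (unit_vec ` S) = (\<lambda>z. if z \<in> S then a (unit_vec z) else \<zero>)"
    if "S \<subseteq> J" "a \<in> unit_vec ` S \<rightarrow> carrier K" for S a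
    using finite_subset[OF that(1) fJ] that
  proof (induction S)
    case empty
    then show ?case by (simp add: fun_zero)
  next
    case (insert y S)
    have ay: "a (unit_vec y) \<in> carrier K" using insert.prems by auto
    have "W.lincomb a (unit_vec ` S \<union> {unit_vec y})
        = a (unit_vec y) \<odot>\<^bsub>V\<^esub> unit_vec y \<oplus>\<^bsub>V\<^esub> W.lincomb a (unit_vec ` S)"
      using insert.prems insert.hyps u unit_vec_inj
      by (subst W.lincomb_insert) (auto simp: inj_def)
    also have "\<dots> = (\<lambda>z. if z \<in> insert y S then a (unit_vec z) else \<zero>)"
    proof -
      have IH: "W.lincomb a (unit_vec ` S) = (\<lambda>z. if z \<in> S then a (unit_vec z) else \<zero>)"
        using insert.prems by (intro insert.IH) auto
      have "(\<lambda>z. if z \<in> S then a (unit_vec z) else \<zero>) \<in> carrier V"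
        using insert.prems J by (auto simp: fun_carrier)
      moreover have "a (unit_vec y) \<odot>\<^bsub>V\<^esub> unit_vec y = (\<lambda>z. a (unit_vec y) \<otimes> unit_vec y z)"
        "a (unit_vec y) \<odot>\<^bsub>V\<^esub> unit_vec y \<in> carrier V"
        using ay insert.prems J unit_vec_in by (auto simp: fun_smult intro!: smult_closed)
      moreover have "a (unit_vec y) \<otimes> unit_vec y z \<oplus> (if z \<in> S then a (unit_vec z) else \<zero>)
          = (if z \<in> insert y S then a (unit_vec z) else \<zero>)" for z
      proof -
        have "z \<in> S \<Longrightarrow> a (unit_vec z) \<in> carrier K" using insert.prems by auto
        moreover have "unit_vec y z = (if z = y then \<one> else \<zero>)" by (simp add: unit_vec_def)
        ultimately show ?thesis using insert.hyps ay by simp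
      qed
      ultimately show ?thesis unfolding IH by (simp add: fun_add)
    qed
    finally show ?case by simp
  qed
  have fin: "finite (unit_vec ` J)" using fJ by simp
  have sub: "unit_vec ` J \<subseteq> carrier (vs (coord_space J))" using u by auto
  have "W.basis (unit_vec ` J)"
    unfolding W.basis_def
  proof (intro conjI sub)
    show "W.lin_indpt (unit_vec ` J)"
    proof (rule W.finite_lin_indpt2[OF fin sub])
      fix a assume a: "a \<in> unit_vec ` J \<rightarrow> carrier K"
        "W.lincomb a (unit_vec ` J) = \<zero>\<^bsub>vs (coord_space J)\<^esub>"
      then have "(\<lambda>z. if z \<in> J then a (unit_vec z) else \<zero>) = (\<lambda>_. \<zero>)"
        using lc[of J a] by (simp add: fun_zero)
      then have "\<And>z. z \<in> J \<Longrightarrow> a (unit_vec z) = \<zero>" by meson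
      then show "\<forall>v\<in>unit_vec ` J. a v = \<zero>" by blast
    qed
    show "W.gen_set (unit_vec ` J)"
    proof
      show "W.span (unit_vec ` J) \<subseteq> carrier (vs (coord_space J))"
        using W.span_closed[OF sub] by auto
      show "carrier (vs (coord_space J)) \<subseteq> W.span (unit_vec ` J)"
      proof
        fix f assume "f \<in> carrier (vs (coord_space J))"
        then have f: "\<And>z. f z \<in> carrier K" "\<And>z. z \<notin> J \<Longrightarrow> f z = \<zero>"
          by (auto simp: coord_space_def fun_carrier)
        define a where "a d = f (the_inv unit_vec d)" for d
        have a: "a (unit_vec z) = f z" for z by (simp add: a_def the_inv_f_f unit_vec_inj)
        have "W.lincomb a (unit_vec ` J) = (\<lambda>z. if z \<in> J then a (unit_vec z) else \<zero>)"
          by (rule lc) (auto simp: a f)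
        also have "\<dots> = f" using f by (auto simp: a)
        finally show "f \<in> W.span (unit_vec ` J)"
          unfolding W.finite_span[OF fin sub] using f by (force simp: a)
      qed
    qed
  qed
  moreover have "card (unit_vec ` J) = card J"
    by (rule card_image) (use unit_vec_inj in \<open>auto simp: inj_def inj_on_def\<close>)
  ultimately show ?thesis using fin by blast
qed

lemma kdim_coord_space:
  assumes "J \<subseteq> D"
  shows "kdim K V (coord_space J) = card J"
proof -
  interpret W: vectorspace K "vs (coord_space J)" by (rule subspace_is_vs[OF coord_space_subspace])
  from coord_space_basis[OF assms] W.dim_basis show ?thesis by (auto simp: kdim_def)
qed

lemma function_space_fin_dim: "fin_dim"
proof -
  have "coord_space D = carrier V" by (auto simp: coord_space_def fun_carrier)
  then have "vs (coord_space D) = V" by simp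
  with coord_space_basis[of D] obtain B where "finite B" "basis B" by auto
  then show ?thesis unfolding fin_dim_def basis_def by blast
qed

end

section \<open>Right modules\<close>

context right_module
begin

lemma smult_zero [simp]: "r \<in> carrier R \<Longrightarrow> r \<odot>\<^bsub>M\<^esub> \<zero>\<^bsub>M\<^esub> = \<zero>\<^bsub>M\<^esub>"
  using smult_add_vector[of r "\<zero>\<^bsub>M\<^esub>" "\<zero>\<^bsub>M\<^esub>"] smult_closed[of r "\<zero>\<^bsub>M\<^esub>"]
  by (metis M.add.l_cancel_one M.zero_closed M.l_zero)

lemma zero_smult [simp]: "x \<in> carrier M \<Longrightarrow> \<zero>\<^bsub>R\<^esub> \<odot>\<^bsub>M\<^esub> x = \<zero>\<^bsub>M\<^esub>"
  using smult_add_scalar[of "\<zero>\<^bsub>R\<^esub>" "\<zero>\<^bsub>R\<^esub>" x] smult_closed[of "\<zero>\<^bsub>R\<^esub>" x]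
  by (metis M.add.l_cancel_one R.zero_closed R.l_zero)

lemma minus_one_smult: "x \<in> carrier M \<Longrightarrow> (\<ominus>\<^bsub>R\<^esub> \<one>\<^bsub>R\<^esub>) \<odot>\<^bsub>M\<^esub> x = \<ominus>\<^bsub>M\<^esub> x"
proof -
  assume x: "x \<in> carrier M"
  have "(\<ominus>\<^bsub>R\<^esub> \<one>\<^bsub>R\<^esub>) \<odot>\<^bsub>M\<^esub> x \<oplus>\<^bsub>M\<^esub> x = (\<ominus>\<^bsub>R\<^esub> \<one>\<^bsub>R\<^esub> \<oplus>\<^bsub>R\<^esub> \<one>\<^bsub>R\<^esub>) \<odot>\<^bsub>M\<^esub> x"
    using x by (simp add: smult_add_scalar smult_one)
  also have "\<dots> = \<zero>\<^bsub>M\<^esub>" using x by (simp add: R.l_neg)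
  finally show ?thesis using x smult_closed M.minus_equality by (metis R.a_inv_closed R.one_closed)
qed

lemma smult_finsum:
  assumes "r \<in> carrier R" "f \<in> A \<rightarrow> carrier M"
  shows "r \<odot>\<^bsub>M\<^esub> (\<Oplus>\<^bsub>M\<^esub>i\<in>A. f i) = (\<Oplus>\<^bsub>M\<^esub>i\<in>A. r \<odot>\<^bsub>M\<^esub> f i)"
  using assms(2)
proof (induction A rule: infinite_finite_induct)
  case (insert a A)
  then have "f \<in> A \<rightarrow> carrier M" "f a \<in> carrier M" by auto
  with insert assms(1) show ?case
    by (simp add: smult_add_vector smult_closed Pi_def)
qed (use assms in auto)

text \<open>Negatives come from the scalar \<open>\<ominus> \<one>\<close>, so closure under
  addition and scalars suffices.\<close>

lemma submodule_iff:
  "Module.submodule H R M \<longleftrightarrow> H \<subseteq> carrier M \<and> \<zero>\<^bsub>M\<^esub> \<in> H \<and> (\<forall>x\<in>H. \<forall>y\<in>H. x \<oplus>\<^bsub>M\<^esub> y \<in> H) \<and>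
    (\<forall>r\<in>carrier R. \<forall>x\<in>H. r \<odot>\<^bsub>M\<^esub> x \<in> H)"
proof (intro iffI conjI ballI)
  assume "Module.submodule H R M"
  then interpret H: Module.submodule H R M .
  show "H \<subseteq> carrier M" using H.subset by simp
  show "\<zero>\<^bsub>M\<^esub> \<in> H" using H.one_closed by simp
  show "x \<oplus>\<^bsub>M\<^esub> y \<in> H" if "x \<in> H" "y \<in> H" for x y using H.m_closed that by simp
  show "r \<odot>\<^bsub>M\<^esub> x \<in> H" if "r \<in> carrier R" "x \<in> H" for r x using H.smult_closed that by simp
next
  assume H: "H \<subseteq> carrier M \<and> \<zero>\<^bsub>M\<^esub> \<in> H \<and> (\<forall>x\<in>H. \<forall>y\<in>H. x \<oplus>\<^bsub>M\<^esub> y \<in> H) \<and>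
    (\<forall>r\<in>carrier R. \<forall>x\<in>H. r \<odot>\<^bsub>M\<^esub> x \<in> H)"
  have neg: "\<ominus>\<^bsub>M\<^esub> x \<in> H" if "x \<in> H" for x
  proof -
    have "(\<ominus>\<^bsub>R\<^esub> \<one>\<^bsub>R\<^esub>) \<odot>\<^bsub>M\<^esub> x \<in> H" using H that by auto
    moreover have "x \<in> carrier M" using H that by blast
    ultimately show ?thesis by (simp add: minus_one_smult)
  qed
  have "subgroup H (add_monoid M)"
    by (rule group.subgroupI[OF M.a_group]) (use H neg in \<open>auto simp: a_inv_def[symmetric]\<close>)
  with H show "Module.submodule H R M"
    by (intro Module.submodule.intro submodule_axioms.intro) auto
qed

lemma submodule_right_module:
  assumes "Module.submodule H R M"
  shows "right_module R (M\<lparr>carrier := H\<rparr>)"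
proof -
  from assms have H: "H \<subseteq> carrier M" "\<zero>\<^bsub>M\<^esub> \<in> H" "\<And>x y. x \<in> H \<Longrightarrow> y \<in> H \<Longrightarrow> x \<oplus>\<^bsub>M\<^esub> y \<in> H"
    "\<And>r x. r \<in> carrier R \<Longrightarrow> x \<in> H \<Longrightarrow> r \<odot>\<^bsub>M\<^esub> x \<in> H" unfolding submodule_iff by auto
  have neg: "\<exists>y\<in>H. y \<oplus>\<^bsub>M\<^esub> x = \<zero>\<^bsub>M\<^esub>" if "x \<in> H" for x
  proof -
    have "(\<ominus>\<^bsub>R\<^esub> \<one>\<^bsub>R\<^esub>) \<odot>\<^bsub>M\<^esub> x \<in> H" using H that by auto
    then show ?thesis using H that minus_one_smult by (metis M.l_neg subsetD)
  qed
  have "abelian_group (M\<lparr>carrier := H\<rparr>)"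
    by (rule abelian_groupI) (use H neg in \<open>auto simp: M.a_ac subset_iff\<close>)
  then show ?thesis
    by (intro right_module.intro right_module_axioms.intro R.ring_axioms)
       (use H in \<open>auto simp: smult_add_scalar smult_add_vector smult_mult smult_one subset_iff\<close>)
qed

end

lemma rmod_homD:
  assumes "f \<in> rmod_hom R M N"
  shows "x \<in> carrier M \<Longrightarrow> f x \<in> carrier N"
    "x \<in> carrier M \<Longrightarrow> y \<in> carrier M \<Longrightarrow> f (x \<oplus>\<^bsub>M\<^esub> y) = f x \<oplus>\<^bsub>N\<^esub> f y"
    "r \<in> carrier R \<Longrightarrow> x \<in> carrier M \<Longrightarrow> f (r \<odot>\<^bsub>M\<^esub> x) = r \<odot>\<^bsub>N\<^esub> f x"
  using assms by (auto simp: rmod_hom_def)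

lemma rmod_hom_comp: "f \<in> rmod_hom R L M \<Longrightarrow> g \<in> rmod_hom R M N \<Longrightarrow> (\<lambda>x. g (f x)) \<in> rmod_hom R L N"
  by (auto simp: rmod_hom_def)

lemma rmod_hom_id: "(\<lambda>x. x) \<in> rmod_hom R M M"
  by (auto simp: rmod_hom_def)

locale rmod_map = M: right_module R M + N: right_module R N
  for R :: "('r, 'i) ring_scheme" and M :: "('r, 'b, 'm) module_scheme" and N :: "('r, 'c, 'n) module_scheme" +
  fixes f :: "'b \<Rightarrow> 'c"
  assumes hom: "f \<in> rmod_hom R M N"
begin

lemmas closed [simp] = rmod_homD(1)[OF hom] and add = rmod_homD(2)[OF hom] and smult = rmod_homD(3)[OF hom]

lemma zero [simp]: "f \<zero>\<^bsub>M\<^esub> = \<zero>\<^bsub>N\<^esub>"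
  using add[of "\<zero>\<^bsub>M\<^esub>" "\<zero>\<^bsub>M\<^esub>"] by (metis M.M.zero_closed M.M.l_zero N.M.add.l_cancel_one closed)

lemma minus: "x \<in> carrier M \<Longrightarrow> f (\<ominus>\<^bsub>M\<^esub> x) = \<ominus>\<^bsub>N\<^esub> f x"
  by (rule N.M.minus_equality[symmetric]) (auto simp: add[symmetric] M.M.l_neg)

lemma diff: "x \<in> carrier M \<Longrightarrow> y \<in> carrier M \<Longrightarrow> f (x \<ominus>\<^bsub>M\<^esub> y) = f x \<ominus>\<^bsub>N\<^esub> f y"
  by (simp add: a_minus_def add minus)

lemma finsum: "g \<in> A \<rightarrow> carrier M \<Longrightarrow> f (\<Oplus>\<^bsub>M\<^esub>i\<in>A. g i) = (\<Oplus>\<^bsub>N\<^esub>i\<in>A. f (g i))"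
proof (induction A rule: infinite_finite_induct)
  case (insert a A)
  then have "g \<in> A \<rightarrow> carrier M" "g a \<in> carrier M" by auto
  with insert show ?case by (simp add: add Pi_def)
qed auto

lemma kernel_submodule: "Module.submodule (rmod_kernel M N f) R M"
  unfolding M.submodule_iff rmod_kernel_def
  by (intro conjI ballI) (auto simp: add smult M.smult_closed)

lemma image_submodule: "Module.submodule H R M \<Longrightarrow> Module.submodule (f ` H) R N"
proof -
  assume "Module.submodule H R M"
  then have H: "H \<subseteq> carrier M" "\<zero>\<^bsub>M\<^esub> \<in> H" "\<And>x y. x \<in> H \<Longrightarrow> y \<in> H \<Longrightarrow> x \<oplus>\<^bsub>M\<^esub> y \<in> H"
    "\<And>r x. r \<in> carrier R \<Longrightarrow> x \<in> H \<Longrightarrow> r \<odot>\<^bsub>M\<^esub> x \<in> H" unfolding M.submodule_iff by blast+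
  have c: "x \<in> carrier M" if "x \<in> H" for x using H(1) that by blast
  show ?thesis
    unfolding N.submodule_iff
  proof (intro conjI ballI)
    show "\<zero>\<^bsub>N\<^esub> \<in> f ` H" using H(2) by (metis image_eqI zero)
  next
    fix x y assume "x \<in> f ` H" "y \<in> f ` H"
    then obtain x' y' where "x' \<in> H" "y' \<in> H" "x = f x'" "y = f y'" by blast
    then show "x \<oplus>\<^bsub>N\<^esub> y \<in> f ` H" using H(3)[of x' y'] c by (simp add: add[symmetric])
  next
    fix r x assume "r \<in> carrier R" "x \<in> f ` H"
    then obtain x' where "x' \<in> H" "x = f x'" by blast
    then show "r \<odot>\<^bsub>N\<^esub> x \<in> f ` H" using H(4)[of r x'] \<open>r \<in> carrier R\<close> c by (simp add: smult[symmetric])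
  qed (use c in auto)
qed

lemma preimage_submodule: "Module.submodule H R N \<Longrightarrow> Module.submodule {x \<in> carrier M. f x \<in> H} R M"
  unfolding M.submodule_iff N.submodule_iff
  by (intro conjI ballI) (auto simp: add smult M.smult_closed)

lemma inj_iff_kernel: "inj_on f (carrier M) \<longleftrightarrow> (\<forall>x\<in>carrier M. f x = \<zero>\<^bsub>N\<^esub> \<longrightarrow> x = \<zero>\<^bsub>M\<^esub>)"
proof
  assume *: "\<forall>x\<in>carrier M. f x = \<zero>\<^bsub>N\<^esub> \<longrightarrow> x = \<zero>\<^bsub>M\<^esub>"
  show "inj_on f (carrier M)"
  proof (rule inj_onI)
    fix x y assume xy: "x \<in> carrier M" "y \<in> carrier M" "f x = f y"
    then have "f (x \<ominus>\<^bsub>M\<^esub> y) = \<zero>\<^bsub>N\<^esub>" by (simp add: diff)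
    then have "x \<ominus>\<^bsub>M\<^esub> y = \<zero>\<^bsub>M\<^esub>" using * xy by (simp add: M.M.minus_closed)
    then show "x = y" using xy by simp
  qed
next
  assume "inj_on f (carrier M)"
  then show "\<forall>x\<in>carrier M. f x = \<zero>\<^bsub>N\<^esub> \<longrightarrow> x = \<zero>\<^bsub>M\<^esub>"
    by (metis M.M.zero_closed inj_onD zero)
qed

end

lemma rmod_mapI:
  "right_module R M \<Longrightarrow> right_module R N \<Longrightarrow> f \<in> rmod_hom R M N \<Longrightarrow> rmod_map R M N f"
  by (simp add: rmod_map_def rmod_map_axioms_def)

lemma rmod_isomorphic_refl: "rmod_isomorphic R M M"
  unfolding rmod_isomorphic_def by (rule bexI[OF _ rmod_hom_id]) (simp add: bij_betw_def)

lemma rmod_isomorphic_trans: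
  "rmod_isomorphic R L M \<Longrightarrow> rmod_isomorphic R M N \<Longrightarrow> rmod_isomorphic R L N"
  unfolding rmod_isomorphic_def using rmod_hom_comp bij_betw_trans unfolding comp_def by blast

lemma rmod_hom_inverse:
  assumes "right_module R M" "f \<in> rmod_hom R M N" "bij_betw f (carrier M) (carrier N)"
  shows "the_inv_into (carrier M) f \<in> rmod_hom R N M"
proof -
  interpret right_module R M by fact
  let ?g = "the_inv_into (carrier M) f"
  have inj: "inj_on f (carrier M)" and im: "f ` carrier M = carrier N" using assms(3) by (auto simp: bij_betw_def)
  have g: "?g (f x) = x" if "x \<in> carrier M" for x using that by (rule the_inv_into_f_f[OF inj])
  show ?thesis unfolding rmod_hom_def im[symmetric]
    using rmod_homD[OF assms(2)] M.add.m_closed smult_closed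
    by (auto simp: g rmod_homD(2,3)[OF assms(2), symmetric])
qed

lemma rmod_isomorphic_sym:
  "right_module R M \<Longrightarrow> rmod_isomorphic R M N \<Longrightarrow> rmod_isomorphic R N M"
  unfolding rmod_isomorphic_def using rmod_hom_inverse bij_betw_the_inv_into by blast

lemma rmod_sum_simps [simp]:
  "carrier (rmod_sum M N) = carrier M \<times> carrier N" "\<zero>\<^bsub>rmod_sum M N\<^esub> = (\<zero>\<^bsub>M\<^esub>, \<zero>\<^bsub>N\<^esub>)"
  "(x, y) \<oplus>\<^bsub>rmod_sum M N\<^esub> (x', y') = (x \<oplus>\<^bsub>M\<^esub> x', y \<oplus>\<^bsub>N\<^esub> y')"
  "r \<odot>\<^bsub>rmod_sum M N\<^esub> (x, y) = (r \<odot>\<^bsub>M\<^esub> x, r \<odot>\<^bsub>N\<^esub> y)"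
  by (simp_all add: rmod_sum_def)

lemma rmod_isomorphic_sum:
  assumes "rmod_isomorphic R M M'" "rmod_isomorphic R N N'"
  shows "rmod_isomorphic R (rmod_sum M N) (rmod_sum M' N')"
proof -
  from assms obtain f g where f: "f \<in> rmod_hom R M M'" "bij_betw f (carrier M) (carrier M')"
    and g: "g \<in> rmod_hom R N N'" "bij_betw g (carrier N) (carrier N')"
    by (auto simp: rmod_isomorphic_def)
  have "map_prod f g \<in> rmod_hom R (rmod_sum M N) (rmod_sum M' N')"
    using rmod_homD[OF f(1)] rmod_homD[OF g(1)] by (auto simp: rmod_hom_def)
  moreover have "bij_betw (map_prod f g) (carrier M \<times> carrier N) (carrier M' \<times> carrier N')"
    using f(2) g(2) by (simp add: bij_betw_def map_prod_inj_on map_prod_surj_on)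
  ultimately show ?thesis unfolding rmod_isomorphic_def by auto
qed

lemma fg_rmodulesD: "M \<in> fg_rmodules R \<Longrightarrow> right_module R M" "M \<in> fg_rmodules R \<Longrightarrow> finitely_generated R M"
  by (auto simp: fg_rmodules_def)

text \<open>The modules constructed below have elements of various types. Their classes in
  \<open>K0 R\<close> are those of a chosen isomorphic copy in the universe of
  \<open>fg_rmodules\<close>.\<close>

definition fg_copy :: "('r, 'i) ring_scheme \<Rightarrow> ('r, 'b, 'n) module_scheme \<Rightarrow> 'r rmodule" where
  "fg_copy R M = (SOME N. N \<in> fg_rmodules R \<and> rmod_isomorphic R M N)"

lemma fg_copy:
  assumes "right_module R M" "finitely_generated R M"
  shows "fg_copy R M \<in> fg_rmodules R" "rmod_isomorphic R M (fg_copy R M)"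
  using ex_isomorphic_fg_rmodule[OF assms] unfolding fg_copy_def
  by (metis (mono_tags, lifting) someI)+

section \<open>The group \<open>K\<^sub>0\<close>\<close>

lemma iso_class_eqI:
  "M \<in> fg_rmodules R \<Longrightarrow> N \<in> fg_rmodules R \<Longrightarrow> rmod_isomorphic R M N \<Longrightarrow> iso_class R M = iso_class R N"
  unfolding iso_class_def
  by (rule Collect_cong) (metis rmod_isomorphic_sym rmod_isomorphic_trans fg_rmodulesD(1))

lemma iso_class_self: "M \<in> fg_rmodules R \<Longrightarrow> M \<in> iso_class R M"
  unfolding iso_class_def using rmod_isomorphic_refl by blast

lemma comm_group_K0_free: "comm_group (K0_free R)"
  unfolding K0_free_def by (rule abelian_free_Abelian_group)

lemma K0_free_carrier: "x \<in> carrier (K0_free R) \<longleftrightarrow> Poly_Mapping.keys x \<subseteq> iso_class R ` fg_rmodules R"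
  unfolding K0_free_def by (rule carrier_free_Abelian_group_iff)

lemma K0_free_mult [simp]: "x \<otimes>\<^bsub>K0_free R\<^esub> y = x + y"
  by (simp add: K0_free_def)

lemma frag_of_K0_free: "M \<in> fg_rmodules R \<Longrightarrow> frag_of (iso_class R M) \<in> carrier (K0_free R)"
  by (simp add: K0_free_def)

lemma K0_free_diff: "x \<in> carrier (K0_free R) \<Longrightarrow> y \<in> carrier (K0_free R) \<Longrightarrow> x - y \<in> carrier (K0_free R)"
  unfolding K0_free_carrier by (meson keys_diff Un_least order_trans)

lemma K0_relations_closed: "K0_relations R \<subseteq> carrier (K0_free R)"
  unfolding K0_relations_def
  by (auto simp: projective_def intro!: K0_free_diff frag_of_K0_free)

abbreviation K0_null :: "('r, 'i) ring_scheme \<Rightarrow> ('r rmodule set \<Rightarrow>\<^sub>0 int) set" where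
  "K0_null R \<equiv> generate (K0_free R) (K0_relations R)"

lemma K0_null_subgroup: "subgroup (K0_null R) (K0_free R)"
  using comm_group_K0_free[of R] K0_relations_closed[of R]
  by (simp add: comm_group_def group.generate_is_subgroup)

lemma K0_null_normal: "K0_null R \<lhd> K0_free R"
  by (rule comm_group.subgroup_imp_normal[OF comm_group_K0_free K0_null_subgroup])

lemma comm_group_K0: "comm_group (K0 R)"
  unfolding K0_def by (rule comm_group.abelian_FactGroup[OF comm_group_K0_free K0_null_subgroup])

lemma K0_group: "Group.group (K0 R)"
  using comm_group_K0 by (rule comm_group.axioms(2))

lemma K0_class_closed [simp]: "M \<in> fg_rmodules R \<Longrightarrow> K0_class R M \<in> carrier (K0 R)"
  unfolding K0_def K0_class_def FactGroup_def RCOSETS_def using frag_of_K0_free by auto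

lemma K0_class_iso:
  "M \<in> fg_rmodules R \<Longrightarrow> N \<in> fg_rmodules R \<Longrightarrow> rmod_isomorphic R M N \<Longrightarrow> K0_class R M = K0_class R N"
  by (simp add: K0_class_def iso_class_eqI)

lemma K0_coset_mult:
  "x \<in> carrier (K0_free R) \<Longrightarrow> y \<in> carrier (K0_free R) \<Longrightarrow>
    (K0_null R #>\<^bsub>K0_free R\<^esub> x) \<otimes>\<^bsub>K0 R\<^esub> (K0_null R #>\<^bsub>K0_free R\<^esub> y) = K0_null R #>\<^bsub>K0_free R\<^esub> (x + y)"
  unfolding K0_def FactGroup_def using normal.rcos_sum[OF K0_null_normal] by simp

lemma K0_one: "\<one>\<^bsub>K0 R\<^esub> = K0_null R"
  by (simp add: K0_def FactGroup_def)

lemma K0_coset_null: "x \<in> K0_null R \<Longrightarrow> K0_null R #>\<^bsub>K0_free R\<^esub> x = \<one>\<^bsub>K0 R\<^esub>"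
  unfolding K0_one
  by (meson K0_null_subgroup comm_group.axioms(2) comm_group_K0_free group.coset_join2 subgroup.mem_carrier)

lemma K0_class_projective: "projective R P \<Longrightarrow> K0_class R P = \<one>\<^bsub>K0 R\<^esub>"
  unfolding K0_class_def by (rule K0_coset_null, rule generate.incl) (auto simp: K0_relations_def)

lemma K0_class_add:
  assumes "M \<in> fg_rmodules R" "M' \<in> fg_rmodules R" "M'' \<in> fg_rmodules R"
    "rmod_isomorphic R M (rmod_sum M' M'')"
  shows "K0_class R M = K0_class R M' \<otimes>\<^bsub>K0 R\<^esub> K0_class R M''"
proof -
  let ?c = "\<lambda>x. K0_null R #>\<^bsub>K0_free R\<^esub> x" and ?m = "frag_of (iso_class R M)"
    and ?m' = "frag_of (iso_class R M')" and ?m'' = "frag_of (iso_class R M'')"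
  note [simp] = frag_of_K0_free[OF assms(1)] frag_of_K0_free[OF assms(2)] frag_of_K0_free[OF assms(3)]
  have "?m - ?m' - ?m'' \<in> K0_null R"
    by (rule generate.incl) (use assms in \<open>auto simp: K0_relations_def\<close>)
  then have "\<one>\<^bsub>K0 R\<^esub> = ?c (?m - ?m' - ?m'')" by (rule K0_coset_null[symmetric])
  then have "?c (?m' + ?m'') = ?c (?m - ?m' - ?m'') \<otimes>\<^bsub>K0 R\<^esub> ?c (?m' + ?m'')"
  proof -
    assume "\<one>\<^bsub>K0 R\<^esub> = ?c (?m - ?m' - ?m'')"
    interpret G: group "K0 R" by (rule K0_group)
    have "?c (?m' + ?m'') = K0_class R M' \<otimes>\<^bsub>K0 R\<^esub> K0_class R M''"
      by (simp add: K0_class_def K0_coset_mult)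
    then have "?c (?m' + ?m'') \<in> carrier (K0 R)" using assms(2,3) by simp
    from G.l_one[OF this] show ?thesis
      unfolding \<open>\<one>\<^bsub>K0 R\<^esub> = ?c (?m - ?m' - ?m'')\<close> by (rule sym)
  qed
  also have "\<dots> = ?c ((?m - ?m' - ?m'') + (?m' + ?m''))"
    by (rule K0_coset_mult)
       (auto intro!: K0_free_diff subgroup.m_closed[OF group.subgroup_self, of "K0_free R", simplified]
         comm_group.axioms(2)[OF comm_group_K0_free])
  finally show ?thesis by (simp add: K0_class_def K0_coset_mult)
qed

text \<open>The free abelian group is built from its generators by differences, and
  \<open>K0 R\<close> is a quotient of it.\<close>

lemma K0_induct [consumes 1, case_names one diff cls]:
  assumes "x \<in> carrier (K0 R)" "P \<one>\<^bsub>K0 R\<^esub>"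
    and "\<And>x y. x \<in> carrier (K0 R) \<Longrightarrow> y \<in> carrier (K0 R) \<Longrightarrow> P x \<Longrightarrow> P y \<Longrightarrow> P (x \<otimes>\<^bsub>K0 R\<^esub> inv\<^bsub>K0 R\<^esub> y)"
    and "\<And>M. M \<in> fg_rmodules R \<Longrightarrow> P (K0_class R M)"
  shows "P x"
proof -
  let ?c = "\<lambda>x. K0_null R #>\<^bsub>K0_free R\<^esub> x"
  from assms(1) obtain z where z: "z \<in> carrier (K0_free R)" "x = ?c z"
    unfolding K0_def FactGroup_def RCOSETS_def by auto
  have cc: "?c z \<in> carrier (K0 R)" if "z \<in> carrier (K0_free R)" for z
    using that unfolding K0_def FactGroup_def RCOSETS_def by auto
  interpret G: group "K0 R" by (rule K0_group)
  have "P (?c z)"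
    using z(1)[unfolded K0_free_carrier]
  proof (induction z rule: free_Abelian_group_induct[consumes 1, where S = "iso_class R ` fg_rmodules R"])
    case 1
    have "?c 0 = \<one>\<^bsub>K0 R\<^esub>"
      by (rule K0_coset_null) (use subgroup.one_closed[OF K0_null_subgroup[of R]] in \<open>simp add: K0_free_def\<close>)
    with assms(2) show ?case by simp
  next
    case (2 z y)
    then have zy: "z \<in> carrier (K0_free R)" "y \<in> carrier (K0_free R)" by (auto simp: K0_free_carrier)
    have "?c (z - y) \<otimes>\<^bsub>K0 R\<^esub> ?c y = ?c z" using zy by (simp add: K0_coset_mult K0_free_diff)
    then have "?c (z - y) = ?c z \<otimes>\<^bsub>K0 R\<^esub> inv\<^bsub>K0 R\<^esub> ?c y"
      using cc zy K0_free_diff by (metis G.inv_solve_right)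
    with assms(3) cc zy 2 show ?case by simp
  next
    case (3 a)
    then show ?case using assms(4) by (auto simp: K0_class_def)
  qed
  with z show ?thesis by simp
qed

text \<open>A function that respects isomorphism, is additive and is trivial on projectives kills
  \<open>K0_relations\<close>, so its extension to the free group factors. This yields both the
  syzygy endomorphism and the integer invariants.\<close>

lemma K0_universal:
  fixes \<phi> :: "'r rmodule \<Rightarrow> 'g"
  assumes G: "comm_group G" and \<phi>: "\<And>M. M \<in> fg_rmodules R \<Longrightarrow> \<phi> M \<in> carrier G"
    and iso: "\<And>M N. M \<in> fg_rmodules R \<Longrightarrow> N \<in> fg_rmodules R \<Longrightarrow> rmod_isomorphic R M N \<Longrightarrow> \<phi> M = \<phi> N"
    and add: "\<And>M M' M''. M \<in> fg_rmodules R \<Longrightarrow> M' \<in> fg_rmodules R \<Longrightarrow> M'' \<in> fg_rmodules R \<Longrightarrow>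
      rmod_isomorphic R M (rmod_sum M' M'') \<Longrightarrow> \<phi> M = \<phi> M' \<otimes>\<^bsub>G\<^esub> \<phi> M''"
    and proj: "\<And>P. projective R P \<Longrightarrow> \<phi> P = \<one>\<^bsub>G\<^esub>"
  shows "\<exists>h\<in>hom (K0 R) G. \<forall>M\<in>fg_rmodules R. h (K0_class R M) = \<phi> M"
proof -
  interpret G: comm_group G by fact
  \<comment> \<open>The generators are isomorphism classes, so \<open>\<phi>\<close> is evaluated at
    a chosen member; by \<open>iso\<close> the value does not depend on the choice.\<close>
  define \<psi> where "\<psi> C = \<phi> (SOME M. M \<in> C)" for C
  have some: "(SOME N. N \<in> iso_class R M) \<in> iso_class R M" if "M \<in> fg_rmodules R" for M
    using iso_class_self[OF that] by (rule someI[of "\<lambda>N. N \<in> iso_class R M"])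
  have \<psi>: "\<psi> (iso_class R M) = \<phi> M" if "M \<in> fg_rmodules R" for M
    using some[OF that] iso[OF that] unfolding \<psi>_def iso_class_def by auto
  have "\<psi> ` (iso_class R ` fg_rmodules R) \<subseteq> carrier G" using \<psi> \<phi> by auto
  then obtain k where k: "k \<in> hom (K0_free R) G" "\<And>C. C \<in> iso_class R ` fg_rmodules R \<Longrightarrow> k (frag_of C) = \<psi> C"
    unfolding K0_free_def using G.free_Abelian_group_universal by metis
  have kM: "k (frag_of (iso_class R M)) = \<phi> M" if "M \<in> fg_rmodules R" for M
    using k(2) \<psi> that by auto
  interpret k: group_hom "K0_free R" G k
    using k(1) comm_group_K0_free[of R] G.group_axioms
    by (simp add: group_hom_def group_hom_axioms_def comm_group_def)
  have kd: "k (x - y) = k x \<otimes>\<^bsub>G\<^esub> inv\<^bsub>G\<^esub> k y" if "x \<in> carrier (K0_free R)" "y \<in> carrier (K0_free R)" for x y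
  proof -
    have "k ((x - y) \<otimes>\<^bsub>K0_free R\<^esub> y) = k (x - y) \<otimes>\<^bsub>G\<^esub> k y"
      by (rule k.hom_mult[OF K0_free_diff[OF that] that(2)])
    then have "k x = k (x - y) \<otimes>\<^bsub>G\<^esub> k y" by simp
    then show ?thesis using that K0_free_diff k.hom_closed by (metis G.inv_solve_right)
  qed
  have "K0_relations R \<subseteq> kernel (K0_free R) G k"
  proof
    fix x assume x: "x \<in> K0_relations R"
    then have "x \<in> carrier (K0_free R)" using K0_relations_closed by blast
    moreover from x consider (sum) M M' M'' where "x = frag_of (iso_class R M) - frag_of (iso_class R M') - frag_of (iso_class R M'')"
        "M \<in> fg_rmodules R" "M' \<in> fg_rmodules R" "M'' \<in> fg_rmodules R" "rmod_isomorphic R M (rmod_sum M' M'')"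
      | (proj) P where "x = frag_of (iso_class R P)" "projective R P"
      unfolding K0_relations_def by blast
    then have "k x = \<one>\<^bsub>G\<^esub>"
    proof cases
      case sum
      then have "k x = \<phi> M \<otimes>\<^bsub>G\<^esub> inv\<^bsub>G\<^esub> \<phi> M' \<otimes>\<^bsub>G\<^esub> inv\<^bsub>G\<^esub> \<phi> M''"
        by (simp add: kd K0_free_diff frag_of_K0_free kM)
      also have "\<dots> = \<one>\<^bsub>G\<^esub>" using add[OF sum(2-)] \<phi>[OF sum(3)] \<phi>[OF sum(4)]
        by (metis G.inv_mult G.m_assoc G.inv_closed G.m_closed G.r_inv)
      finally show ?thesis .
    next
      case (proj P)
      then show ?thesis using assms(5) kM by (simp add: projective_def)
    qed
    ultimately show "x \<in> kernel (K0_free R) G k" by (simp add: kernel_def)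
  qed
  then have "K0_null R \<subseteq> kernel (K0_free R) G k"
    by (rule k.generate_subgroup_incl[OF _ k.subgroup_kernel])
  from k.FactGroup_universal_kernel[OF K0_null_normal this] obtain h where
    h: "h \<in> hom (K0_free R Mod K0_null R) G" "\<And>x. x \<in> carrier (K0_free R) \<Longrightarrow> h (K0_null R #>\<^bsub>K0_free R\<^esub> x) = k x"
    by blast
  show ?thesis
    by (rule bexI[of _ h]) (use h in \<open>auto simp: K0_class_def K0_def frag_of_K0_free kM\<close>)
qed

section \<open>Modules over a radical square zero algebra\<close>

context rad_sq_zero
begin

section \<open>Distinguished ring elements and the underlying vector space\<close>

definition mk :: "('v \<Rightarrow> 'k) \<Rightarrow> ('a \<Rightarrow> 'k) \<Rightarrow> 'r" where
  "mk p q = (SOME r. r \<in> carrier R \<and> (\<forall>v\<in>V. cv v r = p v) \<and> (\<forall>a\<in>E. ca a r = q a))"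

lemma mk:
  assumes "\<And>v. v \<in> V \<Longrightarrow> p v \<in> carrier K" "\<And>a. a \<in> E \<Longrightarrow> q a \<in> carrier K"
  shows "mk p q \<in> carrier R" "v \<in> V \<Longrightarrow> cv v (mk p q) = p v" "a \<in> E \<Longrightarrow> ca a (mk p q) = q a"
proof -
  have "\<exists>r. r \<in> carrier R \<and> (\<forall>v\<in>V. cv v r = p v) \<and> (\<forall>a\<in>E. ca a r = q a)"
    using coord_ex[of p q] assms by blast
  then have *: "mk p q \<in> carrier R \<and> (\<forall>v\<in>V. cv v (mk p q) = p v) \<and> (\<forall>a\<in>E. ca a (mk p q) = q a)"
    unfolding mk_def by (rule someI_ex)
  then show "mk p q \<in> carrier R" "v \<in> V \<Longrightarrow> cv v (mk p q) = p v" "a \<in> E \<Longrightarrow> ca a (mk p q) = q a" by blast+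
qed

text \<open>The diagonal copy of \<open>K\<close> in \<open>R\<close>, which is central by
  \<open>scal_comm\<close>.\<close>

definition scal :: "'k \<Rightarrow> 'r" where "scal c = mk (\<lambda>_. c) (\<lambda>_. \<zero>\<^bsub>K\<^esub>)"

definition idem :: "'v \<Rightarrow> 'r" where "idem v = mk (\<lambda>w. if w = v then \<one>\<^bsub>K\<^esub> else \<zero>\<^bsub>K\<^esub>) (\<lambda>_. \<zero>\<^bsub>K\<^esub>)"

definition arr :: "'a \<Rightarrow> 'r" where "arr a = mk (\<lambda>_. \<zero>\<^bsub>K\<^esub>) (\<lambda>b. if b = a then \<one>\<^bsub>K\<^esub> else \<zero>\<^bsub>K\<^esub>)"

lemma scal [simp]:
  assumes "c \<in> carrier K"
  shows "scal c \<in> carrier R" "v \<in> V \<Longrightarrow> cv v (scal c) = c" "a \<in> E \<Longrightarrow> ca a (scal c) = \<zero>\<^bsub>K\<^esub>"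
  using assms mk[of "\<lambda>_. c" "\<lambda>_. \<zero>\<^bsub>K\<^esub>"] by (auto simp: scal_def)

lemma idem [simp]:
  "idem v \<in> carrier R" "w \<in> V \<Longrightarrow> cv w (idem v) = (if w = v then \<one>\<^bsub>K\<^esub> else \<zero>\<^bsub>K\<^esub>)" "a \<in> E \<Longrightarrow> ca a (idem v) = \<zero>\<^bsub>K\<^esub>"
  using mk[of "\<lambda>w. if w = v then \<one>\<^bsub>K\<^esub> else \<zero>\<^bsub>K\<^esub>" "\<lambda>_. \<zero>\<^bsub>K\<^esub>"] by (auto simp: idem_def)

lemma arr [simp]:
  "arr b \<in> carrier R" "w \<in> V \<Longrightarrow> cv w (arr b) = \<zero>\<^bsub>K\<^esub>" "a \<in> E \<Longrightarrow> ca a (arr b) = (if a = b then \<one>\<^bsub>K\<^esub> else \<zero>\<^bsub>K\<^esub>)"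
  using mk[of "\<lambda>_. \<zero>\<^bsub>K\<^esub>" "\<lambda>a. if a = b then \<one>\<^bsub>K\<^esub> else \<zero>\<^bsub>K\<^esub>"] by (auto simp: arr_def)

lemmas coord_simps [simp] = cv_closed ca_closed cv_add ca_add cv_mult ca_mult cv_one ca_one src_in tgt_in

lemma coord_zero [simp]: "v \<in> V \<Longrightarrow> cv v \<zero> = \<zero>\<^bsub>K\<^esub>" "a \<in> E \<Longrightarrow> ca a \<zero> = \<zero>\<^bsub>K\<^esub>"
proof -
  show "cv v \<zero> = \<zero>\<^bsub>K\<^esub>" if "v \<in> V"
    using cv_add[OF that, of \<zero> \<zero>] cv_closed[OF that, of \<zero>] by (simp add: K.add.l_cancel_one)
  show "ca a \<zero> = \<zero>\<^bsub>K\<^esub>" if "a \<in> E"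
    using ca_add[OF that, of \<zero> \<zero>] ca_closed[OF that, of \<zero>] by (simp add: K.add.l_cancel_one)
qed

lemma scal_zero: "scal \<zero>\<^bsub>K\<^esub> = \<zero>" and scal_one: "scal \<one>\<^bsub>K\<^esub> = \<one>"
  by (rule coord_ext; simp)+

lemma scal_add: "c \<in> carrier K \<Longrightarrow> d \<in> carrier K \<Longrightarrow> scal (c \<oplus>\<^bsub>K\<^esub> d) = scal c \<oplus> scal d"
  and scal_mult: "c \<in> carrier K \<Longrightarrow> d \<in> carrier K \<Longrightarrow> scal (c \<otimes>\<^bsub>K\<^esub> d) = scal c \<otimes> scal d"
  by (rule coord_ext; simp)+

lemma scal_comm: "c \<in> carrier K \<Longrightarrow> r \<in> carrier R \<Longrightarrow> scal c \<otimes> r = r \<otimes> scal c"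
  by (rule coord_ext) (auto simp: K.m_comm)

lemma idem_mult: "idem u \<otimes> idem v = (if u = v then idem u else \<zero>)"
  by (rule coord_ext) auto

lemma idem_arr: "a \<in> E \<Longrightarrow> idem v \<otimes> arr a = (if v = src a then arr a else \<zero>)"
  by (rule coord_ext) auto

text \<open>An element without vertex coordinates lies in the radical and is the sum of the arrow
  multiples \<open>arr a \<otimes> scal (ca a s)\<close>, which are added one by one.\<close>

lemma rad_induct:
  assumes s: "s \<in> carrier R" "\<And>v. v \<in> V \<Longrightarrow> cv v s = \<zero>\<^bsub>K\<^esub>" and "P \<zero>"
    and add: "\<And>x y. x \<in> carrier R \<Longrightarrow> y \<in> carrier R \<Longrightarrow> P x \<Longrightarrow> P y \<Longrightarrow> P (x \<oplus> y)"
    and arr: "\<And>a. a \<in> E \<Longrightarrow> P (arr a \<otimes> scal (ca a s))"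
  shows "P s"
proof -
  \<comment> \<open>The truncation of \<open>s\<close> to the arrows in \<open>B\<close>.\<close>
  define m where "m B = mk (\<lambda>_. \<zero>\<^bsub>K\<^esub>) (\<lambda>a. if a \<in> B then ca a s else \<zero>\<^bsub>K\<^esub>)" for B
  have [simp]: "m B \<in> carrier R" "v \<in> V \<Longrightarrow> cv v (m B) = \<zero>\<^bsub>K\<^esub>"
    "a \<in> E \<Longrightarrow> ca a (m B) = (if a \<in> B then ca a s else \<zero>\<^bsub>K\<^esub>)" for B v a
    using mk[of "\<lambda>_. \<zero>\<^bsub>K\<^esub>" "\<lambda>a. if a \<in> B then ca a s else \<zero>\<^bsub>K\<^esub>"] s by (auto simp: m_def)
  have "P (m B)" if "finite B" "B \<subseteq> E" for B
    using that
  proof (induction B)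
    case empty
    have "m {} = \<zero>" by (rule coord_ext) auto
    with \<open>P \<zero>\<close> show ?case by simp
  next
    case (insert b B)
    then have "b \<in> E" by simp
    have "m (insert b B) = m B \<oplus> arr b \<otimes> scal (ca b s)"
      by (rule coord_ext) (use insert s in auto)
    then show ?case using insert add[of "m B" "arr b \<otimes> scal (ca b s)"] arr[of b] s(1) by simp
  qed
  from this[OF finite_E] have "P (m E)" by simp
  moreover have "m E = s" by (rule coord_ext) (use s in auto)
  ultimately show ?thesis by simp
qed

definition kmod :: "('r, 'b, 'x) module_scheme \<Rightarrow> ('k, 'b) module" where
  "kmod M = \<lparr>carrier = carrier M, monoid.mult = undefined, monoid.one = undefined,
     ring.zero = \<zero>\<^bsub>M\<^esub>, ring.add = (\<lambda>x y. x \<oplus>\<^bsub>M\<^esub> y), smult = (\<lambda>c x. scal c \<odot>\<^bsub>M\<^esub> x)\<rparr>"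

lemma kmod_simps [simp]:
  "carrier (kmod M) = carrier M" "\<zero>\<^bsub>kmod M\<^esub> = \<zero>\<^bsub>M\<^esub>" "x \<oplus>\<^bsub>kmod M\<^esub> y = x \<oplus>\<^bsub>M\<^esub> y" "c \<odot>\<^bsub>kmod M\<^esub> x = scal c \<odot>\<^bsub>M\<^esub> x"
  by (simp_all add: kmod_def)

text \<open>The right action of \<open>R\<close> restricts along \<open>scal\<close> to a left
  action because \<open>K\<close> is commutative.\<close>

lemma kmod_vectorspace:
  assumes "right_module R M"
  shows "vectorspace K (kmod M)"
proof -
  interpret M: right_module R M by fact
  have "abelian_group (kmod M)"
  proof (rule abelian_groupI)
    fix x assume "x \<in> carrier (kmod M)"
    then show "\<exists>y\<in>carrier (kmod M). y \<oplus>\<^bsub>kmod M\<^esub> x = \<zero>\<^bsub>kmod M\<^esub>"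
      by (intro bexI[of _ "\<ominus>\<^bsub>M\<^esub> x"]) (simp_all add: M.M.l_neg)
  qed (simp_all add: M.M.a_ac)
  moreover have "scal (c \<otimes>\<^bsub>K\<^esub> d) \<odot>\<^bsub>M\<^esub> x = scal c \<odot>\<^bsub>M\<^esub> (scal d \<odot>\<^bsub>M\<^esub> x)"
    if "c \<in> carrier K" "d \<in> carrier K" "x \<in> carrier M" for c d x
    using that M.smult_mult[of "scal d" "scal c" x] scal_mult[of d c] by (simp add: K.m_comm)
  ultimately have "Module.module K (kmod M)"
  proof (intro moduleI)
    show "cring K" by (rule K.is_cring)
  qed (simp_all add: M.smult_closed scal_add scal_one M.smult_add_scalar M.smult_add_vector M.smult_one)
  then show ?thesis by (simp add: vectorspace_def K.field_axioms)
qed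

lemma rmod_hom_linear:
  assumes "right_module R M" "f \<in> rmod_hom R M N" "W \<subseteq> carrier M"
  shows "f \<in> module_hom K (kmod M\<lparr>carrier := W\<rparr>) (kmod N)"
  using rmod_homD[OF assms(2)] assms(3) by (auto simp: module_hom_def subset_iff)

lemma submodule_subspace:
  assumes M: "right_module R M" and H: "Module.submodule H R M"
  shows "subspace K H (kmod M)"
proof -
  interpret M: right_module R M by fact
  interpret VM: vectorspace K "kmod M" by (rule kmod_vectorspace[OF M])
  show ?thesis by (rule VM.subspaceI) (use H in \<open>auto simp: M.submodule_iff\<close>)
qed

text \<open>Submodules are subspaces, so a finite spanning set also generates.\<close>

lemma fin_dim_imp_fg:
  assumes M: "right_module R M" and fd: "vectorspace.fin_dim K (kmod M)"
  shows "finitely_generated R M"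
proof -
  interpret VM: vectorspace K "kmod M" by (rule kmod_vectorspace[OF M])
  from fd obtain S where S: "finite S" "S \<subseteq> carrier M" "VM.span S = carrier M"
    unfolding VM.fin_dim_def by auto
  have "H = carrier M" if H: "Module.submodule H R M" "S \<subseteq> H" for H
  proof -
    have "subspace K H (kmod M)" by (rule submodule_subspace[OF M H(1)])
    then have "VM.span S \<subseteq> H" using VM.span_is_subset[OF H(2)] by (simp add: subspace_def)
    moreover have "H \<subseteq> carrier M" using H(1) by (simp add: right_module.submodule_iff[OF M])
    ultimately show ?thesis using S(3) by simp
  qed
  with S show ?thesis unfolding finitely_generated_def by blast
qed

section \<open>The explicit modules \<open>Lmod\<close>\<close>

text \<open>\<open>Lmod I vt A\<close> is the direct sum over \<open>i \<in> I\<close> of the quotients of the projectives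
  \<open>e\<^bsub>vt i\<^esub> R\<close> in which exactly the arrows \<open>a\<close> with \<open>(i, a) \<in> A\<close> survive; the coordinate \<open>(i, None)\<close> belongs
  to the idempotent and \<open>(i, Some a)\<close> to the arrow \<open>a\<close>.\<close>

definition Lsupp :: "'x set \<Rightarrow> ('x \<times> 'a) set \<Rightarrow> ('x \<times> 'a option) set" where
  "Lsupp I A = (\<lambda>i. (i, None)) ` I \<union> (\<lambda>(i, a). (i, Some a)) ` A"

definition Lmod :: "'x set \<Rightarrow> ('x \<Rightarrow> 'v) \<Rightarrow> ('x \<times> 'a) set \<Rightarrow> ('r, 'x \<times> 'a option \<Rightarrow> 'k) module" where
  "Lmod I vt A = \<lparr>carrier = {f. (\<forall>z. f z \<in> carrier K) \<and> (\<forall>z. z \<notin> Lsupp I A \<longrightarrow> f z = \<zero>\<^bsub>K\<^esub>)},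
     monoid.mult = undefined, monoid.one = undefined,
     ring.zero = (\<lambda>_. \<zero>\<^bsub>K\<^esub>), ring.add = (\<lambda>f g z. f z \<oplus>\<^bsub>K\<^esub> g z),
     smult = (\<lambda>r f (i, q). case q of
        None \<Rightarrow> if i \<in> I then f (i, None) \<otimes>\<^bsub>K\<^esub> cv (vt i) r else \<zero>\<^bsub>K\<^esub>
      | Some a \<Rightarrow> if (i, a) \<in> A then f (i, None) \<otimes>\<^bsub>K\<^esub> ca a r \<oplus>\<^bsub>K\<^esub> f (i, Some a) \<otimes>\<^bsub>K\<^esub> cv (tgt a) r else \<zero>\<^bsub>K\<^esub>)\<rparr>"

definition arrows_at :: "'x set \<Rightarrow> ('x \<Rightarrow> 'v) \<Rightarrow> ('x \<times> 'a) set" where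
  "arrows_at I vt = {(i, a). i \<in> I \<and> a \<in> E \<and> src a = vt i}"

definition Ldata :: "'x set \<Rightarrow> ('x \<Rightarrow> 'v) \<Rightarrow> ('x \<times> 'a) set \<Rightarrow> bool" where
  "Ldata I vt A \<longleftrightarrow> finite I \<and> vt ` I \<subseteq> V \<and> A \<subseteq> arrows_at I vt"

definition Lbasis :: "'x \<times> 'a option \<Rightarrow> 'x \<times> 'a option \<Rightarrow> 'k" where
  "Lbasis z = (\<lambda>w. if w = z then \<one>\<^bsub>K\<^esub> else \<zero>\<^bsub>K\<^esub>)"

lemma Lsupp_iff [simp]: "(i, None) \<in> Lsupp I A \<longleftrightarrow> i \<in> I" "(i, Some a) \<in> Lsupp I A \<longleftrightarrow> (i, a) \<in> A"
  by (auto simp: Lsupp_def)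

lemma Lmod_carrier:
  "f \<in> carrier (Lmod I vt A) \<longleftrightarrow> (\<forall>z. f z \<in> carrier K) \<and> (\<forall>z. z \<notin> Lsupp I A \<longrightarrow> f z = \<zero>\<^bsub>K\<^esub>)"
  by (simp add: Lmod_def)

lemma Lmod_carrierI:
  "(\<And>z. f z \<in> carrier K) \<Longrightarrow> (\<And>i. i \<notin> I \<Longrightarrow> f (i, None) = \<zero>\<^bsub>K\<^esub>) \<Longrightarrow>
    (\<And>i a. (i, a) \<notin> A \<Longrightarrow> f (i, Some a) = \<zero>\<^bsub>K\<^esub>) \<Longrightarrow> f \<in> carrier (Lmod I vt A)"
  unfolding Lmod_carrier by (metis Lsupp_iff not_Some_eq surj_pair)

lemma Lmod_closed [simp]: "f \<in> carrier (Lmod I vt A) \<Longrightarrow> f z \<in> carrier K"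
  unfolding Lmod_carrier by blast

lemma Lmod_outside:
  "f \<in> carrier (Lmod I vt A) \<Longrightarrow> i \<notin> I \<Longrightarrow> f (i, None) = \<zero>\<^bsub>K\<^esub>"
  "f \<in> carrier (Lmod I vt A) \<Longrightarrow> (i, a) \<notin> A \<Longrightarrow> f (i, Some a) = \<zero>\<^bsub>K\<^esub>"
  unfolding Lmod_carrier by (metis Lsupp_iff)+

lemma Lmod_simps [simp]:
  "\<zero>\<^bsub>Lmod I vt A\<^esub> = (\<lambda>_. \<zero>\<^bsub>K\<^esub>)" "f \<oplus>\<^bsub>Lmod I vt A\<^esub> g = (\<lambda>z. f z \<oplus>\<^bsub>K\<^esub> g z)"
  "(r \<odot>\<^bsub>Lmod I vt A\<^esub> f) (i, None) = (if i \<in> I then f (i, None) \<otimes>\<^bsub>K\<^esub> cv (vt i) r else \<zero>\<^bsub>K\<^esub>)"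
  "(r \<odot>\<^bsub>Lmod I vt A\<^esub> f) (i, Some a) = (if (i, a) \<in> A then f (i, None) \<otimes>\<^bsub>K\<^esub> ca a r \<oplus>\<^bsub>K\<^esub> f (i, Some a) \<otimes>\<^bsub>K\<^esub> cv (tgt a) r else \<zero>\<^bsub>K\<^esub>)"
  unfolding Lmod_def
  by (simp_all only: module.select_convs ring.select_convs option.case prod.case)

lemma pair_option_ext: "(\<And>i. f (i, None) = g (i, None)) \<Longrightarrow> (\<And>i a. f (i, Some a) = g (i, Some a)) \<Longrightarrow> f = g"
  by (rule ext) (metis not_Some_eq surj_pair)

lemma LdataD:
  assumes "Ldata I vt A"
  shows "finite I" "i \<in> I \<Longrightarrow> vt i \<in> V" "(i, a) \<in> A \<Longrightarrow> i \<in> I" "(i, a) \<in> A \<Longrightarrow> a \<in> E" "(i, a) \<in> A \<Longrightarrow> src a = vt i"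
    "(i, a) \<in> A \<Longrightarrow> tgt a \<in> V"
  using assms by (auto simp: Ldata_def arrows_at_def)

lemma finite_arrows: "finite I \<Longrightarrow> finite (arrows_at I vt)"
  by (rule finite_subset[of _ "I \<times> E"]) (auto simp: arrows_at_def finite_E)

lemma Ldata_finite: "Ldata I vt A \<Longrightarrow> finite A"
  using finite_arrows finite_subset unfolding Ldata_def by blast

lemma finite_Lsupp: "Ldata I vt A \<Longrightarrow> finite (Lsupp I A)"
  using Ldata_finite LdataD(1) unfolding Lsupp_def by blast

lemma Ldata_full: "finite I \<Longrightarrow> vt ` I \<subseteq> V \<Longrightarrow> Ldata I vt (arrows_at I vt)"
  by (simp add: Ldata_def)

lemma Lmod_smult_closed:
  assumes "Ldata I vt A" "r \<in> carrier R" "f \<in> carrier (Lmod I vt A)"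
  shows "r \<odot>\<^bsub>Lmod I vt A\<^esub> f \<in> carrier (Lmod I vt A)"
proof (rule Lmod_carrierI)
  fix z show "(r \<odot>\<^bsub>Lmod I vt A\<^esub> f) z \<in> carrier K"
  proof (cases z)
    case (Pair i q)
    then show ?thesis using assms LdataD[OF assms(1)] by (cases q) auto
  qed
qed auto

lemma Lmod_right_module:
  assumes L: "Ldata I vt A"
  shows "right_module R (Lmod I vt A)"
proof -
  note LD = LdataD[OF L]
  have "abelian_group (Lmod I vt A)"
  proof (rule abelian_groupI)
    fix f assume f: "f \<in> carrier (Lmod I vt A)"
    then have "(\<lambda>z. \<ominus>\<^bsub>K\<^esub> f z) \<in> carrier (Lmod I vt A)"
      by (intro Lmod_carrierI) (simp_all add: Lmod_outside)
    with f show "\<exists>g\<in>carrier (Lmod I vt A). g \<oplus>\<^bsub>Lmod I vt A\<^esub> f = \<zero>\<^bsub>Lmod I vt A\<^esub>"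
      by (intro bexI[of _ "\<lambda>z. \<ominus>\<^bsub>K\<^esub> f z"]) (auto simp: K.l_neg)
  next
    fix f g assume "f \<in> carrier (Lmod I vt A)" "g \<in> carrier (Lmod I vt A)"
    then show "f \<oplus>\<^bsub>Lmod I vt A\<^esub> g \<in> carrier (Lmod I vt A)"
      unfolding Lmod_simps by (intro Lmod_carrierI) (simp_all add: Lmod_outside)
  next
    show "\<zero>\<^bsub>Lmod I vt A\<^esub> \<in> carrier (Lmod I vt A)" unfolding Lmod_simps by (intro Lmod_carrierI) simp_all
  qed (simp_all add: K.a_ac)
  then show ?thesis
  proof (intro right_module.intro right_module_axioms.intro R.ring_axioms)
    fix r f assume "r \<in> carrier R" "f \<in> carrier (Lmod I vt A)"
    then show "r \<odot>\<^bsub>Lmod I vt A\<^esub> f \<in> carrier (Lmod I vt A)" by (rule Lmod_smult_closed[OF L])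
  next
    fix r s f assume c: "r \<in> carrier R" "s \<in> carrier R" "f \<in> carrier (Lmod I vt A)"
    show "(r \<oplus> s) \<odot>\<^bsub>Lmod I vt A\<^esub> f = r \<odot>\<^bsub>Lmod I vt A\<^esub> f \<oplus>\<^bsub>Lmod I vt A\<^esub> s \<odot>\<^bsub>Lmod I vt A\<^esub> f"
      by (rule pair_option_ext) (use c LD in \<open>auto simp: K.r_distr K.a_ac\<close>)
    show "(r \<otimes> s) \<odot>\<^bsub>Lmod I vt A\<^esub> f = s \<odot>\<^bsub>Lmod I vt A\<^esub> (r \<odot>\<^bsub>Lmod I vt A\<^esub> f)"
      by (rule pair_option_ext) (use c LD in \<open>auto simp: K.r_distr K.l_distr K.m_assoc K.a_assoc\<close>)
  next
    fix r f g assume c: "r \<in> carrier R" "f \<in> carrier (Lmod I vt A)" "g \<in> carrier (Lmod I vt A)"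
    show "r \<odot>\<^bsub>Lmod I vt A\<^esub> (f \<oplus>\<^bsub>Lmod I vt A\<^esub> g) = r \<odot>\<^bsub>Lmod I vt A\<^esub> f \<oplus>\<^bsub>Lmod I vt A\<^esub> r \<odot>\<^bsub>Lmod I vt A\<^esub> g"
      by (rule pair_option_ext) (use c LD in \<open>auto simp: K.l_distr K.a_ac\<close>)
  next
    fix f assume c: "f \<in> carrier (Lmod I vt A)"
    show "\<one> \<odot>\<^bsub>Lmod I vt A\<^esub> f = f"
      by (rule pair_option_ext) (use c LD in \<open>auto simp: Lmod_outside\<close>)
  qed
qed

lemma Lbasis_in: "z \<in> Lsupp I A \<Longrightarrow> Lbasis z \<in> carrier (Lmod I vt A)"
  by (auto simp: Lmod_carrier Lbasis_def)

lemma Lmod_scal: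
  assumes "Ldata I vt A" "c \<in> carrier K" "f \<in> carrier (Lmod I vt A)"
  shows "scal c \<odot>\<^bsub>Lmod I vt A\<^esub> f = (\<lambda>z. c \<otimes>\<^bsub>K\<^esub> f z)"
  by (rule pair_option_ext)
     (use assms LdataD[OF assms(1)] in \<open>auto simp: Lmod_outside K.m_comm\<close>)

lemma Lmod_function_space:
  assumes L: "Ldata I vt A"
  shows "function_space K (kmod (Lmod I vt A)) (Lsupp I A)"
proof (intro function_space.intro function_space_axioms.intro)
  show "vectorspace K (kmod (Lmod I vt A))" by (rule kmod_vectorspace[OF Lmod_right_module[OF L]])
  show "finite (Lsupp I A)" by (rule finite_Lsupp[OF L])
  show "carrier (kmod (Lmod I vt A)) = {f. (\<forall>z. f z \<in> carrier K) \<and> (\<forall>z. z \<notin> Lsupp I A \<longrightarrow> f z = \<zero>\<^bsub>K\<^esub>)}"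
    unfolding kmod_simps using Lmod_carrier by blast
qed (simp_all only: kmod_simps Lmod_simps Lmod_scal[OF L])

lemma Lmod_fin_dim: "Ldata I vt A \<Longrightarrow> vectorspace.fin_dim K (kmod (Lmod I vt A))"
  by (rule function_space.function_space_fin_dim[OF Lmod_function_space])

lemma Lmod_fg: "Ldata I vt A \<Longrightarrow> finitely_generated R (Lmod I vt A)"
  by (rule fin_dim_imp_fg[OF Lmod_right_module Lmod_fin_dim])

text \<open>The component of \<open>f\<close> at \<open>i\<close> as a ring element: acting on the
  generator \<open>Lbasis (i, None)\<close> it gives this component back.\<close>

definition elt :: "('x \<Rightarrow> 'v) \<Rightarrow> ('x \<times> 'a) set \<Rightarrow> ('x \<times> 'a option \<Rightarrow> 'k) \<Rightarrow> 'x \<Rightarrow> 'r" where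
  "elt vt A f i = mk (\<lambda>v. if v = vt i then f (i, None) else \<zero>\<^bsub>K\<^esub>) (\<lambda>a. if (i, a) \<in> A then f (i, Some a) else \<zero>\<^bsub>K\<^esub>)"

text \<open>The candidate for the homomorphism that sends the generator
  \<open>Lbasis (i, None)\<close> to \<open>g i\<close>, written out on coordinates.\<close>

definition Lmap :: "('r, 'b, 'z) module_scheme \<Rightarrow> 'x set \<Rightarrow> ('x \<Rightarrow> 'v) \<Rightarrow> ('x \<times> 'a) set \<Rightarrow> ('x \<Rightarrow> 'b) \<Rightarrow>
    ('x \<times> 'a option \<Rightarrow> 'k) \<Rightarrow> 'b" where
  "Lmap M I vt A g f = (\<Oplus>\<^bsub>M\<^esub>i\<in>I. elt vt A f i \<odot>\<^bsub>M\<^esub> g i)"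

lemma elt [simp]:
  assumes "\<And>z. f z \<in> carrier K"
  shows "elt vt A f i \<in> carrier R" "v \<in> V \<Longrightarrow> cv v (elt vt A f i) = (if v = vt i then f (i, None) else \<zero>\<^bsub>K\<^esub>)"
    "a \<in> E \<Longrightarrow> ca a (elt vt A f i) = (if (i, a) \<in> A then f (i, Some a) else \<zero>\<^bsub>K\<^esub>)"
  using assms mk[of "\<lambda>v. if v = vt i then f (i, None) else \<zero>\<^bsub>K\<^esub>" "\<lambda>a. if (i, a) \<in> A then f (i, Some a) else \<zero>\<^bsub>K\<^esub>"]
  by (auto simp: elt_def)

text \<open>The difference of \<open>r\<close> and \<open>s\<close> has no vertex coordinates, so it
  is a sum of arrow multiples, and only arrows that kill \<open>g\<close> occur in it with a nonzero
  coefficient.\<close>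

lemma smult_eqI:
  assumes M: "right_module R M" and g: "g \<in> carrier M" and r: "r \<in> carrier R" "s \<in> carrier R"
    and v: "\<And>v. v \<in> V \<Longrightarrow> cv v r = cv v s"
    and a: "\<And>a. a \<in> E \<Longrightarrow> ca a r = ca a s \<or> arr a \<odot>\<^bsub>M\<^esub> g = \<zero>\<^bsub>M\<^esub>"
  shows "r \<odot>\<^bsub>M\<^esub> g = s \<odot>\<^bsub>M\<^esub> g"
proof -
  interpret M: right_module R M by fact
  let ?t = "mk (\<lambda>_. \<zero>\<^bsub>K\<^esub>) (\<lambda>a. ca a r \<ominus>\<^bsub>K\<^esub> ca a s)"
  have t [simp]: "?t \<in> carrier R" "v \<in> V \<Longrightarrow> cv v ?t = \<zero>\<^bsub>K\<^esub>" "a \<in> E \<Longrightarrow> ca a ?t = ca a r \<ominus>\<^bsub>K\<^esub> ca a s" for v a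
    using mk[of "\<lambda>_. \<zero>\<^bsub>K\<^esub>" "\<lambda>a. ca a r \<ominus>\<^bsub>K\<^esub> ca a s"] r by (auto simp: a_minus_def)
  have eq: "r = s \<oplus> ?t"
  proof (rule coord_ext)
    fix a assume "a \<in> E"
    then have c: "ca a r \<in> carrier K" "ca a s \<in> carrier K" using r by simp_all
    have "ca a (s \<oplus> ?t) = ca a s \<oplus>\<^bsub>K\<^esub> (ca a r \<oplus>\<^bsub>K\<^esub> \<ominus>\<^bsub>K\<^esub> ca a s)"
      unfolding a_minus_def[of K, symmetric] using r \<open>a \<in> E\<close> by simp
    also have "\<dots> = ca a r \<oplus>\<^bsub>K\<^esub> (ca a s \<oplus>\<^bsub>K\<^esub> \<ominus>\<^bsub>K\<^esub> ca a s)"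
      by (rule K.a_lcomm) (use c in auto)
    finally show "ca a r = ca a (s \<oplus> ?t)" using c by (simp add: K.r_neg)
  qed (use r v in auto)
  have tg: "?t \<odot>\<^bsub>M\<^esub> g = \<zero>\<^bsub>M\<^esub>"
  proof (rule rad_induct[of ?t "\<lambda>t. t \<odot>\<^bsub>M\<^esub> g = \<zero>\<^bsub>M\<^esub>"])
    fix b assume b: "b \<in> E"
    show "(arr b \<otimes> scal (ca b ?t)) \<odot>\<^bsub>M\<^esub> g = \<zero>\<^bsub>M\<^esub>"
    proof (cases "arr b \<odot>\<^bsub>M\<^esub> g = \<zero>\<^bsub>M\<^esub>")
      case True
      moreover have "scal (ca b ?t) \<in> carrier R" by (rule scal(1)[OF ca_closed[OF b t(1)]])
      ultimately show ?thesis using g by (simp only: M.smult_mult arr(1) M.smult_zero)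
    next
      case False
      then have "ca b ?t = \<zero>\<^bsub>K\<^esub>" using a[OF b] t(3)[OF b] b r by simp
      then show ?thesis using g by (simp add: scal_zero)
    qed
  qed (use g in \<open>auto simp: M.smult_add_scalar\<close>)
  have "r \<odot>\<^bsub>M\<^esub> g = (s \<oplus> ?t) \<odot>\<^bsub>M\<^esub> g" by (rule arg_cong[where f = "\<lambda>x. x \<odot>\<^bsub>M\<^esub> g", OF eq])
  also have "\<dots> = s \<odot>\<^bsub>M\<^esub> g" using r g tg by (simp add: M.smult_add_scalar M.smult_closed)
  finally show ?thesis .
qed

text \<open>\<open>idem v\<close> fixes \<open>g\<close>, while
  \<open>idem v \<otimes> arr a\<close> is 0 for an arrow that starts elsewhere.\<close>

lemma homogeneous_arr:
  assumes M: "right_module R M" and g: "g \<in> carrier M" "idem v \<odot>\<^bsub>M\<^esub> g = g" and a: "a \<in> E" "src a \<noteq> v"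
  shows "arr a \<odot>\<^bsub>M\<^esub> g = \<zero>\<^bsub>M\<^esub>"
proof -
  interpret M: right_module R M by fact
  have "arr a \<odot>\<^bsub>M\<^esub> g = (idem v \<otimes> arr a) \<odot>\<^bsub>M\<^esub> g" using g by (simp add: M.smult_mult)
  then show ?thesis using g a by (simp add: idem_arr)
qed

text \<open>The universal property of \<open>Lmod\<close>: it is presented by generators at the
  vertices \<open>vt i\<close> with the relations that the arrows outside \<open>A\<close> act as
  zero. For compatibility with the action an arrow either survives at \<open>i\<close>, or kills
  \<open>g i\<close> by \<open>rel\<close>, or starts at another vertex and kills \<open>g i\<close>
  by homogeneity.\<close>

lemma Lmap_hom:
  assumes M: "right_module R M" and L: "Ldata I vt A"
    and g: "\<And>i. i \<in> I \<Longrightarrow> g i \<in> carrier M" "\<And>i. i \<in> I \<Longrightarrow> idem (vt i) \<odot>\<^bsub>M\<^esub> g i = g i"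
    and rel: "\<And>i a. (i, a) \<in> arrows_at I vt - A \<Longrightarrow> arr a \<odot>\<^bsub>M\<^esub> g i = \<zero>\<^bsub>M\<^esub>"
  shows "Lmap M I vt A g \<in> rmod_hom R (Lmod I vt A) M"
proof -
  interpret M: right_module R M by fact
  note LD = LdataD[OF L]
  have c: "(\<lambda>i. elt vt A f i \<odot>\<^bsub>M\<^esub> g i) \<in> I \<rightarrow> carrier M" if "f \<in> carrier (Lmod I vt A)" for f
    using that g by (auto intro!: M.smult_closed)
  have "Lmap M I vt A g (f \<oplus>\<^bsub>Lmod I vt A\<^esub> h) = Lmap M I vt A g f \<oplus>\<^bsub>M\<^esub> Lmap M I vt A g h"
    if fh: "f \<in> carrier (Lmod I vt A)" "h \<in> carrier (Lmod I vt A)" for f h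
  proof -
    have "elt vt A (\<lambda>z. f z \<oplus>\<^bsub>K\<^esub> h z) i = elt vt A f i \<oplus> elt vt A h i" for i
      by (rule coord_ext) (use fh in auto)
    then have "Lmap M I vt A g (f \<oplus>\<^bsub>Lmod I vt A\<^esub> h) = (\<Oplus>\<^bsub>M\<^esub>i\<in>I. elt vt A f i \<odot>\<^bsub>M\<^esub> g i \<oplus>\<^bsub>M\<^esub> elt vt A h i \<odot>\<^bsub>M\<^esub> g i)"
      unfolding Lmap_def Lmod_simps using g fh
      by (intro M.M.finsum_cong') (auto intro!: M.smult_closed simp: M.smult_add_scalar)
    then show ?thesis unfolding Lmap_def by (simp add: M.M.finsum_addf[OF c[OF fh(1)] c[OF fh(2)]])
  qed
  moreover have "Lmap M I vt A g (r \<odot>\<^bsub>Lmod I vt A\<^esub> f) = r \<odot>\<^bsub>M\<^esub> Lmap M I vt A g f"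
    if r: "r \<in> carrier R" and f: "f \<in> carrier (Lmod I vt A)" for r f
  proof -
    have rf: "\<And>z. (r \<odot>\<^bsub>Lmod I vt A\<^esub> f) z \<in> carrier K" using Lmod_smult_closed[OF L r f] by simp
    have "elt vt A (r \<odot>\<^bsub>Lmod I vt A\<^esub> f) i \<odot>\<^bsub>M\<^esub> g i = r \<odot>\<^bsub>M\<^esub> (elt vt A f i \<odot>\<^bsub>M\<^esub> g i)" if i: "i \<in> I" for i
    proof -
      have "elt vt A (r \<odot>\<^bsub>Lmod I vt A\<^esub> f) i \<odot>\<^bsub>M\<^esub> g i = (elt vt A f i \<otimes> r) \<odot>\<^bsub>M\<^esub> g i"
      proof (rule smult_eqI[OF M g(1)[OF i]])
        show "elt vt A (r \<odot>\<^bsub>Lmod I vt A\<^esub> f) i \<in> carrier R" by (rule elt(1)) (rule rf)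
        show "elt vt A f i \<otimes> r \<in> carrier R" using f r by simp
        show "cv v (elt vt A (r \<odot>\<^bsub>Lmod I vt A\<^esub> f) i) = cv v (elt vt A f i \<otimes> r)" if "v \<in> V" for v
          using that f r i rf by (subst elt(2)) auto
        fix a assume a: "a \<in> E"
        show "ca a (elt vt A (r \<odot>\<^bsub>Lmod I vt A\<^esub> f) i) = ca a (elt vt A f i \<otimes> r) \<or> arr a \<odot>\<^bsub>M\<^esub> g i = \<zero>\<^bsub>M\<^esub>"
        proof (cases "src a = vt i \<and> (i, a) \<notin> A")
          case True
          then have "arr a \<odot>\<^bsub>M\<^esub> g i = \<zero>\<^bsub>M\<^esub>" using rel[of i a] a i by (auto simp: arrows_at_def)
          then show ?thesis ..
        next
          case False
          show ?thesis
          proof (cases "src a = vt i")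
            case True
            with False a have "(i, a) \<in> A" by auto
            then have "ca a (elt vt A (r \<odot>\<^bsub>Lmod I vt A\<^esub> f) i) = ca a (elt vt A f i \<otimes> r)"
              using a f r rf True LD(2)[OF i] by (subst elt(3)) auto
            then show ?thesis ..
          next
            case False
            then show ?thesis using homogeneous_arr[OF M g(1)[OF i] g(2)[OF i] a] by auto
          qed
        qed
      qed
      then show ?thesis using f r g(1)[OF i] by (simp add: M.smult_mult)
    qed
    then have "Lmap M I vt A g (r \<odot>\<^bsub>Lmod I vt A\<^esub> f) = (\<Oplus>\<^bsub>M\<^esub>i\<in>I. r \<odot>\<^bsub>M\<^esub> (elt vt A f i \<odot>\<^bsub>M\<^esub> g i))"
      unfolding Lmap_def using f r g by (intro M.M.finsum_cong') (auto intro!: M.smult_closed)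
    then show ?thesis unfolding Lmap_def by (simp add: M.smult_finsum[OF r c[OF f]])
  qed
  moreover have "Lmap M I vt A g f \<in> carrier M" if "f \<in> carrier (Lmod I vt A)" for f
    unfolding Lmap_def by (rule M.M.finsum_closed[OF c[OF that]])
  ultimately show ?thesis by (auto simp: rmod_hom_def)
qed

lemma Lmod_expand:
  assumes L: "Ldata I vt A" and f: "f \<in> carrier (Lmod I vt A)"
  shows "f = Lmap (Lmod I vt A) I vt A (\<lambda>i. Lbasis (i, None)) f"
proof -
  interpret L: right_module R "Lmod I vt A" by (rule Lmod_right_module[OF L])
  note LD = LdataD[OF L]
  let ?t = "\<lambda>i. elt vt A f i \<odot>\<^bsub>Lmod I vt A\<^esub> Lbasis (i, None)"
  have tc: "?t i \<in> carrier (Lmod I vt A)" if "i \<in> I" for i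
    using that f by (intro L.smult_closed Lbasis_in) auto
  have t: "?t i (j, None) = (if j = i then f (i, None) else \<zero>\<^bsub>K\<^esub>)"
    "?t i (j, Some a) = (if j = i then f (i, Some a) else \<zero>\<^bsub>K\<^esub>)" if "i \<in> I" for i j a
    using that f LD by (auto simp: Lbasis_def Lmod_outside)
  have "(\<Oplus>\<^bsub>Lmod I vt A\<^esub>i\<in>J. ?t i) = (\<lambda>z. if fst z \<in> J then f z else \<zero>\<^bsub>K\<^esub>)" if "J \<subseteq> I" for J
    using finite_subset[OF that LD(1)] that
  proof (induction J)
    case (insert j J)
    have "(\<Oplus>\<^bsub>Lmod I vt A\<^esub>i\<in>insert j J. ?t i) = ?t j \<oplus>\<^bsub>Lmod I vt A\<^esub> (\<Oplus>\<^bsub>Lmod I vt A\<^esub>i\<in>J. ?t i)"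
      using insert.hyps insert.prems tc by (intro L.M.finsum_insert) auto
    also have "\<dots> = (\<lambda>z. if fst z \<in> insert j J then f z else \<zero>\<^bsub>K\<^esub>)"
      unfolding insert.IH[OF subset_trans[OF subset_insertI insert.prems]]
      by (rule pair_option_ext) (use insert f t in \<open>auto simp del: Lmod_simps(3,4)\<close>)
    finally show ?case .
  qed simp
  from this[of I] have "Lmap (Lmod I vt A) I vt A (\<lambda>i. Lbasis (i, None)) f = (\<lambda>z. if fst z \<in> I then f z else \<zero>\<^bsub>K\<^esub>)"
    by (simp add: Lmap_def)
  also have "\<dots> = f"
  proof (rule pair_option_ext)
    fix i show "(if fst (i, None) \<in> I then f (i, None) else \<zero>\<^bsub>K\<^esub>) = f (i, None)"
      using Lmod_outside(1)[OF f, of i] by simp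
    fix a show "(if fst (i, Some a) \<in> I then f (i, Some a) else \<zero>\<^bsub>K\<^esub>) = f (i, Some a)"
      using Lmod_outside(2)[OF f, of i a] LD(3)[of i a] by (cases "(i, a) \<in> A") simp_all
  qed
  finally show ?thesis by simp
qed

definition sub_arrows :: "'x set \<Rightarrow> ('x \<times> 'a) set \<Rightarrow> ('x \<times> 'a) set" where
  "sub_arrows J A = {(i, a). (i, a) \<in> A \<and> i \<in> J}"

lemma Ldata_sub: "Ldata I vt A \<Longrightarrow> J \<subseteq> I \<Longrightarrow> Ldata J vt (sub_arrows J A)"
  by (auto simp: Ldata_def sub_arrows_def arrows_at_def finite_subset)

lemma Lmod_split:
  assumes L: "Ldata I vt A" and J: "J \<subseteq> I"
  shows "rmod_isomorphic R (Lmod I vt A)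
    (rmod_sum (Lmod J vt (sub_arrows J A)) (Lmod (I - J) vt (sub_arrows (I - J) A)))"
proof -
  let ?L = "Lmod I vt A" and ?M = "Lmod J vt (sub_arrows J A)" and ?N = "Lmod (I - J) vt (sub_arrows (I - J) A)"
  note LD = LdataD[OF L]
  define res where "res S f = (\<lambda>z. if fst z \<in> S then f z else \<zero>\<^bsub>K\<^esub>)" for S :: "'b set" and f :: "'b \<times> 'a option \<Rightarrow> 'k"
  define h where "h f = (res J f, res (I - J) f)" for f
  have res: "res S f \<in> carrier (Lmod S vt (sub_arrows S A))" if "f \<in> carrier ?L" "S \<subseteq> I" for S f
    by (rule Lmod_carrierI) (use that in \<open>auto simp: res_def sub_arrows_def Lmod_outside\<close>)
  have ressm: "res S (r \<odot>\<^bsub>?L\<^esub> f) = r \<odot>\<^bsub>Lmod S vt (sub_arrows S A)\<^esub> res S f"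
    if "f \<in> carrier ?L" "S \<subseteq> I" for S f r
    by (rule pair_option_ext) (use that in \<open>auto simp: res_def sub_arrows_def\<close>)
  have resadd: "res S (f \<oplus>\<^bsub>?L\<^esub> g) = res S f \<oplus>\<^bsub>Lmod S vt (sub_arrows S A)\<^esub> res S g"
    if "f \<in> carrier ?L" "g \<in> carrier ?L" for S f g
    using that by (auto simp: res_def)
  have "h \<in> rmod_hom R ?L (rmod_sum ?M ?N)"
    unfolding rmod_hom_def h_def using res ressm resadd J by (auto simp del: Lmod_simps)
  moreover have "bij_betw h (carrier ?L) (carrier ?M \<times> carrier ?N)"
  proof (rule bij_betw_byWitness[where f' = "\<lambda>(f, g) z. if fst z \<in> J then f z else g z"])
    show "\<forall>f\<in>carrier ?L. (\<lambda>(f, g) z. if fst z \<in> J then f z else g z) (h f) = f"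
    proof
      fix f assume f: "f \<in> carrier ?L"
      show "(\<lambda>(f, g) z. if fst z \<in> J then f z else g z) (h f) = f"
        unfolding h_def prod.case res_def
      proof (rule pair_option_ext)
        fix i show "(if fst (i, None) \<in> J then if fst (i, None) \<in> J then f (i, None) else \<zero>\<^bsub>K\<^esub>
            else if fst (i, None) \<in> I - J then f (i, None) else \<zero>\<^bsub>K\<^esub>) = f (i, None)"
          using J Lmod_outside(1)[OF f, of i] by auto
        fix a show "(if fst (i, Some a) \<in> J then if fst (i, Some a) \<in> J then f (i, Some a) else \<zero>\<^bsub>K\<^esub>
            else if fst (i, Some a) \<in> I - J then f (i, Some a) else \<zero>\<^bsub>K\<^esub>) = f (i, Some a)"
          using J Lmod_outside(2)[OF f, of i a] LD(3)[of i a] by (cases "(i, a) \<in> A") simp_all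
      qed
    qed
    show "\<forall>p\<in>carrier ?M \<times> carrier ?N. h ((\<lambda>(f, g) z. if fst z \<in> J then f z else g z) p) = p"
    proof
      fix p assume "p \<in> carrier ?M \<times> carrier ?N"
      then obtain f g where p: "p = (f, g)" "f \<in> carrier ?M" "g \<in> carrier ?N" by blast
      let ?k = "\<lambda>z. if fst z \<in> J then f z else g z"
      have "res J ?k = f"
      proof (rule pair_option_ext)
        fix i show "res J ?k (i, None) = f (i, None)"
          using Lmod_outside(1)[OF p(2), of i] by (auto simp: res_def)
        fix a show "res J ?k (i, Some a) = f (i, Some a)"
          using Lmod_outside(2)[OF p(2), of i a] by (cases "i \<in> J") (simp_all add: res_def sub_arrows_def)
      qed
      moreover have "res (I - J) ?k = g"
      proof (rule pair_option_ext)
        fix i show "res (I - J) ?k (i, None) = g (i, None)"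
          using Lmod_outside(1)[OF p(3), of i] by (auto simp: res_def)
        fix a show "res (I - J) ?k (i, Some a) = g (i, Some a)"
          using Lmod_outside(2)[OF p(3), of i a] by (cases "i \<in> I - J") (simp_all add: res_def sub_arrows_def)
      qed
      ultimately show "h ((\<lambda>(f, g) z. if fst z \<in> J then f z else g z) p) = p" by (simp add: h_def p)
    qed
    show "h ` carrier ?L \<subseteq> carrier ?M \<times> carrier ?N" using res J by (auto simp: h_def)
    show "(\<lambda>(f, g) z. if fst z \<in> J then f z else g z) ` (carrier ?M \<times> carrier ?N) \<subseteq> carrier ?L"
    proof clarify
      fix f g assume f: "f \<in> carrier ?M" and g: "g \<in> carrier ?N"
      show "(\<lambda>z. if fst z \<in> J then f z else g z) \<in> carrier ?L"
      proof (rule Lmod_carrierI)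
        fix i a assume "(i, a) \<notin> A"
        then show "(if fst (i, Some a) \<in> J then f (i, Some a) else g (i, Some a)) = \<zero>\<^bsub>K\<^esub>"
          using Lmod_outside(2)[OF f, of i a] Lmod_outside(2)[OF g, of i a] by (simp add: sub_arrows_def)
      qed (use f g J in \<open>auto simp: Lmod_outside\<close>)
    qed
  qed
  ultimately show ?thesis unfolding rmod_isomorphic_def by auto
qed

text \<open>A change of index type, by which a one-element summand of any family is compared with
  the modules indexed by \<open>unit\<close>.\<close>

lemma Lmod_reindex:
  assumes L: "Ldata I vt A" and b: "inj_on b I" and vt: "\<And>i. i \<in> I \<Longrightarrow> vt' (b i) = vt i"
  shows "rmod_isomorphic R (Lmod I vt A) (Lmod (b ` I) vt' ((\<lambda>(i, a). (b i, a)) ` A))"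
proof -
  let ?L = "Lmod I vt A" and ?A = "(\<lambda>(i, a). (b i, a)) ` A"
  let ?M = "Lmod (b ` I) vt' ?A"
  note LD = LdataD[OF L]
  have A: "(b i, a) \<in> ?A \<longleftrightarrow> (i, a) \<in> A" if "i \<in> I" for i a
  proof
    assume "(b i, a) \<in> ?A"
    then obtain i' where "(i', a) \<in> A" "b i = b i'" by auto
    then show "(i, a) \<in> A" using that b LD(3) by (metis inj_onD)
  qed (rule image_eqI[of _ _ "(i, a)"], simp_all)
  define c where "c = the_inv_into I b"
  have c: "c (b i) = i" if "i \<in> I" for i using b that by (simp add: c_def the_inv_into_f_f)
  define h where "h f = (\<lambda>(j, q). if j \<in> b ` I then f (c j, q) else \<zero>\<^bsub>K\<^esub>)" for f :: "'b \<times> 'a option \<Rightarrow> 'k"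
  define h' where "h' f = (\<lambda>(i, q). if i \<in> I then f (b i, q) else \<zero>\<^bsub>K\<^esub>)" for f :: "'c \<times> 'a option \<Rightarrow> 'k"
  have hi: "h f (b i, q) = f (i, q)" if "i \<in> I" for f i q using that c by (simp add: h_def)
  have ho: "h f (j, q) = \<zero>\<^bsub>K\<^esub>" if "j \<notin> b ` I" for f j q using that by (simp add: h_def)
  have hc: "h f \<in> carrier ?M" if f: "f \<in> carrier ?L" for f
  proof (rule Lmod_carrierI)
    show "h f z \<in> carrier K" for z using f by (cases z) (auto simp: h_def)
    fix j a assume ja: "(j, a) \<notin> ?A"
    show "h f (j, Some a) = \<zero>\<^bsub>K\<^esub>"
    proof (cases "j \<in> b ` I")
      case True
      then obtain i where "i \<in> I" "j = b i" by blast
      then show ?thesis using ja A hi Lmod_outside(2)[OF f] by simp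
    qed (simp add: ho)
  qed (simp add: ho)
  have hc': "h' f \<in> carrier ?L" if f: "f \<in> carrier ?M" for f
  proof (rule Lmod_carrierI)
    show "h' f z \<in> carrier K" for z using f by (cases z) (auto simp: h'_def)
    fix i a assume "(i, a) \<notin> A"
    then show "h' f (i, Some a) = \<zero>\<^bsub>K\<^esub>" using A Lmod_outside(2)[OF f, of "b i" a] by (auto simp: h'_def)
  qed (simp add: h'_def)
  have "h (r \<odot>\<^bsub>?L\<^esub> f) = r \<odot>\<^bsub>?M\<^esub> h f" if "f \<in> carrier ?L" for r f
  proof (rule pair_option_ext)
    fix j
    show "h (r \<odot>\<^bsub>?L\<^esub> f) (j, None) = (r \<odot>\<^bsub>?M\<^esub> h f) (j, None)"
      by (cases "j \<in> b ` I") (auto simp: hi ho vt)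
    fix a
    show "h (r \<odot>\<^bsub>?L\<^esub> f) (j, Some a) = (r \<odot>\<^bsub>?M\<^esub> h f) (j, Some a)"
    proof (cases "j \<in> b ` I")
      case True
      then obtain i where "i \<in> I" "j = b i" by blast
      then show ?thesis using A[of i a] by (simp add: hi)
    next
      case False
      then have "(j, a) \<notin> ?A" using LD(3) by auto
      then show ?thesis using False by (simp add: ho)
    qed
  qed
  moreover have "h (f \<oplus>\<^bsub>?L\<^esub> g) = h f \<oplus>\<^bsub>?M\<^esub> h g" for f g
    by (auto simp: h_def fun_eq_iff)
  ultimately have "h \<in> rmod_hom R ?L ?M" using hc unfolding rmod_hom_def by blast
  moreover have "bij_betw h (carrier ?L) (carrier ?M)"
  proof (rule bij_betw_byWitness[where f' = h'])
    show "\<forall>f\<in>carrier ?L. h' (h f) = f"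
    proof
      fix f assume f: "f \<in> carrier ?L"
      show "h' (h f) = f"
      proof (rule pair_option_ext)
        fix i show "h' (h f) (i, None) = f (i, None)" using Lmod_outside(1)[OF f, of i] by (simp add: h'_def hi)
        fix a show "h' (h f) (i, Some a) = f (i, Some a)"
          using Lmod_outside(2)[OF f, of i a] LD(3)[of i a] by (cases "i \<in> I"; cases "(i, a) \<in> A") (simp_all add: h'_def hi)
      qed
    qed
    show "\<forall>f\<in>carrier ?M. h (h' f) = f"
    proof
      fix f assume f: "f \<in> carrier ?M"
      show "h (h' f) = f"
      proof (rule pair_option_ext)
        fix j show "h (h' f) (j, None) = f (j, None)"
          using Lmod_outside(1)[OF f, of j] by (cases "j \<in> b ` I") (auto simp: h'_def hi ho)
        fix a show "h (h' f) (j, Some a) = f (j, Some a)"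
        proof (cases "j \<in> b ` I")
          case False
          then have "(j, a) \<notin> ?A" using LD(3) by auto
          then show ?thesis using False Lmod_outside(2)[OF f] by (simp add: ho)
        qed (auto simp: h'_def hi)
      qed
    qed
  qed (use hc hc' in auto)
  ultimately show ?thesis unfolding rmod_isomorphic_def by blast
qed

section \<open>Minimal homogeneous generating families\<close>

definition genfam :: "('r, 'b, 'z) module_scheme \<Rightarrow> 'x set \<Rightarrow> ('x \<Rightarrow> 'v) \<Rightarrow> ('x \<Rightarrow> 'b) \<Rightarrow> bool" where
  "genfam M I vt g \<longleftrightarrow> finite I \<and> (\<forall>i\<in>I. vt i \<in> V \<and> g i \<in> carrier M \<and> idem (vt i) \<odot>\<^bsub>M\<^esub> g i = g i) \<and>
    (\<forall>y\<in>carrier M. \<exists>r\<in>I \<rightarrow> carrier R. y = (\<Oplus>\<^bsub>M\<^esub>i\<in>I. r i \<odot>\<^bsub>M\<^esub> g i))"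

text \<open>By \<open>min_genfam_relation\<close> such a family represents a basis of the module
  modulo its radical. Competitors are indexed by subsets of the same type.\<close>

definition min_genfam :: "('r, 'b, 'z) module_scheme \<Rightarrow> 'x set \<Rightarrow> ('x \<Rightarrow> 'v) \<Rightarrow> ('x \<Rightarrow> 'b) \<Rightarrow> bool" where
  "min_genfam M I vt g \<longleftrightarrow> genfam M I vt g \<and> (\<forall>(J::'x set) vt' g'. genfam M J vt' g' \<longrightarrow> card I \<le> card J)"

definition gen_span :: "('r, 'b, 'z) module_scheme \<Rightarrow> 'x set \<Rightarrow> ('x \<Rightarrow> 'b) \<Rightarrow> 'b set" where
  "gen_span M I g = {\<Oplus>\<^bsub>M\<^esub>i\<in>I. r i \<odot>\<^bsub>M\<^esub> g i | r. r \<in> I \<rightarrow> carrier R}"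

lemma genfam_iff:
  "genfam M I vt g \<longleftrightarrow> finite I \<and> (\<forall>i\<in>I. vt i \<in> V \<and> g i \<in> carrier M \<and> idem (vt i) \<odot>\<^bsub>M\<^esub> g i = g i) \<and>
    carrier M \<subseteq> gen_span M I g"
  unfolding genfam_def gen_span_def by blast

lemma gen_span_submodule:
  assumes M: "right_module R M" and g: "\<And>i. i \<in> I \<Longrightarrow> g i \<in> carrier M"
  shows "Module.submodule (gen_span M I g) R M"
proof -
  interpret M: right_module R M by fact
  have c: "(\<lambda>i. r i \<odot>\<^bsub>M\<^esub> g i) \<in> I \<rightarrow> carrier M" if "r \<in> I \<rightarrow> carrier R" for r
    using that g by (auto intro!: M.smult_closed)
  show ?thesis
    unfolding M.submodule_iff
  proof (intro conjI ballI subsetI)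
    show "x \<in> carrier M" if "x \<in> gen_span M I g" for x
      using that M.M.finsum_closed[OF c] by (auto simp: gen_span_def)
    have "\<zero>\<^bsub>M\<^esub> = (\<Oplus>\<^bsub>M\<^esub>i\<in>I. \<zero> \<odot>\<^bsub>M\<^esub> g i)"
      using g by (intro M.M.add.finprod_one_eqI[symmetric, folded finsum_def, simplified]) auto
    then show "\<zero>\<^bsub>M\<^esub> \<in> gen_span M I g"
      unfolding gen_span_def by (intro CollectI exI[of _ "\<lambda>_. \<zero>"]) auto
  next
    fix x y assume "x \<in> gen_span M I g" "y \<in> gen_span M I g"
    then obtain r s where rs: "r \<in> I \<rightarrow> carrier R" "s \<in> I \<rightarrow> carrier R"
      "x = (\<Oplus>\<^bsub>M\<^esub>i\<in>I. r i \<odot>\<^bsub>M\<^esub> g i)" "y = (\<Oplus>\<^bsub>M\<^esub>i\<in>I. s i \<odot>\<^bsub>M\<^esub> g i)" by (auto simp: gen_span_def)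
    have "x \<oplus>\<^bsub>M\<^esub> y = (\<Oplus>\<^bsub>M\<^esub>i\<in>I. r i \<odot>\<^bsub>M\<^esub> g i \<oplus>\<^bsub>M\<^esub> s i \<odot>\<^bsub>M\<^esub> g i)"
      unfolding rs(3,4) by (rule M.M.finsum_addf[OF c[OF rs(1)] c[OF rs(2)], symmetric])
    also have "\<dots> = (\<Oplus>\<^bsub>M\<^esub>i\<in>I. (r i \<oplus> s i) \<odot>\<^bsub>M\<^esub> g i)"
      using rs g by (intro M.M.finsum_cong') (auto simp: M.smult_add_scalar Pi_iff intro!: M.smult_closed)
    finally show "x \<oplus>\<^bsub>M\<^esub> y \<in> gen_span M I g"
      unfolding gen_span_def using rs by (intro CollectI exI[of _ "\<lambda>i. r i \<oplus> s i"]) auto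
  next
    fix t x assume t: "t \<in> carrier R" and "x \<in> gen_span M I g"
    then obtain r where r: "r \<in> I \<rightarrow> carrier R" "x = (\<Oplus>\<^bsub>M\<^esub>i\<in>I. r i \<odot>\<^bsub>M\<^esub> g i)" by (auto simp: gen_span_def)
    have "t \<odot>\<^bsub>M\<^esub> x = (\<Oplus>\<^bsub>M\<^esub>i\<in>I. t \<odot>\<^bsub>M\<^esub> (r i \<odot>\<^bsub>M\<^esub> g i))"
      unfolding r(2) by (rule M.smult_finsum[OF t c[OF r(1)]])
    also have "\<dots> = (\<Oplus>\<^bsub>M\<^esub>i\<in>I. (r i \<otimes> t) \<odot>\<^bsub>M\<^esub> g i)"
      using r g t by (intro M.M.finsum_cong') (auto simp: M.smult_mult Pi_iff intro!: M.smult_closed)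
    finally show "t \<odot>\<^bsub>M\<^esub> x \<in> gen_span M I g"
      unfolding gen_span_def using r t by (intro CollectI exI[of _ "\<lambda>i. r i \<otimes> t"]) auto
  qed
qed

lemma gen_span_incl:
  assumes M: "right_module R M" and g: "\<And>i. i \<in> I \<Longrightarrow> g i \<in> carrier M" and "finite I" "j \<in> I"
  shows "g j \<in> gen_span M I g"
proof -
  interpret M: right_module R M by fact
  have "(\<Oplus>\<^bsub>M\<^esub>i\<in>I. (if j = i then \<one> else \<zero>) \<odot>\<^bsub>M\<^esub> g i) = (\<Oplus>\<^bsub>M\<^esub>i\<in>I. if j = i then g i else \<zero>\<^bsub>M\<^esub>)"
    using g by (intro M.M.finsum_cong') (auto simp: M.smult_one)
  also have "\<dots> = g j" by (rule M.M.finsum_singleton[OF assms(4,3)]) (use g in auto)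
  finally show ?thesis unfolding gen_span_def by (intro CollectI exI[of _ "\<lambda>i. if j = i then \<one> else \<zero>"]) auto
qed

lemma idem_sum:
  assumes M: "right_module R M" and y: "y \<in> carrier M"
  shows "y = (\<Oplus>\<^bsub>M\<^esub>v\<in>V. idem v \<odot>\<^bsub>M\<^esub> y)"
proof -
  interpret M: right_module R M by fact
  have "(\<Oplus>\<^bsub>M\<^esub>v\<in>S. idem v \<odot>\<^bsub>M\<^esub> y) = (\<Oplus>v\<in>S. idem v) \<odot>\<^bsub>M\<^esub> y" if "finite S" for S
    using that
  proof (induction S)
    case (insert v S)
    then show ?case
      using y by (simp add: M.smult_add_scalar M.smult_closed R.finsum_closed Pi_def)
  qed (use y in simp)
  moreover have "(\<Oplus>v\<in>V. idem v) = \<one>"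
  proof (rule coord_ext)
    show "(\<Oplus>v\<in>V. idem v) \<in> carrier R" by (rule R.finsum_closed) simp
    have "cv w (\<Oplus>v\<in>S. idem v) = (if w \<in> S then \<one>\<^bsub>K\<^esub> else \<zero>\<^bsub>K\<^esub>)" if "finite S" "w \<in> V" for S w
      using that(1) by (induction S) (use that(2) in \<open>auto simp: R.finsum_closed Pi_def\<close>)
    then show "cv w (\<Oplus>v\<in>V. idem v) = cv w \<one>" if "w \<in> V" for w using that finite_V by simp
    have "ca a (\<Oplus>v\<in>S. idem v) = \<zero>\<^bsub>K\<^esub>" if "finite S" "a \<in> E" for S a
      using that(1) by (induction S) (use that(2) in \<open>auto simp: R.finsum_closed Pi_def\<close>)
    then show "ca a (\<Oplus>v\<in>V. idem v) = ca a \<one>" if "a \<in> E" for a using that finite_V by simp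
  qed simp
  ultimately show ?thesis using finite_V y by (simp add: M.smult_one)
qed

text \<open>Each generator is the sum of its components at the vertices, and these components form a
  homogeneous family. It is indexed by pairs of a generator and a vertex, hence the index type
  \<open>'b \<times> 'v\<close>.\<close>

lemma genfam_exists:
  assumes M: "right_module R M" and fg: "finitely_generated R M"
  shows "\<exists>(I :: ('b \<times> 'v) set) vt g. genfam (M :: ('r, 'b, 'z) module_scheme) I vt g"
proof -
  interpret M: right_module R M by fact
  from fg obtain S where S: "finite S" "S \<subseteq> carrier M"
      "\<And>H. Module.submodule H R M \<Longrightarrow> S \<subseteq> H \<Longrightarrow> H = carrier M"
    unfolding finitely_generated_def by blast
  define g where "g = (\<lambda>(s, v). idem v \<odot>\<^bsub>M\<^esub> s)"
  have gc: "g i \<in> carrier M" if "i \<in> S \<times> V" for i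
    using that S(2) by (auto simp: g_def intro!: M.smult_closed)
  have sub: "Module.submodule (gen_span M (S \<times> V) g) R M" by (rule gen_span_submodule[OF M gc])
  have "s \<in> gen_span M (S \<times> V) g" if s: "s \<in> S" for s
  proof -
    have sc: "s \<in> carrier M" using s S by blast
    have "(\<Oplus>\<^bsub>M\<^esub>v\<in>W. idem v \<odot>\<^bsub>M\<^esub> s) \<in> gen_span M (S \<times> V) g" if "W \<subseteq> V" for W
      using finite_subset[OF that finite_V] that
    proof (induction W)
      case empty then show ?case using sub by (simp add: M.submodule_iff)
    next
      case (insert v W)
      have "idem v \<odot>\<^bsub>M\<^esub> s \<in> gen_span M (S \<times> V) g"
        using gen_span_incl[OF M, of "S \<times> V" g "(s, v)"] gc s insert.prems S(1) finite_V by (simp add: g_def)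
      with insert sub sc show ?case by (simp add: M.submodule_iff Pi_def M.smult_closed)
    qed
    from this[of V] show ?thesis using idem_sum[OF M sc] by simp
  qed
  then have "gen_span M (S \<times> V) g = carrier M" by (intro S(3)[OF sub]) auto
  then have "genfam M (S \<times> V) snd g"
    unfolding genfam_iff using S(1) finite_V gc S(2)
    by (auto simp: g_def M.smult_mult[symmetric] idem_mult)
  then show ?thesis by blast
qed

lemma min_genfam_exists:
  assumes M: "right_module R M" and fg: "finitely_generated R M"
  shows "\<exists>(I :: ('b \<times> 'v) set) vt g. min_genfam (M :: ('r, 'b, 'z) module_scheme) I vt g"
proof -
  let ?P = "\<lambda>n. \<exists>(I :: ('b \<times> 'v) set) vt g. genfam M I vt g \<and> card I = n"
  have ex: "\<exists>n. ?P n" using genfam_exists[OF assms] by blast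
  obtain I :: "('b \<times> 'v) set" and vt g where *: "genfam M I vt g" "card I = (LEAST n. ?P n)"
    using LeastI_ex[OF ex] by blast
  have "card I \<le> card J" if "genfam M J vt' g'" for J :: "('b \<times> 'v) set" and vt' g'
    unfolding *(2) by (rule Least_le) (use that in blast)
  with * show ?thesis unfolding min_genfam_def by blast
qed

lemma scal_inv_smult:
  assumes M: "right_module R M" and c: "c \<in> carrier K" "c \<noteq> \<zero>\<^bsub>K\<^esub>" and x: "x \<in> carrier M"
  shows "scal (inv\<^bsub>K\<^esub> c) \<odot>\<^bsub>M\<^esub> (scal c \<odot>\<^bsub>M\<^esub> x) = x"
proof -
  interpret M: right_module R M by fact
  have u: "inv\<^bsub>K\<^esub> c \<in> carrier K" "c \<otimes>\<^bsub>K\<^esub> inv\<^bsub>K\<^esub> c = \<one>\<^bsub>K\<^esub>" using c K.field_Units by auto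
  have "scal (inv\<^bsub>K\<^esub> c) \<odot>\<^bsub>M\<^esub> (scal c \<odot>\<^bsub>M\<^esub> x) = scal (c \<otimes>\<^bsub>K\<^esub> inv\<^bsub>K\<^esub> c) \<odot>\<^bsub>M\<^esub> x"
    using c u(1) x by (simp add: M.smult_mult scal_mult del: K.Units_r_inv)
  then show ?thesis unfolding u(2) using x by (simp add: scal_one M.smult_one)
qed

text \<open>Otherwise the generator \<open>g j\<close> would lie in the submodule generated by the others: up to a nonzero
  scalar it differs from an element of that submodule by a radical multiple of itself.\<close>

lemma min_genfam_relation:
  assumes M: "right_module R M" and min: "min_genfam M I vt g"
    and r: "r \<in> I \<rightarrow> carrier R" "(\<Oplus>\<^bsub>M\<^esub>i\<in>I. r i \<odot>\<^bsub>M\<^esub> g i) = \<zero>\<^bsub>M\<^esub>" and j: "j \<in> I"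
  shows "cv (vt j) (r j) = \<zero>\<^bsub>K\<^esub>"
proof (rule ccontr)
  interpret M: right_module R M by fact
  assume c0: "cv (vt j) (r j) \<noteq> \<zero>\<^bsub>K\<^esub>"
  from min have gf: "genfam M I vt g" by (simp add: min_genfam_def)
  then have fin: "finite I" and g: "\<And>i. i \<in> I \<Longrightarrow> g i \<in> carrier M" "\<And>i. i \<in> I \<Longrightarrow> idem (vt i) \<odot>\<^bsub>M\<^esub> g i = g i"
    "\<And>i. i \<in> I \<Longrightarrow> vt i \<in> V" and span: "carrier M \<subseteq> gen_span M I g"
    by (auto simp: genfam_iff)
  let ?N = "gen_span M (I - {j}) g"
  have N: "Module.submodule ?N R M" by (rule gen_span_submodule[OF M]) (use g in auto)
  then have Ncl: "?N \<subseteq> carrier M" "\<zero>\<^bsub>M\<^esub> \<in> ?N" "\<And>x y. x \<in> ?N \<Longrightarrow> y \<in> ?N \<Longrightarrow> x \<oplus>\<^bsub>M\<^esub> y \<in> ?N"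
    "\<And>t x. t \<in> carrier R \<Longrightarrow> x \<in> ?N \<Longrightarrow> t \<odot>\<^bsub>M\<^esub> x \<in> ?N" by (auto simp: M.submodule_iff)
  have Nneg: "\<ominus>\<^bsub>M\<^esub> x \<in> ?N" if "x \<in> ?N" for x
  proof -
    have "(\<ominus> \<one>) \<odot>\<^bsub>M\<^esub> x \<in> ?N" using that Ncl by auto
    moreover have "x \<in> carrier M" using that Ncl by blast
    ultimately show ?thesis by (simp add: M.minus_one_smult)
  qed
  have Ndiff: "y \<in> ?N" if "x \<oplus>\<^bsub>M\<^esub> y \<in> ?N" "x \<in> ?N" "y \<in> carrier M" for x y
  proof -
    have "x \<in> carrier M" using that Ncl by blast
    then have "y = \<ominus>\<^bsub>M\<^esub> x \<oplus>\<^bsub>M\<^esub> (x \<oplus>\<^bsub>M\<^esub> y)" using that by (simp add: M.M.a_assoc[symmetric] M.M.l_neg)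
    then show ?thesis using Ncl(3)[OF Nneg[OF that(2)] that(1)] by simp
  qed
  have rj: "r j \<in> carrier R" using r j by auto
  define c where "c = cv (vt j) (r j)"
  have c: "c \<in> carrier K" "c \<noteq> \<zero>\<^bsub>K\<^esub>" using c0 rj g(3)[OF j] by (auto simp: c_def)
  define \<rho> where "\<rho> = mk (\<lambda>_. \<zero>\<^bsub>K\<^esub>) (\<lambda>a. ca a (r j))"
  have \<rho>: "\<rho> \<in> carrier R" "\<And>v. v \<in> V \<Longrightarrow> cv v \<rho> = \<zero>\<^bsub>K\<^esub>" "\<And>a. a \<in> E \<Longrightarrow> ca a \<rho> = ca a (r j)"
    using mk[of "\<lambda>_. \<zero>\<^bsub>K\<^esub>" "\<lambda>a. ca a (r j)"] rj by (auto simp: \<rho>_def)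
  note gj = g(1)[OF j]
  \<comment> \<open>The multiple of \<open>g j\<close> splits into a scalar part and a radical part.
    Coordinates of \<open>r j\<close> at other vertices and at arrows leaving other vertices drop
    out because \<open>idem (vt j)\<close> fixes \<open>g j\<close>.\<close>
  have dec: "r j \<odot>\<^bsub>M\<^esub> g j = scal c \<odot>\<^bsub>M\<^esub> g j \<oplus>\<^bsub>M\<^esub> \<rho> \<odot>\<^bsub>M\<^esub> g j"
  proof -
    have "r j \<odot>\<^bsub>M\<^esub> g j = (idem (vt j) \<otimes> r j) \<odot>\<^bsub>M\<^esub> g j"
      using gj rj by (simp add: M.smult_mult g(2)[OF j])
    also have "\<dots> = (idem (vt j) \<otimes> (scal c \<oplus> \<rho>)) \<odot>\<^bsub>M\<^esub> g j"
    proof (rule arg_cong[where f = "\<lambda>t. t \<odot>\<^bsub>M\<^esub> g j"], rule coord_ext)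
      show "cv v (idem (vt j) \<otimes> r j) = cv v (idem (vt j) \<otimes> (scal c \<oplus> \<rho>))" if "v \<in> V" for v
        using that rj c \<rho> by (simp add: c_def)
      show "ca a (idem (vt j) \<otimes> r j) = ca a (idem (vt j) \<otimes> (scal c \<oplus> \<rho>))" if "a \<in> E" for a
        using that rj c \<rho> by simp
    qed (use rj c \<rho> in auto)
    also have "\<dots> = (scal c \<oplus> \<rho>) \<odot>\<^bsub>M\<^esub> g j"
      using gj c \<rho> by (simp add: M.smult_mult g(2)[OF j])
    finally show ?thesis using gj c \<rho> by (simp add: M.smult_add_scalar)
  qed
  have rest: "(\<Oplus>\<^bsub>M\<^esub>i\<in>I - {j}. r i \<odot>\<^bsub>M\<^esub> g i) \<in> ?N"
    unfolding gen_span_def using r(1) by blast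
  then have restc: "(\<Oplus>\<^bsub>M\<^esub>i\<in>I - {j}. r i \<odot>\<^bsub>M\<^esub> g i) \<in> carrier M" using Ncl by blast
  have "\<zero>\<^bsub>M\<^esub> = r j \<odot>\<^bsub>M\<^esub> g j \<oplus>\<^bsub>M\<^esub> (\<Oplus>\<^bsub>M\<^esub>i\<in>I - {j}. r i \<odot>\<^bsub>M\<^esub> g i)"
  proof -
    have "(\<Oplus>\<^bsub>M\<^esub>i\<in>insert j (I - {j}). r i \<odot>\<^bsub>M\<^esub> g i) = r j \<odot>\<^bsub>M\<^esub> g j \<oplus>\<^bsub>M\<^esub> (\<Oplus>\<^bsub>M\<^esub>i\<in>I - {j}. r i \<odot>\<^bsub>M\<^esub> g i)"
      using fin r(1) g rj gj by (intro M.M.finsum_insert) (auto intro!: M.smult_closed)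
    then show ?thesis using r(2) j by (simp add: insert_absorb)
  qed
  then have z: "r j \<odot>\<^bsub>M\<^esub> g j \<in> ?N"
    using Ndiff[OF _ rest, of "r j \<odot>\<^bsub>M\<^esub> g j"] Ncl(2) restc gj rj
    by (simp add: M.M.a_comm M.smult_closed)
  \<comment> \<open>Products of two radical elements vanish, so an arrow applied to
    \<open>r j\<close> times \<open>g j\<close> leaves only \<open>c\<close> times the arrow
    multiple of \<open>g j\<close>. Hence \<open>?N\<close> contains all arrow multiples of
    \<open>g j\<close>, and with them the radical part in \<open>dec\<close>.\<close>
  have arr: "arr a \<odot>\<^bsub>M\<^esub> g j \<in> ?N" if a: "a \<in> E" for a
  proof -
    have "arr a \<odot>\<^bsub>M\<^esub> (r j \<odot>\<^bsub>M\<^esub> g j) \<in> ?N" using z Ncl by simp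
    moreover have "arr a \<odot>\<^bsub>M\<^esub> (r j \<odot>\<^bsub>M\<^esub> g j) = scal c \<odot>\<^bsub>M\<^esub> (arr a \<odot>\<^bsub>M\<^esub> g j)"
    proof -
      have "\<rho> \<otimes> arr a = \<zero>" by (rule coord_ext) (use \<rho> rj in auto)
      then have "arr a \<odot>\<^bsub>M\<^esub> (\<rho> \<odot>\<^bsub>M\<^esub> g j) = \<zero>\<^bsub>M\<^esub>"
        using \<rho> gj M.smult_mult[of \<rho> "arr a" "g j"] by simp
      moreover have "arr a \<odot>\<^bsub>M\<^esub> (scal c \<odot>\<^bsub>M\<^esub> g j) = scal c \<odot>\<^bsub>M\<^esub> (arr a \<odot>\<^bsub>M\<^esub> g j)"
        using gj c M.smult_mult[of "scal c" "arr a" "g j"] M.smult_mult[of "arr a" "scal c" "g j"]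
          scal_comm[of c "arr a"] by simp
      ultimately show ?thesis unfolding dec using gj c \<rho> by (simp add: M.smult_add_vector M.smult_closed)
    qed
    ultimately have "scal (inv\<^bsub>K\<^esub> c) \<odot>\<^bsub>M\<^esub> (scal c \<odot>\<^bsub>M\<^esub> (arr a \<odot>\<^bsub>M\<^esub> g j)) \<in> ?N"
      using Ncl(4)[of "scal (inv\<^bsub>K\<^esub> c)"] c K.field_Units by auto
    moreover have "scal (inv\<^bsub>K\<^esub> c) \<odot>\<^bsub>M\<^esub> (scal c \<odot>\<^bsub>M\<^esub> (arr a \<odot>\<^bsub>M\<^esub> g j)) = arr a \<odot>\<^bsub>M\<^esub> g j"
      by (rule scal_inv_smult[OF M c]) (use gj in \<open>simp add: M.smult_closed\<close>)
    ultimately show ?thesis by simp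
  qed
  have "\<rho> \<odot>\<^bsub>M\<^esub> g j \<in> ?N"
  proof (rule rad_induct[of \<rho> "\<lambda>t. t \<odot>\<^bsub>M\<^esub> g j \<in> ?N"])
    fix a assume "a \<in> E"
    then show "(arr a \<otimes> scal (ca a \<rho>)) \<odot>\<^bsub>M\<^esub> g j \<in> ?N"
      using arr[of a] \<rho> gj Ncl(4) by (simp add: M.smult_mult rj)
  qed (use \<rho> gj Ncl in \<open>auto simp: M.smult_add_scalar\<close>)
  then have "scal c \<odot>\<^bsub>M\<^esub> g j \<in> ?N"
    using z Ndiff[of "\<rho> \<odot>\<^bsub>M\<^esub> g j" "scal c \<odot>\<^bsub>M\<^esub> g j"] gj c \<rho> unfolding dec
    by (simp add: M.M.a_comm M.smult_closed)
  then have "scal (inv\<^bsub>K\<^esub> c) \<odot>\<^bsub>M\<^esub> (scal c \<odot>\<^bsub>M\<^esub> g j) \<in> ?N"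
    using Ncl(4)[of "scal (inv\<^bsub>K\<^esub> c)"] c K.field_Units by auto
  moreover have "scal (inv\<^bsub>K\<^esub> c) \<odot>\<^bsub>M\<^esub> (scal c \<odot>\<^bsub>M\<^esub> g j) = g j"
    by (rule scal_inv_smult[OF M c gj])
  ultimately have gjN: "g j \<in> ?N" by simp
  have "carrier M \<subseteq> ?N"
  proof
    fix y assume "y \<in> carrier M"
    then obtain s where s: "s \<in> I \<rightarrow> carrier R" "y = (\<Oplus>\<^bsub>M\<^esub>i\<in>I. s i \<odot>\<^bsub>M\<^esub> g i)"
      using span unfolding gen_span_def by blast
    have gi: "g i \<in> ?N" if "i \<in> I" for i
      using that gjN gen_span_incl[OF M, of "I - {j}" g i] g(1) fin by (cases "i = j") auto
    have "(\<Oplus>\<^bsub>M\<^esub>i\<in>J. s i \<odot>\<^bsub>M\<^esub> g i) \<in> ?N" if "J \<subseteq> I" for J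
      using finite_subset[OF that fin] that
    proof (induction J)
      case (insert i J)
      then show ?case using s(1) gi Ncl g(1)
        by (subst M.M.finsum_insert) (auto intro!: M.smult_closed Ncl(3,4))
    qed (use Ncl in simp)
    then show "y \<in> ?N" using s(2) by auto
  qed
  then have "genfam M (I - {j}) vt g" using g fin by (auto simp: genfam_iff)
  then have "card I \<le> card (I - {j})" using min by (auto simp: min_genfam_def)
  then show False using fin j by (metis card_Diff1_less leD)
qed

section \<open>Covers by the explicit modules\<close>

lemma Lmap_basis:
  assumes M: "right_module R M" and L: "Ldata I vt A"
    and g: "\<And>i. i \<in> I \<Longrightarrow> g i \<in> carrier M" "\<And>i. i \<in> I \<Longrightarrow> idem (vt i) \<odot>\<^bsub>M\<^esub> g i = g i"
    and j: "j \<in> I"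
  shows "Lmap M I vt A g (Lbasis (j, None)) = g j"
proof -
  interpret M: right_module R M by fact
  have *: "elt vt A (Lbasis (j, None)) i = (if i = j then idem (vt j) else \<zero>)" for i
  proof (rule coord_ext)
    have b: "\<And>z. Lbasis (j, None) z \<in> carrier K" by (simp add: Lbasis_def)
    show "elt vt A (Lbasis (j, None)) i \<in> carrier R" using b by simp
    show "cv v (elt vt A (Lbasis (j, None)) i) = cv v (if i = j then idem (vt j) else \<zero>)" if "v \<in> V" for v
      unfolding elt(2)[OF b that] using that by (auto simp: Lbasis_def)
    show "ca a (elt vt A (Lbasis (j, None)) i) = ca a (if i = j then idem (vt j) else \<zero>)" if "a \<in> E" for a
      unfolding elt(3)[OF b that] using that by (simp add: Lbasis_def)
  qed auto
  have "Lmap M I vt A g (Lbasis (j, None)) = (\<Oplus>\<^bsub>M\<^esub>i\<in>I. if j = i then g i else \<zero>\<^bsub>M\<^esub>)"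
    unfolding Lmap_def * using g by (intro M.M.finsum_cong') auto
  also have "\<dots> = g j" by (rule M.M.finsum_singleton[OF j LdataD(1)[OF L]]) (use g in auto)
  finally show ?thesis .
qed

lemma Lbasis_homogeneous:
  assumes L: "Ldata I vt A" and j: "j \<in> I"
  shows "Lbasis (j, None) \<in> carrier (Lmod I vt A)"
    "idem (vt j) \<odot>\<^bsub>Lmod I vt A\<^esub> Lbasis (j, None) = Lbasis (j, None)"
proof -
  show "Lbasis (j, None) \<in> carrier (Lmod I vt A)" by (rule Lbasis_in) (simp add: j)
  show "idem (vt j) \<odot>\<^bsub>Lmod I vt A\<^esub> Lbasis (j, None) = Lbasis (j, None)"
    using j LdataD[OF L] by (intro pair_option_ext) (auto simp: Lbasis_def)
qed

lemma hom_eq_on_basis: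
  assumes L: "Ldata I vt A" and N: "right_module R N"
    and f: "f \<in> rmod_hom R (Lmod I vt A) N" and x: "x \<in> carrier (Lmod I vt A)"
  shows "f x = Lmap N I vt A (\<lambda>i. f (Lbasis (i, None))) x"
proof -
  interpret f: rmod_map R "Lmod I vt A" N f by (rule rmod_mapI[OF Lmod_right_module[OF L] N f])
  have "f x = f (Lmap (Lmod I vt A) I vt A (\<lambda>i. Lbasis (i, None)) x)" by (rule arg_cong[OF Lmod_expand[OF L x]])
  also have "\<dots> = (\<Oplus>\<^bsub>N\<^esub>i\<in>I. f (elt vt A x i \<odot>\<^bsub>Lmod I vt A\<^esub> Lbasis (i, None)))"
    unfolding Lmap_def using x Lbasis_homogeneous[OF L]
    by (intro f.finsum) (auto intro!: f.M.smult_closed)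
  also have "\<dots> = Lmap N I vt A (\<lambda>i. f (Lbasis (i, None))) x"
    unfolding Lmap_def using x Lbasis_homogeneous[OF L]
    by (intro f.N.M.finsum_cong') (auto simp: f.smult intro!: f.N.smult_closed)
  finally show ?thesis .
qed

lemma Lmap_surj:
  assumes M: "right_module R M" and L: "Ldata I vt A" and gf: "genfam M I vt g"
    and rel: "\<And>i a. (i, a) \<in> arrows_at I vt - A \<Longrightarrow> arr a \<odot>\<^bsub>M\<^esub> g i = \<zero>\<^bsub>M\<^esub>"
  shows "Lmap M I vt A g ` carrier (Lmod I vt A) = carrier M"
proof
  interpret M: right_module R M by fact
  note LD = LdataD[OF L]
  have g: "\<And>i. i \<in> I \<Longrightarrow> g i \<in> carrier M" "\<And>i. i \<in> I \<Longrightarrow> idem (vt i) \<odot>\<^bsub>M\<^esub> g i = g i"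
    using gf by (auto simp: genfam_def)
  have hom: "Lmap M I vt A g \<in> rmod_hom R (Lmod I vt A) M" by (rule Lmap_hom[OF M L g rel])
  show "Lmap M I vt A g ` carrier (Lmod I vt A) \<subseteq> carrier M" using rmod_homD(1)[OF hom] by blast
  show "carrier M \<subseteq> Lmap M I vt A g ` carrier (Lmod I vt A)"
  proof
    fix y assume "y \<in> carrier M"
    then obtain r where r: "r \<in> I \<rightarrow> carrier R" "y = (\<Oplus>\<^bsub>M\<^esub>i\<in>I. r i \<odot>\<^bsub>M\<^esub> g i)"
      using gf unfolding genfam_def by blast
    \<comment> \<open>Only the coordinates of \<open>r i\<close> at the vertex of \<open>g i\<close>
      and at surviving arrows are kept; by \<open>smult_eqI\<close> the others have no effect on
      \<open>g i\<close>.\<close>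
    define f where "f = (\<lambda>(i, q). if i \<in> I then (case q of None \<Rightarrow> cv (vt i) (r i)
      | Some a \<Rightarrow> if (i, a) \<in> A then ca a (r i) else \<zero>\<^bsub>K\<^esub>) else \<zero>\<^bsub>K\<^esub>)"
    have f: "f \<in> carrier (Lmod I vt A)"
    proof (rule Lmod_carrierI)
      fix z show "f z \<in> carrier K"
        using r(1) LD by (cases z; cases "snd z") (auto simp: f_def Pi_iff)
    qed (auto simp: f_def)
    have "elt vt A f i \<odot>\<^bsub>M\<^esub> g i = r i \<odot>\<^bsub>M\<^esub> g i" if i: "i \<in> I" for i
    proof -
      have ri: "r i \<in> carrier R" using r(1) i by auto
      have "elt vt A f i \<odot>\<^bsub>M\<^esub> g i = (idem (vt i) \<otimes> r i) \<odot>\<^bsub>M\<^esub> g i"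
      proof (rule smult_eqI[OF M g(1)[OF i]])
        fix a assume a: "a \<in> E"
        show "ca a (elt vt A f i) = ca a (idem (vt i) \<otimes> r i) \<or> arr a \<odot>\<^bsub>M\<^esub> g i = \<zero>\<^bsub>M\<^esub>"
        proof (cases "src a = vt i")
          case True
          show ?thesis
          proof (cases "(i, a) \<in> A")
            case True
            then show ?thesis using a f ri LD(5)[OF True] LD(2)[OF i] i by (simp add: f_def)
          next
            case False
            then show ?thesis using rel[of i a] True a i by (auto simp: arrows_at_def)
          qed
        qed (use homogeneous_arr[OF M g(1)[OF i] g(2)[OF i] a] in auto)
      qed (use f ri i in \<open>auto simp: f_def\<close>)
      also have "\<dots> = r i \<odot>\<^bsub>M\<^esub> g i" using ri g i by (simp add: M.smult_mult)
      finally show ?thesis .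
    qed
    then have "Lmap M I vt A g f = y"
      unfolding Lmap_def r(2) using r(1) g by (intro M.M.finsum_cong') (auto intro!: M.smult_closed)
    with f show "y \<in> Lmap M I vt A g ` carrier (Lmod I vt A)" by blast
  qed
qed

text \<open>An element of the kernel encodes a relation among the \<open>g i\<close> whose vertex
  coefficients are its coordinates at the idempotents, and these vanish for a minimal
  family.\<close>

lemma min_genfam_kernel:
  assumes M: "right_module R M" and min: "min_genfam M I vt g"
    and f: "f \<in> carrier (Lmod I vt A)" "Lmap M I vt A g f = \<zero>\<^bsub>M\<^esub>"
  shows "f (i, None) = \<zero>\<^bsub>K\<^esub>"
proof (cases "i \<in> I")
  case True
  have "vt i \<in> V" using min True by (auto simp: min_genfam_def genfam_def)
  moreover have "cv (vt i) (elt vt A f i) = \<zero>\<^bsub>K\<^esub>"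
    by (rule min_genfam_relation[OF M min _ _ True, of "elt vt A f"]) (use f in \<open>auto simp: Lmap_def\<close>)
  ultimately show ?thesis using f(1) by simp
qed (use Lmod_outside(1)[OF f(1)] in auto)

theorem cover_exists:
  fixes M :: "('r, 'b, 'z) module_scheme"
  assumes M: "right_module R M" and fg: "finitely_generated R M"
  obtains I :: "('b \<times> 'v) set" and vt p where "Ldata I vt (arrows_at I vt)"
    "p \<in> rmod_hom R (Lmod I vt (arrows_at I vt)) M" "p ` carrier (Lmod I vt (arrows_at I vt)) = carrier M"
    "\<And>f i. f \<in> carrier (Lmod I vt (arrows_at I vt)) \<Longrightarrow> p f = \<zero>\<^bsub>M\<^esub> \<Longrightarrow> f (i, None) = \<zero>\<^bsub>K\<^esub>"
proof -
  obtain I :: "('b \<times> 'v) set" and vt g where min: "min_genfam M I vt g" using min_genfam_exists[OF assms] by blast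
  then have gf: "genfam M I vt g" by (simp add: min_genfam_def)
  then have "finite I" "vt ` I \<subseteq> V" and g: "\<And>i. i \<in> I \<Longrightarrow> g i \<in> carrier M" "\<And>i. i \<in> I \<Longrightarrow> idem (vt i) \<odot>\<^bsub>M\<^esub> g i = g i"
    by (auto simp: genfam_def)
  then have L: "Ldata I vt (arrows_at I vt)" by (intro Ldata_full)
  show ?thesis
  proof (rule that[OF L])
    show "Lmap M I vt (arrows_at I vt) g \<in> rmod_hom R (Lmod I vt (arrows_at I vt)) M"
      by (rule Lmap_hom[OF M L g]) auto
    show "Lmap M I vt (arrows_at I vt) g ` carrier (Lmod I vt (arrows_at I vt)) = carrier M"
      by (rule Lmap_surj[OF M L gf]) auto
  qed (rule min_genfam_kernel[OF M min])
qed

text \<open>Since all arrows act as zero, the module without surviving arrows maps onto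
  \<open>M\<close>. An element of the kernel has no arrow coordinates by construction and no
  idempotent coordinates by minimality.\<close>

lemma semisimple_Lmod:
  fixes M :: "('r, 'b, 'z) module_scheme"
  assumes M: "right_module R M" and fg: "finitely_generated R M"
    and ss: "\<And>a y. a \<in> E \<Longrightarrow> y \<in> carrier M \<Longrightarrow> arr a \<odot>\<^bsub>M\<^esub> y = \<zero>\<^bsub>M\<^esub>"
  obtains I :: "('b \<times> 'v) set" and vt where "Ldata I vt {}" "rmod_isomorphic R (Lmod I vt {}) M"
proof -
  obtain I :: "('b \<times> 'v) set" and vt g where min: "min_genfam M I vt g" using min_genfam_exists[OF M fg] by blast
  then have gf: "genfam M I vt g" by (simp add: min_genfam_def)
  then have g: "\<And>i. i \<in> I \<Longrightarrow> g i \<in> carrier M" "\<And>i. i \<in> I \<Longrightarrow> idem (vt i) \<odot>\<^bsub>M\<^esub> g i = g i"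
    by (auto simp: genfam_def)
  have L: "Ldata I vt {}" using gf by (auto simp: Ldata_def genfam_def)
  have rel: "arr a \<odot>\<^bsub>M\<^esub> g i = \<zero>\<^bsub>M\<^esub>" if "(i, a) \<in> arrows_at I vt - {}" for i a
    using that ss g by (auto simp: arrows_at_def)
  have hom: "Lmap M I vt {} g \<in> rmod_hom R (Lmod I vt {}) M" by (rule Lmap_hom[OF M L g rel])
  interpret p: rmod_map R "Lmod I vt {}" M "Lmap M I vt {} g"
    by (rule rmod_mapI[OF Lmod_right_module[OF L] M hom])
  have "inj_on (Lmap M I vt {} g) (carrier (Lmod I vt {}))"
    unfolding p.inj_iff_kernel
  proof (intro ballI impI)
    fix f assume f: "f \<in> carrier (Lmod I vt {})" "Lmap M I vt {} g f = \<zero>\<^bsub>M\<^esub>"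
    show "f = \<zero>\<^bsub>Lmod I vt {}\<^esub>"
      using min_genfam_kernel[OF M min f] Lmod_outside(2)[OF f(1)] by (intro pair_option_ext) auto
  qed
  then have "rmod_isomorphic R (Lmod I vt {}) M"
    unfolding rmod_isomorphic_def bij_betw_def using hom Lmap_surj[OF M L gf rel] by blast
  with L show ?thesis by (rule that)
qed

text \<open>The exceptional case: the quiver is a disjoint union of oriented cycles and isolated
  vertices.\<close>

definition arrow_permutation :: bool where
  "arrow_permutation \<longleftrightarrow> inj_on src E \<and> inj_on tgt E \<and> src ` E = tgt ` E"

text \<open>When every vertex has at most one incoming and one outgoing arrow, choose among the minimal
  generating families one that has as many generators as possible killed by the arrow at their vertex.  A
  nontrivial relation between the remaining arrow multiples would allow to replace one generator by a
  combination that is killed.\<close>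

lemma arrow_permutation_Lmod:
  fixes M :: "('r, 'b, 'z) module_scheme"
  assumes M: "right_module R M" and fg: "finitely_generated R M" and perm: arrow_permutation
  obtains I :: "('b \<times> 'v) set" and vt A where "Ldata I vt A" "rmod_isomorphic R (Lmod I vt A) M"
proof -
  interpret M: right_module R M by fact
  define Z where "Z I vt g = {(i, a). (i, a) \<in> arrows_at I vt \<and> arr a \<odot>\<^bsub>M\<^esub> g i = \<zero>\<^bsub>M\<^esub>}"
    for I :: "('b \<times> 'v) set" and vt g
  obtain I0 :: "('b \<times> 'v) set" and vt0 g0 where min0: "min_genfam M I0 vt0 g0" using min_genfam_exists[OF M fg] by blast
  let ?P = "\<lambda>n. \<exists>(I :: ('b \<times> 'v) set) vt g. min_genfam M I vt g \<and> card (Z I vt g) = n"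
  have Zfin: "finite (Z I vt g)" if "finite I" for I vt g
    by (rule finite_subset[OF _ finite_arrows[OF that]]) (auto simp: Z_def)
  \<comment> \<open>Any two minimal families have the same number of elements, so the number of
    killed pairs is bounded and attains a maximum.\<close>
  have bound: "n \<le> card I0 * card E" if "?P n" for n
  proof -
    from that obtain I :: "('b \<times> 'v) set" and vt g where I: "min_genfam M I vt g" "card (Z I vt g) = n" by blast
    then have fin: "finite I" by (simp add: min_genfam_def genfam_def)
    have "n \<le> card (I \<times> E)"
      unfolding I(2)[symmetric]
      by (rule card_mono) (auto simp: fin finite_E Z_def arrows_at_def)
    moreover have "card I = card I0" using I(1) min0 by (meson min_genfam_def le_antisym)
    ultimately show ?thesis by (simp add: card_cartesian_product)
  qed
  have "\<exists>n. ?P n" using min0 by blast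
  then have "?P (Greatest ?P)" using bound by (rule GreatestI_ex_nat[where P = ?P]) 
  then obtain I :: "('b \<times> 'v) set" and vt g where min: "min_genfam M I vt g"
    and max: "card (Z I vt g) = Greatest ?P" by blast
  have maxZ: "card (Z J vt' g') \<le> card (Z I vt g)" if "min_genfam M J vt' g'" for J :: "('b \<times> 'v) set" and vt' g'
    unfolding max by (rule Greatest_le_nat[where P = ?P, OF _ bound]) (use that in blast)
  from min have gf: "genfam M I vt g" by (simp add: min_genfam_def)
  then have fin: "finite I" and vt: "\<And>i. i \<in> I \<Longrightarrow> vt i \<in> V"
    and g: "\<And>i. i \<in> I \<Longrightarrow> g i \<in> carrier M" "\<And>i. i \<in> I \<Longrightarrow> idem (vt i) \<odot>\<^bsub>M\<^esub> g i = g i"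
    and span: "carrier M \<subseteq> gen_span M I g"
    by (auto simp: genfam_iff)
  define A where "A = arrows_at I vt - Z I vt g"
  have L: "Ldata I vt A" using fin vt by (auto simp: Ldata_def A_def)
  note LD = LdataD[OF L]
  have rel: "arr a \<odot>\<^bsub>M\<^esub> g i = \<zero>\<^bsub>M\<^esub>" if "(i, a) \<in> arrows_at I vt - A" for i a
    using that by (auto simp: A_def Z_def)
  have hom: "Lmap M I vt A g \<in> rmod_hom R (Lmod I vt A) M" by (rule Lmap_hom[OF M L g rel])
  interpret p: rmod_map R "Lmod I vt A" M "Lmap M I vt A g"
    by (rule rmod_mapI[OF Lmod_right_module[OF L] M hom])
  have "inj_on (Lmap M I vt A g) (carrier (Lmod I vt A))"
    unfolding p.inj_iff_kernel
  proof (intro ballI impI)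
    fix f assume f: "f \<in> carrier (Lmod I vt A)" "Lmap M I vt A g f = \<zero>\<^bsub>M\<^esub>"
    have f0: "f (i, None) = \<zero>\<^bsub>K\<^esub>" for i by (rule min_genfam_kernel[OF M min f])
    have "f (j, Some a) = \<zero>\<^bsub>K\<^esub>" for j a
    proof (rule ccontr)
      assume fja: "f (j, Some a) \<noteq> \<zero>\<^bsub>K\<^esub>"
      then have ja: "(j, a) \<in> A" using Lmod_outside(2)[OF f(1)] by blast
      have a: "a \<in> E" "src a = vt j" "j \<in> I" using LD(3-5)[OF ja] by auto
      define c where "c i = (if (i, a) \<in> A then f (i, Some a) else \<zero>\<^bsub>K\<^esub>)" for i
      have c: "c i \<in> carrier K" for i using f(1) by (simp add: c_def)
      have cj: "c j \<noteq> \<zero>\<^bsub>K\<^esub>" using fja ja by (simp add: c_def)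
      have vti: "vt i = vt j" if "c i \<noteq> \<zero>\<^bsub>K\<^esub>" "i \<in> I" for i
        using that LD(5)[of i a] a by (auto simp: c_def split: if_splits)
      \<comment> \<open>\<open>a\<close> is the only arrow with its target, so multiplication by
        \<open>idem (tgt a)\<close> isolates the part of the relation that belongs to
        \<open>a\<close>.\<close>
      have ei: "elt vt A f i \<otimes> idem (tgt a) = arr a \<otimes> scal (c i)" for i
      proof (rule coord_ext)
        show "cv v (elt vt A f i \<otimes> idem (tgt a)) = cv v (arr a \<otimes> scal (c i))" if "v \<in> V" for v
          using that f(1) f0 c by simp
        fix b assume b: "b \<in> E"
        have "tgt b = tgt a \<longleftrightarrow> b = a" using perm a(1) b unfolding arrow_permutation_def inj_on_def by blast
        then show "ca b (elt vt A f i \<otimes> idem (tgt a)) = ca b (arr a \<otimes> scal (c i))"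
          using b f(1) f0 c a by (auto simp: c_def)
      qed (use f(1) c in auto)
      \<comment> \<open>The isolated relation says that \<open>a\<close> kills \<open>y\<close>. All
        generators occurring in \<open>y\<close> sit at the source of \<open>a\<close>, and
        \<open>g j\<close> occurs with the nonzero coefficient \<open>c j\<close>, so
        \<open>y\<close> can replace it.\<close>
      define y where "y = (\<Oplus>\<^bsub>M\<^esub>i\<in>I. scal (c i) \<odot>\<^bsub>M\<^esub> g i)"
      have yc: "(\<lambda>i. scal (c i) \<odot>\<^bsub>M\<^esub> g i) \<in> I \<rightarrow> carrier M" using g c by (auto intro!: M.smult_closed)
      then have y: "y \<in> carrier M" unfolding y_def by (rule M.M.finsum_closed)
      have "arr a \<odot>\<^bsub>M\<^esub> y = (\<Oplus>\<^bsub>M\<^esub>i\<in>I. arr a \<odot>\<^bsub>M\<^esub> (scal (c i) \<odot>\<^bsub>M\<^esub> g i))"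
        unfolding y_def by (rule M.smult_finsum[OF _ yc]) simp
      also have "\<dots> = (\<Oplus>\<^bsub>M\<^esub>i\<in>I. idem (tgt a) \<odot>\<^bsub>M\<^esub> (elt vt A f i \<odot>\<^bsub>M\<^esub> g i))"
      proof (rule M.M.finsum_cong')
        fix i assume i: "i \<in> I"
        have "arr a \<odot>\<^bsub>M\<^esub> (scal (c i) \<odot>\<^bsub>M\<^esub> g i) = (scal (c i) \<otimes> arr a) \<odot>\<^bsub>M\<^esub> g i"
          using g i c by (simp add: M.smult_mult)
        also have "scal (c i) \<otimes> arr a = elt vt A f i \<otimes> idem (tgt a)"
          unfolding ei by (rule scal_comm[OF c]) simp
        also have "(elt vt A f i \<otimes> idem (tgt a)) \<odot>\<^bsub>M\<^esub> g i = idem (tgt a) \<odot>\<^bsub>M\<^esub> (elt vt A f i \<odot>\<^bsub>M\<^esub> g i)"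
          using g i f(1) by (simp add: M.smult_mult)
        finally show "arr a \<odot>\<^bsub>M\<^esub> (scal (c i) \<odot>\<^bsub>M\<^esub> g i) = idem (tgt a) \<odot>\<^bsub>M\<^esub> (elt vt A f i \<odot>\<^bsub>M\<^esub> g i)" .
      qed (use g f(1) in \<open>auto intro!: M.smult_closed\<close>)
      also have "\<dots> = idem (tgt a) \<odot>\<^bsub>M\<^esub> Lmap M I vt A g f"
        unfolding Lmap_def using g f(1) by (intro M.smult_finsum[symmetric]) (auto intro!: M.smult_closed)
      finally have ay: "arr a \<odot>\<^bsub>M\<^esub> y = \<zero>\<^bsub>M\<^esub>" using f(2) by simp
      have yh: "idem (vt j) \<odot>\<^bsub>M\<^esub> y = y"
      proof -
        have "idem (vt j) \<odot>\<^bsub>M\<^esub> y = (\<Oplus>\<^bsub>M\<^esub>i\<in>I. idem (vt j) \<odot>\<^bsub>M\<^esub> (scal (c i) \<odot>\<^bsub>M\<^esub> g i))"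
          unfolding y_def by (rule M.smult_finsum[OF _ yc]) simp
        also have "\<dots> = y"
          unfolding y_def
        proof (rule M.M.finsum_cong')
          fix i assume i: "i \<in> I"
          have "idem (vt j) \<odot>\<^bsub>M\<^esub> (scal (c i) \<odot>\<^bsub>M\<^esub> g i) = (scal (c i) \<otimes> idem (vt j)) \<odot>\<^bsub>M\<^esub> g i"
            using g i c by (simp add: M.smult_mult)
          also have "scal (c i) \<otimes> idem (vt j) = idem (vt j) \<otimes> scal (c i)" by (rule scal_comm[OF c]) simp
          also have "(idem (vt j) \<otimes> scal (c i)) \<odot>\<^bsub>M\<^esub> g i = scal (c i) \<odot>\<^bsub>M\<^esub> (idem (vt j) \<odot>\<^bsub>M\<^esub> g i)"
            using g i c by (simp add: M.smult_mult)
          also have "\<dots> = scal (c i) \<odot>\<^bsub>M\<^esub> g i"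
          proof (cases "c i = \<zero>\<^bsub>K\<^esub>")
            case True
            then show ?thesis using g i by (simp add: scal_zero M.smult_closed)
          next
            case False
            then show ?thesis using vti[OF False i] g(2)[OF i] by simp
          qed
          finally show "idem (vt j) \<odot>\<^bsub>M\<^esub> (scal (c i) \<odot>\<^bsub>M\<^esub> g i) = scal (c i) \<odot>\<^bsub>M\<^esub> g i" .
        qed (use yc in auto)
        finally show ?thesis .
      qed
      define g' where "g' = g(j := y)"
      have g': "\<And>i. i \<in> I \<Longrightarrow> g' i \<in> carrier M" "\<And>i. i \<in> I \<Longrightarrow> idem (vt i) \<odot>\<^bsub>M\<^esub> g' i = g' i"
        using g y yh by (auto simp: g'_def)
      have N: "Module.submodule (gen_span M I g') R M" by (rule gen_span_submodule[OF M g'(1)])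
      then have Ncl: "gen_span M I g' \<subseteq> carrier M" "\<zero>\<^bsub>M\<^esub> \<in> gen_span M I g'"
        "\<And>x y. x \<in> gen_span M I g' \<Longrightarrow> y \<in> gen_span M I g' \<Longrightarrow> x \<oplus>\<^bsub>M\<^esub> y \<in> gen_span M I g'"
        "\<And>t x. t \<in> carrier R \<Longrightarrow> x \<in> gen_span M I g' \<Longrightarrow> t \<odot>\<^bsub>M\<^esub> x \<in> gen_span M I g'" by (auto simp: M.submodule_iff)
      have gi: "g i \<in> gen_span M I g'" if "i \<in> I" "i \<noteq> j" for i
        using gen_span_incl[OF M, of I g' i] g'(1) fin that by (simp add: g'_def)
      have sumN: "(\<Oplus>\<^bsub>M\<^esub>i\<in>J. r i \<odot>\<^bsub>M\<^esub> g i) \<in> gen_span M I g'"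
        if "J \<subseteq> I" "r \<in> I \<rightarrow> carrier R" "\<And>i. i \<in> J \<Longrightarrow> g i \<in> gen_span M I g'" for J r
        using finite_subset[OF that(1) fin] that(1,3)
      proof (induction J)
        case (insert i J)
        then have i: "g i \<in> carrier M" "g i \<in> gen_span M I g'" "r i \<in> carrier R" using that(2) g(1) by auto
        have "(\<lambda>i. r i \<odot>\<^bsub>M\<^esub> g i) \<in> J \<rightarrow> carrier M"
          using insert.prems that(2) g(1) by (intro Pi_I M.smult_closed) auto
        then have "(\<Oplus>\<^bsub>M\<^esub>i\<in>insert i J. r i \<odot>\<^bsub>M\<^esub> g i) = r i \<odot>\<^bsub>M\<^esub> g i \<oplus>\<^bsub>M\<^esub> (\<Oplus>\<^bsub>M\<^esub>i\<in>J. r i \<odot>\<^bsub>M\<^esub> g i)"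
          using insert.hyps i by (intro M.M.finsum_insert M.smult_closed) auto
        moreover have "(\<Oplus>\<^bsub>M\<^esub>i\<in>J. r i \<odot>\<^bsub>M\<^esub> g i) \<in> gen_span M I g'"
          using insert.prems by (intro insert.IH) auto
        ultimately show ?case using Ncl(3)[OF Ncl(4)[OF i(3,2)]] by simp
      qed (use Ncl in simp)
      have gj: "g j \<in> gen_span M I g'"
      proof -
        let ?s = "\<Oplus>\<^bsub>M\<^esub>i\<in>I - {j}. scal (c i) \<odot>\<^bsub>M\<^esub> g i"
        have s: "?s \<in> gen_span M I g'" by (rule sumN) (use c gi in auto)
        then have sc: "?s \<in> carrier M" using Ncl by blast
        have gjc: "scal (c j) \<odot>\<^bsub>M\<^esub> g j \<in> carrier M" by (intro M.smult_closed scal(1) c g(1) a(3))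
        have "y = scal (c j) \<odot>\<^bsub>M\<^esub> g j \<oplus>\<^bsub>M\<^esub> ?s"
        proof -
          have "(\<Oplus>\<^bsub>M\<^esub>i\<in>insert j (I - {j}). scal (c i) \<odot>\<^bsub>M\<^esub> g i) = scal (c j) \<odot>\<^bsub>M\<^esub> g j \<oplus>\<^bsub>M\<^esub> ?s"
            using fin yc gjc by (intro M.M.finsum_insert) auto
          then show ?thesis using a(3) by (simp add: y_def insert_absorb)
        qed
        then have "scal (c j) \<odot>\<^bsub>M\<^esub> g j = y \<oplus>\<^bsub>M\<^esub> \<ominus>\<^bsub>M\<^esub> ?s"
          using sc gjc by (simp add: M.M.a_assoc M.M.r_neg)
        moreover have "y \<in> gen_span M I g'"
          using gen_span_incl[OF M, of I g' j] g'(1) fin a(3) by (simp add: g'_def)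
        moreover have "\<ominus>\<^bsub>M\<^esub> ?s \<in> gen_span M I g'"
          using Ncl(4)[OF _ s, of "\<ominus> \<one>"] sc by (simp add: M.minus_one_smult)
        ultimately have "scal (c j) \<odot>\<^bsub>M\<^esub> g j \<in> gen_span M I g'" using Ncl(3) by simp
        then have "scal (inv\<^bsub>K\<^esub> c j) \<odot>\<^bsub>M\<^esub> (scal (c j) \<odot>\<^bsub>M\<^esub> g j) \<in> gen_span M I g'"
          using Ncl(4) c[of j] cj K.field_Units by auto
        then show ?thesis using scal_inv_smult[OF M c cj g(1)[OF a(3)]] by simp
      qed
      have "carrier M \<subseteq> gen_span M I g'"
      proof
        fix x assume "x \<in> carrier M"
        then obtain r where "r \<in> I \<rightarrow> carrier R" "x = (\<Oplus>\<^bsub>M\<^esub>i\<in>I. r i \<odot>\<^bsub>M\<^esub> g i)"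
          using span unfolding gen_span_def by blast
        then show "x \<in> gen_span M I g'" using sumN[of I r] gi gj by blast
      qed
      then have "min_genfam M I vt g'"
        using min g' vt fin unfolding min_genfam_def genfam_iff by blast
      then have le: "card (Z I vt g') \<le> card (Z I vt g)" by (rule maxZ)
      \<comment> \<open>The exchange adds the pair \<open>(j, a)\<close> and loses none: pairs at
        other generators are unchanged, and \<open>a\<close> is the only arrow leaving the vertex of
        \<open>g j\<close>.\<close>
      have "insert (j, a) (Z I vt g) \<subseteq> Z I vt g'"
      proof -
        have "(j, a) \<in> Z I vt g'" using ja ay by (auto simp: Z_def g'_def A_def)
        moreover have "(i, b) \<in> Z I vt g'" if "(i, b) \<in> Z I vt g" for i b
        proof (cases "i = j")
          case True
          then have "b \<in> E" "src b = src a" using that a by (auto simp: Z_def arrows_at_def)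
          then have "b = a" using perm a(1) by (auto simp: arrow_permutation_def inj_on_def)
          with True that ja show ?thesis by (simp add: A_def)
        qed (use that in \<open>auto simp: Z_def g'_def\<close>)
        ultimately show ?thesis by auto
      qed
      then have "card (insert (j, a) (Z I vt g)) \<le> card (Z I vt g')" by (rule card_mono[OF Zfin[OF fin]])
      moreover have "(j, a) \<notin> Z I vt g" using ja by (simp add: A_def)
      ultimately show False using le Zfin[OF fin] by simp
    qed
    with f0 show "f = \<zero>\<^bsub>Lmod I vt A\<^esub>" by (intro pair_option_ext) auto
  qed
  then have "rmod_isomorphic R (Lmod I vt A) M"
    unfolding rmod_isomorphic_def bij_betw_def using hom Lmap_surj[OF M L gf rel] by blast
  with L show ?thesis by (rule that)
qed

section \<open>Projective modules\<close>

lemma Lfull_lift: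
  assumes L: "Ldata I vt (arrows_at I vt)" and M: "right_module R M" and N: "right_module R N"
    and p: "p \<in> rmod_hom R M N" "p ` carrier M = carrier N"
    and f: "f \<in> rmod_hom R (Lmod I vt (arrows_at I vt)) N"
  shows "\<exists>h\<in>rmod_hom R (Lmod I vt (arrows_at I vt)) M. \<forall>x\<in>carrier (Lmod I vt (arrows_at I vt)). p (h x) = f x"
proof -
  let ?A = "arrows_at I vt"
  interpret p: rmod_map R M N p by (rule rmod_mapI[OF M N p(1)])
  interpret f: rmod_map R "Lmod I vt ?A" N f by (rule rmod_mapI[OF Lmod_right_module[OF L] N f])
  \<comment> \<open>A preimage of the value at a generator is made homogeneous by applying
    \<open>idem (vt i)\<close>.\<close>
  have "\<exists>m. m \<in> carrier M \<and> idem (vt i) \<odot>\<^bsub>M\<^esub> m = m \<and> p m = f (Lbasis (i, None))" if i: "i \<in> I" for i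
  proof -
    have "f (Lbasis (i, None)) \<in> carrier N" using Lbasis_homogeneous[OF L i] by simp
    then obtain m where m: "m \<in> carrier M" "p m = f (Lbasis (i, None))" using p(2) by (metis imageE)
    have "p (idem (vt i) \<odot>\<^bsub>M\<^esub> m) = f (idem (vt i) \<odot>\<^bsub>Lmod I vt ?A\<^esub> Lbasis (i, None))"
      unfolding p.smult[OF idem(1) m(1)] f.smult[OF idem(1) Lbasis_homogeneous(1)[OF L i]] m(2) ..
    then show ?thesis using m Lbasis_homogeneous[OF L i]
      by (intro exI[of _ "idem (vt i) \<odot>\<^bsub>M\<^esub> m"])
         (auto simp: p.M.smult_closed p.M.smult_mult[symmetric] idem_mult)
  qed
  then obtain m where m: "\<And>i. i \<in> I \<Longrightarrow> m i \<in> carrier M" "\<And>i. i \<in> I \<Longrightarrow> idem (vt i) \<odot>\<^bsub>M\<^esub> m i = m i"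
    "\<And>i. i \<in> I \<Longrightarrow> p (m i) = f (Lbasis (i, None))" by metis
  \<comment> \<open>All arrows leaving the generators survive in the full module, so the lift has no
    relations to respect.\<close>
  have h: "Lmap M I vt ?A m \<in> rmod_hom R (Lmod I vt ?A) M" by (rule Lmap_hom[OF M L m(1,2)]) auto
  have "p (Lmap M I vt ?A m x) = f x" if x: "x \<in> carrier (Lmod I vt ?A)" for x
  proof -
    have ph: "(\<lambda>x. p (Lmap M I vt ?A m x)) \<in> rmod_hom R (Lmod I vt ?A) N" by (rule rmod_hom_comp[OF h p(1)])
    have "p (Lmap M I vt ?A m x) = Lmap N I vt ?A (\<lambda>i. p (Lmap M I vt ?A m (Lbasis (i, None)))) x"
      by (rule hom_eq_on_basis[OF L N ph x])
    also have "\<dots> = Lmap N I vt ?A (\<lambda>i. f (Lbasis (i, None))) x"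
      unfolding Lmap_def[of N]
      using x Lbasis_homogeneous[OF L] m
      by (intro p.N.M.finsum_cong') (auto simp: Lmap_basis[OF M L m(1,2)] intro!: p.N.smult_closed)
    also have "\<dots> = f x" by (rule hom_eq_on_basis[OF L N f x, symmetric])
    finally show ?thesis .
  qed
  with h show ?thesis by blast
qed

lemma projectiveI:
  assumes L: "Ldata I vt (arrows_at I vt)" and P: "P \<in> fg_rmodules R"
    and iso: "rmod_isomorphic R (Lmod I vt (arrows_at I vt)) P"
  shows "projective R P"
  unfolding projective_def
proof (intro conjI ballI impI P)
  let ?L = "Lmod I vt (arrows_at I vt)"
  fix M N p f assume M: "M \<in> fg_rmodules R" and N: "N \<in> fg_rmodules R"
    and p: "p \<in> rmod_hom R M N" "p ` carrier M = carrier N" and f: "f \<in> rmod_hom R P N"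
  from iso obtain e where e: "e \<in> rmod_hom R ?L P" "bij_betw e (carrier ?L) (carrier P)"
    by (auto simp: rmod_isomorphic_def)
  let ?e' = "the_inv_into (carrier ?L) e"
  have e': "?e' \<in> rmod_hom R P ?L" by (rule rmod_hom_inverse[OF Lmod_right_module[OF L] e])
  obtain h where h: "h \<in> rmod_hom R ?L M" "\<forall>x\<in>carrier ?L. p (h x) = f (e x)"
    using Lfull_lift[OF L fg_rmodulesD(1)[OF M] fg_rmodulesD(1)[OF N] p rmod_hom_comp[OF e(1) f]] by blast
  have "p (h (?e' x)) = f x" if "x \<in> carrier P" for x
    using h(2) rmod_homD(1)[OF e' that] f_the_inv_into_f_bij_betw[OF e(2)] that by simp
  then show "\<exists>h\<in>rmod_hom R P M. \<forall>x\<in>carrier P. p (h x) = f x"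
    by (intro bexI[OF _ rmod_hom_comp[OF e' h(1)]] ballI)
qed

text \<open>The cover \<open>p\<close> splits by projectivity; let \<open>s\<close> be a section. On
  a generator the composite of \<open>p\<close> and \<open>s\<close> differs from the identity by an
  element of the kernel, hence by a radical element. For \<open>f\<close> in the kernel all
  coefficients are radical too, so they annihilate these differences, and \<open>f\<close> equals
  \<open>s (p f)\<close>, which is 0.\<close>

lemma projective_Lmod:
  assumes P: "projective R P"
  obtains I :: "((nat \<Rightarrow> 'r) set \<times> 'v) set" and vt where "Ldata I vt (arrows_at I vt)"
    "rmod_isomorphic R (Lmod I vt (arrows_at I vt)) P"
proof -
  have Pfg: "P \<in> fg_rmodules R" using P by (simp add: projective_def)
  note PM = fg_rmodulesD[OF Pfg]
  obtain I :: "((nat \<Rightarrow> 'r) set \<times> 'v) set" and vt p where L: "Ldata I vt (arrows_at I vt)" and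
    p: "p \<in> rmod_hom R (Lmod I vt (arrows_at I vt)) P" "p ` carrier (Lmod I vt (arrows_at I vt)) = carrier P"
    and ker: "\<And>f i. f \<in> carrier (Lmod I vt (arrows_at I vt)) \<Longrightarrow> p f = \<zero>\<^bsub>P\<^esub> \<Longrightarrow> f (i, None) = \<zero>\<^bsub>K\<^esub>"
    using cover_exists[OF PM] by metis
  let ?L = "Lmod I vt (arrows_at I vt)" let ?A = "arrows_at I vt"
  interpret p: rmod_map R ?L P p by (rule rmod_mapI[OF Lmod_right_module[OF L] PM(1) p(1)])
  let ?F = "fg_copy R ?L"
  note F = fg_copy[OF Lmod_right_module[OF L] Lmod_fg[OF L]]
  from F(2) obtain e where e: "e \<in> rmod_hom R ?L ?F" "bij_betw e (carrier ?L) (carrier ?F)"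
    by (auto simp: rmod_isomorphic_def)
  let ?e' = "the_inv_into (carrier ?L) e"
  have e': "?e' \<in> rmod_hom R ?F ?L" by (rule rmod_hom_inverse[OF Lmod_right_module[OF L] e])
  have ee: "?e' ` carrier ?F = carrier ?L" using bij_betw_the_inv_into[OF e(2)] by (simp add: bij_betw_def)
  have pe: "(\<lambda>x. p (?e' x)) \<in> rmod_hom R ?F P" by (rule rmod_hom_comp[OF e' p(1)])
  have pes: "(\<lambda>x. p (?e' x)) ` carrier ?F = carrier P"
  proof -
    have "(\<lambda>x. p (?e' x)) ` carrier ?F = p ` (?e' ` carrier ?F)" by (rule image_image[symmetric])
    also have "\<dots> = carrier P" unfolding ee by (rule p(2))
    finally show ?thesis .
  qed
  have lift: "\<exists>h\<in>rmod_hom R P M. \<forall>x\<in>carrier P. q (h x) = f x" if "M \<in> fg_rmodules R" "N \<in> fg_rmodules R"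
    "q \<in> rmod_hom R M N" "f \<in> rmod_hom R P N" "q ` carrier M = carrier N" for M N q f
    by (rule mp[OF bspec[OF bspec[OF bspec[OF bspec[OF conjunct2[OF P[unfolded projective_def]]]]]]]) (rule that)+
  obtain k where k: "k \<in> rmod_hom R P ?F" "\<forall>x\<in>carrier P. p (?e' (k x)) = x"
    using lift[OF F(1) Pfg pe rmod_hom_id pes] by (elim bexE)
  define s where "s x = ?e' (k x)" for x
  have s: "s \<in> rmod_hom R P ?L" unfolding s_def by (rule rmod_hom_comp[OF k(1) e'])
  have ps: "p (s x) = x" if "x \<in> carrier P" for x using k(2) that by (simp add: s_def)
  interpret s: rmod_map R P ?L s by (rule rmod_mapI[OF PM(1) Lmod_right_module[OF L] s])
  have "f = \<zero>\<^bsub>?L\<^esub>" if f: "f \<in> carrier ?L" "p f = \<zero>\<^bsub>P\<^esub>" for f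
  proof -
    have f0: "f (i, None) = \<zero>\<^bsub>K\<^esub>" for i by (rule ker[OF f])
    have sp: "(\<lambda>x. s (p x)) \<in> rmod_hom R ?L ?L" by (rule rmod_hom_comp[OF p(1) s])
    \<comment> \<open>The coefficient is radical and so is \<open>d\<close>, hence their product
      vanishes.\<close>
    have *: "elt vt ?A f i \<odot>\<^bsub>?L\<^esub> s (p (Lbasis (i, None))) = elt vt ?A f i \<odot>\<^bsub>?L\<^esub> Lbasis (i, None)" if i: "i \<in> I" for i
    proof -
      note b = Lbasis_homogeneous(1)[OF L i]
      define d where "d = s (p (Lbasis (i, None))) \<ominus>\<^bsub>?L\<^esub> Lbasis (i, None)"
      have dc: "d \<in> carrier ?L" using b by (simp add: d_def p.M.M.minus_closed del: Lmod_simps)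
      have "p d = \<zero>\<^bsub>P\<^esub>" using b by (simp add: d_def p.diff ps del: Lmod_simps)
      then have d0: "d (j, None) = \<zero>\<^bsub>K\<^esub>" for j by (rule ker[OF dc])
      have ef: "elt vt ?A f i \<in> carrier R" using f by simp
      have "elt vt ?A f i \<odot>\<^bsub>?L\<^esub> d = \<zero>\<^bsub>?L\<^esub>"
        by (rule pair_option_ext) (use f dc d0 f0 LdataD[OF L] in \<open>auto\<close>)
      moreover have "s (p (Lbasis (i, None))) = d \<oplus>\<^bsub>?L\<^esub> Lbasis (i, None)"
        using b by (simp add: d_def a_minus_def p.M.M.a_assoc p.M.M.l_neg del: Lmod_simps)
      ultimately show ?thesis using b ef dc p.M.smult_closed[OF ef b]
        by (simp add: p.M.smult_add_vector del: Lmod_simps)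
    qed
    have "s (p f) = Lmap ?L I vt ?A (\<lambda>i. s (p (Lbasis (i, None)))) f"
      by (rule hom_eq_on_basis[OF L Lmod_right_module[OF L] sp f(1)])
    also have "\<dots> = Lmap ?L I vt ?A (\<lambda>i. Lbasis (i, None)) f"
      unfolding Lmap_def using * f(1) Lbasis_homogeneous[OF L]
      by (intro p.M.M.finsum_cong') (auto intro!: p.M.smult_closed)
    also have "\<dots> = f" by (rule Lmod_expand[OF L f(1), symmetric])
    finally show ?thesis using f(2) s.zero by simp
  qed
  then have "inj_on p (carrier ?L)" unfolding p.inj_iff_kernel by blast
  then have "rmod_isomorphic R ?L P" unfolding rmod_isomorphic_def bij_betw_def using p by blast
  with L show ?thesis by (rule that)
qed

end

section \<open>Dimension invariants\<close>

context rad_sq_zero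
begin

section \<open>Subspaces respected by all homomorphisms\<close>

definition vpart :: "'v \<Rightarrow> ('r, 'b, 'z) module_scheme \<Rightarrow> 'b set" where
  "vpart w M = {y \<in> carrier M. idem w \<odot>\<^bsub>M\<^esub> y = y}"

text \<open>The part of the radical at \<open>w\<close>. An arrow multiplies into the part at its
  target, so only arrows ending at \<open>w\<close> contribute.\<close>

definition vrad :: "'v \<Rightarrow> ('r, 'b, 'z) module_scheme \<Rightarrow> 'b set" where
  "vrad w M = {\<Oplus>\<^bsub>M\<^esub>a\<in>{a \<in> E. tgt a = w}. arr a \<odot>\<^bsub>M\<^esub> z a | z. z \<in> E \<rightarrow> carrier M}"

text \<open>The part at \<open>v\<close> of the socle, the largest submodule killed by the
  radical.\<close>

definition vsoc :: "'v \<Rightarrow> ('r, 'b, 'z) module_scheme \<Rightarrow> 'b set" where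
  "vsoc v M = {y \<in> carrier M. idem v \<odot>\<^bsub>M\<^esub> y = y \<and> (\<forall>a\<in>E. arr a \<odot>\<^bsub>M\<^esub> y = \<zero>\<^bsub>M\<^esub>)}"

definition aimage :: "'a \<Rightarrow> ('r, 'b, 'z) module_scheme \<Rightarrow> 'b set" where
  "aimage a M = (\<lambda>z. arr a \<odot>\<^bsub>M\<^esub> z) ` carrier M"

abbreviation mdim :: "('r, 'b, 'z) module_scheme \<Rightarrow> 'b set \<Rightarrow> nat" where
  "mdim M W \<equiv> kdim K (kmod M) W"

context
  fixes M :: "('r, 'b, 'z) module_scheme"
  assumes M: "right_module R M"
begin

interpretation M: right_module R M by (rule M)
interpretation VM: vectorspace K "kmod M" by (rule kmod_vectorspace[OF M])

lemma scal_smult_comm: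
  "c \<in> carrier K \<Longrightarrow> r \<in> carrier R \<Longrightarrow> x \<in> carrier M \<Longrightarrow> r \<odot>\<^bsub>M\<^esub> (scal c \<odot>\<^bsub>M\<^esub> x) = scal c \<odot>\<^bsub>M\<^esub> (r \<odot>\<^bsub>M\<^esub> x)"
  using M.smult_mult[of "scal c" r x] M.smult_mult[of r "scal c" x] scal_comm[of c r] by simp

lemma vpart_subspace: "subspace K (vpart w M) (kmod M)"
  by (rule VM.subspaceI) (auto simp: vpart_def M.smult_add_vector M.smult_closed scal_smult_comm)

lemma vsoc_subspace: "subspace K (vsoc w M) (kmod M)"
  by (rule VM.subspaceI) (auto simp: vsoc_def M.smult_add_vector M.smult_closed scal_smult_comm)

lemma aimage_subspace: "subspace K (aimage a M) (kmod M)"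
proof (rule VM.subspaceI)
  show "\<zero>\<^bsub>kmod M\<^esub> \<in> aimage a M"
    unfolding aimage_def by (intro image_eqI[of _ _ "\<zero>\<^bsub>M\<^esub>"]) auto
  fix x y assume "x \<in> aimage a M" "y \<in> aimage a M"
  then obtain x' y' where "x' \<in> carrier M" "y' \<in> carrier M" "x = arr a \<odot>\<^bsub>M\<^esub> x'" "y = arr a \<odot>\<^bsub>M\<^esub> y'"
    by (auto simp: aimage_def)
  then show "x \<oplus>\<^bsub>kmod M\<^esub> y \<in> aimage a M"
    unfolding aimage_def by (intro image_eqI[of _ _ "x' \<oplus>\<^bsub>M\<^esub> y'"]) (auto simp: M.smult_add_vector)
next
  fix c x assume "c \<in> carrier K" "x \<in> aimage a M"
  then obtain x' where "x' \<in> carrier M" "x = arr a \<odot>\<^bsub>M\<^esub> x'" by (auto simp: aimage_def)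
  then show "c \<odot>\<^bsub>kmod M\<^esub> x \<in> aimage a M" using \<open>c \<in> carrier K\<close>
    unfolding aimage_def by (intro image_eqI[of _ _ "scal c \<odot>\<^bsub>M\<^esub> x'"]) (auto simp: scal_smult_comm M.smult_closed)
qed (auto simp: aimage_def M.smult_closed)

lemma vrad_closed:
  assumes "z \<in> E \<rightarrow> carrier M"
  shows "(\<lambda>a. arr a \<odot>\<^bsub>M\<^esub> z a) \<in> {a \<in> E. tgt a = w} \<rightarrow> carrier M"
  using assms by (auto intro!: M.smult_closed)

lemma vrad_subspace: "subspace K (vrad w M) (kmod M)"
proof (rule VM.subspaceI)
  let ?E = "{a \<in> E. tgt a = w}"
  show "vrad w M \<subseteq> carrier (kmod M)"
    unfolding vrad_def using M.M.finsum_closed[OF vrad_closed] by auto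
  have "\<zero>\<^bsub>M\<^esub> = (\<Oplus>\<^bsub>M\<^esub>a\<in>?E. arr a \<odot>\<^bsub>M\<^esub> \<zero>\<^bsub>M\<^esub>)" by simp
  then show "\<zero>\<^bsub>kmod M\<^esub> \<in> vrad w M"
    unfolding vrad_def kmod_simps by (intro CollectI exI[of _ "\<lambda>_. \<zero>\<^bsub>M\<^esub>"]) auto
  fix x y assume "x \<in> vrad w M" "y \<in> vrad w M"
  then obtain f g where fg: "f \<in> E \<rightarrow> carrier M" "g \<in> E \<rightarrow> carrier M"
    "x = (\<Oplus>\<^bsub>M\<^esub>a\<in>?E. arr a \<odot>\<^bsub>M\<^esub> f a)" "y = (\<Oplus>\<^bsub>M\<^esub>a\<in>?E. arr a \<odot>\<^bsub>M\<^esub> g a)" by (auto simp: vrad_def)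
  have "x \<oplus>\<^bsub>M\<^esub> y = (\<Oplus>\<^bsub>M\<^esub>a\<in>?E. arr a \<odot>\<^bsub>M\<^esub> f a \<oplus>\<^bsub>M\<^esub> arr a \<odot>\<^bsub>M\<^esub> g a)"
    unfolding fg(3,4) by (rule M.M.finsum_addf[OF vrad_closed[OF fg(1)] vrad_closed[OF fg(2)], symmetric])
  also have "\<dots> = (\<Oplus>\<^bsub>M\<^esub>a\<in>?E. arr a \<odot>\<^bsub>M\<^esub> (f a \<oplus>\<^bsub>M\<^esub> g a))"
    using fg by (intro M.M.finsum_cong') (auto simp: M.smult_add_vector Pi_iff intro!: M.smult_closed)
  finally show "x \<oplus>\<^bsub>kmod M\<^esub> y \<in> vrad w M"
    unfolding vrad_def kmod_simps using fg by (intro CollectI exI[of _ "\<lambda>a. f a \<oplus>\<^bsub>M\<^esub> g a"]) auto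
next
  let ?E = "{a \<in> E. tgt a = w}"
  fix c x assume c: "c \<in> carrier K" and "x \<in> vrad w M"
  then obtain f where f: "f \<in> E \<rightarrow> carrier M" "x = (\<Oplus>\<^bsub>M\<^esub>a\<in>?E. arr a \<odot>\<^bsub>M\<^esub> f a)" by (auto simp: vrad_def)
  have "scal c \<odot>\<^bsub>M\<^esub> x = (\<Oplus>\<^bsub>M\<^esub>a\<in>?E. scal c \<odot>\<^bsub>M\<^esub> (arr a \<odot>\<^bsub>M\<^esub> f a))"
    unfolding f(2) using c by (intro M.smult_finsum vrad_closed[OF f(1)]) simp
  also have "\<dots> = (\<Oplus>\<^bsub>M\<^esub>a\<in>?E. arr a \<odot>\<^bsub>M\<^esub> (scal c \<odot>\<^bsub>M\<^esub> f a))"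
    using f c by (intro M.M.finsum_cong') (auto simp: scal_smult_comm Pi_iff intro!: M.smult_closed)
  finally show "c \<odot>\<^bsub>kmod M\<^esub> x \<in> vrad w M"
    unfolding vrad_def kmod_simps using f c
    by (intro CollectI exI[of _ "\<lambda>a. scal c \<odot>\<^bsub>M\<^esub> f a"]) (auto intro!: M.smult_closed)
qed

text \<open>The module is an image of some \<open>Lmod\<close>, which has finitely many
  coordinates.\<close>

lemma fg_fin_dim:
  assumes fg: "finitely_generated R M"
  shows "vectorspace.fin_dim K (kmod M)"
proof -
  obtain I :: "('b \<times> 'v) set" and vt p where L: "Ldata I vt (arrows_at I vt)" and
    p: "p \<in> rmod_hom R (Lmod I vt (arrows_at I vt)) M" "p ` carrier (Lmod I vt (arrows_at I vt)) = carrier M"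
    using cover_exists[OF M fg] by metis
  let ?L = "Lmod I vt (arrows_at I vt)"
  interpret VL: vectorspace K "kmod ?L" by (rule kmod_vectorspace[OF Lmod_right_module[OF L]])
  have "p \<in> module_hom K (kmod ?L) (kmod M)"
    using rmod_homD[OF p(1)] by (auto simp: module_hom_def simp del: Lmod_simps)
  then interpret p: linear_map K "kmod ?L" "kmod M" p
    by (intro linear_map.intro mod_hom.intro mod_hom_axioms.intro
        VL.vectorspace_axioms VM.vectorspace_axioms VL.module_axioms VM.module_axioms)
  show ?thesis using p.rank_nullity_main(2)[OF Lmod_fin_dim[OF L]] p(2) by simp
qed

end

lemma hom_vpart: "f \<in> rmod_hom R M N \<Longrightarrow> f ` vpart w M \<subseteq> vpart w N"
proof clarify
  fix x assume f: "f \<in> rmod_hom R M N" and "x \<in> vpart w M"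
  then have x: "x \<in> carrier M" "idem w \<odot>\<^bsub>M\<^esub> x = x" by (auto simp: vpart_def)
  then show "f x \<in> vpart w N"
    using rmod_homD(1)[OF f x(1)] rmod_homD(3)[OF f idem(1) x(1), of w] by (simp add: vpart_def)
qed

lemma hom_vsoc:
  assumes "right_module R M" "right_module R N" and f: "f \<in> rmod_hom R M N"
  shows "f ` vsoc w M \<subseteq> vsoc w N"
proof clarify
  interpret f: rmod_map R M N f using assms by (rule rmod_mapI)
  fix x assume "x \<in> vsoc w M"
  then have x: "x \<in> carrier M" "idem w \<odot>\<^bsub>M\<^esub> x = x" "\<And>a. a \<in> E \<Longrightarrow> arr a \<odot>\<^bsub>M\<^esub> x = \<zero>\<^bsub>M\<^esub>" by (auto simp: vsoc_def)
  then show "f x \<in> vsoc w N"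
    using f.smult[OF idem(1) x(1), of w] by (simp add: vsoc_def f.smult[OF arr(1) x(1), symmetric])
qed

lemma hom_aimage: "f \<in> rmod_hom R M N \<Longrightarrow> f ` aimage a M \<subseteq> aimage a N"
proof clarify
  fix x assume f: "f \<in> rmod_hom R M N" and "x \<in> aimage a M"
  then obtain z where "z \<in> carrier M" "x = arr a \<odot>\<^bsub>M\<^esub> z" by (auto simp: aimage_def)
  then show "f x \<in> aimage a N"
    using rmod_homD(1)[OF f] rmod_homD(3)[OF f arr(1), of z a] by (auto simp: aimage_def)
qed

text \<open>A surjection allows the entries \<open>z a\<close> to be lifted one arrow at a time, so
  it remains surjective on radicals. For a cover this gives the rank in the rank-nullity
  count.\<close>

lemma hom_vrad:
  assumes M: "right_module R M" and N: "right_module R N" and f: "f \<in> rmod_hom R M N"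
  shows "f ` vrad w M \<subseteq> vrad w N" "f ` carrier M = carrier N \<Longrightarrow> f ` vrad w M = vrad w N"
proof -
  interpret f: rmod_map R M N f using assms by (rule rmod_mapI)
  let ?E = "{a \<in> E. tgt a = w}"
  have eq: "f (\<Oplus>\<^bsub>M\<^esub>a\<in>?E. arr a \<odot>\<^bsub>M\<^esub> z a) = (\<Oplus>\<^bsub>N\<^esub>a\<in>?E. arr a \<odot>\<^bsub>N\<^esub> f (z a))" if "z \<in> E \<rightarrow> carrier M" for z
  proof -
    have "f (\<Oplus>\<^bsub>M\<^esub>a\<in>?E. arr a \<odot>\<^bsub>M\<^esub> z a) = (\<Oplus>\<^bsub>N\<^esub>a\<in>?E. f (arr a \<odot>\<^bsub>M\<^esub> z a))"
      by (rule f.finsum[OF vrad_closed[OF M that]])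
    also have "\<dots> = (\<Oplus>\<^bsub>N\<^esub>a\<in>?E. arr a \<odot>\<^bsub>N\<^esub> f (z a))"
      using that by (intro f.N.M.finsum_cong') (auto simp: f.smult Pi_iff intro!: f.N.smult_closed)
    finally show ?thesis .
  qed
  show sub: "f ` vrad w M \<subseteq> vrad w N"
  proof clarify
    fix x assume "x \<in> vrad w M"
    then obtain z where z: "z \<in> E \<rightarrow> carrier M" "x = (\<Oplus>\<^bsub>M\<^esub>a\<in>?E. arr a \<odot>\<^bsub>M\<^esub> z a)" by (auto simp: vrad_def)
    then show "f x \<in> vrad w N"
      unfolding vrad_def by (intro CollectI exI[of _ "\<lambda>a. f (z a)"]) (auto simp: eq Pi_iff)
  qed
  assume surj: "f ` carrier M = carrier N"
  show "f ` vrad w M = vrad w N"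
  proof (intro equalityI sub subsetI)
    fix y assume "y \<in> vrad w N"
    then obtain z where z: "z \<in> E \<rightarrow> carrier N" "y = (\<Oplus>\<^bsub>N\<^esub>a\<in>?E. arr a \<odot>\<^bsub>N\<^esub> z a)" by (auto simp: vrad_def)
    have "\<exists>x. x \<in> carrier M \<and> f x = z a" if "a \<in> E" for a
    proof -
      have "z a \<in> f ` carrier M" unfolding surj using z(1) that by blast
      then obtain x where "z a = f x" "x \<in> carrier M" by (rule imageE)
      then show ?thesis by (intro exI[of _ x]) simp
    qed
    then obtain z' where z': "\<And>a. a \<in> E \<Longrightarrow> z' a \<in> carrier M" "\<And>a. a \<in> E \<Longrightarrow> f (z' a) = z a" by metis
    have "y = f (\<Oplus>\<^bsub>M\<^esub>a\<in>?E. arr a \<odot>\<^bsub>M\<^esub> z' a)"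
      unfolding z(2) using z' z(1) by (subst eq) (auto intro!: f.N.M.finsum_cong' f.N.smult_closed)
    moreover have "(\<Oplus>\<^bsub>M\<^esub>a\<in>?E. arr a \<odot>\<^bsub>M\<^esub> z' a) \<in> vrad w M" using z' by (auto simp: vrad_def)
    ultimately show "y \<in> f ` vrad w M" by blast
  qed
qed

lemma mdim_iso:
  assumes M: "right_module R M" and N: "right_module R N" and fg: "finitely_generated R M"
    and f: "f \<in> rmod_hom R M N" "inj_on f (carrier M)"
    and W: "subspace K W (kmod M)"
  shows "mdim N (f ` W) = mdim M W"
proof -
  interpret VM: vectorspace K "kmod M" by (rule kmod_vectorspace[OF M])
  have WM: "W \<subseteq> carrier M" using W by (auto simp: subspace_def submodule_def)
  show ?thesis
    by (rule VM.kdim_inj_image[OF fg_fin_dim[OF M fg] W kmod_vectorspace[OF N] rmod_hom_linear[OF M f(1) WM]])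
       (rule inj_on_subset[OF f(2) WM])
qed

lemma iso_image_eq:
  assumes M: "right_module R M" and f: "f \<in> rmod_hom R M N" "bij_betw f (carrier M) (carrier N)"
    and 1: "f ` W \<subseteq> W'" and 2: "the_inv_into (carrier M) f ` W' \<subseteq> W" and W': "W' \<subseteq> carrier N"
  shows "f ` W = W'"
proof (intro equalityI 1 subsetI)
  fix y assume y: "y \<in> W'"
  then have "f (the_inv_into (carrier M) f y) = y" using W' f_the_inv_into_f_bij_betw[OF f(2)] by blast
  then show "y \<in> f ` W" using 2 y by (metis image_eqI image_subset_iff)
qed

text \<open>A choice of subspaces respected by all homomorphisms is compatible with the projections
  and inclusions of a direct sum. Rank and nullity of the first projection, restricted to
  \<open>T M\<close>, then give additivity.\<close>

lemma mdim_invariants: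
  assumes sub: "\<And>N. N \<in> fg_rmodules R \<Longrightarrow> subspace K (T N) (kmod N)"
    and hom: "\<And>N N' f. N \<in> fg_rmodules R \<Longrightarrow> N' \<in> fg_rmodules R \<Longrightarrow> f \<in> rmod_hom R N N' \<Longrightarrow> f ` T N \<subseteq> T N'"
    and M: "M \<in> fg_rmodules R" "M' \<in> fg_rmodules R"
  shows "rmod_isomorphic R M M' \<Longrightarrow> mdim M (T M) = mdim M' (T M')"
    and "M'' \<in> fg_rmodules R \<Longrightarrow> rmod_isomorphic R M (rmod_sum M' M'') \<Longrightarrow>
      mdim M (T M) = mdim M' (T M') + mdim M'' (T M'')"
proof -
  note MM = fg_rmodulesD[OF M(1)] and MM' = fg_rmodulesD[OF M(2)]
  have T: "T N \<subseteq> carrier N" if "N \<in> fg_rmodules R" for N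
    using sub[OF that] by (auto simp: subspace_def submodule_def)
  show "mdim M (T M) = mdim M' (T M')" if "rmod_isomorphic R M M'"
  proof -
    from that obtain f where f: "f \<in> rmod_hom R M M'" "bij_betw f (carrier M) (carrier M')"
      by (auto simp: rmod_isomorphic_def)
    have "f ` T M = T M'"
      by (rule iso_image_eq[OF MM(1) f hom[OF M f(1)] hom[OF M(2,1) rmod_hom_inverse[OF MM(1) f]] T[OF M(2)]])
    then show ?thesis using mdim_iso[OF MM(1) MM'(1) MM(2) f(1) _ sub[OF M(1)]] f(2) by (simp add: bij_betw_def)
  qed
  show "mdim M (T M) = mdim M' (T M') + mdim M'' (T M'')"
    if M'': "M'' \<in> fg_rmodules R" and iso: "rmod_isomorphic R M (rmod_sum M' M'')"
  proof -
    note MM'' = fg_rmodulesD[OF M'']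
    interpret VM: vectorspace K "kmod M" by (rule kmod_vectorspace[OF MM(1)])
    interpret M: right_module R M by (rule MM)
    interpret M': right_module R M' by (rule MM')
    interpret M'': right_module R M'' by (rule MM'')
    from iso obtain f where f: "f \<in> rmod_hom R M (rmod_sum M' M'')" "bij_betw f (carrier M) (carrier M' \<times> carrier M'')"
      by (auto simp: rmod_isomorphic_def)
    define g where "g = the_inv_into (carrier M) f"
    have g: "g \<in> rmod_hom R (rmod_sum M' M'') M" unfolding g_def by (rule rmod_hom_inverse[OF MM(1) f(1)]) (simp add: f(2))
    have gf: "g (f x) = x" if "x \<in> carrier M" for x
      using the_inv_into_f_f[of f "carrier M"] f(2) that by (simp add: g_def bij_betw_def)
    have fg: "f (g p) = p" if "p \<in> carrier M' \<times> carrier M''" for p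
      using f_the_inv_into_f_bij_betw[OF f(2)] that by (simp add: g_def)
    define \<pi> where "\<pi> x = fst (f x)" for x
    define \<pi>' where "\<pi>' x = snd (f x)" for x
    define \<iota> where "\<iota> x = g (x, \<zero>\<^bsub>M''\<^esub>)" for x
    define \<iota>' where "\<iota>' y = g (\<zero>\<^bsub>M'\<^esub>, y)" for y
    have "fst \<in> rmod_hom R (rmod_sum M' M'') M'" "snd \<in> rmod_hom R (rmod_sum M' M'') M''"
      by (auto simp: rmod_hom_def)
    then have \<pi>: "\<pi> \<in> rmod_hom R M M'" "\<pi>' \<in> rmod_hom R M M''"
      unfolding \<pi>_def \<pi>'_def by (auto intro: rmod_hom_comp[OF f(1)])
    have "(\<lambda>x. (x, \<zero>\<^bsub>M''\<^esub>)) \<in> rmod_hom R M' (rmod_sum M' M'')" "(\<lambda>y. (\<zero>\<^bsub>M'\<^esub>, y)) \<in> rmod_hom R M'' (rmod_sum M' M'')"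
      by (auto simp: rmod_hom_def)
    then have \<iota>: "\<iota> \<in> rmod_hom R M' M" "\<iota>' \<in> rmod_hom R M'' M"
      unfolding \<iota>_def \<iota>'_def by (auto intro: rmod_hom_comp[OF _ g])
    have im: "\<pi> ` T M = T M'"
    proof (intro equalityI hom[OF M \<pi>(1)] subsetI)
      fix y assume y: "y \<in> T M'"
      then have "y \<in> carrier M'" using T[OF M(2)] by blast
      then have "\<pi> (\<iota> y) = y" by (simp add: \<pi>_def \<iota>_def fg)
      then show "y \<in> \<pi> ` T M" using hom[OF M(2,1) \<iota>(1)] y by (metis image_eqI image_subset_iff)
    qed
    \<comment> \<open>An element of \<open>T M\<close> with first component 0 is the inclusion of
      its second component, which lies in \<open>T M''\<close> because the projection respects
      \<open>T\<close>.\<close>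
    have ker: "{x \<in> T M. \<pi> x = \<zero>\<^bsub>M'\<^esub>} = \<iota>' ` T M''"
    proof (intro equalityI subsetI)
      fix x assume x: "x \<in> {x \<in> T M. \<pi> x = \<zero>\<^bsub>M'\<^esub>}"
      then have xc: "x \<in> carrier M" using T[OF M(1)] by blast
      have "f x = (\<zero>\<^bsub>M'\<^esub>, \<pi>' x)" using x by (simp add: prod_eq_iff \<pi>_def \<pi>'_def)
      then have "x = \<iota>' (\<pi>' x)" using gf[OF xc] by (simp add: \<iota>'_def)
      moreover have "\<pi>' x \<in> T M''" using hom[OF M(1) M'' \<pi>(2)] x by blast
      ultimately show "x \<in> \<iota>' ` T M''" by blast
    next
      fix x assume "x \<in> \<iota>' ` T M''"
      then obtain y where y: "y \<in> T M''" "x = \<iota>' y" by blast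
      then have "y \<in> carrier M''" using T[OF M''] by blast
      then have "\<pi> x = \<zero>\<^bsub>M'\<^esub>" by (simp add: y \<pi>_def \<iota>'_def fg)
      moreover have "x \<in> T M" using hom[OF M'' M(1) \<iota>(2)] y by blast
      ultimately show "x \<in> {x \<in> T M. \<pi> x = \<zero>\<^bsub>M'\<^esub>}" by simp
    qed
    have inj: "inj_on \<iota>' (carrier M'')"
    proof (rule inj_onI)
      fix x y assume xy: "x \<in> carrier M''" "y \<in> carrier M''" "\<iota>' x = \<iota>' y"
      then have "f (g (\<zero>\<^bsub>M'\<^esub>, x)) = f (g (\<zero>\<^bsub>M'\<^esub>, y))" by (simp add: \<iota>'_def)
      then show "x = y" using xy by (simp add: fg)
    qed
    have "mdim M (T M) = mdim M {x \<in> T M. \<pi> x = \<zero>\<^bsub>kmod M'\<^esub>} + mdim M' (\<pi> ` T M)"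
      by (rule VM.rank_nullity_subspace[OF fg_fin_dim[OF MM] sub[OF M(1)] kmod_vectorspace[OF MM'(1)]
            rmod_hom_linear[OF MM(1) \<pi>(1) T[OF M(1)]]])
    also have "{x \<in> T M. \<pi> x = \<zero>\<^bsub>kmod M'\<^esub>} = \<iota>' ` T M''" using ker by simp
    also have "mdim M (\<iota>' ` T M'') = mdim M'' (T M'')"
      by (rule mdim_iso[OF MM''(1) MM(1) MM''(2) \<iota>(2) inj sub[OF M'']])
    finally show ?thesis using im by simp
  qed
qed

lemma subspace_finsum:
  assumes M: "right_module R M" and W: "subspace K W (kmod M)" and f: "\<And>i. i \<in> S \<Longrightarrow> f i \<in> W" "finite S"
  shows "(\<Oplus>\<^bsub>M\<^esub>i\<in>S. f i) \<in> W"
proof -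
  interpret M: right_module R M by fact
  have W': "W \<subseteq> carrier M" "\<zero>\<^bsub>M\<^esub> \<in> W" "\<And>x y. x \<in> W \<Longrightarrow> y \<in> W \<Longrightarrow> x \<oplus>\<^bsub>M\<^esub> y \<in> W"
    using W by (auto simp: subspace_def submodule_def)
  from f(2,1) show ?thesis
  proof (induction S)
    case (insert i S)
    then have "f \<in> S \<rightarrow> carrier M" "f i \<in> carrier M" using W' by auto
    with insert W' show ?case by simp
  qed (use W' in simp)
qed

section \<open>Dimensions of these subspaces on the explicit modules\<close>

context
  fixes I :: "'x set" and vt :: "'x \<Rightarrow> 'v" and A :: "('x \<times> 'a) set"
  assumes L: "Ldata I vt A"
begin

interpretation FS: function_space K "kmod (Lmod I vt A)" "Lsupp I A" by (rule Lmod_function_space[OF L])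

lemma coord_space_iff: "f \<in> FS.coord_space J \<longleftrightarrow> f \<in> carrier (Lmod I vt A) \<and> (\<forall>z. z \<notin> J \<longrightarrow> f z = \<zero>\<^bsub>K\<^esub>)"
  by (simp add: FS.coord_space_def)

abbreviation "none_at P \<equiv> {(i, None :: 'a option) | i. i \<in> I \<and> P i}"
abbreviation "some_at P \<equiv> {(i, Some a) | i a. (i, a) \<in> A \<and> P a}"

lemma vpart_Lmod:
  assumes "w \<in> V"
  shows "vpart w (Lmod I vt A) = FS.coord_space (none_at (\<lambda>i. vt i = w) \<union> some_at (\<lambda>a. tgt a = w))" (is "_ = FS.coord_space ?J")
proof (intro equalityI subsetI)
  note LD = LdataD[OF L]
  fix f assume "f \<in> vpart w (Lmod I vt A)"
  then have f: "f \<in> carrier (Lmod I vt A)" "idem w \<odot>\<^bsub>Lmod I vt A\<^esub> f = f" by (auto simp: vpart_def)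
  have "f z = \<zero>\<^bsub>K\<^esub>" if "z \<notin> ?J" for z
  proof (cases z)
    case (Pair i q)
    have "(idem w \<odot>\<^bsub>Lmod I vt A\<^esub> f) (i, q) = \<zero>\<^bsub>K\<^esub>"
      using that f(1) LD Pair by (cases q) auto
    then show ?thesis using f(2) Pair by simp
  qed
  with f(1) show "f \<in> FS.coord_space ?J" by (simp add: coord_space_iff)
next
  note LD = LdataD[OF L]
  fix f assume "f \<in> FS.coord_space ?J"
  then have f: "f \<in> carrier (Lmod I vt A)" "\<And>z. z \<notin> ?J \<Longrightarrow> f z = \<zero>\<^bsub>K\<^esub>" by (auto simp: coord_space_iff)
  have "idem w \<odot>\<^bsub>Lmod I vt A\<^esub> f = f"
  proof (rule pair_option_ext)
    fix i show "(idem w \<odot>\<^bsub>Lmod I vt A\<^esub> f) (i, None) = f (i, None)"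
      using f(1) f(2)[of "(i, None)"] LD by auto
    fix a show "(idem w \<odot>\<^bsub>Lmod I vt A\<^esub> f) (i, Some a) = f (i, Some a)"
      using f(1) f(2)[of "(i, Some a)"] LD by auto
  qed
  with f(1) show "f \<in> vpart w (Lmod I vt A)" by (simp add: vpart_def)
qed

lemma aimage_Lmod:
  assumes "b \<in> E"
  shows "aimage b (Lmod I vt A) = FS.coord_space (some_at (\<lambda>a. a = b))" (is "_ = FS.coord_space ?J")
proof (intro equalityI subsetI)
  note LD = LdataD[OF L]
  fix f assume "f \<in> aimage b (Lmod I vt A)"
  then obtain z where z: "z \<in> carrier (Lmod I vt A)" "f = arr b \<odot>\<^bsub>Lmod I vt A\<^esub> z" by (auto simp: aimage_def)
  have "f (i, q) = \<zero>\<^bsub>K\<^esub>" if "(i, q) \<notin> ?J" for i q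
    unfolding z(2) using that z(1) LD by (cases q) auto
  then have "\<forall>y. y \<notin> ?J \<longrightarrow> f y = \<zero>\<^bsub>K\<^esub>" by (intro allI impI) (metis (mono_tags, lifting) prod.exhaust)
  moreover have "f \<in> carrier (Lmod I vt A)" unfolding z(2) by (rule Lmod_smult_closed[OF L _ z(1)]) simp
  ultimately show "f \<in> FS.coord_space ?J" by (simp add: coord_space_iff)
next
  note LD = LdataD[OF L]
  fix f assume "f \<in> FS.coord_space ?J"
  then have f: "f \<in> carrier (Lmod I vt A)" "\<And>z. z \<notin> ?J \<Longrightarrow> f z = \<zero>\<^bsub>K\<^esub>" by (auto simp: coord_space_iff)
  define z where "z = (\<lambda>(i, q :: 'a option). if q = None \<and> i \<in> I then f (i, Some b) else \<zero>\<^bsub>K\<^esub>)"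
  have z: "z \<in> carrier (Lmod I vt A)" by (rule Lmod_carrierI) (use f(1) in \<open>auto simp: z_def\<close>)
  have "f = arr b \<odot>\<^bsub>Lmod I vt A\<^esub> z"
  proof (rule pair_option_ext)
    fix i show "f (i, None) = (arr b \<odot>\<^bsub>Lmod I vt A\<^esub> z) (i, None)"
      using f(2)[of "(i, None)"] LD z by auto
    fix a show "f (i, Some a) = (arr b \<odot>\<^bsub>Lmod I vt A\<^esub> z) (i, Some a)"
      using f(2)[of "(i, Some a)"] f(1) LD z by (auto simp: z_def)
  qed
  with z show "f \<in> aimage b (Lmod I vt A)" by (auto simp: aimage_def)
qed

lemma vrad_Lmod:
  "vrad w (Lmod I vt A) = FS.coord_space (some_at (\<lambda>a. tgt a = w))" (is "_ = FS.coord_space ?J")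
proof (intro equalityI subsetI)
  note LD = LdataD[OF L]
  let ?E = "{a \<in> E. tgt a = w}"
  fix f assume "f \<in> vrad w (Lmod I vt A)"
  then obtain z where z: "z \<in> E \<rightarrow> carrier (Lmod I vt A)" "f = (\<Oplus>\<^bsub>Lmod I vt A\<^esub>a\<in>?E. arr a \<odot>\<^bsub>Lmod I vt A\<^esub> z a)"
    by (auto simp: vrad_def)
  have "arr a \<odot>\<^bsub>Lmod I vt A\<^esub> z a \<in> FS.coord_space ?J" if a: "a \<in> ?E" for a
  proof -
    have "arr a \<odot>\<^bsub>Lmod I vt A\<^esub> z a \<in> aimage a (Lmod I vt A)" using z(1) a by (auto simp: aimage_def)
    then show ?thesis using aimage_Lmod[of a] a by (fastforce simp: coord_space_iff)
  qed
  then show "f \<in> FS.coord_space ?J"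
    unfolding z(2) using finite_E by (intro subspace_finsum[OF Lmod_right_module[OF L] FS.coord_space_subspace]) auto
next
  note LD = LdataD[OF L]
  let ?E = "{a \<in> E. tgt a = w}"
  fix f assume "f \<in> FS.coord_space ?J"
  then have f: "f \<in> carrier (Lmod I vt A)" "\<And>z. z \<notin> ?J \<Longrightarrow> f z = \<zero>\<^bsub>K\<^esub>" by (auto simp: coord_space_iff)
  \<comment> \<open>The coordinate of \<open>f\<close> at the arrow \<open>a\<close> is placed at
    the generator, from where \<open>arr a\<close> moves it back.\<close>
  define z where "z a = (\<lambda>(i, q :: 'a option). if q = None \<and> i \<in> I then f (i, Some a) else \<zero>\<^bsub>K\<^esub>)" for a
  have z: "z a \<in> carrier (Lmod I vt A)" for a by (rule Lmod_carrierI) (use f(1) in \<open>auto simp: z_def\<close>)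
  interpret LL: right_module R "Lmod I vt A" by (rule Lmod_right_module[OF L])
  have "(\<Oplus>\<^bsub>Lmod I vt A\<^esub>a\<in>S. arr a \<odot>\<^bsub>Lmod I vt A\<^esub> z a) = (\<lambda>(i, q). case q of None \<Rightarrow> \<zero>\<^bsub>K\<^esub> | Some a \<Rightarrow> if a \<in> S then f (i, q) else \<zero>\<^bsub>K\<^esub>)"
    if "finite S" "S \<subseteq> E" for S
    using that
  proof (induction S)
    case empty
    show ?case by (rule pair_option_ext) auto
  next
    case (insert b S)
    have "(\<Oplus>\<^bsub>Lmod I vt A\<^esub>a\<in>insert b S. arr a \<odot>\<^bsub>Lmod I vt A\<^esub> z a)
        = arr b \<odot>\<^bsub>Lmod I vt A\<^esub> z b \<oplus>\<^bsub>Lmod I vt A\<^esub> (\<Oplus>\<^bsub>Lmod I vt A\<^esub>a\<in>S. arr a \<odot>\<^bsub>Lmod I vt A\<^esub> z a)"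
      using insert.hyps z by (intro LL.M.finsum_insert) (auto intro!: LL.smult_closed)
    also have "(\<Oplus>\<^bsub>Lmod I vt A\<^esub>a\<in>S. arr a \<odot>\<^bsub>Lmod I vt A\<^esub> z a) = (\<lambda>(i, q). case q of None \<Rightarrow> \<zero>\<^bsub>K\<^esub> | Some a \<Rightarrow> if a \<in> S then f (i, q) else \<zero>\<^bsub>K\<^esub>)"
      using insert by blast
    finally show ?case
    proof (simp only:, intro pair_option_ext)
      fix i
      show "(arr b \<odot>\<^bsub>Lmod I vt A\<^esub> z b \<oplus>\<^bsub>Lmod I vt A\<^esub> (\<lambda>(i, q). case q of None \<Rightarrow> \<zero>\<^bsub>K\<^esub> | Some a \<Rightarrow> if a \<in> S then f (i, q) else \<zero>\<^bsub>K\<^esub>)) (i, None)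
        = (case (i, None) of (i, q) \<Rightarrow> case q of None \<Rightarrow> \<zero>\<^bsub>K\<^esub> | Some a \<Rightarrow> if a \<in> insert b S then f (i, q) else \<zero>\<^bsub>K\<^esub>)"
        using LD z[of b] by auto
      fix a
      show "(arr b \<odot>\<^bsub>Lmod I vt A\<^esub> z b \<oplus>\<^bsub>Lmod I vt A\<^esub> (\<lambda>(i, q). case q of None \<Rightarrow> \<zero>\<^bsub>K\<^esub> | Some a \<Rightarrow> if a \<in> S then f (i, q) else \<zero>\<^bsub>K\<^esub>)) (i, Some a)
        = (case (i, Some a) of (i, q) \<Rightarrow> case q of None \<Rightarrow> \<zero>\<^bsub>K\<^esub> | Some a \<Rightarrow> if a \<in> insert b S then f (i, q) else \<zero>\<^bsub>K\<^esub>)"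
        using LD z[of b] f(1) insert.hyps Lmod_outside(2)[OF f(1), of i a] by (auto simp: z_def)
    qed
  qed
  from this[of ?E] finite_E have "(\<Oplus>\<^bsub>Lmod I vt A\<^esub>a\<in>?E. arr a \<odot>\<^bsub>Lmod I vt A\<^esub> z a)
      = (\<lambda>(i, q). case q of None \<Rightarrow> \<zero>\<^bsub>K\<^esub> | Some a \<Rightarrow> if a \<in> ?E then f (i, q) else \<zero>\<^bsub>K\<^esub>)" by simp
  also have "\<dots> = f"
  proof (rule pair_option_ext)
    fix i show "(case (i, None) of (i, q) \<Rightarrow> case q of None \<Rightarrow> \<zero>\<^bsub>K\<^esub> | Some a \<Rightarrow> if a \<in> ?E then f (i, q) else \<zero>\<^bsub>K\<^esub>) = f (i, None)"
      using f(2)[of "(i, None)"] by simp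
    fix a show "(case (i, Some a) of (i, q) \<Rightarrow> case q of None \<Rightarrow> \<zero>\<^bsub>K\<^esub> | Some a \<Rightarrow> if a \<in> ?E then f (i, q) else \<zero>\<^bsub>K\<^esub>) = f (i, Some a)"
      using f(2)[of "(i, Some a)"] LD(4)[of i a] by auto
  qed
  finally show "f \<in> vrad w (Lmod I vt A)"
    unfolding vrad_def using z by (intro CollectI exI[of _ z]) auto
qed

text \<open>A generator belongs to the socle only if none of its arrows survives; the arrow
  coordinates always do, since a second arrow kills them.\<close>

lemma vsoc_Lmod:
  assumes "w \<in> V"
  shows "vsoc w (Lmod I vt A) = FS.coord_space (none_at (\<lambda>i. vt i = w \<and> (\<forall>a. (i, a) \<notin> A)) \<union> some_at (\<lambda>a. tgt a = w))"
    (is "_ = FS.coord_space ?J")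
proof (intro equalityI subsetI)
  note LD = LdataD[OF L]
  fix f assume "f \<in> vsoc w (Lmod I vt A)"
  then have f: "f \<in> carrier (Lmod I vt A)" "f \<in> vpart w (Lmod I vt A)"
    "\<And>a. a \<in> E \<Longrightarrow> arr a \<odot>\<^bsub>Lmod I vt A\<^esub> f = (\<lambda>_. \<zero>\<^bsub>K\<^esub>)" by (auto simp: vsoc_def vpart_def)
  have "f z = \<zero>\<^bsub>K\<^esub>" if z: "z \<notin> ?J" for z
  proof (cases "z \<in> none_at (\<lambda>i. vt i = w) \<union> some_at (\<lambda>a. tgt a = w)")
    case True
    with z obtain i a where i: "z = (i, None)" "(i, a) \<in> A" by auto
    have "(arr a \<odot>\<^bsub>Lmod I vt A\<^esub> f) (i, Some a) = \<zero>\<^bsub>K\<^esub>" using f(3) LD(4)[OF i(2)] by simp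
    then show ?thesis using i f(1) LD by auto
  next
    case False
    then show ?thesis using f(2)[unfolded vpart_Lmod[OF assms] coord_space_iff] by blast
  qed
  with f(1) show "f \<in> FS.coord_space ?J" by (simp add: coord_space_iff)
next
  note LD = LdataD[OF L]
  fix f assume "f \<in> FS.coord_space ?J"
  then have f: "f \<in> carrier (Lmod I vt A)" "\<And>z. z \<notin> ?J \<Longrightarrow> f z = \<zero>\<^bsub>K\<^esub>" by (auto simp: coord_space_iff)
  have "f \<in> vpart w (Lmod I vt A)"
    unfolding vpart_Lmod[OF assms] coord_space_iff by (intro conjI allI impI f(1) f(2)) auto
  moreover have "arr a \<odot>\<^bsub>Lmod I vt A\<^esub> f = \<zero>\<^bsub>Lmod I vt A\<^esub>" if "a \<in> E" for a
  proof (rule pair_option_ext)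
    fix i show "(arr a \<odot>\<^bsub>Lmod I vt A\<^esub> f) (i, None) = \<zero>\<^bsub>Lmod I vt A\<^esub> (i, None)"
      using f(1) LD by auto
    fix b show "(arr a \<odot>\<^bsub>Lmod I vt A\<^esub> f) (i, Some b) = \<zero>\<^bsub>Lmod I vt A\<^esub> (i, Some b)"
      using f(1) f(2)[of "(i, None)"] LD by auto
  qed
  ultimately show "f \<in> vsoc w (Lmod I vt A)" by (simp add: vsoc_def vpart_def)
qed

lemma card_none_at: "card (none_at P) = card {i \<in> I. P i}"
proof -
  have "none_at P = (\<lambda>i. (i, None)) ` {i \<in> I. P i}" by auto
  then show ?thesis by (simp add: card_image inj_on_def)
qed

lemma card_some_at: "card (some_at P) = card {(i, a). (i, a) \<in> A \<and> P a}"
proof -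
  have "some_at P = (\<lambda>(i, a). (i, Some a)) ` {(i, a). (i, a) \<in> A \<and> P a}" by force
  then show ?thesis by (simp add: card_image inj_on_def)
qed

lemma finite_none_some: "finite (none_at P)" "finite (some_at Q)"
  by (rule finite_subset[OF _ finite_Lsupp[OF L]]; auto)+

lemma none_some_card: "card (none_at P \<union> some_at Q) = card {i \<in> I. P i} + card {(i, a). (i, a) \<in> A \<and> Q a}"
  using finite_none_some by (subst card_Un_disjoint) (auto simp: card_none_at card_some_at)

text \<open>All four subspaces are spanned by coordinate vectors, so their dimensions are numbers of
  coordinates.\<close>

lemma mdim_Lmod:
  shows "w \<in> V \<Longrightarrow> mdim (Lmod I vt A) (vpart w (Lmod I vt A)) = card {i \<in> I. vt i = w} + card {(i, a). (i, a) \<in> A \<and> tgt a = w}"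
    and "mdim (Lmod I vt A) (vrad w (Lmod I vt A)) = card {(i, a). (i, a) \<in> A \<and> tgt a = w}"
    and "w \<in> V \<Longrightarrow> mdim (Lmod I vt A) (vsoc w (Lmod I vt A))
        = card {i \<in> I. vt i = w \<and> (\<forall>a. (i, a) \<notin> A)} + card {(i, a). (i, a) \<in> A \<and> tgt a = w}"
    and "b \<in> E \<Longrightarrow> mdim (Lmod I vt A) (aimage b (Lmod I vt A)) = card {(i, a). (i, a) \<in> A \<and> a = b}"
proof -
  show "mdim (Lmod I vt A) (vpart w (Lmod I vt A)) = card {i \<in> I. vt i = w} + card {(i, a). (i, a) \<in> A \<and> tgt a = w}"
    if "w \<in> V"
    unfolding vpart_Lmod[OF that] none_some_card[symmetric] by (rule FS.kdim_coord_space) auto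
  show "mdim (Lmod I vt A) (vrad w (Lmod I vt A)) = card {(i, a). (i, a) \<in> A \<and> tgt a = w}"
    unfolding vrad_Lmod card_some_at[symmetric] by (rule FS.kdim_coord_space) auto
  show "mdim (Lmod I vt A) (vsoc w (Lmod I vt A))
      = card {i \<in> I. vt i = w \<and> (\<forall>a. (i, a) \<notin> A)} + card {(i, a). (i, a) \<in> A \<and> tgt a = w}" if "w \<in> V"
    unfolding vsoc_Lmod[OF that] none_some_card[symmetric] by (rule FS.kdim_coord_space) auto
  show "mdim (Lmod I vt A) (aimage b (Lmod I vt A)) = card {(i, a). (i, a) \<in> A \<and> a = b}" if "b \<in> E"
    unfolding aimage_Lmod[OF that] card_some_at[symmetric] by (rule FS.kdim_coord_space) auto
qed

end

end

section \<open>Syzygies\<close>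

context rad_sq_zero
begin

text \<open>The multiplicity of the simple at \<open>w\<close> in the syzygy. The difference at
  \<open>src a\<close> counts the summands of the projective cover at that vertex, so the sum is the
  dimension at \<open>w\<close> of the radical of the cover. The kernel lies in this radical, and
  the quotient is the radical of \<open>M\<close>. Integer values make the expression additive on
  all modules.\<close>

definition syz :: "('r, 'b, 'z) module_scheme \<Rightarrow> 'v \<Rightarrow> int" where
  "syz M w = (\<Sum>a\<in>{a \<in> E. tgt a = w}. int (mdim M (vpart (src a) M)) - int (mdim M (vrad (src a) M)))
     - int (mdim M (vrad w M))"

lemma mdim_carrier: "mdim (M\<lparr>carrier := H\<rparr>) W = mdim M W"
  by (simp add: kdim_def kmod_def)

lemma None_zero_arr:
  assumes L: "Ldata I vt A" and f: "f \<in> carrier (Lmod I vt A)" "\<And>i. f (i, None) = \<zero>\<^bsub>K\<^esub>" and a: "a \<in> E"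
  shows "arr a \<odot>\<^bsub>Lmod I vt A\<^esub> f = \<zero>\<^bsub>Lmod I vt A\<^esub>"
  by (rule pair_option_ext) (use f a LdataD[OF L] in auto)

text \<open>Rank and nullity of \<open>p\<close> on the part at \<open>w\<close> and on the radical
  part at \<open>w\<close> involve the same kernel, because the kernel has no idempotent
  coordinates. The difference of the two equations counts the generators at \<open>w\<close>. The
  radical equation, with the radical of the cover counted arrow by arrow, gives
  \<open>syz\<close>.\<close>

lemma
  assumes M: "right_module R M" and L: "Ldata I vt (arrows_at I vt)"
    and p: "p \<in> rmod_hom R (Lmod I vt (arrows_at I vt)) M" "p ` carrier (Lmod I vt (arrows_at I vt)) = carrier M"
    and ker: "\<And>f i. f \<in> carrier (Lmod I vt (arrows_at I vt)) \<Longrightarrow> p f = \<zero>\<^bsub>M\<^esub> \<Longrightarrow> f (i, None) = \<zero>\<^bsub>K\<^esub>"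
    and w: "w \<in> V"
  shows syz_cover: "int (mdim (Lmod I vt (arrows_at I vt)) {f \<in> vpart w (Lmod I vt (arrows_at I vt)). p f = \<zero>\<^bsub>M\<^esub>}) = syz M w"
    and top_cover: "int (mdim M (vpart w M)) - int (mdim M (vrad w M)) = int (card {i \<in> I. vt i = w})"
proof -
  let ?A = "arrows_at I vt"
  let ?L = "Lmod I vt ?A"
  note LM = Lmod_right_module[OF L]
  interpret VL: vectorspace K "kmod ?L" by (rule kmod_vectorspace[OF LM])
  interpret p: rmod_map R ?L M p by (rule rmod_mapI[OF LM M p(1)])
  have rn: "mdim ?L W = mdim ?L {x \<in> W. p x = \<zero>\<^bsub>M\<^esub>} + mdim M (p ` W)"
    if "subspace K W (kmod ?L)" for W
  proof -
    have "W \<subseteq> carrier ?L" using that by (auto simp: subspace_def submodule_def)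
    then show ?thesis
      using VL.rank_nullity_subspace[OF Lmod_fin_dim[OF L] that kmod_vectorspace[OF M] rmod_hom_linear[OF LM p(1)]]
      by simp
  qed
  define \<kappa> where "\<kappa> w = mdim ?L {f \<in> vpart w ?L. p f = \<zero>\<^bsub>M\<^esub>}" for w
  have img: "p ` vpart w ?L = vpart w M" for w
  proof (intro equalityI hom_vpart[OF p(1)] subsetI)
    fix y assume "y \<in> vpart w M"
    then have y: "y \<in> carrier M" "idem w \<odot>\<^bsub>M\<^esub> y = y" by (auto simp: vpart_def)
    then obtain x where x: "x \<in> carrier ?L" "y = p x" unfolding p(2)[symmetric] by blast
    have "p (idem w \<odot>\<^bsub>?L\<^esub> x) = y" using p.smult[OF idem(1) x(1), of w] y x by simp
    moreover have "idem w \<odot>\<^bsub>?L\<^esub> x \<in> vpart w ?L"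
      unfolding vpart_def using x p.M.smult_closed[OF idem(1) x(1)] p.M.smult_mult[of "idem w" "idem w" x]
      by (auto simp: idem_mult simp del: Lmod_simps)
    ultimately show "y \<in> p ` vpart w ?L" by (metis image_eqI)
  qed
  have m: "mdim ?L (vpart w ?L) = \<kappa> w + mdim M (vpart w M)" for w
    using rn[OF vpart_subspace[OF LM]] img by (simp add: \<kappa>_def)
  \<comment> \<open>The two subspaces of the cover differ only in the idempotent coordinates, and
    these vanish on the kernel.\<close>
  have sub: "{f \<in> vrad w ?L. p f = \<zero>\<^bsub>M\<^esub>} = {f \<in> vpart w ?L. p f = \<zero>\<^bsub>M\<^esub>}" if w: "w \<in> V" for w
  proof (intro equalityI subsetI)
    fix f assume "f \<in> {f \<in> vrad w ?L. p f = \<zero>\<^bsub>M\<^esub>}"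
    then show "f \<in> {f \<in> vpart w ?L. p f = \<zero>\<^bsub>M\<^esub>}"
      unfolding vrad_Lmod[OF L] vpart_Lmod[OF L w] mem_Collect_eq coord_space_iff[OF L] by auto
  next
    fix f assume "f \<in> {f \<in> vpart w ?L. p f = \<zero>\<^bsub>M\<^esub>}"
    then have f: "f \<in> vpart w ?L" "p f = \<zero>\<^bsub>M\<^esub>" by auto
    then have fc: "f \<in> carrier ?L" by (simp add: vpart_def)
    have "f z = \<zero>\<^bsub>K\<^esub>" if "z \<notin> {(i, Some a) | i a. (i, a) \<in> ?A \<and> tgt a = w}" for z
    proof (cases "snd z")
      case None
      then show ?thesis using ker[OF fc f(2), of "fst z"] by (metis prod.collapse)
    next
      case (Some a)
      then obtain i where "z = (i, Some a)" by (cases z) auto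
      then have "z \<notin> {(i, None) | i. i \<in> I \<and> vt i = w} \<union> {(i, Some a) | i a. (i, a) \<in> ?A \<and> tgt a = w}"
        using that by auto
      then show ?thesis using f(1)[unfolded vpart_Lmod[OF L w] coord_space_iff[OF L]] by blast
    qed
    then have "f \<in> vrad w ?L" unfolding vrad_Lmod[OF L] coord_space_iff[OF L] using fc by blast
    with f show "f \<in> {f \<in> vrad w ?L. p f = \<zero>\<^bsub>M\<^esub>}" by simp
  qed
  have rho: "mdim ?L (vrad w ?L) = \<kappa> w + mdim M (vrad w M)" if "w \<in> V" for w
    using rn[OF vrad_subspace[OF LM], of w] hom_vrad(2)[OF LM M p] sub[OF that] by (simp add: \<kappa>_def)
  have n: "int (mdim M (vpart w M)) - int (mdim M (vrad w M)) = int (card {i \<in> I. vt i = w})" if "w \<in> V" for w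
    using m[of w] rho[OF that] mdim_Lmod(1)[OF L that] mdim_Lmod(2)[OF L, of w] by simp
  have "card {(i, a). (i, a) \<in> ?A \<and> tgt a = w} = (\<Sum>a\<in>{a \<in> E. tgt a = w}. card {i \<in> I. vt i = src a})"
  proof -
    have "{(i, a). (i, a) \<in> ?A \<and> tgt a = w} = prod.swap ` (SIGMA a:{a \<in> E. tgt a = w}. {i \<in> I. vt i = src a})"
      by (auto simp: arrows_at_def image_iff)
    then show ?thesis using finite_E LdataD(1)[OF L] by (simp add: card_image)
  qed
  then have "int (mdim ?L (vrad w ?L)) = (\<Sum>a\<in>{a \<in> E. tgt a = w}. int (card {i \<in> I. vt i = src a}))"
    using mdim_Lmod(2)[OF L, of w] by simp
  also have "\<dots> = (\<Sum>a\<in>{a \<in> E. tgt a = w}. int (mdim M (vpart (src a) M)) - int (mdim M (vrad (src a) M)))"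
    by (rule sum.cong) (auto simp: n)
  finally have "int (\<kappa> w) = syz M w" using rho[OF w] by (simp add: syz_def)
  then show "int (mdim ?L {f \<in> vpart w ?L. p f = \<zero>\<^bsub>M\<^esub>}) = syz M w" by (simp add: \<kappa>_def)
  show "int (mdim M (vpart w M)) - int (mdim M (vrad w M)) = int (card {i \<in> I. vt i = w})" by (rule n[OF w])
qed

text \<open>By \<open>projective_Lmod\<close> the projective in the definition is an
  \<open>Lmod\<close> with all arrows. Superfluity of the kernel forces it into the radical, so all
  arrows kill it and \<open>syz_cover\<close> computes its dimensions.\<close>

lemma is_syzygyD:
  assumes "is_syzygy R M N"
  shows "M \<in> fg_rmodules R" "N \<in> fg_rmodules R" "a \<in> E \<Longrightarrow> y \<in> carrier N \<Longrightarrow> arr a \<odot>\<^bsub>N\<^esub> y = \<zero>\<^bsub>N\<^esub>"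
    "w \<in> V \<Longrightarrow> int (mdim N (vpart w N)) = syz M w"
proof -
  from assms obtain P f where N: "N \<in> fg_rmodules R" and cov: "projective_cover R P M f"
    and iso: "rmod_isomorphic R N (P\<lparr>carrier := rmod_kernel P M f\<rparr>)" by (auto simp: is_syzygy_def)
  from cov have P: "projective R P" and Mfg: "M \<in> fg_rmodules R" and f: "f \<in> rmod_hom R P M" "f ` carrier P = carrier M"
    and sup: "\<And>H. Module.submodule H R P \<Longrightarrow> H <+>\<^bsub>P\<^esub> rmod_kernel P M f = carrier P \<Longrightarrow> H = carrier P"
    by (auto simp: projective_cover_def)
  show "M \<in> fg_rmodules R" "N \<in> fg_rmodules R" by fact+
  have Pfg: "P \<in> fg_rmodules R" using P by (simp add: projective_def)
  note MM = fg_rmodulesD[OF Mfg] and PM = fg_rmodulesD[OF Pfg] and NM = fg_rmodulesD[OF N]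
  obtain I :: "((nat \<Rightarrow> 'r) set \<times> 'v) set" and vt where L: "Ldata I vt (arrows_at I vt)" and
    LP: "rmod_isomorphic R (Lmod I vt (arrows_at I vt)) P" using projective_Lmod[OF P] by metis
  let ?A = "arrows_at I vt"
  let ?L = "Lmod I vt ?A"
  note LM = Lmod_right_module[OF L]
  from LP obtain e where e: "e \<in> rmod_hom R ?L P" "bij_betw e (carrier ?L) (carrier P)" by (auto simp: rmod_isomorphic_def)
  define p where "p x = f (e x)" for x
  have p: "p \<in> rmod_hom R ?L M" unfolding p_def by (rule rmod_hom_comp[OF e(1) f(1)])
  have psurj: "p ` carrier ?L = carrier M"
  proof -
    have "p ` carrier ?L = f ` (e ` carrier ?L)" unfolding p_def by (rule image_image[symmetric])
    also have "\<dots> = carrier M" using e(2) f(2) by (simp add: bij_betw_def)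
    finally show ?thesis .
  qed
  interpret e: rmod_map R ?L P e by (rule rmod_mapI[OF LM PM(1) e(1)])
  interpret f: rmod_map R P M f by (rule rmod_mapI[OF PM(1) MM(1) f(1)])
  have esurj: "\<exists>k\<in>carrier ?L. y = e k" if "y \<in> carrier P" for y
  proof -
    have "y \<in> e ` carrier ?L" using that unfolding bij_betw_imp_surj_on[OF e(2)] .
    then obtain k where "y = e k" "k \<in> carrier ?L" by (rule imageE)
    then show ?thesis by (rule bexI)
  qed
  interpret p: rmod_map R ?L M p by (rule rmod_mapI[OF LM MM(1) p])
  \<comment> \<open>A kernel element with a nonzero coordinate at the generator \<open>i\<close>
    could absorb this coordinate of every element. The submodule \<open>H\<close> where the
    coordinate vanishes and the kernel would together be everything, although \<open>H\<close>
    misses the generator itself.\<close>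
  have ker: "k (i, None) = \<zero>\<^bsub>K\<^esub>" if k: "k \<in> carrier ?L" "p k = \<zero>\<^bsub>M\<^esub>" for k i
  proof (rule ccontr)
    assume ki: "k (i, None) \<noteq> \<zero>\<^bsub>K\<^esub>"
    then have i: "i \<in> I" using Lmod_outside(1)[OF k(1)] by blast
    define H where "H = {h \<in> carrier ?L. h (i, None) = \<zero>\<^bsub>K\<^esub>}"
    have H: "Module.submodule H R ?L"
      unfolding e.M.submodule_iff
    proof (intro conjI ballI)
      show "x \<oplus>\<^bsub>?L\<^esub> y \<in> H" if "x \<in> H" "y \<in> H" for x y
        using that e.M.M.add.m_closed[of x y] by (simp add: H_def)
      show "r \<odot>\<^bsub>?L\<^esub> x \<in> H" if "r \<in> carrier R" "x \<in> H" for r x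
        using that e.M.smult_closed[of r x] LdataD(2)[OF L i] by (simp add: H_def)
      show "\<zero>\<^bsub>?L\<^esub> \<in> H" using e.M.M.zero_closed by (simp add: H_def)
    qed (auto simp: H_def)
    have "(e ` H) <+>\<^bsub>P\<^esub> rmod_kernel P M f = carrier P"
    proof (intro equalityI subsetI)
      fix x assume "x \<in> (e ` H) <+>\<^bsub>P\<^esub> rmod_kernel P M f"
      then show "x \<in> carrier P" by (auto simp: set_add_def' H_def rmod_kernel_def)
    next
      fix x assume "x \<in> carrier P"
      then obtain h where h: "h \<in> carrier ?L" "x = e h" using e(2) by (auto simp: bij_betw_def)
      define c where "c = h (i, None) \<otimes>\<^bsub>K\<^esub> inv\<^bsub>K\<^esub> k (i, None)"
      have ku: "k (i, None) \<in> Units K" using ki k(1) K.field_Units by auto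
      have c: "c \<in> carrier K" using h(1) ku by (simp add: c_def)
      have ck: "c \<otimes>\<^bsub>K\<^esub> k (i, None) = h (i, None)"
        using h(1) k(1) ku by (simp add: c_def K.m_assoc)
      let ?k = "scal c \<odot>\<^bsub>?L\<^esub> k"
      have kc: "?k \<in> carrier ?L" using c k(1) by (simp add: e.M.smult_closed)
      have hk: "h \<ominus>\<^bsub>?L\<^esub> ?k \<in> carrier ?L" using h(1) kc by (rule e.M.M.minus_closed)
      have sum: "h = (h \<ominus>\<^bsub>?L\<^esub> ?k) \<oplus>\<^bsub>?L\<^esub> ?k"
        using h(1) kc unfolding a_minus_def by (simp only: e.M.M.a_assoc e.M.M.l_neg e.M.M.r_zero e.M.M.a_inv_closed)
      then have "h (i, None) = (h \<ominus>\<^bsub>?L\<^esub> ?k) (i, None) \<oplus>\<^bsub>K\<^esub> ?k (i, None)" by (metis Lmod_simps(2))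
      moreover have "?k (i, None) = h (i, None)" using Lmod_scal[OF L c k(1)] ck by simp
      ultimately have "(h \<ominus>\<^bsub>?L\<^esub> ?k) (i, None) = \<zero>\<^bsub>K\<^esub>"
        using Lmod_closed[OF hk, of "(i, None)"] Lmod_closed[OF h(1), of "(i, None)"] by (metis K.add.r_cancel_one)
      then have "h \<ominus>\<^bsub>?L\<^esub> ?k \<in> H" using hk by (simp add: H_def)
      moreover have "e ?k \<in> rmod_kernel P M f"
        using kc p.smult[of "scal c" k] c k by (simp add: rmod_kernel_def p_def[symmetric] f.N.smult_closed)
      moreover have "x = e (h \<ominus>\<^bsub>?L\<^esub> ?k) \<oplus>\<^bsub>P\<^esub> e ?k" using sum h hk kc by (metis e.add)
      ultimately show "x \<in> (e ` H) <+>\<^bsub>P\<^esub> rmod_kernel P M f" unfolding set_add_def' by blast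
    qed
    then have "e ` H = carrier P" by (rule sup[OF e.image_submodule[OF H]])
    then have "e (Lbasis (i, None)) \<in> e ` H" using Lbasis_homogeneous(1)[OF L i] by simp
    then have "Lbasis (i, None) \<in> H"
      using inj_on_image_mem_iff[of e "carrier ?L" "Lbasis (i, None)" H] Lbasis_homogeneous(1)[OF L i] e(2)
      by (auto simp: bij_betw_def H_def)
    then show False by (simp add: H_def Lbasis_def)
  qed
  let ?N = "P\<lparr>carrier := rmod_kernel P M f\<rparr>"
  have N': "right_module R ?N" by (rule e.N.submodule_right_module[OF f.kernel_submodule])
  from iso obtain g where g: "g \<in> rmod_hom R N ?N" "bij_betw g (carrier N) (carrier ?N)" by (auto simp: rmod_isomorphic_def)
  have ss: "arr a \<odot>\<^bsub>P\<^esub> y = \<zero>\<^bsub>P\<^esub>" if a: "a \<in> E" and "y \<in> rmod_kernel P M f" for a y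
  proof -
    from that have y: "y \<in> carrier P" "f y = \<zero>\<^bsub>M\<^esub>" by (auto simp: rmod_kernel_def)
    then obtain k where k: "k \<in> carrier ?L" "y = e k" using esurj by blast
    then have "k (i, None) = \<zero>\<^bsub>K\<^esub>" for i using ker[of k i] y by (simp add: p_def)
    then have "arr a \<odot>\<^bsub>?L\<^esub> k = \<zero>\<^bsub>?L\<^esub>" by (rule None_zero_arr[OF L k(1) _ a])
    then show ?thesis using e.smult[OF arr(1) k(1), of a] k(2) e.zero by simp
  qed
  interpret g: rmod_map R N ?N g by (rule rmod_mapI[OF NM(1) N' g(1)])
  show "arr a \<odot>\<^bsub>N\<^esub> y = \<zero>\<^bsub>N\<^esub>" if a: "a \<in> E" and y: "y \<in> carrier N" for a y
  proof -
    have "g y \<in> rmod_kernel P M f" using g.closed[OF y] by simp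
    then have gz: "g (arr a \<odot>\<^bsub>N\<^esub> y) = \<zero>\<^bsub>?N\<^esub>" using ss[OF a] g.smult[OF arr(1) y, of a] by simp
    have *: "\<forall>x\<in>carrier N. g x = \<zero>\<^bsub>?N\<^esub> \<longrightarrow> x = \<zero>\<^bsub>N\<^esub>"
      using g.inj_iff_kernel bij_betw_imp_inj_on[OF g(2)] by simp
    show ?thesis by (rule mp[OF bspec[OF * g.M.smult_closed[OF arr(1) y]] gz])
  qed
  assume w: "w \<in> V"
  have "g ` vpart w N = vpart w ?N"
    by (rule iso_image_eq[OF NM(1) g hom_vpart[OF g(1)] hom_vpart[OF rmod_hom_inverse[OF NM(1) g]]]) (auto simp: vpart_def)
  then have "mdim N (vpart w N) = mdim ?N (vpart w ?N)"
    using mdim_iso[OF NM(1) N' NM(2) g(1) _ vpart_subspace[OF NM(1)], of w] g(2) by (simp add: bij_betw_def)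
  also have "\<dots> = mdim P {y \<in> rmod_kernel P M f. idem w \<odot>\<^bsub>P\<^esub> y = y}" by (simp add: mdim_carrier vpart_def)
  also have "{y \<in> rmod_kernel P M f. idem w \<odot>\<^bsub>P\<^esub> y = y} = e ` {k \<in> vpart w ?L. p k = \<zero>\<^bsub>M\<^esub>}"
  proof (intro equalityI subsetI)
    fix y assume "y \<in> {y \<in> rmod_kernel P M f. idem w \<odot>\<^bsub>P\<^esub> y = y}"
    then have y: "y \<in> carrier P" "f y = \<zero>\<^bsub>M\<^esub>" "idem w \<odot>\<^bsub>P\<^esub> y = y" by (auto simp: rmod_kernel_def)
    then obtain k where k: "k \<in> carrier ?L" "y = e k" using esurj by blast
    have "e (idem w \<odot>\<^bsub>?L\<^esub> k) = e k" using e.smult[OF idem(1) k(1), of w] y k by simp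
    then have "idem w \<odot>\<^bsub>?L\<^esub> k = k"
      using e(2) k(1) e.M.smult_closed[OF idem(1) k(1)] by (metis bij_betw_def inj_onD)
    then show "y \<in> e ` {k \<in> vpart w ?L. p k = \<zero>\<^bsub>M\<^esub>}" using k y by (auto simp: vpart_def p_def)
  next
    fix y assume "y \<in> e ` {k \<in> vpart w ?L. p k = \<zero>\<^bsub>M\<^esub>}"
    then obtain k where k: "k \<in> carrier ?L" "idem w \<odot>\<^bsub>?L\<^esub> k = k" "f (e k) = \<zero>\<^bsub>M\<^esub>" "y = e k"
      by (auto simp: vpart_def p_def)
    then show "y \<in> {y \<in> rmod_kernel P M f. idem w \<odot>\<^bsub>P\<^esub> y = y}"
      using e.smult[OF idem(1) k(1), of w] by (simp add: rmod_kernel_def)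
  qed
  also have "mdim P (e ` {k \<in> vpart w ?L. p k = \<zero>\<^bsub>M\<^esub>}) = mdim ?L {k \<in> vpart w ?L. p k = \<zero>\<^bsub>M\<^esub>}"
  proof (rule mdim_iso[OF LM PM(1) Lmod_fg[OF L] e(1)])
    show "inj_on e (carrier ?L)" using e(2) by (simp add: bij_betw_def)
    interpret VL: vectorspace K "kmod ?L" by (rule kmod_vectorspace[OF LM])
    have v: "subspace K (vpart w ?L) (kmod ?L)" by (rule vpart_subspace[OF LM])
    then have vv: "vpart w ?L \<subseteq> carrier ?L" "\<zero>\<^bsub>?L\<^esub> \<in> vpart w ?L"
      "\<And>x y. x \<in> vpart w ?L \<Longrightarrow> y \<in> vpart w ?L \<Longrightarrow> x \<oplus>\<^bsub>?L\<^esub> y \<in> vpart w ?L"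
      "\<And>c x. c \<in> carrier K \<Longrightarrow> x \<in> vpart w ?L \<Longrightarrow> scal c \<odot>\<^bsub>?L\<^esub> x \<in> vpart w ?L"
      by (auto simp: subspace_def submodule_def simp del: Lmod_simps)
    show "subspace K {k \<in> vpart w ?L. p k = \<zero>\<^bsub>M\<^esub>} (kmod ?L)"
    proof (rule VL.subspaceI)
      fix x y assume "x \<in> {k \<in> vpart w ?L. p k = \<zero>\<^bsub>M\<^esub>}" "y \<in> {k \<in> vpart w ?L. p k = \<zero>\<^bsub>M\<^esub>}"
      then show "x \<oplus>\<^bsub>kmod ?L\<^esub> y \<in> {k \<in> vpart w ?L. p k = \<zero>\<^bsub>M\<^esub>}"
        using vv(1,3) p.add[of x y] by (auto simp del: Lmod_simps)
    next
      fix c x assume "c \<in> carrier K" "x \<in> {k \<in> vpart w ?L. p k = \<zero>\<^bsub>M\<^esub>}"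
      then show "c \<odot>\<^bsub>kmod ?L\<^esub> x \<in> {k \<in> vpart w ?L. p k = \<zero>\<^bsub>M\<^esub>}"
        using vv(1,4) p.smult[of "scal c" x] by (auto simp del: Lmod_simps)
    qed (use vv(1,2) p.zero in \<open>auto simp del: Lmod_simps\<close>)
  qed
  finally show "int (mdim N (vpart w N)) = syz M w" using syz_cover[OF MM(1) L p psurj _ w] ker by simp
qed

text \<open>The elements without idempotent coordinates form the radical, so they are sums of arrow
  multiples of the generators.\<close>

lemma None_zero_in_submodule:
  assumes L: "Ldata I vt A" and H: "Module.submodule H R (Lmod I vt A)"
    and rad: "\<And>a x. a \<in> E \<Longrightarrow> x \<in> carrier (Lmod I vt A) \<Longrightarrow> arr a \<odot>\<^bsub>Lmod I vt A\<^esub> x \<in> H"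
    and f: "f \<in> carrier (Lmod I vt A)" "\<And>i. f (i, None) = \<zero>\<^bsub>K\<^esub>"
  shows "f \<in> H"
proof -
  let ?L = "Lmod I vt A"
  note LM = Lmod_right_module[OF L]
  interpret L: right_module R ?L by (rule LM)
  from H have Hc: "H \<subseteq> carrier ?L" "\<zero>\<^bsub>?L\<^esub> \<in> H" "\<And>x y. x \<in> H \<Longrightarrow> y \<in> H \<Longrightarrow> x \<oplus>\<^bsub>?L\<^esub> y \<in> H"
    "\<And>r x. r \<in> carrier R \<Longrightarrow> x \<in> H \<Longrightarrow> r \<odot>\<^bsub>?L\<^esub> x \<in> H"
    unfolding L.submodule_iff by (auto simp del: Lmod_simps)
  have "elt vt A f i \<odot>\<^bsub>?L\<^esub> Lbasis (i, None) \<in> H" if i: "i \<in> I" for i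
  proof (rule rad_induct[of "elt vt A f i" "\<lambda>t. t \<odot>\<^bsub>?L\<^esub> Lbasis (i, None) \<in> H"])
    note b = Lbasis_homogeneous(1)[OF L i]
    show "elt vt A f i \<in> carrier R" using f by simp
    show "cv v (elt vt A f i) = \<zero>\<^bsub>K\<^esub>" if "v \<in> V" for v using that f by simp
    show "\<zero> \<odot>\<^bsub>?L\<^esub> Lbasis (i, None) \<in> H" using L.zero_smult[OF b] Hc(2) by simp
    fix a assume a: "a \<in> E"
    have "ca a (elt vt A f i) \<in> carrier K" using a f by simp
    then show "(arr a \<otimes> scal (ca a (elt vt A f i))) \<odot>\<^bsub>?L\<^esub> Lbasis (i, None) \<in> H"
      using L.smult_mult[of "arr a" "scal (ca a (elt vt A f i))", OF _ _ b] Hc(4)[OF _ rad[OF a b]] by simp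
  next
    fix x y assume "x \<in> carrier R" "y \<in> carrier R" "x \<odot>\<^bsub>?L\<^esub> Lbasis (i, None) \<in> H" "y \<odot>\<^bsub>?L\<^esub> Lbasis (i, None) \<in> H"
    then show "(x \<oplus> y) \<odot>\<^bsub>?L\<^esub> Lbasis (i, None) \<in> H"
      using Hc(3) L.smult_add_scalar[OF _ _ Lbasis_homogeneous(1)[OF L i]] by metis
  qed
  then have "Lmap ?L I vt A (\<lambda>i. Lbasis (i, None)) f \<in> H"
    unfolding Lmap_def by (intro subspace_finsum[OF LM submodule_subspace[OF LM H]] LdataD(1)[OF L])
  then show ?thesis using Lmod_expand[OF L f(1)] by simp
qed

lemma syzygy_exists:
  assumes Mfg: "M \<in> fg_rmodules R"
  shows "\<exists>N. is_syzygy R M N"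
proof -
  note MM = fg_rmodulesD[OF Mfg]
  obtain I :: "((nat \<Rightarrow> 'r) set \<times> 'v) set" and vt p where L: "Ldata I vt (arrows_at I vt)" and
    p: "p \<in> rmod_hom R (Lmod I vt (arrows_at I vt)) M" "p ` carrier (Lmod I vt (arrows_at I vt)) = carrier M"
    and ker: "\<And>f i. f \<in> carrier (Lmod I vt (arrows_at I vt)) \<Longrightarrow> p f = \<zero>\<^bsub>M\<^esub> \<Longrightarrow> f (i, None) = \<zero>\<^bsub>K\<^esub>"
    using cover_exists[OF MM] by metis
  let ?L = "Lmod I vt (arrows_at I vt)"
  note LM = Lmod_right_module[OF L]
  let ?P = "fg_copy R ?L"
  note P = fg_copy[OF LM Lmod_fg[OF L]]
  note PM = fg_rmodulesD[OF P(1)]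
  from P(2) obtain e where e: "e \<in> rmod_hom R ?L ?P" "bij_betw e (carrier ?L) (carrier ?P)" by (auto simp: rmod_isomorphic_def)
  let ?e' = "the_inv_into (carrier ?L) e"
  have e': "?e' \<in> rmod_hom R ?P ?L" by (rule rmod_hom_inverse[OF LM e])
  have ee: "?e' ` carrier ?P = carrier ?L" using bij_betw_the_inv_into[OF e(2)] by (simp add: bij_betw_def)
  have ee': "e (?e' x) = x" if "x \<in> carrier ?P" for x using f_the_inv_into_f_bij_betw[OF e(2)] that by simp
  have e'e: "?e' (e x) = x" if "x \<in> carrier ?L" for x
    using the_inv_into_f_f[of e "carrier ?L"] e(2) that by (simp add: bij_betw_def)
  define f where "f x = p (?e' x)" for x
  have f: "f \<in> rmod_hom R ?P M" unfolding f_def by (rule rmod_hom_comp[OF e' p(1)])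
  have fs: "f ` carrier ?P = carrier M"
  proof -
    have "f ` carrier ?P = p ` (?e' ` carrier ?P)" unfolding f_def by (rule image_image[symmetric])
    also have "\<dots> = carrier M" unfolding ee by (rule p(2))
    finally show ?thesis .
  qed
  interpret e: rmod_map R ?L ?P e by (rule rmod_mapI[OF LM PM(1) e(1)])
  interpret e': rmod_map R ?P ?L ?e' by (rule rmod_mapI[OF PM(1) LM e'])
  interpret f: rmod_map R ?P M f by (rule rmod_mapI[OF PM(1) MM(1) f])
  have kNone: "?e' k (i, None) = \<zero>\<^bsub>K\<^esub>" if "k \<in> rmod_kernel ?P M f" for k i
    using that ker[of "?e' k" i] e'.closed[of k] by (auto simp: rmod_kernel_def f_def)
  have "H = carrier ?P" if H: "Module.submodule H R ?P" "H <+>\<^bsub>?P\<^esub> rmod_kernel ?P M f = carrier ?P" for H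
  proof -
    from H(1) have Hc: "H \<subseteq> carrier ?P" "\<And>x y. x \<in> H \<Longrightarrow> y \<in> H \<Longrightarrow> x \<oplus>\<^bsub>?P\<^esub> y \<in> H"
      "\<And>r x. r \<in> carrier R \<Longrightarrow> x \<in> H \<Longrightarrow> r \<odot>\<^bsub>?P\<^esub> x \<in> H" unfolding e.N.submodule_iff by auto
    have split: "\<exists>h\<in>H. \<exists>k\<in>rmod_kernel ?P M f. x = h \<oplus>\<^bsub>?P\<^esub> k" if "x \<in> carrier ?P" for x
      using that unfolding H(2)[symmetric] set_add_def' by blast
    have kc: "k \<in> carrier ?P" if "k \<in> rmod_kernel ?P M f" for k using that by (simp add: rmod_kernel_def)
    have rad: "arr a \<odot>\<^bsub>?P\<^esub> x \<in> H" if a: "a \<in> E" and x: "x \<in> carrier ?P" for a x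
    proof -
      obtain h k where h: "h \<in> H" and k: "k \<in> rmod_kernel ?P M f" and x: "x = h \<oplus>\<^bsub>?P\<^esub> k" using split[OF x] by blast
      have "?e' (arr a \<odot>\<^bsub>?P\<^esub> k) = \<zero>\<^bsub>?L\<^esub>"
        using e'.smult[OF arr(1) kc[OF k]] None_zero_arr[OF L e'.closed[OF kc[OF k]] kNone[OF k] a] by simp
      then have "arr a \<odot>\<^bsub>?P\<^esub> k = \<zero>\<^bsub>?P\<^esub>"
        using ee'[of "arr a \<odot>\<^bsub>?P\<^esub> k"] e.N.smult_closed[OF arr(1) kc[OF k]] e.zero by simp
      then have "arr a \<odot>\<^bsub>?P\<^esub> x = arr a \<odot>\<^bsub>?P\<^esub> h"
        using x h Hc(1) kc[OF k] e.N.smult_closed[OF arr(1), of h a] by (simp add: e.N.smult_add_vector subset_iff)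
      then show ?thesis using Hc(3)[OF arr(1) h] by simp
    qed
    have "k \<in> H" if k: "k \<in> rmod_kernel ?P M f" for k
    proof -
      have "?e' k \<in> {x \<in> carrier ?L. e x \<in> H}"
      proof (rule None_zero_in_submodule[OF L e.preimage_submodule[OF H(1)] _ e'.closed[OF kc[OF k]] kNone[OF k]])
        fix a x assume "a \<in> E" "x \<in> carrier ?L"
        then show "arr a \<odot>\<^bsub>?L\<^esub> x \<in> {x \<in> carrier ?L. e x \<in> H}"
          using rad[of a "e x"] e.smult[OF arr(1)] e.M.smult_closed[OF arr(1)] by simp
      qed
      then show ?thesis using ee'[OF kc[OF k]] by simp
    qed
    then have "carrier ?P \<subseteq> H" using split Hc(2) by blast
    with Hc(1) show ?thesis by blast
  qed
  moreover have "projective R ?P" by (rule projectiveI[OF L P])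
  ultimately have cov: "projective_cover R ?P M f" using f fs Mfg by (auto simp: projective_cover_def)
  let ?N = "?P\<lparr>carrier := rmod_kernel ?P M f\<rparr>"
  have N: "right_module R ?N" by (rule e.N.submodule_right_module[OF f.kernel_submodule])
  interpret VP: vectorspace K "kmod ?P" by (rule kmod_vectorspace[OF PM(1)])
  have "kmod ?N = VP.vs (rmod_kernel ?P M f)" by (simp add: kmod_def)
  then have "vectorspace.fin_dim K (kmod ?N)"
    using VP.fin_dim_subspace[OF fg_fin_dim[OF PM] submodule_subspace[OF PM(1) f.kernel_submodule]] by simp
  then have fgN: "finitely_generated R ?N" by (rule fin_dim_imp_fg[OF N])
  from fg_copy[OF N fgN] have "is_syzygy R M (fg_copy R ?N)"
    unfolding is_syzygy_def using cov rmod_isomorphic_sym[OF N] by blast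
  then show ?thesis ..
qed

end

section \<open>Classes in \<open>K\<^sub>0\<close>\<close>

lemma hom_finprod:
  assumes G: "comm_group G" and H: "comm_group H" and h: "h \<in> hom G H" and f: "f \<in> A \<rightarrow> carrier G"
  shows "h (finprod G f A) = finprod H (\<lambda>i. h (f i)) A"
proof -
  interpret G: comm_group G by fact
  interpret H: comm_group H by fact
  interpret h: group_hom G H h
    using h by (simp add: group_hom_def group_hom_axioms_def G.group_axioms H.group_axioms)
  from f show ?thesis
  proof (induction A rule: infinite_finite_induct)
    case (insert a A)
    then have "f \<in> A \<rightarrow> carrier G" "f a \<in> carrier G" by auto
    with insert show ?case by (simp add: Pi_def)
  qed auto
qed

lemma comm_group_integer_group: "comm_group integer_group"
  by (rule group.group_comm_groupI) auto

lemma finprod_integer_group: "finprod integer_group f A = sum f A"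
proof -
  interpret comm_group integer_group by (rule comm_group_integer_group)
  show ?thesis by (induction A rule: infinite_finite_induct) auto
qed

context rad_sq_zero
begin

interpretation G: comm_group "K0 R" by (rule comm_group_K0)

section \<open>Classes of the explicit modules\<close>

definition cls :: "('r, 'b, 'z) module_scheme \<Rightarrow> ('r rmodule set \<Rightarrow>\<^sub>0 int) set" where
  "cls M = K0_class R (fg_copy R M)"

lemma cls_closed: "right_module R M \<Longrightarrow> finitely_generated R M \<Longrightarrow> cls M \<in> carrier (K0 R)"
  unfolding cls_def by (rule K0_class_closed) (rule fg_copy)

lemma cls_iso:
  assumes "right_module R M" "finitely_generated R M" "right_module R N" "finitely_generated R N" "rmod_isomorphic R M N"
  shows "cls M = cls N"
  unfolding cls_def
  using fg_copy[OF assms(1,2)] fg_copy[OF assms(3,4)]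
    rmod_isomorphic_trans[OF rmod_isomorphic_sym[OF assms(1)] rmod_isomorphic_trans[OF assms(5)]]
  by (intro K0_class_iso)

lemma cls_self: "M \<in> fg_rmodules R \<Longrightarrow> cls M = K0_class R M"
  unfolding cls_def using fg_copy[OF fg_rmodulesD] rmod_isomorphic_sym[OF fg_rmodulesD(1)]
  by (metis K0_class_iso)

lemma cls_add:
  assumes "right_module R M" "finitely_generated R M" "right_module R N" "finitely_generated R N"
    "right_module R N'" "finitely_generated R N'" "rmod_isomorphic R M (rmod_sum N N')"
  shows "cls M = cls N \<otimes>\<^bsub>K0 R\<^esub> cls N'"
proof -
  note M = fg_copy[OF assms(1,2)] and N = fg_copy[OF assms(3,4)] and N' = fg_copy[OF assms(5,6)]
  have "rmod_isomorphic R (fg_copy R M) (rmod_sum (fg_copy R N) (fg_copy R N'))"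
    using rmod_isomorphic_sym[OF assms(1) M(2)] rmod_isomorphic_trans[OF assms(7) rmod_isomorphic_sum[OF N(2) N'(2)]]
    by (rule rmod_isomorphic_trans)
  then show ?thesis unfolding cls_def by (rule K0_class_add[OF M(1) N(1) N'(1)])
qed

lemma cls_full:
  assumes L: "Ldata I vt (arrows_at I vt)"
  shows "cls (Lmod I vt (arrows_at I vt)) = \<one>\<^bsub>K0 R\<^esub>"
  unfolding cls_def using fg_copy[OF Lmod_right_module[OF L] Lmod_fg[OF L]]
  by (intro K0_class_projective projectiveI[OF L])

definition out :: "'v \<Rightarrow> 'a set" where "out u = {a \<in> E. src a = u}"

text \<open>The quotient of the projective at \<open>u\<close> in which exactly the arrows of
  \<open>B\<close> survive: the simple module for empty \<open>B\<close>, the projective itself for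
  \<open>out u\<close>. Every \<open>Lmod\<close> is a direct sum of such modules.\<close>

definition Lone :: "'v \<Rightarrow> 'a set \<Rightarrow> ('r, unit \<times> 'a option \<Rightarrow> 'k) module" where
  "Lone u B = Lmod {()} (\<lambda>_. u) (Pair () ` B)"

lemma Ldata_one: "u \<in> V \<Longrightarrow> B \<subseteq> out u \<Longrightarrow> Ldata {()} (\<lambda>_. u) (Pair () ` B)"
  by (auto simp: Ldata_def arrows_at_def out_def)

lemma Lone_module:
  assumes "u \<in> V" "B \<subseteq> out u"
  shows "right_module R (Lone u B)" "finitely_generated R (Lone u B)"
  unfolding Lone_def by (rule Lmod_right_module Lmod_fg, rule Ldata_one[OF assms])+

definition simple :: "'v \<Rightarrow> ('r rmodule set \<Rightarrow>\<^sub>0 int) set" where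
  "simple u = cls (Lone u {})"

lemma simple_closed [simp]: "u \<in> V \<Longrightarrow> simple u \<in> carrier (K0 R)"
  unfolding simple_def by (rule cls_closed; rule Lone_module) auto

lemma Lmod_single:
  assumes L: "Ldata I vt A" and i: "i \<in> I"
  shows "rmod_isomorphic R (Lmod {i} vt (sub_arrows {i} A)) (Lone (vt i) {a. (i, a) \<in> A})"
proof -
  have "Ldata {i} vt (sub_arrows {i} A)" by (rule Ldata_sub[OF L]) (use i in auto)
  from Lmod_reindex[OF this, of "\<lambda>_. ()" "\<lambda>_. vt i"]
  have "rmod_isomorphic R (Lmod {i} vt (sub_arrows {i} A)) (Lmod {()} (\<lambda>_. vt i) ((\<lambda>(i, a). ((), a)) ` sub_arrows {i} A))"
    by simp
  moreover have "(\<lambda>(i, a). ((), a)) ` sub_arrows {i} A = Pair () ` {a. (i, a) \<in> A}"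
    by (force simp: sub_arrows_def)
  ultimately show ?thesis by (simp add: Lone_def)
qed

lemma arrows_sub_out: "Ldata I vt A \<Longrightarrow> {a. (i, a) \<in> A} \<subseteq> out (vt i)"
  by (auto simp: Ldata_def arrows_at_def out_def)

lemma cls_Lmod:
  assumes L: "Ldata I vt A"
  shows "cls (Lmod I vt A) = (\<Otimes>\<^bsub>K0 R\<^esub>i\<in>I. cls (Lone (vt i) {a. (i, a) \<in> A}))"
  using LdataD(1)[OF L] L
proof (induction I arbitrary: A)
  case empty
  then have "A = arrows_at {} vt" by (auto simp: Ldata_def arrows_at_def)
  with empty cls_full[of "{}" vt] show ?case by simp
next
  case (insert i I)
  note L = insert.prems
  have sub: "Ldata {i} vt (sub_arrows {i} A)" "Ldata I vt (sub_arrows I A)"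
    by (rule Ldata_sub[OF L]; auto)+
  have I: "insert i I - {i} = I" using insert.hyps by auto
  have c1: "cls (Lone (vt j) {a. (j, a) \<in> A}) \<in> carrier (K0 R)" if "j \<in> insert i I" for j
    using Lone_module[OF LdataD(2)[OF L that] arrows_sub_out[OF L]] by (rule cls_closed)
  have "cls (Lmod (insert i I) vt A) = cls (Lmod {i} vt (sub_arrows {i} A)) \<otimes>\<^bsub>K0 R\<^esub> cls (Lmod I vt (sub_arrows I A))"
    using Lmod_split[OF L, of "{i}"] unfolding I
    by (intro cls_add Lmod_right_module Lmod_fg sub L) auto
  also have "cls (Lmod {i} vt (sub_arrows {i} A)) = cls (Lone (vt i) {a. (i, a) \<in> A})"
    using Lmod_single[OF L, of i] Lone_module[OF LdataD(2)[OF L, of i] arrows_sub_out[OF L, of i]]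
    by (intro cls_iso Lmod_right_module Lmod_fg sub) auto
  also have "cls (Lmod I vt (sub_arrows I A)) = (\<Otimes>\<^bsub>K0 R\<^esub>j\<in>I. cls (Lone (vt j) {a. (j, a) \<in> sub_arrows I A}))"
    by (rule insert.IH[OF sub(2)])
  also have "\<dots> = (\<Otimes>\<^bsub>K0 R\<^esub>j\<in>I. cls (Lone (vt j) {a. (j, a) \<in> A}))"
    by (rule G.finprod_cong') (use c1 in \<open>auto simp: sub_arrows_def\<close>)
  finally show ?case
    using insert.hyps c1 by (subst G.finprod_insert) auto
qed

text \<open>The class of a virtual semisimple module; the multiplicities \<open>x\<close> may be
  negative, so these classes form a subgroup.\<close>

definition semisimple :: "('v \<Rightarrow> int) \<Rightarrow> ('r rmodule set \<Rightarrow>\<^sub>0 int) set" where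
  "semisimple x = (\<Otimes>\<^bsub>K0 R\<^esub>w\<in>V. simple w [^]\<^bsub>K0 R\<^esub> x w)"

lemma semisimple_closed [simp]: "semisimple x \<in> carrier (K0 R)"
  unfolding semisimple_def by (rule G.finprod_closed) auto

lemma semisimple_cong: "(\<And>w. w \<in> V \<Longrightarrow> x w = y w) \<Longrightarrow> semisimple x = semisimple y"
  unfolding semisimple_def by (rule G.finprod_cong') auto

lemma semisimple_add: "semisimple (\<lambda>w. x w + y w) = semisimple x \<otimes>\<^bsub>K0 R\<^esub> semisimple y"
proof -
  have "semisimple (\<lambda>w. x w + y w) = (\<Otimes>\<^bsub>K0 R\<^esub>w\<in>V. simple w [^]\<^bsub>K0 R\<^esub> x w \<otimes>\<^bsub>K0 R\<^esub> simple w [^]\<^bsub>K0 R\<^esub> y w)"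
    unfolding semisimple_def by (rule G.finprod_cong') (auto simp: G.int_pow_mult)
  then show ?thesis unfolding semisimple_def by (simp add: G.finprod_multf Pi_def)
qed

lemma semisimple_zero: "semisimple (\<lambda>_. 0) = \<one>\<^bsub>K0 R\<^esub>"
  unfolding semisimple_def by simp

lemma semisimple_uminus: "semisimple (\<lambda>w. - x w) = inv\<^bsub>K0 R\<^esub> semisimple x"
proof -
  have "semisimple (\<lambda>w. - x w) \<otimes>\<^bsub>K0 R\<^esub> semisimple x = \<one>\<^bsub>K0 R\<^esub>"
    unfolding semisimple_add[symmetric] by (simp add: semisimple_zero)
  then show ?thesis by (metis G.inv_equality semisimple_closed)
qed

lemma semisimple_int_pow: "semisimple x [^]\<^bsub>K0 R\<^esub> (n::int) = semisimple (\<lambda>w. n * x w)"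
proof -
  have nat: "semisimple x [^]\<^bsub>K0 R\<^esub> (m::nat) = semisimple (\<lambda>w. int m * x w)" for m
  proof (induction m)
    case 0 show ?case by (simp add: semisimple_zero)
  next
    case (Suc m)
    then show ?case by (simp add: semisimple_add[symmetric] algebra_simps)
  qed
  show ?thesis
  proof (cases n rule: int_cases2)
    case (nonneg m)
    then show ?thesis by (simp add: nat int_pow_int)
  next
    case (nonpos m)
    then show ?thesis using semisimple_uminus[of "\<lambda>w. int m * x w"] by (simp add: G.int_pow_neg_int nat)
  qed
qed

lemma semisimple_single:
  assumes "v \<in> V"
  shows "semisimple (\<lambda>w. if w = v then 1 else 0) = simple v"
proof -
  have "semisimple (\<lambda>w. if w = v then 1 else 0) = (\<Otimes>\<^bsub>K0 R\<^esub>w\<in>V. if v = w then simple w else \<one>\<^bsub>K0 R\<^esub>)"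
    unfolding semisimple_def by (rule G.finprod_cong') auto
  also have "\<dots> = simple v" by (rule G.finprod_singleton[OF assms finite_V]) auto
  finally show ?thesis .
qed

lemma hom_semisimple:
  assumes H: "comm_group H" and h: "h \<in> hom (K0 R) H"
  shows "h (semisimple x) = (\<Otimes>\<^bsub>H\<^esub>w\<in>V. h (simple w) [^]\<^bsub>H\<^esub> x w)"
proof -
  interpret H: comm_group H by fact
  have "h (semisimple x) = (\<Otimes>\<^bsub>H\<^esub>w\<in>V. h (simple w [^]\<^bsub>K0 R\<^esub> x w))"
    unfolding semisimple_def by (rule hom_finprod[OF comm_group_K0 H h]) auto
  also have "\<dots> = (\<Otimes>\<^bsub>H\<^esub>w\<in>V. h (simple w) [^]\<^bsub>H\<^esub> x w)"
    using hom_in_carrier[OF h] hom_int_pow[OF h _ K0_group H.group_axioms]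
    by (intro H.finprod_cong') auto
  finally show ?thesis .
qed

lemma hom_semisimple_int:
  assumes "h \<in> hom (K0 R) integer_group"
  shows "h (semisimple x) = (\<Sum>w\<in>V. x w * h (simple w))"
  unfolding hom_semisimple[OF comm_group_integer_group assms] finprod_integer_group
  by (simp add: mult.commute)

lemma semisimple_count:
  assumes "finite I" "vt ` I \<subseteq> V"
  shows "(\<Otimes>\<^bsub>K0 R\<^esub>i\<in>I. simple (vt i)) = semisimple (\<lambda>w. int (card {i \<in> I. vt i = w}))"
  using assms
proof (induction I)
  case empty
  then show ?case by (simp add: semisimple_zero)
next
  case (insert i I)
  have "(\<lambda>w. int (card {j \<in> insert i I. vt j = w})) = (\<lambda>w. (if w = vt i then 1 else 0) + int (card {j \<in> I. vt j = w}))"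
  proof
    fix w
    have "{j \<in> insert i I. vt j = w} = (if w = vt i then insert i {j \<in> I. vt j = w} else {j \<in> I. vt j = w})" by auto
    then show "int (card {j \<in> insert i I. vt j = w}) = (if w = vt i then 1 else 0) + int (card {j \<in> I. vt j = w})"
      using insert.hyps by simp
  qed
  then have "semisimple (\<lambda>w. int (card {j \<in> insert i I. vt j = w})) = simple (vt i) \<otimes>\<^bsub>K0 R\<^esub> semisimple (\<lambda>w. int (card {j \<in> I. vt j = w}))"
    using insert.prems by (simp add: semisimple_add semisimple_single)
  then show ?case using insert by (subst G.finprod_insert) (auto simp: image_subset_iff)
qed

lemma mdim_transfer:
  assumes M: "right_module R M" and fg: "finitely_generated R M" and N: "right_module R N" and iso: "rmod_isomorphic R M N"
  shows "mdim N (vpart w N) = mdim M (vpart w M)" "mdim N (vrad w N) = mdim M (vrad w M)"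
    "mdim N (vsoc w N) = mdim M (vsoc w M)" "mdim N (aimage a N) = mdim M (aimage a M)"
proof -
  from iso obtain f where f: "f \<in> rmod_hom R M N" "bij_betw f (carrier M) (carrier N)" by (auto simp: rmod_isomorphic_def)
  note g = rmod_hom_inverse[OF M f]
  note dim = mdim_iso[OF M N fg f(1) bij_betw_imp_inj_on[OF f(2)]]
  interpret N: right_module R N by (rule N)
  have sub: "W \<subseteq> carrier N" if "subspace K W (kmod N)" for W using that by (auto simp: subspace_def submodule_def)
  have "f ` vpart w M = vpart w N"
    by (rule iso_image_eq[OF M f hom_vpart[OF f(1)] hom_vpart[OF g] sub[OF vpart_subspace[OF N]]])
  then show "mdim N (vpart w N) = mdim M (vpart w M)" using dim[OF vpart_subspace[OF M], of w] by simp
  have "f ` vrad w M = vrad w N"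
    by (rule iso_image_eq[OF M f hom_vrad(1)[OF M N f(1)] hom_vrad(1)[OF N M g] sub[OF vrad_subspace[OF N]]])
  then show "mdim N (vrad w N) = mdim M (vrad w M)" using dim[OF vrad_subspace[OF M], of w] by simp
  have "f ` vsoc w M = vsoc w N"
    by (rule iso_image_eq[OF M f hom_vsoc[OF M N f(1)] hom_vsoc[OF N M g] sub[OF vsoc_subspace[OF N]]])
  then show "mdim N (vsoc w N) = mdim M (vsoc w M)" using dim[OF vsoc_subspace[OF M], of w] by simp
  have "f ` aimage a M = aimage a N"
    by (rule iso_image_eq[OF M f hom_aimage[OF f(1)] hom_aimage[OF g] sub[OF aimage_subspace[OF N]]])
  then show "mdim N (aimage a N) = mdim M (aimage a M)" using dim[OF aimage_subspace[OF M], of a] by simp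
qed

lemma mdim_sum:
  assumes M: "M \<in> fg_rmodules R" "M' \<in> fg_rmodules R" "M'' \<in> fg_rmodules R" and iso: "rmod_isomorphic R M (rmod_sum M' M'')"
  shows "mdim M (vpart w M) = mdim M' (vpart w M') + mdim M'' (vpart w M'')"
    "mdim M (vrad w M) = mdim M' (vrad w M') + mdim M'' (vrad w M'')"
    "mdim M (vsoc w M) = mdim M' (vsoc w M') + mdim M'' (vsoc w M'')"
    "mdim M (aimage a M) = mdim M' (aimage a M') + mdim M'' (aimage a M'')"
  by (rule mdim_invariants(2)[OF _ _ M(1,2,3) iso];
      auto intro!: vpart_subspace vrad_subspace vsoc_subspace aimage_subspace fg_rmodulesD(1)
        dest: subsetD[OF hom_vpart] subsetD[OF hom_vrad(1)[OF fg_rmodulesD(1) fg_rmodulesD(1)]]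
          subsetD[OF hom_vsoc[OF fg_rmodulesD(1) fg_rmodulesD(1)]] subsetD[OF hom_aimage])+

lemma syz_transfer:
  assumes "right_module R M" "finitely_generated R M" "right_module R N" "rmod_isomorphic R M N"
  shows "syz N w = syz M w"
  unfolding syz_def mdim_transfer[OF assms] ..

lemma syz_sum:
  assumes "M \<in> fg_rmodules R" "M' \<in> fg_rmodules R" "M'' \<in> fg_rmodules R" "rmod_isomorphic R M (rmod_sum M' M'')"
  shows "syz M w = syz M' w + syz M'' w"
  unfolding syz_def mdim_sum[OF assms] by (simp add: sum.distrib[symmetric] algebra_simps)

text \<open>The identity serves as a cover, with kernel zero.\<close>

lemma syz_full:
  assumes L: "Ldata I vt (arrows_at I vt)" and w: "w \<in> V"
  shows "syz (Lmod I vt (arrows_at I vt)) w = 0"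
proof -
  let ?L = "Lmod I vt (arrows_at I vt)"
  note LM = Lmod_right_module[OF L]
  interpret VL: vectorspace K "kmod ?L" by (rule kmod_vectorspace[OF LM])
  have "{f \<in> vpart w ?L. f = \<zero>\<^bsub>?L\<^esub>} = {\<zero>\<^bsub>kmod ?L\<^esub>}"
    using vpart_subspace[OF LM, of w] by (auto simp: subspace_def submodule_def)
  then have "mdim ?L {f \<in> vpart w ?L. f = \<zero>\<^bsub>?L\<^esub>} = 0" using VL.kdim_zero by simp
  moreover have "int (mdim ?L {f \<in> vpart w ?L. f = \<zero>\<^bsub>?L\<^esub>}) = syz ?L w"
    by (rule syz_cover[OF LM L rmod_hom_id _ _ w]) auto
  ultimately show ?thesis by simp
qed

text \<open>A syzygy is semisimple, so its class is determined by its dimensions at the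
  vertices.\<close>

lemma K0_class_syzygy:
  assumes "is_syzygy R M N"
  shows "K0_class R N = semisimple (syz M)"
proof -
  note N = is_syzygyD(2)[OF assms]
  note NM = fg_rmodulesD[OF N]
  obtain I :: "((nat \<Rightarrow> 'r) set \<times> 'v) set" and vt where L: "Ldata I vt {}" and iso: "rmod_isomorphic R (Lmod I vt {}) N"
    using semisimple_Lmod[OF NM is_syzygyD(3)[OF assms]] by metis
  note LM = Lmod_right_module[OF L] Lmod_fg[OF L]
  have "K0_class R N = cls (Lmod I vt {})"
    unfolding cls_self[OF N, symmetric] by (rule cls_iso[OF LM NM iso, symmetric])
  also have "\<dots> = (\<Otimes>\<^bsub>K0 R\<^esub>i\<in>I. simple (vt i))" unfolding cls_Lmod[OF L] simple_def by simp
  also have "\<dots> = semisimple (\<lambda>w. int (card {i \<in> I. vt i = w}))"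
    by (rule semisimple_count) (use L in \<open>auto simp: Ldata_def\<close>)
  also have "\<dots> = semisimple (syz M)"
  proof (rule semisimple_cong)
    fix w assume w: "w \<in> V"
    have "int (mdim N (vpart w N)) = int (card {i \<in> I. vt i = w})"
      using mdim_transfer(1)[OF LM NM(1) iso] mdim_Lmod(1)[OF L w] by simp
    then show "int (card {i \<in> I. vt i = w}) = syz M w" using is_syzygyD(4)[OF assms w] by simp
  qed
  finally show ?thesis .
qed

lemma K0_hom_eqI:
  assumes "group H" "h \<in> hom (K0 R) H" "h' \<in> hom (K0 R) H" and x: "x \<in> carrier (K0 R)"
    and eq: "\<And>M. M \<in> fg_rmodules R \<Longrightarrow> h (K0_class R M) = h' (K0_class R M)"
  shows "h x = h' x"
proof -
  interpret h: group_hom "K0 R" H h using assms by (simp add: group_hom_def group_hom_axioms_def K0_group)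
  interpret h': group_hom "K0 R" H h' using assms by (simp add: group_hom_def group_hom_axioms_def K0_group)
  from x show ?thesis by (induction rule: K0_induct) (auto simp: eq)
qed

text \<open>Additivity of \<open>syz\<close> and its vanishing on projectives give the endomorphism
  by the universal property. It is the one selected by \<open>THE\<close>, because every module has
  a syzygy and the classes of modules generate the group.\<close>

lemma K0_syzygy:
  shows K0_syzygy_hom: "K0_syzygy R \<in> hom (K0 R) (K0 R)"
    and K0_syzygy_class: "M \<in> fg_rmodules R \<Longrightarrow> K0_syzygy R (K0_class R M) = semisimple (syz M)"
proof -
  have "\<exists>h\<in>hom (K0 R) (K0 R). \<forall>M\<in>fg_rmodules R. h (K0_class R M) = semisimple (syz M)"
  proof (rule K0_universal[OF comm_group_K0])
    fix M N assume "M \<in> fg_rmodules R" "N \<in> fg_rmodules R" "rmod_isomorphic R M N"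
    then show "semisimple (syz M) = semisimple (syz N)" by (intro semisimple_cong) (metis syz_transfer fg_rmodulesD)
  next
    fix M M' M'' assume "M \<in> fg_rmodules R" "M' \<in> fg_rmodules R" "M'' \<in> fg_rmodules R" "rmod_isomorphic R M (rmod_sum M' M'')"
    then show "semisimple (syz M) = semisimple (syz M') \<otimes>\<^bsub>K0 R\<^esub> semisimple (syz M'')"
      unfolding semisimple_add[symmetric] by (intro semisimple_cong) (rule syz_sum)
  next
    fix P assume P: "projective R P"
    then have PM: "right_module R P" by (simp add: projective_def fg_rmodulesD)
    obtain I :: "((nat \<Rightarrow> 'r) set \<times> 'v) set" and vt where L: "Ldata I vt (arrows_at I vt)"
      "rmod_isomorphic R (Lmod I vt (arrows_at I vt)) P" using projective_Lmod[OF P] by metis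
    have "semisimple (syz P) = semisimple (\<lambda>_. 0)"
      using syz_transfer[OF Lmod_right_module[OF L(1)] Lmod_fg[OF L(1)] PM L(2)] syz_full[OF L(1)]
      by (intro semisimple_cong) simp
    then show "semisimple (syz P) = \<one>\<^bsub>K0 R\<^esub>" by (simp add: semisimple_zero)
  qed simp
  then obtain h where h: "h \<in> hom (K0 R) (K0 R)" "\<And>M. M \<in> fg_rmodules R \<Longrightarrow> h (K0_class R M) = semisimple (syz M)" by blast
  \<comment> \<open>The definition selects an extensional function, hence the restriction to the
    carrier.\<close>
  define k where "k = restrict h (carrier (K0 R))"
  have k: "k \<in> hom (K0 R) (K0 R)" "k \<in> extensional (carrier (K0 R))"
    "\<And>M. M \<in> fg_rmodules R \<Longrightarrow> k (K0_class R M) = semisimple (syz M)"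
    using h by (auto simp: k_def hom_def Pi_def)
  have "K0_syzygy R = k"
    unfolding K0_syzygy_def
  proof (rule the_equality)
    show "k \<in> hom (K0 R) (K0 R) \<and> k \<in> extensional (carrier (K0 R)) \<and>
        (\<forall>M N. is_syzygy R M N \<longrightarrow> k (K0_class R M) = K0_class R N)"
      using k by (auto simp: K0_class_syzygy is_syzygyD(1))
  next
    fix g assume g: "g \<in> hom (K0 R) (K0 R) \<and> g \<in> extensional (carrier (K0 R)) \<and>
        (\<forall>M N. is_syzygy R M N \<longrightarrow> g (K0_class R M) = K0_class R N)"
    have "g (K0_class R M) = k (K0_class R M)" if M: "M \<in> fg_rmodules R" for M
    proof -
      obtain N where "is_syzygy R M N" using syzygy_exists[OF M] ..
      then show ?thesis using g k(3)[OF M] K0_class_syzygy by metis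
    qed
    then have "g x = k x" if "x \<in> carrier (K0 R)" for x
      using K0_hom_eqI[OF K0_group _ k(1) that] g by blast
    then show "g = k" using g k(2) by (intro extensionalityI) auto
  qed
  with k show "K0_syzygy R \<in> hom (K0 R) (K0 R)"
    "M \<in> fg_rmodules R \<Longrightarrow> K0_syzygy R (K0_class R M) = semisimple (syz M)" by simp_all
qed

end

section \<open>The \<open>\<phi>\<close>-dimension\<close>

definition adjacency :: "'a set \<Rightarrow> ('a \<Rightarrow> 'v) \<Rightarrow> ('a \<Rightarrow> 'v) \<Rightarrow> 'v \<Rightarrow> 'v \<Rightarrow> int" where
  "adjacency E s t u w = int (card {a \<in> E. s a = u \<and> t a = w})"

text \<open>Outside the exceptional case the \<open>Suc\<close> counts the first syzygy, which takes
  every class into the span of simples at vertices that are both source and target.\<close>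

definition quiver_phi :: "'a set \<Rightarrow> ('a \<Rightarrow> 'v) \<Rightarrow> ('a \<Rightarrow> 'v) \<Rightarrow> nat" where
  "quiver_phi E s t = (if inj_on s E \<and> inj_on t E \<and> s ` E = t ` E then 0
     else Suc (stable_index (s ` E \<inter> t ` E) (adjacency E s t)))"

text \<open>The exceptional condition and the index set are symmetric in \<open>s\<close> and
  \<open>t\<close>; only the matrix changes, and it is transposed.\<close>

lemma quiver_phi_reverse: "finite E \<Longrightarrow> quiver_phi E t s = quiver_phi E s t"
proof -
  assume "finite E"
  then have fin: "finite (s ` E \<inter> t ` E)" by simp
  have "adjacency E t s = (\<lambda>v w. adjacency E s t w v)" by (simp add: adjacency_def fun_eq_iff conj_commute)
  then show ?thesis
    using stable_index_transpose[OF fin, of "adjacency E s t"]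
    by (auto simp: quiver_phi_def Int_commute)
qed

context rad_sq_zero
begin

interpretation G: comm_group "K0 R" by (rule comm_group_K0)

abbreviation "\<Omega> \<equiv> K0_syzygy R"

interpretation \<Omega>: group_hom "K0 R" "K0 R" \<Omega>
  using K0_syzygy_hom by (simp add: group_hom_def group_hom_axioms_def K0_group)

abbreviation internal :: "'v set" where "internal \<equiv> src ` E \<inter> tgt ` E"

abbreviation adj :: "'v \<Rightarrow> 'v \<Rightarrow> int" where "adj \<equiv> adjacency E src tgt"

lemma finite_internal: "finite internal" using finite_E by simp

lemma internal_V: "internal \<subseteq> V" using src_in by auto

lemma card_Pair_image: "card {(i, a). (i, a) \<in> Pair () ` B \<and> P a} = card {a \<in> B. P a}"
proof -
  have "{(i, a). (i, a) \<in> Pair () ` B \<and> P a} = Pair () ` {a \<in> B. P a}" by auto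
  then show ?thesis by (simp add: card_image inj_on_def)
qed

lemma mdim_Lone:
  assumes u: "u \<in> V" and B: "B \<subseteq> out u"
  shows "w \<in> V \<Longrightarrow> mdim (Lone u B) (vpart w (Lone u B)) = (if u = w then 1 else 0) + card {a \<in> B. tgt a = w}"
    and "mdim (Lone u B) (vrad w (Lone u B)) = card {a \<in> B. tgt a = w}"
    and "w \<in> V \<Longrightarrow> mdim (Lone u B) (vsoc w (Lone u B)) = (if u = w \<and> B = {} then 1 else 0) + card {a \<in> B. tgt a = w}"
    and "b \<in> E \<Longrightarrow> mdim (Lone u B) (aimage b (Lone u B)) = (if b \<in> B then 1 else 0)"
proof -
  have L: "Ldata {()} (\<lambda>_. u) (Pair () ` B)" by (rule Ldata_one[OF u B])
  have c: "card {i \<in> {()}. Q} = (if Q then 1 else 0)" for Q by auto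
  have e: "(\<forall>a. ((), a) \<notin> Pair () ` B) \<longleftrightarrow> B = {}" by auto
  show "mdim (Lone u B) (vpart w (Lone u B)) = (if u = w then 1 else 0) + card {a \<in> B. tgt a = w}"
    if "w \<in> V"
    unfolding Lone_def mdim_Lmod(1)[OF L that] card_Pair_image by (simp only: c)
  show "mdim (Lone u B) (vrad w (Lone u B)) = card {a \<in> B. tgt a = w}"
    unfolding Lone_def mdim_Lmod(2)[OF L] card_Pair_image ..
  show "mdim (Lone u B) (vsoc w (Lone u B)) = (if u = w \<and> B = {} then 1 else 0) + card {a \<in> B. tgt a = w}" if "w \<in> V"
  proof -
    have "{i \<in> {()}. u = w \<and> (\<forall>a. (i, a) \<notin> Pair () ` B)} = {i \<in> {()}. u = w \<and> B = {}}" using e by auto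
    then show ?thesis unfolding Lone_def mdim_Lmod(3)[OF L that] card_Pair_image by (simp only: c)
  qed
  show "b \<in> E \<Longrightarrow> mdim (Lone u B) (aimage b (Lone u B)) = (if b \<in> B then 1 else 0)"
  proof -
    assume b: "b \<in> E"
    have "{a \<in> B. a = b} = (if b \<in> B then {b} else {})" by auto
    then show ?thesis unfolding Lone_def mdim_Lmod(4)[OF L b] card_Pair_image by simp
  qed
qed

text \<open>The cover is the projective at \<open>u\<close>, and its kernel is spanned by the arrows
  that leave \<open>u\<close> and are not in \<open>B\<close>.\<close>

lemma syz_Lone:
  assumes u: "u \<in> V" and B: "B \<subseteq> out u"
  shows "syz (Lone u B) w = adj u w - int (card {a \<in> B. tgt a = w})"
proof -
  have "(\<Sum>a\<in>{a \<in> E. tgt a = w}. int (mdim (Lone u B) (vpart (src a) (Lone u B))) - int (mdim (Lone u B) (vrad (src a) (Lone u B))))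
      = (\<Sum>a\<in>{a \<in> E. tgt a = w}. if src a = u then 1 else 0)"
    by (rule sum.cong) (auto simp: mdim_Lone[OF u B])
  also have "\<dots> = adj u w"
  proof -
    have "{a \<in> E. src a = u \<and> tgt a = w} = {a \<in> {a \<in> E. tgt a = w}. src a = u}" by auto
    then show ?thesis using finite_E by (simp add: adjacency_def sum.If_cases Int_def)
  qed
  finally show ?thesis by (simp add: syz_def mdim_Lone(2)[OF u B])
qed

lemma syzygy_cls:
  assumes "right_module R M" "finitely_generated R M"
  shows "\<Omega> (cls M) = semisimple (syz M)"
  unfolding cls_def using fg_copy[OF assms] syz_transfer[OF assms fg_rmodulesD(1)]
  by (subst K0_syzygy_class) (auto intro!: semisimple_cong)

lemma finprod_semisimple: "finite S \<Longrightarrow> (\<Otimes>\<^bsub>K0 R\<^esub>u\<in>S. semisimple (f u)) = semisimple (\<lambda>w. \<Sum>u\<in>S. f u w)"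
  by (induction S rule: finite_induct) (auto simp: semisimple_zero semisimple_add)

lemma syzygy_semisimple: "\<Omega> (semisimple x) = semisimple (\<lambda>w. \<Sum>u\<in>V. x u * adj u w)"
proof -
  have "\<Omega> (semisimple x) = (\<Otimes>\<^bsub>K0 R\<^esub>u\<in>V. \<Omega> (simple u) [^]\<^bsub>K0 R\<^esub> x u)" by (rule hom_semisimple[OF comm_group_K0 K0_syzygy_hom])
  also have "\<dots> = (\<Otimes>\<^bsub>K0 R\<^esub>u\<in>V. semisimple (\<lambda>w. x u * adj u w))"
  proof (rule G.finprod_cong')
    fix u assume u: "u \<in> V"
    have "\<Omega> (simple u) = semisimple (adj u)"
      unfolding simple_def using syzygy_cls[OF Lone_module[OF u, of "{}"]]
      by (simp add: syz_Lone[OF u] cong: semisimple_cong)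
    then show "\<Omega> (simple u) [^]\<^bsub>K0 R\<^esub> x u = semisimple (\<lambda>w. x u * adj u w)" by (simp add: semisimple_int_pow)
  qed auto
  also have "\<dots> = semisimple (\<lambda>w. \<Sum>u\<in>V. x u * adj u w)" by (rule finprod_semisimple[OF finite_V])
  finally show ?thesis .
qed

lemma arrows_at_one: "arrows_at {()} (\<lambda>_. u) = Pair () ` out u"
  by (auto simp: arrows_at_def out_def)

lemma cls_Lone_full: "u \<in> V \<Longrightarrow> cls (Lone u (out u)) = \<one>\<^bsub>K0 R\<^esub>"
  unfolding Lone_def arrows_at_one[symmetric] by (rule cls_full) (simp add: Ldata_full)

text \<open>At a sink the empty set of arrows is all of \<open>out u\<close>, so the simple is
  projective.\<close>

lemma simple_sink: "u \<in> V \<Longrightarrow> u \<notin> src ` E \<Longrightarrow> simple u = \<one>\<^bsub>K0 R\<^esub>"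
proof -
  assume u: "u \<in> V" "u \<notin> src ` E"
  then have "out u = {}" by (auto simp: out_def)
  then show ?thesis using cls_Lone_full[OF u(1)] by (simp add: simple_def)
qed

text \<open>Simples at sinks vanish in \<open>K0 R\<close>, so only the multiplicities at the other
  vertices count.\<close>

lemma semisimple_eqI: "(\<And>w. w \<in> V \<Longrightarrow> w \<in> src ` E \<Longrightarrow> x w = y w) \<Longrightarrow> semisimple x = semisimple y"
  unfolding semisimple_def
proof (rule G.finprod_cong')
  fix w assume *: "\<And>w. w \<in> V \<Longrightarrow> w \<in> src ` E \<Longrightarrow> x w = y w" and w: "w \<in> V"
  show "simple w [^]\<^bsub>K0 R\<^esub> x w = simple w [^]\<^bsub>K0 R\<^esub> y w"
    using * w simple_sink[OF w] by (cases "w \<in> src ` E") simp_all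
qed auto

lemma syz_source:
  assumes "right_module R M" "w \<notin> tgt ` E"
  shows "syz M w = 0"
proof -
  interpret VM: vectorspace K "kmod M" by (rule kmod_vectorspace[OF assms(1)])
  interpret M: right_module R M by fact
  have E: "{a \<in> E. tgt a = w} = {}" using assms(2) by auto
  have "vrad w M = {\<zero>\<^bsub>kmod M\<^esub>}" unfolding vrad_def E by auto
  then show ?thesis using VM.kdim_zero by (simp add: syz_def E)
qed

definition restr :: "('v \<Rightarrow> int) \<Rightarrow> 'v \<Rightarrow> int" where
  "restr x w = (if w \<in> internal then x w else 0)"

lemma restr_in: "restr x \<in> int_vecs internal" by (auto simp: restr_def int_vecs_def)

lemma semisimple_restr: "(\<And>w. w \<notin> tgt ` E \<Longrightarrow> x w = 0) \<Longrightarrow> semisimple x = semisimple (restr x)"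
  by (rule semisimple_eqI) (auto simp: restr_def)

text \<open>Sinks are discarded by \<open>semisimple_eqI\<close>, and at a vertex that is not a
  target the column of \<open>adj\<close> vanishes. The two sums over vertices therefore agree at
  all vertices that count.\<close>

lemma syzygy_semisimple_internal:
  assumes x: "x \<in> int_vecs internal"
  shows "\<Omega> (semisimple x) = semisimple (mat_vec internal adj x)"
  unfolding syzygy_semisimple
proof (rule semisimple_eqI)
  fix w assume w: "w \<in> V" "w \<in> src ` E"
  have "(\<Sum>u\<in>V. x u * adj u w) = (\<Sum>u\<in>internal. x u * adj u w)"
    by (rule sum.mono_neutral_right) (use finite_V internal_V x in \<open>auto simp: int_vecs_def\<close>)
  moreover have "adj u w = 0" if "w \<notin> tgt ` E" for u
  proof -
    have "{a \<in> E. src a = u \<and> tgt a = w} = {}" using that by auto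
    then show ?thesis unfolding adjacency_def by (simp only: card.empty of_nat_0)
  qed
  ultimately show "(\<Sum>u\<in>V. x u * adj u w) = mat_vec internal adj x w" using w by (auto simp: mat_vec_def)
qed

lemma syzygy_pow_semisimple:
  assumes "x \<in> int_vecs internal"
  shows "(\<Omega> ^^ n) (semisimple x) = semisimple ((mat_vec internal adj ^^ n) x)"
  by (induction n) (use assms in \<open>simp_all add: syzygy_semisimple_internal mat_vec_pow_in\<close>)

section \<open>Integer invariants of \<open>K0 R\<close>\<close>

lemma K0_int_hom:
  fixes \<phi> :: "'r rmodule \<Rightarrow> int"
  assumes iso: "\<And>M N. M \<in> fg_rmodules R \<Longrightarrow> N \<in> fg_rmodules R \<Longrightarrow> rmod_isomorphic R M N \<Longrightarrow> \<phi> M = \<phi> N"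
    and add: "\<And>M M' M''. M \<in> fg_rmodules R \<Longrightarrow> M' \<in> fg_rmodules R \<Longrightarrow> M'' \<in> fg_rmodules R \<Longrightarrow>
      rmod_isomorphic R M (rmod_sum M' M'') \<Longrightarrow> \<phi> M = \<phi> M' + \<phi> M''"
    and proj: "\<And>P. projective R P \<Longrightarrow> \<phi> P = 0"
  shows "\<exists>h\<in>hom (K0 R) integer_group. \<forall>M\<in>fg_rmodules R. h (K0_class R M) = \<phi> M"
  using K0_universal[OF comm_group_integer_group, of R \<phi>] assms by auto

text \<open>The quantities behind the following invariants, evaluated on projectives: the socle
  exceeds the radical by the simple projective summands, and the image of an arrow counts the
  summands at its source.\<close>

lemma projective_numbers:
  assumes "projective R P"
  obtains I :: "((nat \<Rightarrow> 'r) set \<times> 'v) set" and vt where "Ldata I vt (arrows_at I vt)"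
    "\<And>w. w \<in> V \<Longrightarrow> mdim P (vsoc w P) = card {i \<in> I. vt i = w \<and> (\<forall>a. (i, a) \<notin> arrows_at I vt)} + mdim P (vrad w P)"
    "\<And>b. b \<in> E \<Longrightarrow> mdim P (aimage b P) = card {i \<in> I. vt i = src b}"
proof -
  have PM: "right_module R P" using assms by (simp add: projective_def fg_rmodulesD)
  obtain I :: "((nat \<Rightarrow> 'r) set \<times> 'v) set" and vt where L: "Ldata I vt (arrows_at I vt)"
      "rmod_isomorphic R (Lmod I vt (arrows_at I vt)) P" using projective_Lmod[OF assms] by metis
  note t = mdim_transfer[OF Lmod_right_module[OF L(1)] Lmod_fg[OF L(1)] PM L(2)]
  show ?thesis
  proof (rule that[OF L(1)])
    show "mdim P (vsoc w P) = card {i \<in> I. vt i = w \<and> (\<forall>a. (i, a) \<notin> arrows_at I vt)} + mdim P (vrad w P)" if "w \<in> V" for w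
      using mdim_Lmod(2,3)[OF L(1)] that by (simp add: t)
    show "mdim P (aimage b P) = card {i \<in> I. vt i = src b}" if b: "b \<in> E" for b
    proof -
      have "{(i, a). (i, a) \<in> arrows_at I vt \<and> a = b} = (\<lambda>i. (i, b)) ` {i \<in> I. vt i = src b}"
        using b by (auto simp: arrows_at_def)
      then show ?thesis using mdim_Lmod(4)[OF L(1) b] by (simp add: t card_image inj_on_def)
    qed
  qed
qed

text \<open>The number of direct summands of \<open>M\<close> isomorphic to the simple at \<open>v\<close> is the difference between the dimensions
  at \<open>v\<close> of its socle and its radical.\<close>

lemma simple_multiplicity:
  assumes v: "v \<in> src ` E"
  obtains d where "d \<in> hom (K0 R) integer_group" "\<And>w. w \<in> V \<Longrightarrow> d (simple w) = (if w = v then 1 else 0)"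
proof -
  define \<phi> where "\<phi> M = int (mdim M (vsoc v M)) - int (mdim M (vrad v M))" for M :: "'r rmodule"
  have vV: "v \<in> V" using v src_in by auto
  have p: "\<phi> P = 0" if "projective R P" for P
  proof -
    show ?thesis
    proof (rule projective_numbers[OF that])
      fix I :: "((nat \<Rightarrow> 'r) set \<times> 'v) set" and vt
      assume *: "\<And>w. w \<in> V \<Longrightarrow> mdim P (vsoc w P) = card {i \<in> I. vt i = w \<and> (\<forall>a. (i, a) \<notin> arrows_at I vt)} + mdim P (vrad w P)"
      \<comment> \<open>An arrow leaves \<open>v\<close>, so it survives at every generator at
        \<open>v\<close> in the projective.\<close>
      have "{i \<in> I. vt i = v \<and> (\<forall>a. (i, a) \<notin> arrows_at I vt)} = {}" using v by (auto simp: arrows_at_def)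
      then show "\<phi> P = 0" unfolding \<phi>_def *[OF vV] by (simp only: card.empty add_0_left diff_self)
    qed
  qed
  have i: "\<phi> M = \<phi> N" if "M \<in> fg_rmodules R" "N \<in> fg_rmodules R" "rmod_isomorphic R M N" for M N
    unfolding \<phi>_def mdim_transfer[OF fg_rmodulesD[OF that(1)] fg_rmodulesD(1)[OF that(2)] that(3)] ..
  have s: "\<phi> M = \<phi> M' + \<phi> M''" if "M \<in> fg_rmodules R" "M' \<in> fg_rmodules R" "M'' \<in> fg_rmodules R"
      "rmod_isomorphic R M (rmod_sum M' M'')" for M M' M''
    unfolding \<phi>_def mdim_sum[OF that] by simp
  have "\<exists>h\<in>hom (K0 R) integer_group. \<forall>M\<in>fg_rmodules R. h (K0_class R M) = \<phi> M"
    by (rule K0_int_hom[OF i s p])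
  then obtain h where h: "h \<in> hom (K0 R) integer_group" "\<And>M. M \<in> fg_rmodules R \<Longrightarrow> h (K0_class R M) = \<phi> M"
    by blast
  have "h (simple w) = (if w = v then 1 else 0)" if w: "w \<in> V" for w
  proof -
    note W = Lone_module[OF w, of "{}", simplified]
    note t = mdim_transfer[OF W fg_rmodulesD(1)[OF fg_copy(1)[OF W]] fg_copy(2)[OF W]]
    show ?thesis
      unfolding simple_def cls_def h(2)[OF fg_copy(1)[OF W]] \<phi>_def t using mdim_Lone(2,3)[OF w, of "{}"] vV by simp
  qed
  with h(1) show ?thesis by (rule that)
qed

text \<open>The homomorphism from \<open>simple_multiplicity\<close> picks out the coordinate at
  \<open>v\<close>.\<close>

lemma semisimple_inject:
  assumes "semisimple x = semisimple y" "v \<in> src ` E"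
  shows "x v = y v"
proof -
  from simple_multiplicity[OF assms(2)] obtain d where
    d: "d \<in> hom (K0 R) integer_group" "\<And>w. w \<in> V \<Longrightarrow> d (simple w) = (if w = v then 1 else 0)" by blast
  have "d (semisimple x) = x v" for x
  proof -
    have "d (semisimple x) = (\<Sum>w\<in>V. if v = w then x w else 0)"
      unfolding hom_semisimple_int[OF d(1)] by (rule sum.cong) (auto simp: d(2))
    then show ?thesis using assms(2) src_in finite_V by auto
  qed
  then show ?thesis using assms(1) by metis
qed

lemma semisimple_inj_on: "inj_on semisimple (int_vecs internal)"
proof (rule inj_onI)
  fix x y assume xy: "x \<in> int_vecs internal" "y \<in> int_vecs internal" "semisimple x = semisimple y"
  show "x = y"
  proof
    fix v show "x v = y v"
    proof (cases "v \<in> internal")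
      case True
      then show ?thesis by (intro semisimple_inject[OF xy(3)]) simp
    next
      case False
      then have "x v = 0" "y v = 0" using xy(1,2) by (simp_all add: int_vecs_def)
      then show ?thesis by simp
    qed
  qed
qed

text \<open>The invariant is \<open>dim Ma - dim Mb\<close>; for projective \<open>M\<close> both dimensions count the summands
  \<open>e\<^bsub>s(a)\<^esub>R\<close> of \<open>M\<close>.\<close>

lemma arrow_multiplicity:
  assumes ab: "a \<in> E" "b \<in> E" "src a = src b" "a \<noteq> b"
  obtains r where "r \<in> hom (K0 R) integer_group" "\<And>w. w \<in> V \<Longrightarrow> r (simple w) = 0"
    "r (cls (Lone (src a) (out (src a) - {a}))) = - 1"
proof -
  define \<phi> where "\<phi> M = int (mdim M (aimage a M)) - int (mdim M (aimage b M))" for M :: "'r rmodule"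
  have p: "\<phi> P = 0" if "projective R P" for P
  proof -
    show ?thesis
    proof (rule projective_numbers[OF that])
      fix I :: "((nat \<Rightarrow> 'r) set \<times> 'v) set" and vt
      assume "\<And>b. b \<in> E \<Longrightarrow> mdim P (aimage b P) = card {i \<in> I. vt i = src b}"
      then show "\<phi> P = 0" using ab by (simp add: \<phi>_def)
    qed
  qed
  have i: "\<phi> M = \<phi> N" if "M \<in> fg_rmodules R" "N \<in> fg_rmodules R" "rmod_isomorphic R M N" for M N
    unfolding \<phi>_def mdim_transfer[OF fg_rmodulesD[OF that(1)] fg_rmodulesD(1)[OF that(2)] that(3)] ..
  have s: "\<phi> M = \<phi> M' + \<phi> M''" if "M \<in> fg_rmodules R" "M' \<in> fg_rmodules R" "M'' \<in> fg_rmodules R"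
      "rmod_isomorphic R M (rmod_sum M' M'')" for M M' M''
    unfolding \<phi>_def mdim_sum[OF that] by simp
  have "\<exists>h\<in>hom (K0 R) integer_group. \<forall>M\<in>fg_rmodules R. h (K0_class R M) = \<phi> M"
    by (rule K0_int_hom[OF i s p])
  then obtain h where h: "h \<in> hom (K0 R) integer_group" "\<And>M. M \<in> fg_rmodules R \<Longrightarrow> h (K0_class R M) = \<phi> M"
    by blast
  have hL: "h (cls (Lone w B)) = (if a \<in> B then 1 else 0) - (if b \<in> B then 1 else 0)" if w: "w \<in> V" "B \<subseteq> out w" for w B
  proof -
    note W = Lone_module[OF w]
    note t = mdim_transfer[OF W fg_rmodulesD(1)[OF fg_copy(1)[OF W]] fg_copy(2)[OF W]]
    show ?thesis
      unfolding cls_def h(2)[OF fg_copy(1)[OF W]] \<phi>_def t using mdim_Lone(4)[OF w] ab by simp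
  qed
  show ?thesis
  proof (rule that[OF h(1)])
    show "h (simple w) = 0" if "w \<in> V" for w unfolding simple_def using hL[OF that, of "{}"] by simp
    show "h (cls (Lone (src a) (out (src a) - {a}))) = - 1"
      using hL[of "src a" "out (src a) - {a}"] ab by (auto simp: out_def)
  qed
qed

section \<open>Upper bound\<close>

lemma syzygy_image: "c \<in> carrier (K0 R) \<Longrightarrow> \<Omega> c \<in> semisimple ` int_vecs internal"
proof (induction rule: K0_induct)
  case one
  have "(\<lambda>_. 0) \<in> int_vecs internal" by (simp add: int_vecs_def)
  then show ?case using semisimple_zero by (metis \<Omega>.hom_one image_eqI)
next
  case (diff x y)
  then obtain x' y' where "x' \<in> int_vecs internal" "y' \<in> int_vecs internal" "\<Omega> x = semisimple x'" "\<Omega> y = semisimple y'" by blast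
  then have "\<Omega> (x \<otimes>\<^bsub>K0 R\<^esub> inv\<^bsub>K0 R\<^esub> y) = semisimple (\<lambda>w. x' w - y' w)"
    using diff semisimple_add[of x' "\<lambda>w. - y' w"] by (simp add: semisimple_uminus)
  then show ?case using int_vecs_diff[OF \<open>x' \<in> int_vecs internal\<close> \<open>y' \<in> int_vecs internal\<close>] by blast
next
  \<comment> \<open>The multiplicities of a syzygy vanish at vertices that are not targets, and
    simples at sinks are trivial. What remains is supported on \<open>internal\<close>.\<close>
  case (cls M)
  have "\<Omega> (K0_class R M) = semisimple (restr (syz M))"
    unfolding K0_syzygy_class[OF cls] using syz_source[OF fg_rmodulesD(1)[OF cls]] by (rule semisimple_restr)
  then show ?case using restr_in by blast
qed

lemma add_subgroup: "subgroup (add_subgroup R M) (K0 R)"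
  unfolding add_subgroup_def by (rule G.generate_is_subgroup) (auto simp: indecomposable_def)

lemma syzygy_pow_Suc_image:
  "(\<Omega> ^^ Suc n) ` C = (\<Omega> ^^ n) ` \<Omega> ` C"
  by (simp add: image_image funpow_swap1)

text \<open>After one syzygy all elements are semisimple classes of vectors on
  \<open>internal\<close>, where \<open>\<Omega>\<close> acts by the matrix. The remaining
  \<open>stable_index internal adj + s\<close> steps reach a power on whose image the matrix is
  injective.\<close>

lemma inj_on_syzygy_pow:
  "inj_on \<Omega> ((\<Omega> ^^ (Suc (stable_index internal adj) + s)) ` add_subgroup R M)"
proof -
  let ?n = "stable_index internal adj + s"
  have inj: "inj_after internal adj ?n" unfolding inj_after_iff_le[OF finite_internal] by simp
  have sub: "\<Omega> x \<in> semisimple ` int_vecs internal" if "x \<in> add_subgroup R M" for x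
    using subsetD[OF subgroup.subset[OF add_subgroup] that] by (rule syzygy_image)
  have ex: "\<exists>x. x \<in> int_vecs internal \<and> p = semisimple ((mat_vec internal adj ^^ ?n) x)"
    if "p \<in> (\<Omega> ^^ ?n) ` \<Omega> ` add_subgroup R M" for p
  proof -
    from that obtain q where q: "p = (\<Omega> ^^ ?n) (\<Omega> q)" "q \<in> add_subgroup R M" by (elim imageE) simp
    from sub[OF q(2)] obtain x where x: "\<Omega> q = semisimple x" "x \<in> int_vecs internal" by (rule imageE)
    then show ?thesis using q(1) syzygy_pow_semisimple[OF x(2)] by auto
  qed
  have "inj_on \<Omega> ((\<Omega> ^^ ?n) ` \<Omega> ` add_subgroup R M)"
  proof (rule inj_onI)
    fix p q assume p: "p \<in> (\<Omega> ^^ ?n) ` \<Omega> ` add_subgroup R M" and q: "q \<in> (\<Omega> ^^ ?n) ` \<Omega> ` add_subgroup R M" and eq: "\<Omega> p = \<Omega> q"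
    from ex[OF p] obtain x where x: "x \<in> int_vecs internal" "p = semisimple ((mat_vec internal adj ^^ ?n) x)" by (elim exE conjE)
    from ex[OF q] obtain y where y: "y \<in> int_vecs internal" "q = semisimple ((mat_vec internal adj ^^ ?n) y)" by (elim exE conjE)
    let ?x = "(mat_vec internal adj ^^ ?n) x" and ?y = "(mat_vec internal adj ^^ ?n) y"
    have "semisimple (mat_vec internal adj ?x) = semisimple (mat_vec internal adj ?y)"
      using eq x y by (simp add: syzygy_semisimple_internal mat_vec_pow_in)
    then have "mat_vec internal adj ?x = mat_vec internal adj ?y"
      by (rule inj_onD[OF semisimple_inj_on]) (rule mat_vec_in)+
    then have "?x = ?y" using inj_onD[OF inj[unfolded inj_after_def] _ imageI[OF x(1)] imageI[OF y(1)]] by simp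
    then show "p = q" using x y by simp
  qed
  then show ?thesis unfolding add_Suc syzygy_pow_Suc_image .
qed

lemma phi_le: "phi R M \<le> Suc (stable_index internal adj)"
  unfolding phi_def by (rule Least_le) (intro allI inj_on_syzygy_pow)

lemma inj_on_syzygy_phi: "inj_on \<Omega> ((\<Omega> ^^ (phi R M + s)) ` add_subgroup R M)"
proof -
  have "\<forall>s. inj_on \<Omega> ((\<Omega> ^^ (phi R M + s)) ` add_subgroup R M)"
    unfolding phi_def by (rule LeastI[of _ "Suc (stable_index internal adj)"]) (intro allI inj_on_syzygy_pow)
  then show ?thesis ..
qed

section \<open>Indecomposable summands and a test module\<close>

definition top_length :: "('r, 'b, 'z) module_scheme \<Rightarrow> int" where
  "top_length M = (\<Sum>w\<in>V. int (mdim M (vpart w M)) - int (mdim M (vrad w M)))"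

text \<open>By \<open>top_cover\<close> it is the number of generators of a cover. If there are
  none, the cover is zero and so is its image.\<close>

lemma top_length:
  assumes M: "right_module R M" "finitely_generated R M"
  shows "0 \<le> top_length M" and "top_length M = 0 \<Longrightarrow> carrier M = {\<zero>\<^bsub>M\<^esub>}"
proof -
  obtain I :: "('b \<times> 'v) set" and vt p where L: "Ldata I vt (arrows_at I vt)" and
    p: "p \<in> rmod_hom R (Lmod I vt (arrows_at I vt)) M" "p ` carrier (Lmod I vt (arrows_at I vt)) = carrier M"
    and ker: "\<And>f i. f \<in> carrier (Lmod I vt (arrows_at I vt)) \<Longrightarrow> p f = \<zero>\<^bsub>M\<^esub> \<Longrightarrow> f (i, None) = \<zero>\<^bsub>K\<^esub>"
    using cover_exists[OF M] by metis
  let ?L = "Lmod I vt (arrows_at I vt)"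
  have t: "top_length M = (\<Sum>w\<in>V. int (card {i \<in> I. vt i = w}))"
    unfolding top_length_def
  proof (rule sum.cong[OF refl])
    fix w assume w: "w \<in> V"
    show "int (mdim M (vpart w M)) - int (mdim M (vrad w M)) = int (card {i \<in> I. vt i = w})"
      by (rule top_cover[OF M(1) L p(1) p(2) _ w]) (rule ker)
  qed
  then show "0 \<le> top_length M" by (simp add: sum_nonneg)
  show "carrier M = {\<zero>\<^bsub>M\<^esub>}" if "top_length M = 0"
  proof -
    have "int (card {i \<in> I. vt i = w}) = 0" if "w \<in> V" for w
      using \<open>top_length M = 0\<close> that finite_V unfolding t by (simp add: sum_nonneg_eq_0_iff)
    then have "{i \<in> I. vt i = w} = {}" if "w \<in> V" for w using that LdataD(1)[OF L] by simp
    then have I: "I = {}" using LdataD(2)[OF L] by blast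
    interpret p: rmod_map R ?L M p by (rule rmod_mapI[OF Lmod_right_module[OF L] M(1) p(1)])
    have "f = \<zero>\<^bsub>?L\<^esub>" if f: "f \<in> carrier ?L" for f
      by (rule pair_option_ext) (use Lmod_outside[OF f] LdataD(3)[OF L] in \<open>auto simp: I arrows_at_def\<close>)
    then have "carrier ?L = {\<zero>\<^bsub>?L\<^esub>}" using p.M.M.zero_closed by blast
    then show ?thesis using p(2) p.zero by (simp del: Lmod_simps)
  qed
qed

text \<open>The module has a single generator. Since \<open>top_length\<close> is additive,
  nonnegative and zero only on zero modules, the value 1 admits no proper decomposition.\<close>

lemma Lone_indecomposable:
  assumes u: "u \<in> V" and B: "B \<subseteq> out u"
  shows "indecomposable R (fg_copy R (Lone u B))"
proof -
  let ?C = "fg_copy R (Lone u B)"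
  note W = Lone_module[OF u B]
  note C = fg_copy[OF W]
  note t = mdim_transfer[OF W fg_rmodulesD(1)[OF C(1)] C(2)]
  have top: "top_length ?C = 1"
  proof -
    have "top_length ?C = (\<Sum>w\<in>V. if u = w then 1 else 0)"
      unfolding top_length_def t by (rule sum.cong) (simp_all add: mdim_Lone[OF u B])
    then show ?thesis using u finite_V by simp
  qed
  show ?thesis
    unfolding indecomposable_def
  proof (intro conjI ballI impI C(1))
    interpret VC: vectorspace K "kmod ?C" by (rule kmod_vectorspace[OF fg_rmodulesD(1)[OF C(1)]])
    have s: "subspace K (vpart w ?C) (kmod ?C)" "subspace K (vrad w ?C) (kmod ?C)" for w
      by (rule vpart_subspace vrad_subspace, rule fg_rmodulesD(1)[OF C(1)])+
    show "carrier ?C \<noteq> {\<zero>\<^bsub>?C\<^esub>}"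
    proof
      assume "carrier ?C = {\<zero>\<^bsub>?C\<^esub>}"
      then have "vpart u ?C = {\<zero>\<^bsub>kmod ?C\<^esub>}" using s(1)[of u] by (auto simp: subspace_def submodule_def)
      then have "mdim ?C (vpart u ?C) = 0" using VC.kdim_zero by simp
      then show False unfolding t using mdim_Lone(1)[OF u B u] by simp
    qed
  next
    fix M N assume MN: "M \<in> fg_rmodules R" "N \<in> fg_rmodules R" "rmod_isomorphic R ?C (rmod_sum M N)"
    have "top_length ?C = top_length M + top_length N"
      unfolding top_length_def mdim_sum[OF C(1) MN] by (simp add: sum.distrib[symmetric] algebra_simps)
    then have "top_length M = 0 \<or> top_length N = 0"
      using top_length(1)[OF fg_rmodulesD[OF MN(1)]] top_length(1)[OF fg_rmodulesD[OF MN(2)]] unfolding top by linarith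
    then show "carrier M = {\<zero>\<^bsub>M\<^esub>} \<or> carrier N = {\<zero>\<^bsub>N\<^esub>}"
      using top_length(2)[OF fg_rmodulesD[OF MN(1)]] top_length(2)[OF fg_rmodulesD[OF MN(2)]] by blast
  qed
qed

lemma cls_Lone_in_add_subgroup:
  assumes L: "Ldata I vt A" and i: "i \<in> I"
  shows "cls (Lone (vt i) {a. (i, a) \<in> A}) \<in> add_subgroup R (fg_copy R (Lmod I vt A))"
proof -
  let ?S = "Lone (vt i) {a. (i, a) \<in> A}" and ?N = "Lmod (I - {i}) vt (sub_arrows (I - {i}) A)"
  note v = LdataD(2)[OF L i] and B = arrows_sub_out[OF L, of i]
  note S = fg_copy[OF Lone_module[OF v B]]
  have LN: "Ldata (I - {i}) vt (sub_arrows (I - {i}) A)" by (rule Ldata_sub[OF L]) auto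
  note N = fg_copy[OF Lmod_right_module[OF LN] Lmod_fg[OF LN]]
  note C = fg_copy[OF Lmod_right_module[OF L] Lmod_fg[OF L]]
  have "rmod_isomorphic R (Lmod I vt A) (rmod_sum (Lmod {i} vt (sub_arrows {i} A)) ?N)"
    using Lmod_split[OF L, of "{i}"] i by simp
  then have "rmod_isomorphic R (fg_copy R (Lmod I vt A)) (rmod_sum (Lmod {i} vt (sub_arrows {i} A)) ?N)"
    by (rule rmod_isomorphic_trans[OF rmod_isomorphic_sym[OF Lmod_right_module[OF L] C(2)]])
  from rmod_isomorphic_trans[OF this rmod_isomorphic_sum[OF rmod_isomorphic_trans[OF Lmod_single[OF L i] S(2)] N(2)]]
  have "direct_summand R (fg_copy R ?S) (fg_copy R (Lmod I vt A))"
    unfolding direct_summand_def using S(1) N(1) by blast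
  then have "K0_class R (fg_copy R ?S) \<in> {K0_class R N |N. indecomposable R N \<and> direct_summand R N (fg_copy R (Lmod I vt A))}"
    using Lone_indecomposable[OF v B] by blast
  then show ?thesis unfolding add_subgroup_def cls_def by (rule generate.incl)
qed

lemma test_module:
  obtains M where "M \<in> fg_rmodules R" "\<And>v. v \<in> V \<Longrightarrow> simple v \<in> add_subgroup R M"
    "\<And>a. a \<in> E \<Longrightarrow> cls (Lone (src a) (out (src a) - {a})) \<in> add_subgroup R M"
proof -
  \<comment> \<open>An index \<open>Inl v\<close> carries no arrows and contributes the simple at
    \<open>v\<close>; an index \<open>Inr a\<close> carries all arrows leaving the source of
    \<open>a\<close> except \<open>a\<close>.\<close>
  define A :: "(('v + 'a) \<times> 'a) set" where "A = {(Inr a, b) | a b. a \<in> E \<and> b \<in> out (src a) - {a}}"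
  let ?vt = "case_sum (\<lambda>v. v) src"
  have L: "Ldata (V <+> E) ?vt A"
    using finite_V finite_E src_in by (auto simp: Ldata_def A_def arrows_at_def out_def)
  show ?thesis
  proof (rule that[OF fg_copy(1)[OF Lmod_right_module[OF L] Lmod_fg[OF L]]])
    fix v assume "v \<in> V"
    moreover have "{a. (Inl v, a) \<in> A} = {}" by (auto simp: A_def)
    ultimately show "simple v \<in> add_subgroup R (fg_copy R (Lmod (V <+> E) ?vt A))"
      using cls_Lone_in_add_subgroup[OF L InlI] unfolding simple_def by force
  next
    fix a assume "a \<in> E"
    moreover have "{b. (Inr a, b) \<in> A} = out (src a) - {a}" using \<open>a \<in> E\<close> by (auto simp: A_def)
    ultimately show "cls (Lone (src a) (out (src a) - {a})) \<in> add_subgroup R (fg_copy R (Lmod (V <+> E) ?vt A))"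
      using cls_Lone_in_add_subgroup[OF L InrI] by force
  qed
qed

text \<open>The kernel of the cover is spanned by the one omitted arrow, which sits at its
  target.\<close>

lemma syzygy_arrow:
  assumes a: "a \<in> E"
  shows "\<Omega> (cls (Lone (src a) (out (src a) - {a}))) = semisimple (\<lambda>w. if w = tgt a then 1 else 0)"
proof -
  have u: "src a \<in> V" "out (src a) - {a} \<subseteq> out (src a)" using a src_in by auto
  have "syz (Lone (src a) (out (src a) - {a})) w = (if w = tgt a then 1 else 0)" for w
  proof -
    let ?B = "{b \<in> out (src a) - {a}. tgt b = w}"
    have "{b \<in> E. src b = src a \<and> tgt b = w} = (if w = tgt a then insert a ?B else ?B)"
      using a by (auto simp: out_def)
    moreover have "finite ?B" using finite_E by (simp add: out_def)
    then have "card (insert a ?B) = 1 + card ?B" by simp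
    ultimately have "card {b \<in> E. src b = src a \<and> tgt b = w} = (if w = tgt a then 1 else 0) + card ?B"
      by (cases "w = tgt a") (simp_all only: refl if_True if_False add_0)
    then show ?thesis unfolding syz_Lone[OF u] adjacency_def by (simp only: of_nat_add) simp
  qed
  then show ?thesis unfolding syzygy_cls[OF Lone_module[OF u]] by (intro semisimple_cong) simp
qed

section \<open>Lower bound\<close>

lemma semisimple_in_subgroup:
  assumes H: "subgroup H (K0 R)" and x: "\<And>v. v \<in> V \<Longrightarrow> x v \<noteq> 0 \<Longrightarrow> simple v \<in> H"
  shows "semisimple x \<in> H"
proof -
  interpret H: subgroup H "K0 R" by (rule H)
  have p: "simple v [^]\<^bsub>K0 R\<^esub> x v \<in> H" if "v \<in> V" for v
    using x[OF that] that G.subgroup_int_pow_closed[OF H] by (cases "x v = 0") auto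
  have "(\<Otimes>\<^bsub>K0 R\<^esub>v\<in>S. simple v [^]\<^bsub>K0 R\<^esub> x v) \<in> H" if "finite S" "S \<subseteq> V" for S
    using that
  proof (induction S rule: finite_induct)
    case (insert v S)
    then show ?case using p by (subst G.finprod_insert) (auto simp: subset_iff)
  qed auto
  then show ?thesis unfolding semisimple_def using finite_V by simp
qed

text \<open>Every internal vertex is the target of some arrow \<open>a\<close>, and the simple there
  is the syzygy of the module that omits \<open>a\<close>.\<close>

lemma semisimple_in_syzygy_image:
  assumes H: "subgroup H (K0 R)" and c: "\<And>a. a \<in> E \<Longrightarrow> cls (Lone (src a) (out (src a) - {a})) \<in> H"
    and x: "x \<in> int_vecs internal"
  shows "semisimple x \<in> \<Omega> ` H"
proof (rule semisimple_in_subgroup)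
  show "subgroup (\<Omega> ` H) (K0 R)" by (rule \<Omega>.subgroup_img_is_subgroup[OF H])
  fix v assume v: "v \<in> V" "x v \<noteq> 0"
  then have "v \<in> internal" using x by (auto simp: int_vecs_def)
  then obtain a where a: "a \<in> E" "v = tgt a" by auto
  have "\<Omega> (cls (Lone (src a) (out (src a) - {a}))) = simple v"
    unfolding syzygy_arrow[OF a(1)] a(2)[symmetric] by (rule semisimple_single[OF v(1)])
  then show "simple v \<in> \<Omega> ` H" using c[OF a(1)] by (metis image_eqI)
qed

text \<open>The image of \<open>H\<close> under one syzygy already contains all semisimple classes
  on \<open>internal\<close>. After \<open>n + 1\<close> syzygies it therefore contains the classes
  of the image of the \<open>n\<close>-th matrix power, which explains the shift by one.\<close>

lemma inj_syzygy_imp_inj_after: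
  assumes H: "subgroup H (K0 R)" and c: "\<And>a. a \<in> E \<Longrightarrow> cls (Lone (src a) (out (src a) - {a})) \<in> H"
    and inj: "inj_on \<Omega> ((\<Omega> ^^ Suc n) ` H)"
  shows "inj_after internal adj n"
  unfolding inj_after_def
proof (rule inj_onI)
  have semisimple: "semisimple ((mat_vec internal adj ^^ n) x) \<in> (\<Omega> ^^ Suc n) ` H" if "x \<in> int_vecs internal" for x
    unfolding syzygy_pow_Suc_image syzygy_pow_semisimple[OF that, symmetric]
    by (rule imageI) (rule semisimple_in_syzygy_image[OF H c that])
  fix p q assume p: "p \<in> (mat_vec internal adj ^^ n) ` int_vecs internal"
    and q: "q \<in> (mat_vec internal adj ^^ n) ` int_vecs internal" and eq: "mat_vec internal adj p = mat_vec internal adj q"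
  from p obtain x where x: "p = (mat_vec internal adj ^^ n) x" "x \<in> int_vecs internal" by (rule imageE)
  from q obtain y where y: "q = (mat_vec internal adj ^^ n) y" "y \<in> int_vecs internal" by (rule imageE)
  have pq: "p \<in> int_vecs internal" "q \<in> int_vecs internal" using x y by (simp_all add: mat_vec_pow_in)
  have "\<Omega> (semisimple p) = \<Omega> (semisimple q)" using pq eq by (simp add: syzygy_semisimple_internal)
  then have "semisimple p = semisimple q" by (rule inj_onD[OF inj]) (use semisimple x y in simp_all)
  then show "p = q" by (rule inj_onD[OF semisimple_inj_on]) (rule pq)+
qed

text \<open>If \<open>src\<close> is injective and every source is a target, then counting gives as
  many targets as arrows, so sources and targets coincide and \<open>tgt\<close> is injective as
  well. Thus the failure of the exceptional case is always visible in one of two ways at the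
  sources.\<close>

lemma not_arrow_permutation:
  assumes "\<not> arrow_permutation"
  obtains v where "v \<in> src ` E" "v \<notin> tgt ` E" | a b where "a \<in> E" "b \<in> E" "src a = src b" "a \<noteq> b"
proof (cases "src ` E \<subseteq> tgt ` E \<and> inj_on src E")
  case True
  have "card (tgt ` E) \<le> card (src ` E)"
    using True card_image_le[OF finite_E, of tgt] by (simp add: card_image)
  then have eq: "src ` E = tgt ` E" using True finite_E by (intro card_seteq) auto
  then have "card (tgt ` E) = card E" using True card_image[of src E] by simp
  then have "inj_on tgt E" using finite_E by (rule eq_card_imp_inj_on[rotated])
  then show ?thesis using assms True eq by (simp add: arrow_permutation_def)
next
  case False
  then show ?thesis using that unfolding inj_on_def by blast
qed

text \<open>For index 0 the matrix is invertible over the rationals, so a multiple of every syzygy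
  of an element of \<open>H\<close> is also the syzygy of a semisimple class on
  \<open>internal\<close>. Injectivity would make the same multiple of the element itself equal to
  that class, and this fails for a simple at a vertex that is no target, or for the module omitting
  one of two arrows with a common source.\<close>

lemma not_inj_syzygy:
  assumes perm: "\<not> arrow_permutation" and 0: "stable_index internal adj = 0" and H: "subgroup H (K0 R)"
    and S: "\<And>v. v \<in> V \<Longrightarrow> simple v \<in> H" and c: "\<And>a. a \<in> E \<Longrightarrow> cls (Lone (src a) (out (src a) - {a})) \<in> H"
  shows "\<not> inj_on \<Omega> H"
proof
  assume inj: "inj_on \<Omega> H"
  \<comment> \<open>The integer \<open>n\<close> is the denominator of the rational preimage of
    \<open>z\<close> under the matrix.\<close>
  have key: "\<exists>n y. n \<noteq> 0 \<and> y \<in> int_vecs internal \<and> x [^]\<^bsub>K0 R\<^esub> (n::int) = semisimple y"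
    if x: "x \<in> H" "\<Omega> x = semisimple z" "\<And>w. w \<notin> tgt ` E \<Longrightarrow> z w = 0" for x z
  proof -
    obtain n y where y: "n \<noteq> 0" "y \<in> int_vecs internal" "mat_vec internal adj y = (\<lambda>w. n * restr z w)"
      by (rule stable_index_0_preimage[OF finite_internal 0 restr_in[of z]]) (rule that)
    have xK: "x \<in> carrier (K0 R)" using subgroup.mem_carrier[OF H x(1)] .
    have "\<Omega> (x [^]\<^bsub>K0 R\<^esub> n) = semisimple (restr z) [^]\<^bsub>K0 R\<^esub> n"
      using \<Omega>.hom_int_pow[OF xK] x(2) semisimple_restr[OF x(3)] by simp
    also have "\<dots> = \<Omega> (semisimple y)" by (simp only: semisimple_int_pow syzygy_semisimple_internal[OF y(2)] y(3))
    finally have "\<Omega> (x [^]\<^bsub>K0 R\<^esub> n) = \<Omega> (semisimple y)" .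
    then have "x [^]\<^bsub>K0 R\<^esub> n = semisimple y"
      by (rule inj_onD[OF inj]) (intro G.subgroup_int_pow_closed[OF H] semisimple_in_subgroup[OF H] x S)+
    then show ?thesis using y by blast
  qed
  from perm show False
  proof (rule not_arrow_permutation)
    \<comment> \<open>The simple at \<open>v\<close> has coordinate 1 at \<open>v\<close>, whereas
      \<open>y\<close> has coordinate 0 there because \<open>v\<close> is not internal. Since
      \<open>v\<close> is no sink, coordinates at \<open>v\<close> can be compared.\<close>
    fix v assume v: "v \<in> src ` E" "v \<notin> tgt ` E"
    let ?d = "\<lambda>w. if w = v then 1 else 0 :: int"
    have vV: "v \<in> V" using v src_in by auto
    have "\<Omega> (semisimple ?d) = semisimple (adj v)"
      unfolding syzygy_semisimple by (rule semisimple_cong) (use vV finite_V in \<open>simp add: if_distrib[of "\<lambda>x. x * _"] cong: if_cong\<close>)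
    moreover have "adj v w = 0" if "w \<notin> tgt ` E" for w
    proof -
      have "{a \<in> E. src a = v \<and> tgt a = w} = {}" using that by auto
      then show ?thesis unfolding adjacency_def by (simp only: card.empty of_nat_0)
    qed
    moreover have "semisimple ?d \<in> H" unfolding semisimple_single[OF vV] by (rule S[OF vV])
    ultimately have "\<exists>n y. n \<noteq> 0 \<and> y \<in> int_vecs internal \<and> semisimple ?d [^]\<^bsub>K0 R\<^esub> (n::int) = semisimple y"
      by (intro key[of "semisimple ?d" "adj v"])
    then obtain n y where y: "n \<noteq> 0" "y \<in> int_vecs internal" "semisimple ?d [^]\<^bsub>K0 R\<^esub> (n::int) = semisimple y" by (elim exE conjE)
    have "n * ?d v = y v" using semisimple_inject[OF y(3)[unfolded semisimple_int_pow] v(1)] .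
    moreover have "y v = 0" using y(2) v(2) by (simp add: int_vecs_def)
    ultimately show False using y(1) by simp
  next
    \<comment> \<open>The invariant \<open>r\<close> vanishes on simples and is -1 on the class in
      question, so no nonzero multiple of that class is a combination of simples.\<close>
    fix a b assume ab: "a \<in> E" "b \<in> E" "src a = src b" "a \<noteq> b"
    let ?c = "cls (Lone (src a) (out (src a) - {a}))"
    obtain r where r: "r \<in> hom (K0 R) integer_group" "\<And>w. w \<in> V \<Longrightarrow> r (simple w) = 0" "r ?c = - 1"
      by (rule arrow_multiplicity[OF ab]) (rule that)
    have "\<exists>n y. n \<noteq> 0 \<and> y \<in> int_vecs internal \<and> ?c [^]\<^bsub>K0 R\<^esub> (n::int) = semisimple y"
      by (rule key[OF c[OF ab(1)] syzygy_arrow[OF ab(1)]]) (use ab(1) in auto)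
    then obtain n y where y: "n \<noteq> 0" "?c [^]\<^bsub>K0 R\<^esub> (n::int) = semisimple y" by (elim exE conjE)
    have cK: "?c \<in> carrier (K0 R)" using subgroup.mem_carrier[OF H c[OF ab(1)]] .
    have "r (?c [^]\<^bsub>K0 R\<^esub> n) = - n"
      using hom_int_pow[OF r(1) cK K0_group comm_group.axioms(2)[OF comm_group_integer_group]] r(3) by simp
    moreover have "r (semisimple y) = 0" unfolding hom_semisimple_int[OF r(1)] using r(2) by simp
    ultimately show False using y by simp
  qed
qed

text \<open>A smaller value of \<open>phi\<close> would make \<open>\<Omega>\<close> injective on
  the image of the subgroup under \<open>stable_index internal adj\<close> syzygies. For positive
  index this gives injectivity of the matrix one power too early, against minimality of the index;
  for index 0 it contradicts \<open>not_inj_syzygy\<close>.\<close>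

lemma phi_test_module:
  assumes perm: "\<not> arrow_permutation" and S: "\<And>v. v \<in> V \<Longrightarrow> simple v \<in> add_subgroup R M"
    and c: "\<And>a. a \<in> E \<Longrightarrow> cls (Lone (src a) (out (src a) - {a})) \<in> add_subgroup R M"
  shows "phi R M = Suc (stable_index internal adj)"
proof (rule antisym[OF phi_le], rule ccontr)
  assume "\<not> Suc (stable_index internal adj) \<le> phi R M"
  then have le: "phi R M \<le> stable_index internal adj" by simp
  have inj: "inj_on \<Omega> ((\<Omega> ^^ stable_index internal adj) ` add_subgroup R M)"
    using inj_on_syzygy_phi[of M "stable_index internal adj - phi R M"] le by simp
  show False
  proof (cases "stable_index internal adj")
    case 0
    then have "inj_on \<Omega> (add_subgroup R M)" using inj by simp
    then show False using not_inj_syzygy[OF perm 0 add_subgroup S c] by blast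
  next
    case (Suc n)
    have "inj_after internal adj n"
      by (rule inj_syzygy_imp_inj_after[OF add_subgroup c]) (use inj in \<open>simp_all only: Suc\<close>)
    then show False unfolding inj_after_iff_le[OF finite_internal] Suc by simp
  qed
qed

section \<open>The exceptional case\<close>

lemma finprod_range_semisimple:
  "finite S \<Longrightarrow> (\<And>i. i \<in> S \<Longrightarrow> f i \<in> range semisimple) \<Longrightarrow> (\<Otimes>\<^bsub>K0 R\<^esub>i\<in>S. f i) \<in> range semisimple"
proof (induction S rule: finite_induct)
  case empty
  then show ?case using semisimple_zero[symmetric] by simp
next
  case (insert i S)
  from insert.prems[of i] obtain x where x: "f i = semisimple x" by auto
  have "(\<Otimes>\<^bsub>K0 R\<^esub>i\<in>S. f i) \<in> range semisimple" using insert by simp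
  then obtain y where y: "(\<Otimes>\<^bsub>K0 R\<^esub>i\<in>S. f i) = semisimple y" by auto
  have "f \<in> S \<rightarrow> carrier (K0 R)" "f i \<in> carrier (K0 R)" using insert.prems semisimple_closed by (force, simp add: x)
  then have "(\<Otimes>\<^bsub>K0 R\<^esub>i\<in>insert i S. f i) = semisimple (\<lambda>w. x w + y w)"
    using insert.hyps by (simp add: x y semisimple_add)
  then show ?case by simp
qed

text \<open>Every module is some \<open>Lmod\<close> here, hence a sum of modules with one
  generator. At most one arrow leaves each vertex, so such a module is either simple or projective,
  and its class is semisimple or trivial.\<close>

lemma arrow_permutation_range_semisimple:
  assumes perm: arrow_permutation and c: "c \<in> carrier (K0 R)"
  shows "c \<in> semisimple ` int_vecs internal"
proof -
  have L: "cls (Lone u B) \<in> range semisimple" if u: "u \<in> V" and B: "B \<subseteq> out u" for u B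
  proof -
    have "a = b" if "a \<in> out u" "b \<in> out u" for a b
      using perm that unfolding arrow_permutation_def inj_on_def out_def by simp
    then have "B = {} \<or> B = out u" using B by blast
    then show ?thesis
    proof
      assume "B = {}"
      then have "cls (Lone u B) = semisimple (\<lambda>w. if w = u then 1 else 0)" using semisimple_single[OF u] by (simp add: simple_def)
      then show ?thesis by simp
    next
      assume "B = out u"
      then have "cls (Lone u B) = semisimple (\<lambda>_. 0)" using cls_Lone_full[OF u] by (simp add: semisimple_zero)
      then show ?thesis by simp
    qed
  qed
  from c have "c \<in> range semisimple"
  proof (induction rule: K0_induct)
    case one
    then show ?case using semisimple_zero[symmetric] by simp
  next
    case (diff x y)
    then obtain x' y' where "x = semisimple x'" "y = semisimple y'" by blast
    then have "x \<otimes>\<^bsub>K0 R\<^esub> inv\<^bsub>K0 R\<^esub> y = semisimple (\<lambda>w. x' w + - y' w)" by (simp only: semisimple_add semisimple_uminus)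
    then show ?case by simp
  next
    case (cls M)
    show ?case
    proof (rule arrow_permutation_Lmod[OF fg_rmodulesD[OF cls] perm])
      fix I :: "((nat \<Rightarrow> 'r) set \<times> 'v) set" and vt A
      assume D: "Ldata I vt A" and iso: "rmod_isomorphic R (Lmod I vt A) M"
      have "K0_class R M = cls (Lmod I vt A)"
        unfolding cls_self[OF cls, symmetric]
        by (rule cls_iso[OF Lmod_right_module[OF D] Lmod_fg[OF D] fg_rmodulesD[OF cls] iso, symmetric])
      also have "\<dots> \<in> range semisimple"
        unfolding cls_Lmod[OF D] using LdataD(1)[OF D]
        by (rule finprod_range_semisimple) (rule L[OF LdataD(2)[OF D] arrows_sub_out[OF D]])
      finally show "K0_class R M \<in> range semisimple" .
    qed
  qed
  then obtain x where x: "c = semisimple x" by auto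
  also have "\<dots> = semisimple (restr x)" by (rule semisimple_eqI) (use perm in \<open>simp add: restr_def arrow_permutation_def\<close>)
  finally show ?thesis using restr_in by blast
qed

text \<open>The adjacency matrix is a permutation matrix: the coordinate of the image at
  \<open>tgt a\<close> is the coordinate of \<open>x\<close> at \<open>src a\<close>.\<close>

lemma arrow_permutation_mat_vec:
  assumes perm: arrow_permutation
  shows "inj_on (mat_vec internal adj) (int_vecs internal)"
proof (rule inj_onI, rule ext)
  fix x y v assume xy: "x \<in> int_vecs internal" "y \<in> int_vecs internal" and eq: "mat_vec internal adj x = mat_vec internal adj y"
  show "x v = y v"
  proof (cases "v \<in> src ` E")
    case True
    then obtain a where a: "a \<in> E" "v = src a" by auto
    have t: "tgt a \<in> internal" "src a \<in> internal" using perm a(1) unfolding arrow_permutation_def by auto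
    have adj: "adj u (tgt a) = (if u = src a then 1 else 0)" for u
    proof -
      have "{b \<in> E. src b = u \<and> tgt b = tgt a} = (if u = src a then {a} else {})"
        using perm a(1) unfolding arrow_permutation_def inj_on_def by auto
      then show ?thesis unfolding adjacency_def by simp
    qed
    have "mat_vec internal adj x (tgt a) = x (src a)" for x
    proof -
      have "mat_vec internal adj x (tgt a) = (\<Sum>u\<in>internal. if u = src a then x u else 0)"
        unfolding mat_vec_def adj using t by (auto intro!: sum.cong)
      then show ?thesis using t finite_internal by simp
    qed
    then show ?thesis using eq a(2) by metis
  next
    case False
    then show ?thesis using xy by (simp add: int_vecs_def)
  qed
qed

lemma phi_arrow_permutation:
  assumes perm: arrow_permutation
  shows "phi R M = 0"
proof -
  \<comment> \<open>All of \<open>K0 R\<close> is the span of the simples on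
    \<open>internal\<close>, so the permutation matrix describes \<open>\<Omega>\<close> completely
    and no syzygy has to be taken first.\<close>
  have inj: "inj_on \<Omega> (carrier (K0 R))"
  proof (rule inj_onI)
    fix c d assume c: "c \<in> carrier (K0 R)" and d: "d \<in> carrier (K0 R)" and eq: "\<Omega> c = \<Omega> d"
    from arrow_permutation_range_semisimple[OF perm c] obtain x where x: "c = semisimple x" "x \<in> int_vecs internal" by (rule imageE)
    from arrow_permutation_range_semisimple[OF perm d] obtain y where y: "d = semisimple y" "y \<in> int_vecs internal" by (rule imageE)
    have "semisimple (mat_vec internal adj x) = semisimple (mat_vec internal adj y)"
      using eq unfolding x(1) y(1) syzygy_semisimple_internal[OF x(2)] syzygy_semisimple_internal[OF y(2)] .
    then have "mat_vec internal adj x = mat_vec internal adj y"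
      by (rule inj_onD[OF semisimple_inj_on]) (rule mat_vec_in)+
    then have "x = y" by (rule inj_onD[OF arrow_permutation_mat_vec[OF perm]]) (rule x y)+
    then show "c = d" using x y by simp
  qed
  have "(\<Omega> ^^ n) x \<in> carrier (K0 R)" if "x \<in> add_subgroup R M" for n x
    by (induction n) (use subgroup.mem_carrier[OF add_subgroup that] in auto)
  then have "inj_on \<Omega> ((\<Omega> ^^ (0 + s)) ` add_subgroup R M)" for s
    by (intro inj_on_subset[OF inj]) auto
  then have "phi R M \<le> 0" unfolding phi_def by (intro Least_le allI)
  then show ?thesis by simp
qed

theorem phi_dim_eq: "phi_dim R = enat (quiver_phi E src tgt)"
proof (cases arrow_permutation)
  case True
  obtain M where "M \<in> fg_rmodules R" by (rule test_module)
  \<comment> \<open>The supremum of a constant family is the constant only over a nonempty set of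
    modules.\<close>
  then have "fg_rmodules R \<noteq> {}" by blast
  then have "phi_dim R = enat 0" unfolding phi_dim_def phi_arrow_permutation[OF True] by (rule SUP_const)
  then show ?thesis using True by (simp add: quiver_phi_def arrow_permutation_def)
next
  case False
  obtain M where M: "M \<in> fg_rmodules R" "\<And>v. v \<in> V \<Longrightarrow> simple v \<in> add_subgroup R M"
    "\<And>a. a \<in> E \<Longrightarrow> cls (Lone (src a) (out (src a) - {a})) \<in> add_subgroup R M" by (rule test_module) (rule that)
  have e: "phi R M = Suc (stable_index internal adj)" by (rule phi_test_module[OF False]) (rule M, assumption)+
  have "phi_dim R = enat (Suc (stable_index internal adj))"
  proof (rule antisym)
    show "phi_dim R \<le> enat (Suc (stable_index internal adj))"
      unfolding phi_dim_def by (rule SUP_least) (simp add: phi_le)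
    show "enat (Suc (stable_index internal adj)) \<le> phi_dim R"
      using SUP_upper[OF M(1), of "\<lambda>M. enat (phi R M)"] unfolding phi_dim_def e .
  qed
  then show ?thesis using False unfolding quiver_phi_def arrow_permutation_def by (simp only: if_False)
qed

end

theorem theorem4p21:
  fixes K :: "('k, 'm) ring_scheme" and Q :: "('v, 'a) pre_digraph"
  assumes "field K"
    and "fin_digraph Q" and "connected Q"
  shows "phi_dim (radical_square_zero_algebra K Q)
       = phi_dim (opposite_ring (radical_square_zero_algebra K Q))"
proof -
  interpret path_alg K Q using assms by (simp add: path_alg_def)
  note A = rad_sq_zero_path_algebra
  have "finite (arcs Q)" using assms(2) by (simp add: fin_digraph_def fin_digraph_axioms_def)
  \<comment> \<open>The same coordinates serve the algebra and its opposite, with tails and heads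
    exchanged, so both sides become values of \<open>quiver_phi\<close>.\<close>
  then show ?thesis
    unfolding rad_sq_zero.phi_dim_eq[OF A] rad_sq_zero.phi_dim_eq[OF rad_sq_zero.opposite[OF A]]
    by (simp add: quiver_phi_reverse)
qed

end
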